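(* Let $(f,\mu)$ satisfy (H1)–(H3), let $\Gamma=\Gamma(\lambda^*;m,p)$ with $\lambda^*<\frac1{2p}$ and $\mu(\Gamma)>0$, let $l_0>1$, $n_0\in\mathbb N$, $x_0\in\Gamma_{l_0}\cap K_{n_0}$, let $\delta\le\frac14\delta_1'$ be sufficiently small, let $\mathcal S$ be a stack of strong stable leaves through the points of a compact set $\bar U\subset U(x_0,\epsilon_0)$, let $\Sigma^1,\Sigma^2$ be two transversals, $\check\Sigma^i=\Sigma^i\cap\mathcal S$, and let $p:\check\Sigma^1\to\check\Sigma^2$ be the holonomy map along the leaves of $\mathcal S$ (all defined in the context). Then for all $y\in\check\Sigma^1$, $$\frac{d(p^{-1}_*\nu_{\Sigma^2})}{d\nu_{\Sigma^1}}(y)=\Delta(y),\qquad \Delta(y)=\lim_{N\to\infty}\frac{\det(df^N_y|T_y\Sigma^1)}{\det(df^N_{p(y)}|T_{p(y)}\Sigma^2)},$$ i.e. $\Delta$ is the Radon–Nikodym derivative of $p^{-1}_*(\nu_{\Sigma^2}|_{\check\Sigma^2})$ with respect to $\nu_{\Sigma^1}|_{\check\Sigma^1}$.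
   Context: Setting. $(\mathcal B,|\cdot|)$ is a Banach space, $f:\mathcal B\to\mathcal B$ a map and $\mu$ an $f$-invariant Borel probability measure such that: (H1) $f$ is injective and $C^2$ Fréchet differentiable, and each derivative $df_x$ is injective; (H2) there is a compact set $\mathscr A\subset\mathcal B$ with $f(\mathscr A)=\mathscr A$, and $\mu$ is supported on $\mathscr A$; (H3) $l_\alpha(x):=\lim_{n}\frac1n\log|df^n_x|_\alpha<0$ for $\mu$-a.e. $x$, where $|df^n_x|_\alpha$ is the Kuratowski measure of noncompactness of the image of the unit ball under $df^n_x$. Lyapunov splitting. Fix an $f$-invariant measurable function $\lambda_\alpha$ with $l_\alpha<\lambda_\alpha<0$ $\mu$-a.e. By the multiplicative ergodic theorem there is an $f$-invariant Borel set $\overline\Gamma\subset\mathscr A$, $\mu(\overline\Gamma)=1$, and for $x\in\overline\Gamma$ finitely many exponents $\lambda_1(x)>\dots>\lambda_{r(x)}(x)>\lambda_\alpha(x)$ and a splitting $\mathcal B=E_1(x)\oplus\dots\oplus E_{r(x)}(x)\oplus F(x)$ into closed subspaces, with $\dim E_i(x)<\infty$, $df_xE_i(x)=E_i(fx)$, $df_xF(x)\subset F(fx)$, growth rate $\lambda_i(x)$ (as $n\to\pm\infty$) on $E_i(x)\setminus\{0\}$, $\limsup_n\frac1n\log|df^n_x|_{F(x)}|\le\lambda_\alpha(x)$, and $\frac1n\log$ of the norms of the associated projections along orbits tending to $0$. There are Borel sets $K_1\subset K_2\subset\cdots$ with $\overline\Gamma=\bigcup_nK_n$ such that the subspaces $E_i,F$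 vary continuously (in the Hausdorff distance $d_H$ between unit spheres) on each $K_n$. For $\lambda^*\in\mathbb R$ and positive integers $m,p$, let $\Gamma(\lambda^*;m,p)=\{x\in\overline\Gamma:\lambda_\alpha(x)<\lambda^*-\frac1p,\ \min_i|\lambda_i(x)-\lambda^*|>\frac1p,\ \dim E^+_x=m\}$, where $E^+_x=\bigoplus_{\lambda_i(x)>\lambda^*}E_i(x)$ and $E^-_x=F(x)\oplus\bigoplus_{\lambda_i(x)<\lambda^*}E_i(x)$. Fix $\Gamma=\Gamma(\lambda^*;m,p)$ with $\lambda^*<\frac1{2p}$ and put $\lambda^\pm=\lambda^*\pm\frac1{2p}$ (so $\lambda^-<0$). Adapted norms. For $x\in\Gamma$: $|u|'_x=\sum_{n\le0}e^{-n\lambda^+}|df^n_xu|$ for $u\in E^+_x$ (for $n<0$, $df^n_x$ is the inverse of $df^{|n|}_{f^{n}x}:E^+_{f^nx}\to E^+_x$), $|w|'_x=\sum_{n\ge0}e^{-n\lambda^-}|df^n_xw|$ for $w\in E^-_x$, and $|u+w|'_x=\max\{|u|'_x,|w|'_x\}$. Write $\tilde B^\pm_x(r)=\{v\in E^\pm_x:|v|'_x\le r\}$, $\tilde B_x(r)=\tilde B_x^+(r)+\tilde B_x^-(r)$, $B^\pm_x(r)=\{v\in E^\pm_x:|v|\le r\}$, $\exp_x(v)=x+v$, $\tilde f_x=\exp_{fx}^{-1}\circ f\circ\exp_x$. There is $\delta_1>0$ such that for a fixed $\delta_2>0$, $\delta_2\ll\lambda^+-\lambda^-$, there is a Borel function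 $l:\Gamma\to[1,\infty)$ with $l(f^{\pm1}x)\le e^{\delta_2}l(x)$, $\frac12|v|\le|v|'_x\le l(x)|v|$, and, for $\delta\le\delta_1$, on $\tilde B_x(\delta l(x)^{-1})$: $\mathrm{Lip}'(\tilde f_x-(d\tilde f_x)_0)\le\delta$ and $\mathrm{Lip}'(d\tilde f_x)\le l(x)$ (Lipschitz constants in the norms $|\cdot|'$). Put $\Gamma_{l_0}=\{x\in\Gamma:l(x)\le l_0\}$. Local strong stable manifolds. There are $\delta_1'\le\delta_1$ and $C^{1+\mathrm{Lip}}$ maps $h_x:\tilde B^-_x(\delta_1'l(x)^{-1})\to\tilde B^+_x(\delta_1'l(x)^{-1})$, $x\in\Gamma$, with $h_x(0)=0$, $(dh_x)_0=0$, $\mathrm{Lip}'h_x\le\frac1{10}$, $\tilde f_x(\mathrm{graph}\,h_x)\subset\mathrm{graph}\,h_{fx}$, $|\tilde f_xz_1-\tilde f_xz_2|'_{fx}\le(e^{\lambda^-}+\delta_1')|z_1-z_2|'_x$ on $\mathrm{graph}\,h_x$; $W^{ss}_{\mathrm{loc},x}=\exp_x\mathrm{graph}\,h_x$. Stacks. Fix $l_0>1$, $n_0\in\mathbb N$, $x_0\in\Gamma_{l_0}\cap K_{n_0}$, and $\delta\le\frac14\delta_1'$ sufficiently small. Let $U(x_0,\epsilon)=\Gamma_{l_0}\cap K_{n_0}\cap\{y:|y-x_0|<\epsilon\}$. For $\epsilon_0>0$ sufficiently small and $y\in U(x_0,\epsilon_0)$, the manifold $W^{ss}_{\mathrm{loc},y}$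 is, over $B^-_{x_0}(\delta l_0^{-3})$, the $\exp_{x_0}$-image of the graph of a map $\Theta(y):B^-_{x_0}(\delta l_0^{-3})\to B^+_{x_0}(\delta l_0^{-3})$ with $\mathrm{Lip}\,\Theta(y)\le\frac1{10}$, and $y\mapsto\Theta(y)$ is continuous in the uniform norm. For compact $\bar U\subset U(x_0,\epsilon_0)$, the stack of strong stable leaves is $\mathcal S=\bigcup_{x\in\bar U}\exp_{x_0}\mathrm{graph}\,\Theta(x)$; two leaves are either equal or disjoint. Transversals and holonomy. $\Sigma^i=\exp_{x_0}\mathrm{graph}\,\sigma_i$, $i=1,2$, where $\sigma_i:B^+_{x_0}(2\delta l_0^{-3})\to B^-_{x_0}(\frac12\delta l_0^{-4})$ are $C^{1+\mathrm{Lip}}$ (differentiable with Lipschitz derivative) with $\mathrm{Lip}(\sigma_i)\le\frac1{40l_0}$. $\check\Sigma^i=\Sigma^i\cap\mathcal S$, and $p:\check\Sigma^1\to\check\Sigma^2$ sends $z\in\Sigma^1\cap\exp_{x_0}\mathrm{graph}\,\Theta(x)$ to the unique point of $\Sigma^2\cap\exp_{x_0}\mathrm{graph}\,\Theta(x)$; it is a homeomorphism. Induced volume and determinant. For a $k$-dimensional subspace $E\subset\mathcal B$, $m_E$ is the Haar measure on $E$ giving the unit ball $B_E$ of $(E,|\cdot|)$ the Lebesgue measure $\omega_k$ of the Euclidean unit ball of $\mathbb R^k$. For a $k$-dimensional $C^1$ submanifold $W\subset\mathcal B$, $\nu_W$ is the measure with volume element $m_{T_yW}$ on $T_yW$: for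 a local parametrization $\psi:O\subset\mathbb R^k\to W$, $\nu_W(\psi(Q))=\int_Q J_\psi(z)\,dz$ with $J_\psi(z)=m_{T_{\psi(z)}W}(d\psi_z(Q_0))/\mathrm{Leb}(Q_0)$ for any ball $Q_0\subset\mathbb R^k$. For a bounded operator $A$ injective on $E$, $\det(A|E)=m_{AE}(AB_E)/m_E(B_E)$. The limit defining $\Delta(y)$ exists, uniformly in $y\in\check\Sigma^1$, and $\Delta$ is continuous and bounded away from $0$ and $\infty$ on $\check\Sigma^1$. *)

theory Defs
  imports "HOL-Probability.Probability"
begin

section \<open>Standing hypotheses\<close>

definition C2_map :: "('a::real_normed_vector \<Rightarrow> 'b::real_normed_vector) \<Rightarrow> bool" where
  "C2_map f \<longleftrightarrow>
     (\<exists>(f' :: 'a \<Rightarrow> 'a \<Rightarrow>\<^sub>L 'b) (f'' :: 'a \<Rightarrow> 'a \<Rightarrow>\<^sub>L 'a \<Rightarrow>\<^sub>L 'b).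
        (\<forall>x. (f has_derivative blinfun_apply (f' x)) (at x)) \<and>
        (\<forall>x. (f' has_derivative blinfun_apply (f'' x)) (at x)) \<and>
        continuous_on UNIV f'')"

definition diter :: "('a::real_normed_vector \<Rightarrow> 'a) \<Rightarrow> nat \<Rightarrow> 'a \<Rightarrow> 'a \<Rightarrow> 'a" where
  "diter f n x = frechet_derivative (f ^^ n) (at x)"

definition kuratowski :: "'a::metric_space set \<Rightarrow> real" where
  "kuratowski S =
     Inf {d. 0 < d \<and> (\<exists>\<C>. finite \<C> \<and> S \<subseteq> \<Union>\<C> \<and> (\<forall>X\<in>\<C>. bounded X \<and> diameter X \<le> d))}"

text \<open>The real \<^const>\<open>ln\<close> takes the value 0 at 0; here the logarithm of 0 has to be
  \<open>- \<infinity>\<close>, for instance when the derivatives are compact operators.\<close>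

definition elog :: "real \<Rightarrow> ereal" where
  "elog t = (if t \<le> 0 then - \<infinity> else ereal (ln t))"

definition nc_rate :: "('a::real_normed_vector \<Rightarrow> 'a) \<Rightarrow> 'a \<Rightarrow> nat \<Rightarrow> ereal" where
  "nc_rate f x n = elog (kuratowski (diter f n x ` cball 0 1)) / ereal (real n)"

definition l_alpha :: "('a::real_normed_vector \<Rightarrow> 'a) \<Rightarrow> 'a \<Rightarrow> ereal" where
  "l_alpha f x = lim (nc_rate f x)"

definition invariant_prob :: "('a::real_normed_vector \<Rightarrow> 'a) \<Rightarrow> 'a measure \<Rightarrow> bool" where
  "invariant_prob f \<mu> \<longleftrightarrow> prob_space \<mu> \<and> sets \<mu> = sets borel \<and> distr \<mu> borel f = \<mu>"

definition hyp_H1 :: "('a::real_normed_vector \<Rightarrow> 'a) \<Rightarrow> bool" where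
  "hyp_H1 f \<longleftrightarrow> inj f \<and> C2_map f \<and> (\<forall>x. inj (frechet_derivative f (at x)))"

definition hyp_H2 :: "('a::real_normed_vector \<Rightarrow> 'a) \<Rightarrow> 'a measure \<Rightarrow> 'a set \<Rightarrow> bool" where
  "hyp_H2 f \<mu> A \<longleftrightarrow> compact A \<and> f ` A = A \<and> emeasure \<mu> (- A) = 0"

definition hyp_H3 :: "('a::real_normed_vector \<Rightarrow> 'a) \<Rightarrow> 'a measure \<Rightarrow> bool" where
  "hyp_H3 f \<mu> \<longleftrightarrow> (AE x in \<mu>. convergent (nc_rate f x) \<and> l_alpha f x < 0)"


section \<open>The Lyapunov splitting\<close>

text \<open>\<open>msp_dom\<close> is the full-measure invariant set of the multiplicative ergodic theorem, \<open>msp_K\<close> its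
  exhaustion by continuity sets. At \<open>x\<close> there are \<open>msp_r x\<close> exponents, indexed from 1;
  \<open>msp_E\<close>, \<open>msp_F\<close> are the subspaces of the splitting.\<close>

record 'a met_splitting =
  msp_dom :: "'a set"
  msp_K :: "nat \<Rightarrow> 'a set"
  msp_r :: "'a \<Rightarrow> nat"
  msp_lam :: "nat \<Rightarrow> 'a \<Rightarrow> real"
  msp_E :: "nat \<Rightarrow> 'a \<Rightarrow> 'a set"
  msp_F :: "'a \<Rightarrow> 'a set"

definition ziter :: "('a \<Rightarrow> 'a) \<Rightarrow> int \<Rightarrow> 'a \<Rightarrow> 'a" where
  "ziter f n x = (if 0 \<le> n then (f ^^ nat n) x else (inv f ^^ nat (- n)) x)"

text \<open>The derivative of the \<open>n\<close>-th iterate at \<open>x\<close> along an invariant subbundle \<open>V\<close>. For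
  \<open>n < 0\<close> it is the inverse of the derivative of the \<open>\<bar>n\<bar>\<close>-th iterate, as a map
  from the fibre of \<open>V\<close> over the \<open>\<bar>n\<bar>\<close>-th preimage of \<open>x\<close> to the fibre over \<open>x\<close>.\<close>

definition zderiv :: "('a::real_normed_vector \<Rightarrow> 'a) \<Rightarrow> ('a \<Rightarrow> 'a set) \<Rightarrow> int \<Rightarrow> 'a \<Rightarrow> 'a \<Rightarrow> 'a" where
  "zderiv f V n x =
     (if 0 \<le> n then diter f (nat n) x
      else inv_into (V (ziter f n x)) (diter f (nat (- n)) (ziter f n x)))"

definition proj_along :: "'a::real_vector set \<Rightarrow> 'a set \<Rightarrow> 'a \<Rightarrow> 'a" where
  "proj_along U V v = (THE u. u \<in> U \<and> v - u \<in> V)"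

definition norm_on :: "'a::real_normed_vector set \<Rightarrow> ('a \<Rightarrow> 'b::real_normed_vector) \<Rightarrow> real" where
  "norm_on V T = (SUP v\<in>V \<inter> cball 0 1. norm (T v))"

text \<open>Hausdorff distance between unit spheres. Two unit vectors are at distance at most 2, so the
  element 2 only matters when exactly one of the spheres is empty.\<close>

definition sphere_dist :: "'a::real_normed_vector set \<Rightarrow> 'a set \<Rightarrow> real" where
  "sphere_dist U V =
     Inf (insert 2 {d. 0 \<le> d \<and>
       (\<forall>u\<in>U \<inter> sphere 0 1. \<exists>v\<in>V \<inter> sphere 0 1. dist u v \<le> d) \<and>
       (\<forall>v\<in>V \<inter> sphere 0 1. \<exists>u\<in>U \<inter> sphere 0 1. dist u v \<le> d)})"

text \<open>All summands of the splitting as one family over \<open>{0..r}\<close>, with \<open>F\<close> in position 0, and for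
  each the sum of the others. The \<^const>\<open>span\<close> of a union of subspaces is their sum.\<close>

definition piece :: "('a::real_normed_vector) met_splitting \<Rightarrow> nat \<Rightarrow> 'a \<Rightarrow> 'a set" where
  "piece M i x = (if i = 0 then msp_F M x else msp_E M i x)"

definition copiece :: "('a::real_normed_vector) met_splitting \<Rightarrow> nat \<Rightarrow> 'a \<Rightarrow> 'a set" where
  "copiece M i x = span (\<Union>j\<in>{0..msp_r M x} - {i}. piece M j x)"

definition splits_at :: "('a::real_normed_vector) met_splitting \<Rightarrow> 'a \<Rightarrow> bool" where
  "splits_at M x \<longleftrightarrow>
     (\<forall>i\<le>msp_r M x. subspace (piece M i x) \<and> closed (piece M i x)) \<and>
     (\<forall>i\<in>{1..msp_r M x}. msp_E M i x \<noteq> {0} \<and> (\<exists>B. finite B \<and> span B = msp_E M i x)) \<and>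
     span (\<Union>i\<le>msp_r M x. piece M i x) = UNIV \<and>
     (\<forall>i\<le>msp_r M x. piece M i x \<inter> copiece M i x = {0})"

text \<open>In the last clause the real \<^const>\<open>ln\<close> is intended: if \<open>F = {0}\<close>, which happens in finite
  dimension, the projection onto \<open>F\<close> is 0 and imposes no condition.\<close>

definition met_at ::
  "('a::real_normed_vector \<Rightarrow> 'a) \<Rightarrow> ('a \<Rightarrow> real) \<Rightarrow> 'a met_splitting \<Rightarrow> 'a \<Rightarrow> bool" where
  "met_at f la M x \<longleftrightarrow>
     msp_r M (f x) = msp_r M x \<and>
     (\<forall>i\<in>{1..msp_r M x}. la x < msp_lam M i x) \<and>
     (\<forall>i\<in>{1..msp_r M x}. \<forall>j\<in>{1..msp_r M x}. i < j \<longrightarrow> msp_lam M j x < msp_lam M i x) \<and>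
     splits_at M x \<and>
     (\<forall>i\<in>{1..msp_r M x}. frechet_derivative f (at x) ` msp_E M i x = msp_E M i (f x)) \<and>
     frechet_derivative f (at x) ` msp_F M x \<subseteq> msp_F M (f x) \<and>
     (\<forall>i\<in>{1..msp_r M x}. \<forall>v\<in>msp_E M i x - {0}.
        ((\<lambda>n. ln (norm (zderiv f (msp_E M i) n x v)) / real_of_int n) \<longlongrightarrow> msp_lam M i x) at_top \<and>
        ((\<lambda>n. ln (norm (zderiv f (msp_E M i) n x v)) / real_of_int n) \<longlongrightarrow> msp_lam M i x) at_bot) \<and>
     limsup (\<lambda>n. elog (norm_on (msp_F M x) (diter f n x)) / ereal (real n)) \<le> ereal (la x) \<and>
     (\<forall>i\<le>msp_r M x.
        ((\<lambda>n. ln (onorm (proj_along (piece M i (ziter f n x)) (copiece M i (ziter f n x))))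
              / real_of_int n) \<longlongrightarrow> 0) at_top \<and>
        ((\<lambda>n. ln (onorm (proj_along (piece M i (ziter f n x)) (copiece M i (ziter f n x))))
              / real_of_int n) \<longlongrightarrow> 0) at_bot)"

definition lyapunov_splitting ::
  "('a::real_normed_vector \<Rightarrow> 'a) \<Rightarrow> 'a measure \<Rightarrow> 'a set \<Rightarrow> ('a \<Rightarrow> real) \<Rightarrow> 'a met_splitting \<Rightarrow> bool" where
  "lyapunov_splitting f \<mu> A la M \<longleftrightarrow>
     la \<in> borel_measurable borel \<and> (\<forall>x\<in>A. la (f x) = la x) \<and>
     (AE x in \<mu>. l_alpha f x < ereal (la x) \<and> la x < 0) \<and>
     msp_dom M \<in> sets borel \<and> msp_dom M \<subseteq> A \<and> f ` msp_dom M = msp_dom M \<and>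
     emeasure \<mu> (msp_dom M) = 1 \<and>
     (\<forall>x\<in>msp_dom M. met_at f la M x) \<and>
     (\<forall>n. msp_K M n \<in> sets borel \<and> msp_K M n \<subseteq> msp_K M (Suc n)) \<and>
     msp_dom M = (\<Union>n. msp_K M n) \<and>
     (\<forall>n. continuous_on (msp_K M n) (msp_r M) \<and>
        (\<forall>x\<in>msp_K M n. \<forall>i\<le>msp_r M x.
           ((\<lambda>y. sphere_dist (piece M i y) (piece M i x)) \<longlongrightarrow> 0) (at x within msp_K M n)))"

definition Eplus :: "('a::real_normed_vector) met_splitting \<Rightarrow> real \<Rightarrow> 'a \<Rightarrow> 'a set" where
  "Eplus M ls x = span (\<Union>i\<in>{i\<in>{1..msp_r M x}. ls < msp_lam M i x}. msp_E M i x)"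

definition Eminus :: "('a::real_normed_vector) met_splitting \<Rightarrow> real \<Rightarrow> 'a \<Rightarrow> 'a set" where
  "Eminus M ls x = span (msp_F M x \<union> (\<Union>i\<in>{i\<in>{1..msp_r M x}. msp_lam M i x < ls}. msp_E M i x))"

definition Gamma_set ::
  "('a::real_normed_vector) met_splitting \<Rightarrow> ('a \<Rightarrow> real) \<Rightarrow> real \<Rightarrow> nat \<Rightarrow> nat \<Rightarrow> 'a set" where
  "Gamma_set M la ls m p =
     {x \<in> msp_dom M. la x < ls - 1 / real p \<and>
        (\<forall>i\<in>{1..msp_r M x}. 1 / real p < \<bar>msp_lam M i x - ls\<bar>) \<and> dim (Eplus M ls x) = m}"


section \<open>Adapted norms and charts\<close>

definition lam_plus :: "real \<Rightarrow> nat \<Rightarrow> real" where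
  "lam_plus ls p = ls + 1 / (2 * real p)"

definition lam_minus :: "real \<Rightarrow> nat \<Rightarrow> real" where
  "lam_minus ls p = ls - 1 / (2 * real p)"

definition norm_plus ::
  "('a::real_normed_vector \<Rightarrow> 'a) \<Rightarrow> 'a met_splitting \<Rightarrow> real \<Rightarrow> nat \<Rightarrow> 'a \<Rightarrow> 'a \<Rightarrow> real" where
  "norm_plus f M ls p x u =
     (\<Sum>\<^sub>\<infinity>n\<in>{..0::int}. exp (- real_of_int n * lam_plus ls p) * norm (zderiv f (Eplus M ls) n x u))"

definition norm_minus ::
  "('a::real_normed_vector \<Rightarrow> 'a) \<Rightarrow> real \<Rightarrow> nat \<Rightarrow> 'a \<Rightarrow> 'a \<Rightarrow> real" where
  "norm_minus f ls p x w =
     (\<Sum>\<^sub>\<infinity>n\<in>(UNIV::nat set). exp (- real n * lam_minus ls p) * norm (diter f n x w))"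

definition adapted_norm ::
  "('a::real_normed_vector \<Rightarrow> 'a) \<Rightarrow> 'a met_splitting \<Rightarrow> real \<Rightarrow> nat \<Rightarrow> 'a \<Rightarrow> 'a \<Rightarrow> real" where
  "adapted_norm f M ls p x v =
     max (norm_plus f M ls p x (proj_along (Eplus M ls x) (Eminus M ls x) v))
         (norm_minus f ls p x (proj_along (Eminus M ls x) (Eplus M ls x) v))"

definition tball_plus ::
  "('a::real_normed_vector \<Rightarrow> 'a) \<Rightarrow> 'a met_splitting \<Rightarrow> real \<Rightarrow> nat \<Rightarrow> 'a \<Rightarrow> real \<Rightarrow> 'a set" where
  "tball_plus f M ls p x r = {v \<in> Eplus M ls x. adapted_norm f M ls p x v \<le> r}"

definition tball_minus ::
  "('a::real_normed_vector \<Rightarrow> 'a) \<Rightarrow> 'a met_splitting \<Rightarrow> real \<Rightarrow> nat \<Rightarrow> 'a \<Rightarrow> real \<Rightarrow> 'a set" where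
  "tball_minus f M ls p x r = {v \<in> Eminus M ls x. adapted_norm f M ls p x v \<le> r}"

definition tball ::
  "('a::real_normed_vector \<Rightarrow> 'a) \<Rightarrow> 'a met_splitting \<Rightarrow> real \<Rightarrow> nat \<Rightarrow> 'a \<Rightarrow> real \<Rightarrow> 'a set" where
  "tball f M ls p x r = {u + w | u w. u \<in> tball_plus f M ls p x r \<and> w \<in> tball_minus f M ls p x r}"

definition ball_plus :: "('a::real_normed_vector) met_splitting \<Rightarrow> real \<Rightarrow> 'a \<Rightarrow> real \<Rightarrow> 'a set" where
  "ball_plus M ls x r = Eplus M ls x \<inter> cball 0 r"

definition ball_minus :: "('a::real_normed_vector) met_splitting \<Rightarrow> real \<Rightarrow> 'a \<Rightarrow> real \<Rightarrow> 'a set" where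
  "ball_minus M ls x r = Eminus M ls x \<inter> cball 0 r"

definition in_chart :: "('a::real_normed_vector \<Rightarrow> 'a) \<Rightarrow> 'a \<Rightarrow> 'a \<Rightarrow> 'a" where
  "in_chart f x v = f (x + v) - f x"

definition lip_wrt ::
  "('a::real_vector \<Rightarrow> real) \<Rightarrow> ('b::real_vector \<Rightarrow> real) \<Rightarrow> real \<Rightarrow> 'a set \<Rightarrow> ('a \<Rightarrow> 'b) \<Rightarrow> bool" where
  "lip_wrt N N' L S g \<longleftrightarrow> (\<forall>v\<in>S. \<forall>w\<in>S. N' (g v - g w) \<le> L * N (v - w))"

definition lyapunov_charts ::
  "('a::real_normed_vector \<Rightarrow> 'a) \<Rightarrow> 'a met_splitting \<Rightarrow> real \<Rightarrow> nat \<Rightarrow> 'a set \<Rightarrow>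
   real \<Rightarrow> real \<Rightarrow> ('a \<Rightarrow> real) \<Rightarrow> bool" where
  "lyapunov_charts f M ls p G \<delta>1 \<delta>2 l \<longleftrightarrow>
     0 < \<delta>1 \<and> l \<in> borel_measurable (restrict_space borel G) \<and>
     (\<forall>x\<in>G.
        1 \<le> l x \<and> l (f x) \<le> exp \<delta>2 * l x \<and> l (inv f x) \<le> exp \<delta>2 * l x \<and>
        (\<forall>v. norm v / 2 \<le> adapted_norm f M ls p x v \<and> adapted_norm f M ls p x v \<le> l x * norm v) \<and>
        (\<forall>\<delta>. 0 < \<delta> \<and> \<delta> \<le> \<delta>1 \<longrightarrow>
           lip_wrt (adapted_norm f M ls p x) (adapted_norm f M ls p (f x)) \<delta>
             (tball f M ls p x (\<delta> / l x))
             (\<lambda>v. in_chart f x v - frechet_derivative (in_chart f x) (at 0) v) \<and>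
           (\<forall>w. lip_wrt (adapted_norm f M ls p x) (adapted_norm f M ls p (f x))
             (l x * adapted_norm f M ls p x w)
             (tball f M ls p x (\<delta> / l x))
             (\<lambda>v. frechet_derivative (in_chart f x) (at v) w))))"


section \<open>Local strong stable manifolds, stacks and transversals\<close>

text \<open>Here \<open>S\<close> is a ball in a closed complemented subspace \<open>V\<close>. A derivative defined on \<open>V\<close> only is
  extended to the whole space by a bounded projection onto \<open>V\<close>, which preserves
  Lipschitz dependence on the point.\<close>

definition C1_Lip_on :: "'a::real_normed_vector set \<Rightarrow> ('a \<Rightarrow> 'a) \<Rightarrow> bool" where
  "C1_Lip_on S g \<longleftrightarrow>
     (\<exists>(D :: 'a \<Rightarrow> 'a \<Rightarrow>\<^sub>L 'a) L.
        (\<forall>w\<in>S. (g has_derivative blinfun_apply (D w)) (at w within S)) \<and> L-lipschitz_on S D)"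

definition graph_on :: "('a::real_vector \<Rightarrow> 'a) \<Rightarrow> 'a set \<Rightarrow> 'a set" where
  "graph_on g S = (\<lambda>w. w + g w) ` S"

definition local_stable ::
  "('a::real_normed_vector \<Rightarrow> 'a) \<Rightarrow> 'a met_splitting \<Rightarrow> real \<Rightarrow> nat \<Rightarrow> 'a set \<Rightarrow>
   ('a \<Rightarrow> real) \<Rightarrow> real \<Rightarrow> ('a \<Rightarrow> 'a \<Rightarrow> 'a) \<Rightarrow> bool" where
  "local_stable f M ls p G l \<delta>1' h \<longleftrightarrow>
     (\<forall>x\<in>G.
        let N = adapted_norm f M ls p x; N' = adapted_norm f M ls p (f x);
            B = tball_minus f M ls p x (\<delta>1' / l x);
            B' = tball_minus f M ls p (f x) (\<delta>1' / l (f x))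
        in h x ` B \<subseteq> tball_plus f M ls p x (\<delta>1' / l x) \<and>
           C1_Lip_on B (h x) \<and> h x 0 = 0 \<and> (h x has_derivative (\<lambda>_. 0)) (at 0 within B) \<and>
           lip_wrt N N (1 / 10) B (h x) \<and>
           in_chart f x ` graph_on (h x) B \<subseteq> graph_on (h (f x)) B' \<and>
           lip_wrt N N' (exp (lam_minus ls p) + \<delta>1') (graph_on (h x) B) (in_chart f x))"

definition Wss_loc ::
  "('a::real_normed_vector \<Rightarrow> 'a) \<Rightarrow> 'a met_splitting \<Rightarrow> real \<Rightarrow> nat \<Rightarrow>
   ('a \<Rightarrow> real) \<Rightarrow> real \<Rightarrow> ('a \<Rightarrow> 'a \<Rightarrow> 'a) \<Rightarrow> 'a \<Rightarrow> 'a set" where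
  "Wss_loc f M ls p l \<delta>1' h x = (+) x ` graph_on (h x) (tball_minus f M ls p x (\<delta>1' / l x))"

definition Gamma_le :: "'a set \<Rightarrow> ('a \<Rightarrow> real) \<Rightarrow> real \<Rightarrow> 'a set" where
  "Gamma_le G l l0 = {x \<in> G. l x \<le> l0}"

definition U_nbhd ::
  "('a::real_normed_vector) met_splitting \<Rightarrow> 'a set \<Rightarrow> ('a \<Rightarrow> real) \<Rightarrow> real \<Rightarrow> nat \<Rightarrow> 'a \<Rightarrow> real \<Rightarrow> 'a set" where
  "U_nbhd M G l l0 n0 x0 \<epsilon> = Gamma_le G l l0 \<inter> msp_K M n0 \<inter> {y. norm (y - x0) < \<epsilon>}"

definition leaf ::
  "('a::real_normed_vector) met_splitting \<Rightarrow> real \<Rightarrow> real \<Rightarrow> 'a \<Rightarrow> real \<Rightarrow> ('a \<Rightarrow> 'a \<Rightarrow> 'a) \<Rightarrow> 'a \<Rightarrow> 'a set" where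
  "leaf M ls l0 x0 \<delta> \<Theta> y = (+) x0 ` graph_on (\<Theta> y) (ball_minus M ls x0 (\<delta> / l0 ^ 3))"

text \<open>\<open>\<Theta> y\<close> represents the part of the stable manifold \<open>W y\<close> lying over the
  ball of radius \<open>\<delta> / l0 ^ 3\<close> in \<open>Eminus M ls x0\<close>.\<close>

definition leaf_family ::
  "('a::real_normed_vector) met_splitting \<Rightarrow> real \<Rightarrow> ('a \<Rightarrow> 'a set) \<Rightarrow> real \<Rightarrow> 'a \<Rightarrow> real \<Rightarrow>
   'a set \<Rightarrow> ('a \<Rightarrow> 'a \<Rightarrow> 'a) \<Rightarrow> bool" where
  "leaf_family M ls W l0 x0 \<delta> U \<Theta> \<longleftrightarrow>
     (\<forall>y\<in>U.
        \<Theta> y ` ball_minus M ls x0 (\<delta> / l0 ^ 3) \<subseteq> ball_plus M ls x0 (\<delta> / l0 ^ 3) \<and>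
        (1 / 10)-lipschitz_on (ball_minus M ls x0 (\<delta> / l0 ^ 3)) (\<Theta> y) \<and>
        W y \<inter> {x0 + u + w | u w. u \<in> Eplus M ls x0 \<and> w \<in> ball_minus M ls x0 (\<delta> / l0 ^ 3)}
          = leaf M ls l0 x0 \<delta> \<Theta> y \<and>
        uniform_limit (ball_minus M ls x0 (\<delta> / l0 ^ 3)) \<Theta> (\<Theta> y) (at y within U)) \<and>
     (\<forall>y\<in>U. \<forall>y'\<in>U. leaf M ls l0 x0 \<delta> \<Theta> y = leaf M ls l0 x0 \<delta> \<Theta> y' \<or>
        leaf M ls l0 x0 \<delta> \<Theta> y \<inter> leaf M ls l0 x0 \<delta> \<Theta> y' = {})"

definition transversal_map ::
  "('a::real_normed_vector) met_splitting \<Rightarrow> real \<Rightarrow> real \<Rightarrow> 'a \<Rightarrow> real \<Rightarrow> ('a \<Rightarrow> 'a) \<Rightarrow> bool" where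
  "transversal_map M ls l0 x0 \<delta> \<sigma> \<longleftrightarrow>
     \<sigma> ` ball_plus M ls x0 (2 * \<delta> / l0 ^ 3) \<subseteq> ball_minus M ls x0 (\<delta> / (2 * l0 ^ 4)) \<and>
     C1_Lip_on (ball_plus M ls x0 (2 * \<delta> / l0 ^ 3)) \<sigma> \<and>
     (1 / (40 * l0))-lipschitz_on (ball_plus M ls x0 (2 * \<delta> / l0 ^ 3)) \<sigma>"

definition transversal ::
  "('a::real_normed_vector) met_splitting \<Rightarrow> real \<Rightarrow> real \<Rightarrow> 'a \<Rightarrow> real \<Rightarrow> ('a \<Rightarrow> 'a) \<Rightarrow> 'a set" where
  "transversal M ls l0 x0 \<delta> \<sigma> = (+) x0 ` graph_on \<sigma> (ball_plus M ls x0 (2 * \<delta> / l0 ^ 3))"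

definition holonomy :: "('a \<Rightarrow> 'a set) \<Rightarrow> 'a set \<Rightarrow> 'a set \<Rightarrow> 'a \<Rightarrow> 'a" where
  "holonomy Lf U \<Sigma>2 z = (THE z'. \<exists>x\<in>U. z \<in> Lf x \<and> z' \<in> \<Sigma>2 \<inter> Lf x)"


section \<open>Induced volume and determinant\<close>

definition haar_on :: "'a::real_normed_vector set \<Rightarrow> 'a measure" where
  "haar_on E = (THE m. sets m = sets (restrict_space borel E) \<and>
     (\<forall>v\<in>E. \<forall>X\<in>sets m. emeasure m ((+) v ` X) = emeasure m X) \<and>
     emeasure m (E \<inter> cball 0 1) = ennreal (unit_ball_vol (real (dim E))))"

definition det_on :: "('a::real_normed_vector \<Rightarrow> 'a) \<Rightarrow> 'a set \<Rightarrow> real" where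
  "det_on A E =
     measure (haar_on (A ` E)) (A ` (E \<inter> cball 0 1)) / measure (haar_on E) (E \<inter> cball 0 1)"

definition local_param :: "'a::real_normed_vector set \<Rightarrow> (real^'k) set \<Rightarrow> (real^'k \<Rightarrow> 'a) \<Rightarrow> bool" where
  "local_param W Q \<psi> \<longleftrightarrow>
     open Q \<and> openin (top_of_set W) (\<psi> ` Q) \<and> (\<exists>g. homeomorphism Q (\<psi> ` Q) \<psi> g) \<and>
     (\<exists>D :: real^'k \<Rightarrow> (real^'k) \<Rightarrow>\<^sub>L 'a. continuous_on Q D \<and>
        (\<forall>z\<in>Q. (\<psi> has_derivative blinfun_apply (D z)) (at z) \<and> inj (blinfun_apply (D z))))"

definition volume_jacobian :: "(real^'k \<Rightarrow> 'a::real_normed_vector) \<Rightarrow> real^'k \<Rightarrow> real" where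
  "volume_jacobian \<psi> z =
     (let T = frechet_derivative \<psi> (at z)
      in measure (haar_on (range T)) (T ` cball 0 1) / measure lborel (cball (0::real^'k) 1))"

definition tangent_space :: "'k::finite itself \<Rightarrow> 'a::real_normed_vector set \<Rightarrow> 'a \<Rightarrow> 'a set" where
  "tangent_space _ W y =
     {v. \<exists>Q (\<psi> :: real^'k \<Rightarrow> 'a). local_param W Q \<psi> \<and>
        (\<exists>z\<in>Q. \<psi> z = y \<and> v \<in> range (frechet_derivative \<psi> (at z)))}"

text \<open>The last clause is void for a manifold without boundary. It makes the
  boundary of a graph over a closed ball, which no chart covers, a null set.\<close>

definition induced_volume :: "'k::finite itself \<Rightarrow> 'a::real_normed_vector set \<Rightarrow> 'a measure" where
  "induced_volume _ W = (THE \<nu>. sets \<nu> = sets (restrict_space borel W) \<and>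
     (\<forall>Q (\<psi> :: real^'k \<Rightarrow> 'a). local_param W Q \<psi> \<longrightarrow>
        (\<forall>X\<in>sets borel. X \<subseteq> Q \<longrightarrow>
           emeasure \<nu> (\<psi> ` X) = (\<integral>\<^sup>+ z\<in>X. ennreal (volume_jacobian \<psi> z) \<partial>lborel))) \<and>
     emeasure \<nu> (W - \<Union>{\<psi> ` Q | Q (\<psi> :: real^'k \<Rightarrow> 'a). local_param W Q \<psi>}) = 0)"

definition det_ratio ::
  "'k::finite itself \<Rightarrow> ('a::real_normed_vector \<Rightarrow> 'a) \<Rightarrow> 'a set \<Rightarrow> 'a set \<Rightarrow> ('a \<Rightarrow> 'a) \<Rightarrow> 'a \<Rightarrow> nat \<Rightarrow> real" where
  "det_ratio k f \<Sigma>1 \<Sigma>2 hol y N =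
     det_on (diter f N y) (tangent_space k \<Sigma>1 y) /
     det_on (diter f N (hol y)) (tangent_space k \<Sigma>2 (hol y))"

end

theory Submission
  imports Defs
begin

text \<open>In linear coordinates on \<open>Eplus\<close> at \<open>x0\<close> the transversals are parametrised by balls of \<open>\<real>\<^sup>m\<close>, and
  the holonomy becomes a homeomorphism \<open>P\<close> between compact sets; the volume \<open>unit_vol\<close> of the preimage of the
  unit ball computes both determinants and volume densities, so it suffices that
  \<open>Leb (P X) = \<integral>\<^sub>X exp R\<close>, where \<open>R\<close> is the limit of the differences of \<open>ln unit_vol\<close> along the two
  forward orbits. In the Lyapunov charts the two orbits approach each other like \<open>a ^ n\<close>, while a piece of size \<open>b ^ n\<close>
  of the \<open>n\<close>-th image of a transversal, for some \<open>b\<close> strictly between the contraction rate \<open>a\<close> and the expansion rate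
  (and below 1), stays in the chart and has tangent slopes tending to 0 exponentially. On the Bowen balls corresponding to such
  pieces \<open>P\<close> is therefore, after \<open>n\<close> steps, a perturbation of a smooth map of controlled Jacobian whose size relative to the
  ball is exponentially small. A partition of unity subordinate to a maximal separated net, of multiplicity growing only
  like \<open>exp (\<delta>2 * m * n)\<close>, turns this into \<open>Leb (P X) \<le> sup (exp R) * Leb X\<close> for compact \<open>X\<close>; applying it to
  \<open>P\<close> and to its inverse on small pieces gives the density.\<close>


text \<open>The holonomy is known only to be a homeomorphism, and Bowen balls are not round, so no
  covering or differentiation theorem yields its Jacobian, while a plain cover would lose its
  multiplicity, which grows exponentially. Weights avoid this loss. They have slope at most one in
  the Bowen metric and size \<sigma>, while replacing \<open>P \<zeta>\<close> by the point of the
  first disc with the same unstable coordinate at time \<open>n\<close> displaces by at most \<eta>.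
  Sums of weights then change by at most multiplicity times \<eta>, to be compared with \<sigma>.
  This quotient behaves like the \<open>n\<close>-th power of
  \<open>E ^ (CARD('k) + 2) * a / b\<close>: one factor \<open>E\<close> per dimension for the
  multiplicity, one in \<eta> for passing between charts of different leaves, one in \<sigma> for
  passing from the chart scale to the norm. Different charts are compared only through the ambient
  norm, since adapted norms are not assumed to depend continuously on the point. The rate
  \<open>b\<close> exceeds \<open>a\<close> so that leaves merge inside a piece, and stays below the
  expansion so that backward iteration keeps a piece small.\<close>

text \<open>The library states its change of variables inequality only for well-ordered index types.\<close>

typedef 'm idx = "{..<card (UNIV :: 'm::finite set)}"
  by (auto intro!: exI[of _ 0])

instantiation idx :: (finite) linorder
begin

definition less_eq_idx :: "'a idx \<Rightarrow> 'a idx \<Rightarrow> bool" where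
  "less_eq_idx x y \<longleftrightarrow> Rep_idx x \<le> Rep_idx y"

definition less_idx :: "'a idx \<Rightarrow> 'a idx \<Rightarrow> bool" where
  "less_idx x y \<longleftrightarrow> Rep_idx x < Rep_idx y"

instance
  by standard (auto simp: less_eq_idx_def less_idx_def Rep_idx_inject)

end

lemma UNIV_idx: "(UNIV :: 'm::finite idx set) = Abs_idx ` {..<CARD('m)}"
  by (metis type_definition.Abs_image type_definition_idx)

instance idx :: (finite) finite
  by standard (simp add: UNIV_idx)

instance idx :: (finite) wellorder
proof
  fix P :: "'a idx \<Rightarrow> bool" and x
  assume step: "\<And>x. (\<And>y. y < x \<Longrightarrow> P y) \<Longrightarrow> P x"
  show "P x"
    by (induction x rule: measure_induct_rule[of Rep_idx])
      (use step in \<open>auto simp: less_idx_def\<close>)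
qed

lemma card_idx: "CARD('m::finite idx) = CARD('m)"
  by (metis card_lessThan type_definition.card type_definition_idx)

section \<open>Coordinate permutations and the change of variables inequality\<close>

definition reindex :: "('n \<Rightarrow> 'm) \<Rightarrow> real^'m \<Rightarrow> real^'n" where
  "reindex e x = (\<chi> i. x $ e i)"

lemma linear_reindex: "linear (reindex e)"
  by (rule linearI) (auto simp: reindex_def vec_eq_iff)

lemma bounded_linear_reindex: "bounded_linear (reindex e)"
  using linear_reindex linear_conv_bounded_linear by blast

lemma reindex_inverse:
  assumes "bij e"
  shows "reindex (inv e) (reindex e x) = x" "reindex e (reindex (inv e) y) = y"
  using assms by (auto simp: reindex_def vec_eq_iff bij_is_surj bij_is_inj surj_f_inv_f inv_f_f)

lemma reindex_vimage_image:
  assumes "bij e"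
  shows "reindex e ` X = reindex (inv e) -` X"
  using reindex_inverse[OF assms] by (auto simp: image_iff) metis

text \<open>Lebesgue measure is determined by boxes, and permuting the coordinates only permutes the
  side lengths.\<close>

lemma distr_lborel_reindex:
  assumes "bij (e :: 'n::finite \<Rightarrow> 'm::finite)"
  shows "distr lborel borel (reindex e) = lborel"
proof (rule lborel_eqI[symmetric])
  have [measurable]: "reindex e \<in> borel_measurable borel"
    by (intro borel_measurable_continuous_onI linear_continuous_on bounded_linear_reindex)
  fix l u :: "real^'n"
  assume le: "\<And>b. b \<in> Basis \<Longrightarrow> l \<bullet> b \<le> u \<bullet> b"
  have ax: "b \<in> Basis \<longleftrightarrow> (\<exists>i. b = axis i 1)" for b :: "real^'k::finite"
    by (auto simp: Basis_vec_def)
  have "reindex e -` box l u = box (reindex (inv e) l) (reindex (inv e) u)"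
    using assms
    by (auto simp: mem_box_cart reindex_def bij_is_inj)
       (metis assms bij_inv_eq_iff)+
  moreover have "l $ i \<le> u $ i" for i
    using le[of "axis i 1"] by (auto simp: ax inner_axis)
  then have "(\<forall>b\<in>Basis. reindex (inv e) l \<bullet> b \<le> reindex (inv e) u \<bullet> b)"
    by (auto simp: ax inner_axis reindex_def)
  moreover have "(\<Prod>b\<in>Basis. (reindex (inv e) u - reindex (inv e) l) \<bullet> b) = (\<Prod>b\<in>Basis. (u - l) \<bullet> b)"
  proof -
    have prod_ax: "(\<Prod>b\<in>Basis. w \<bullet> b) = (\<Prod>i\<in>UNIV. w $ i)" for w :: "real^'k::finite"
    proof -
      have inj: "inj (\<lambda>i. axis i 1 :: real^'k)"
        by (auto simp: inj_on_def axis_eq_axis)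
      have "(Basis :: (real^'k) set) = range (\<lambda>i. axis i 1)"
        using ax by auto
      then show ?thesis
        using prod.reindex[OF inj, of "\<lambda>b. w \<bullet> b"] by (simp add: inner_axis o_def)
    qed
    show ?thesis
      unfolding prod_ax
      by (rule prod.reindex_bij_witness[of _ e "inv e"])
         (use assms in \<open>auto simp: reindex_def bij_is_surj bij_is_inj surj_f_inv_f inv_f_f\<close>)
  qed
  ultimately show "emeasure (distr lborel borel (reindex e)) (box l u) = (\<Prod>b\<in>Basis. (u - l) \<bullet> b)"
    by (simp add: emeasure_distr emeasure_lborel_box_eq)
qed simp

lemma reindex_borel:
  assumes "bij (e :: 'n::finite \<Rightarrow> 'm::finite)" "X \<in> sets borel"
  shows "reindex e ` X \<in> sets borel"
proof -
  have "reindex (inv e) \<in> borel_measurable borel"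
    by (intro borel_measurable_continuous_onI linear_continuous_on bounded_linear_reindex)
  then show ?thesis
    using assms(2) measurable_sets_borel by (auto simp: reindex_vimage_image[OF assms(1)])
qed

lemma emeasure_reindex:
  assumes "bij (e :: 'n::finite \<Rightarrow> 'm::finite)" "X \<in> sets borel"
  shows "emeasure lborel (reindex e ` X) = emeasure lborel X"
proof -
  have b: "bij (inv e)" using assms bij_imp_bij_inv by blast
  have [measurable]: "reindex (inv e) \<in> borel_measurable borel"
    by (intro borel_measurable_continuous_onI linear_continuous_on bounded_linear_reindex)
  have "emeasure lborel X = emeasure (distr lborel borel (reindex (inv e))) X"
    by (simp add: distr_lborel_reindex[OF b])
  also have "\<dots> = emeasure lborel (reindex e ` X)"
    using assms by (simp add: emeasure_distr reindex_vimage_image)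
  finally show ?thesis ..
qed

text \<open>By \<open>vol_ratio_det\<close> this is the absolute value of the determinant. The form
  through volumes is invariant under \<open>reindex\<close> and combines directly with
  \<open>unit_vol\<close>.\<close>

definition vol_ratio :: "(real^'m::finite \<Rightarrow> real^'m) \<Rightarrow> real" where
  "vol_ratio L = measure lborel (L ` cball 0 1) / measure lborel (cball (0::real^'m) 1)"

lemma vol_ratio_det:
  fixes L :: "real^'n::{finite,wellorder} \<Rightarrow> real^'n::_"
  assumes "linear L"
  shows "vol_ratio L = \<bar>det (matrix L)\<bar>"
proof -
  have "compact (L ` cball 0 1)"
    using assms by (intro compact_continuous_image linear_continuous_on) (auto simp: linear_conv_bounded_linear)
  then have "L ` cball 0 1 \<in> sets lborel"
    using borel_compact by simp
  then have "measure lborel (L ` cball 0 1) = measure lebesgue (L ` cball 0 1)"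
    by (rule measure_completion[symmetric])
  also have "\<dots> = \<bar>det (matrix L)\<bar> * measure lebesgue (cball (0::real^'n::_) 1)"
    using assms by (intro measure_linear_image) auto
  also have "measure lebesgue (cball (0::real^'n::_) 1) = measure lborel (cball (0::real^'n::_) 1)"
    by (simp add: measure_completion)
  finally show ?thesis
    using content_cball_pos[of 1 "0::real^'n::_"] by (simp add: vol_ratio_def)
qed

lemma vol_ratio_conjugate:
  fixes L :: "real^'m::finite \<Rightarrow> real^'m"
  assumes "bij (e :: 'n::finite \<Rightarrow> 'm)" "linear L"
  shows "vol_ratio (reindex e \<circ> L \<circ> reindex (inv e)) = vol_ratio L"
proof -
  have b: "bij (inv e)" using assms bij_imp_bij_inv by blast
  have nrm: "norm (reindex e x) = norm x" for x :: "real^'m"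
    unfolding norm_vec_def L2_set_def reindex_def
    by (rule arg_cong[of _ _ sqrt], rule sum.reindex_bij_witness[of _ "inv e" e])
       (use assms(1) in \<open>auto simp: bij_is_surj bij_is_inj surj_f_inv_f inv_f_f\<close>)
  have ball: "reindex e ` cball 0 1 = cball 0 1"
    using nrm reindex_inverse[OF assms(1)]
    by (auto simp: image_iff) (metis mem_cball_0)
  then have ball': "reindex (inv e) ` cball 0 1 = cball 0 1"
    using reindex_inverse[OF assms(1)] by (metis (no_types, lifting) image_cong image_ident image_image)
  have "compact (L ` cball 0 1)"
    using assms(2) by (intro compact_continuous_image linear_continuous_on) (auto simp: linear_conv_bounded_linear)
  then have "emeasure lborel ((reindex e \<circ> L \<circ> reindex (inv e)) ` cball 0 1) = emeasure lborel (L ` cball 0 1)"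
    unfolding image_comp[symmetric] ball'
    by (intro emeasure_reindex assms borel_compact)
  moreover have "emeasure lborel (cball (0::real^'n) 1) = emeasure lborel (cball (0::real^'m) 1)"
    using emeasure_reindex[OF assms(1), of "cball 0 1"] by (simp add: ball)
  ultimately show ?thesis
    by (simp add: vol_ratio_def measure_def)
qed

text \<open>A constant bound on the Jacobian is enough, because densities are recovered later by
  cutting the domain into pieces on which they are almost constant.\<close>

lemma emeasure_bounded_image_wellorder:
  fixes g :: "real^'n::{finite,wellorder} \<Rightarrow> real^'n::_"
  assumes S: "S \<in> sets borel" "bounded S"
    and der: "\<And>x. x \<in> S \<Longrightarrow> (g has_derivative g' x) (at x within S)"
    and le: "\<And>x. x \<in> S \<Longrightarrow> vol_ratio (g' x) \<le> c" and "0 \<le> c"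
    and im: "g ` S \<in> sets borel"
  shows "emeasure lborel (g ` S) \<le> ennreal c * emeasure lborel S"
proof -
  have Sl: "S \<in> lmeasurable"
    using S by (auto intro!: bounded_set_imp_lmeasurable)
  have lin: "linear (g' x)" if "x \<in> S" for x
    using der[OF that] has_derivative_linear by blast
  have det: "\<bar>det (matrix (g' x))\<bar> \<le> c" if "x \<in> S" for x
    using vol_ratio_det[OF lin[OF that]] le[OF that] by simp
  have meas: "(\<lambda>x. \<bar>det (matrix (g' x))\<bar>) \<in> borel_measurable (lebesgue_on S)"
    using borel_measurable_det_Jacobian[OF fmeasurableD[OF Sl] der] by measurable
  have int: "(\<lambda>x. \<bar>det (matrix (g' x))\<bar>) integrable_on S"
    using measurable_bounded_by_integrable_imp_integrable[OF meas, of "\<lambda>_. c"] Sl det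
    by (auto simp: integrable_on_const)
  note * = measurable_bounded_differentiable_image[OF Sl der int det]
    measure_bounded_differentiable_image[OF Sl der int det]
  have "emeasure lborel (g ` S) = ennreal (measure lebesgue (g ` S))"
    using emeasure_eq_measure2[OF *(1)] im by simp
  also have "\<dots> \<le> ennreal (c * measure lebesgue S)"
    using *(2) by (intro ennreal_leI) auto
  also have "\<dots> = ennreal c * emeasure lborel S"
    using emeasure_eq_measure2[OF Sl] S \<open>0 \<le> c\<close> by (simp add: ennreal_mult)
  finally show ?thesis .
qed

text \<open>Conjugation by \<open>reindex e\<close> changes neither volumes nor
  \<open>vol_ratio\<close>, so the well-ordered case carries over; unbounded sets are exhausted by
  balls. The last assumption makes the images of the exhausting pieces measurable.\<close>

lemma emeasure_differentiable_image_le: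
  fixes g :: "real^'m::finite \<Rightarrow> real^'m"
  assumes S: "S \<in> sets borel" 
    and der: "\<And>x. x \<in> S \<Longrightarrow> (g has_derivative g' x) (at x within S)"
    and le: "\<And>x. x \<in> S \<Longrightarrow> vol_ratio (g' x) \<le> c" and "0 \<le> c"
    and im: "\<And>n::nat. g ` (S \<inter> cball 0 n) \<in> sets borel"
  shows "emeasure lborel (g ` S) \<le> ennreal c * emeasure lborel S"
proof -
  obtain e :: "'m idx \<Rightarrow> 'm" where e: "bij e"
    using finite_same_card_bij[of "UNIV :: 'm idx set" "UNIV :: 'm set"] card_idx by auto
  note inverse = reindex_inverse[OF e]
  have bd: "emeasure lborel (g ` T) \<le> ennreal c * emeasure lborel T"
    if T: "T \<in> sets borel" "bounded T" "T \<subseteq> S" "g ` T \<in> sets borel" for T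
  proof -
    let ?g = "reindex e \<circ> g \<circ> reindex (inv e)"
    have "emeasure lborel (?g ` reindex e ` T) \<le> ennreal c * emeasure lborel (reindex e ` T)"
    proof (rule emeasure_bounded_image_wellorder)
      show "bounded (reindex e ` T)"
        by (intro bounded_linear_image that bounded_linear_reindex)
      have eq: "?g ` reindex e ` T = reindex e ` g ` T"
        by (auto simp: image_comp o_def inverse)
      show "?g ` reindex e ` T \<in> sets borel"
        unfolding eq by (intro reindex_borel e that)
      fix y assume "y \<in> reindex e ` T"
      then obtain x where x: "x \<in> T" "y = reindex e x" by auto
      have gx: "(g has_derivative g' x) (at x within T)"
        using der[of x] x that has_derivative_subset by blast
      have "(reindex (inv e) has_derivative reindex (inv e)) (at y within reindex e ` T)"
        by (intro bounded_linear_imp_has_derivative bounded_linear_reindex)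
      moreover have "(g has_derivative g' x) (at (reindex (inv e) y) within reindex (inv e) ` reindex e ` T)"
        using gx by (simp add: x inverse image_image)
      ultimately have "(g \<circ> reindex (inv e) has_derivative g' x \<circ> reindex (inv e)) (at y within reindex e ` T)"
        by (rule diff_chain_within)
      moreover have "(reindex e has_derivative reindex e) (at ((g \<circ> reindex (inv e)) y) within (g \<circ> reindex (inv e)) ` reindex e ` T)"
        by (intro bounded_linear_imp_has_derivative bounded_linear_reindex)
      ultimately have "(reindex e \<circ> (g \<circ> reindex (inv e)) has_derivative reindex e \<circ> (g' x \<circ> reindex (inv e))) (at y within reindex e ` T)"
        by (rule diff_chain_within)
      then show "(?g has_derivative (\<lambda>y. reindex e \<circ> g' (reindex (inv e) y) \<circ> reindex (inv e)) y) (at y within reindex e ` T)"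
        by (simp add: x inverse o_assoc)
      have "linear (g' x)" using gx has_derivative_linear by blast
      then have "vol_ratio (reindex e \<circ> g' x \<circ> reindex (inv e)) = vol_ratio (g' x)"
        using vol_ratio_conjugate[OF e] by blast
      then show "vol_ratio ((\<lambda>y. reindex e \<circ> g' (reindex (inv e) y) \<circ> reindex (inv e)) y) \<le> c"
        using le[of x] x that by (auto simp: inverse)
    qed (use that e \<open>0 \<le> c\<close> in \<open>auto intro: reindex_borel\<close>)
    moreover have "?g ` reindex e ` T = reindex e ` g ` T"
      by (auto simp: image_comp o_def inverse)
    ultimately show ?thesis
      using emeasure_reindex[OF e] that by simp
  qed
  have inc: "incseq (\<lambda>n::nat. S \<inter> cball 0 n)"
    by (auto simp: incseq_def)
  have US: "(\<Union>n::nat. S \<inter> cball 0 n) = S"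
    by (auto simp: real_arch_simple)
  have "emeasure lborel (g ` S) = emeasure lborel (\<Union>n::nat. g ` (S \<inter> cball 0 n))"
    by (metis US image_UN)
  also have "\<dots> = (SUP n::nat. emeasure lborel (g ` (S \<inter> cball 0 n)))"
    using im by (intro SUP_emeasure_incseq[symmetric]) (fastforce simp: incseq_def)+
  also have "\<dots> \<le> ennreal c * emeasure lborel S"
  proof (rule SUP_least)
    fix n :: nat
    have "emeasure lborel (g ` (S \<inter> cball 0 n)) \<le> ennreal c * emeasure lborel (S \<inter> cball 0 n)"
      using S im by (intro bd) auto
    also have "\<dots> \<le> ennreal c * emeasure lborel S"
      using S by (intro mult_left_mono emeasure_mono) auto
    finally show "emeasure lborel (g ` (S \<inter> cball 0 n)) \<le> ennreal c * emeasure lborel S" .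
  qed
  finally show ?thesis .
qed


section \<open>Unit volumes of injective linear maps, Haar measure and determinants\<close>

lemma inj_linear_bounded_below:
  fixes T :: "'e::euclidean_space \<Rightarrow> 'a::real_normed_vector"
  assumes "bounded_linear T" "inj T"
  obtains c where "0 < c" "\<And>v. c * norm v \<le> norm (T v)"
proof -
  interpret T: bounded_linear T by fact
  have "continuous_on (sphere 0 1) (\<lambda>v. norm (T v))"
    by (intro continuous_intros T.continuous_on)
  then have "\<exists>u\<in>sphere 0 1. \<forall>v\<in>sphere 0 1. norm (T u) \<le> norm (T v)"
    by (intro continuous_attains_inf) simp_all
  then obtain u where u: "u \<in> sphere 0 1" "\<And>v. v \<in> sphere 0 1 \<Longrightarrow> norm (T u) \<le> norm (T v)"
    by blast
  have "u \<noteq> 0" using u(1) by auto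
  then have "T u \<noteq> 0"
    using assms(2) T.zero by (metis injD)
  moreover have "norm (T u) * norm v \<le> norm (T v)" for v
  proof (cases "v = 0")
    case False
    have "norm (T u) \<le> norm (T (v /\<^sub>R norm v))"
      using False by (intro u) simp
    then show ?thesis
      using False by (simp add: T.scaleR field_simps)
  qed simp
  ultimately show ?thesis
    using that[of "norm (T u)"] by auto
qed

lemma translation_vimage: "(+) v ` X = (\<lambda>x. x - v) -` X" for v :: "'e::ab_group_add"
  by (force simp: image_iff)

lemma translation_borel:
  fixes v :: "'e::real_normed_vector"
  assumes "X \<in> sets borel" shows "(+) v ` X \<in> sets borel"
proof -
  have "(\<lambda>x. x - v) \<in> borel_measurable borel"
    by (intro borel_measurable_continuous_onI continuous_intros)
  then show ?thesis
    using assms measurable_sets_borel by (auto simp: translation_vimage)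
qed

lemma emeasure_lborel_translation:
  fixes v :: "'e::euclidean_space"
  assumes "X \<in> sets borel" shows "emeasure lborel ((+) v ` X) = emeasure lborel X"
proof -
  have "emeasure lborel X = emeasure (distr lborel borel (\<lambda>x. - v + x)) X"
    by (subst lborel_distr_plus) simp
  then show ?thesis
    using assms by (simp add: emeasure_distr translation_vimage)
qed

text \<open>Both sides evaluate the double integral of
  \<open>indicator A x * indicator B (y - x)\<close> against \<open>m\<close> and
  \<open>lborel\<close>. Integrating first over \<open>y\<close> gives the left side. Shifting
  \<open>x\<close> by \<open>y\<close>, using the symmetry of \<open>B\<close>, and then again
  integrating first over \<open>y\<close> gives the right side.\<close>

lemma translation_invariant_unique:
  fixes m :: "'e::euclidean_space measure"
  assumes sets: "sets m = sets borel"
    and inv: "\<And>v X. X \<in> sets borel \<Longrightarrow> emeasure m ((+) v ` X) = emeasure m X"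
    and B: "B \<in> sets borel" "uminus ` B = B" "ball 0 r \<subseteq> B" "0 < r" "emeasure m B < \<infinity>"
    and A: "A \<in> sets borel"
  shows "emeasure m A * emeasure lborel B = emeasure lborel A * emeasure m B"
proof -
  note [measurable_cong] = sets
  have sp: "space m = UNIV" using sets_eq_imp_space_eq[OF sets] by simp
  note [measurable] = A B(1)
  have distr: "distr m borel (\<lambda>x. v + x) = m" for v
  proof (rule measure_eqI)
    fix X assume "X \<in> sets (distr m borel (\<lambda>x. v + x))"
    then have [measurable]: "X \<in> sets borel" by simp
    have "(\<lambda>x. v + x) -` X = (+) (- v) ` X"
      unfolding translation_vimage by (simp add: add.commute)
    then show "emeasure (distr m borel (\<lambda>x. v + x)) X = emeasure m X"
      using inv[of X "- v"] by (simp add: emeasure_distr sp)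
  qed (simp add: sets)
  \<comment> \<open>Translates of \<open>B\<close> by a countable dense set cover the space, because
    \<open>B\<close> contains a ball, and they all have the same finite mass.\<close>
  have "sigma_finite_measure m"
  proof
    obtain D :: "'e set" where D: "countable D" "closure D = UNIV"
      using separable[of UNIV] by (metis top.extremum_uniqueI)
    have "\<Union>((\<lambda>d. (+) d ` B) ` D) = UNIV"
    proof (safe, simp)
      fix x :: 'e
      have "x \<in> closure D" using D by simp
      then obtain d where "d \<in> D" "dist d x < r"
        using \<open>0 < r\<close> by (auto simp: closure_approachable)
      then have "x - d \<in> B"
        using B(3) by (auto simp: dist_norm norm_minus_commute)
      then have "x \<in> (+) d ` B"
        using image_eqI[of x "(+) d" "x - d" B] by simp
      with \<open>d \<in> D\<close> show "x \<in> (\<Union>d\<in>D. (+) d ` B)"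
        by (rule UN_I)
    qed
    moreover have "(\<lambda>d. (+) d ` B) ` D \<subseteq> sets m"
      unfolding sets using translation_borel[OF B(1)] by blast
    moreover have "\<forall>a\<in>(\<lambda>d. (+) d ` B) ` D. emeasure m a \<noteq> \<infinity>"
      using inv[OF B(1)] B(5) by (metis (no_types, lifting) imageE less_irrefl)
    ultimately show "\<exists>A. countable A \<and> A \<subseteq> sets m \<and> \<Union> A = space m \<and> (\<forall>a\<in>A. emeasure m a \<noteq> \<infinity>)"
      unfolding sp using D(1) by (metis countable_image)
  qed
  then interpret pair_sigma_finite m "lborel :: 'e measure"
    by (simp add: pair_sigma_finite_def sigma_finite_lborel)
  have "emeasure m A * emeasure lborel B = (\<integral>\<^sup>+x. (\<integral>\<^sup>+y. indicator A x * indicator B (y - x) \<partial>lborel) \<partial>m)"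
  proof -
    have "(\<integral>\<^sup>+y. indicator A x * indicator B (y - x) \<partial>lborel) = indicator A x * emeasure lborel B" for x
    proof -
      have "(\<integral>\<^sup>+y. indicator A x * indicator B (y - x) \<partial>lborel)
        = indicator A x * (\<integral>\<^sup>+y. indicator B (y - x) \<partial>lborel)"
        by (rule nn_integral_cmult) measurable
      also have "(\<integral>\<^sup>+y. indicator B (y - x) \<partial>lborel) = (\<integral>\<^sup>+y. indicator B y \<partial>distr lborel borel (\<lambda>y. -x + y))"
        by (subst nn_integral_distr) (auto simp: algebra_simps)
      also have "distr lborel borel (\<lambda>y. -x + y) = lborel"
        by (rule lborel_distr_plus)
      finally show ?thesis by simp
    qed
    then show ?thesis
      by (simp add: nn_integral_multc sets)
  qed
  also have "\<dots> = (\<integral>\<^sup>+y. (\<integral>\<^sup>+x. indicator A x * indicator B (y - x) \<partial>m) \<partial>lborel)"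
    by (rule Fubini'[symmetric]) measurable
  also have "\<dots> = (\<integral>\<^sup>+y. (\<integral>\<^sup>+x. indicator A (y + x) * indicator B x \<partial>m) \<partial>lborel)"
  proof (rule nn_integral_cong)
    fix y :: 'e
    have Bsym: "- x \<in> B \<longleftrightarrow> x \<in> B" for x
      using B(2) by (metis image_eqI minus_minus)
    have "(\<integral>\<^sup>+x. indicator A x * indicator B (y - x) \<partial>m)
      = (\<integral>\<^sup>+x. indicator A x * indicator B (y - x) \<partial>distr m borel (\<lambda>x. y + x))"
      by (simp add: distr)
    also have "\<dots> = (\<integral>\<^sup>+x. indicator A (y + x) * indicator B (- x) \<partial>m)"
      by (subst nn_integral_distr) auto
    also have "\<dots> = (\<integral>\<^sup>+x. indicator A (y + x) * indicator B x \<partial>m)"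
      by (simp add: indicator_def Bsym)
    finally show "(\<integral>\<^sup>+x. indicator A x * indicator B (y - x) \<partial>m) = (\<integral>\<^sup>+x. indicator A (y + x) * indicator B x \<partial>m)" .
  qed
  also have "\<dots> = (\<integral>\<^sup>+x. (\<integral>\<^sup>+y. indicator A (y + x) * indicator B x \<partial>lborel) \<partial>m)"
    by (rule Fubini') measurable
  also have "\<dots> = (\<integral>\<^sup>+x. emeasure lborel A * indicator B x \<partial>m)"
  proof (rule nn_integral_cong)
    fix x :: 'e
    have "(\<integral>\<^sup>+y. indicator A (y + x) * indicator B x \<partial>lborel) = (\<integral>\<^sup>+y. indicator A (y + x) \<partial>lborel) * indicator B x"
      by (rule nn_integral_multc) measurable
    also have "(\<integral>\<^sup>+y. indicator A (y + x) \<partial>lborel) = (\<integral>\<^sup>+y. indicator A y \<partial>distr lborel borel (\<lambda>y. x + y))"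
      by (subst nn_integral_distr) (auto simp: algebra_simps)
    also have "\<dots> = emeasure lborel A"
      by (simp add: lborel_distr_plus)
    finally show "(\<integral>\<^sup>+y. indicator A (y + x) * indicator B x \<partial>lborel) = emeasure lborel A * indicator B x" .
  qed
  also have "\<dots> = emeasure lborel A * emeasure m B"
    by (simp add: nn_integral_cmult sets)
  finally show ?thesis .
qed

lemma uminus_image_eqI:
  fixes S :: "'e::group_add set"
  assumes "\<And>v. v \<in> S \<Longrightarrow> - v \<in> S" shows "uminus ` S = S"
proof (intro equalityI subsetI)
  fix v assume "v \<in> S"
  then show "v \<in> uminus ` S"
    using assms[of v] by (intro image_eqI[of _ _ "- v"]) simp_all
qed (use assms in auto)

text \<open>Strong expansion makes it small, so it behaves like the reciprocal of a volume growth.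
  Only the norm of the target enters, which suits subspaces of a Banach space, where there is no
  inner product.\<close>

definition unit_vol :: "('e::euclidean_space \<Rightarrow> 'a::real_normed_vector) \<Rightarrow> real" where
  "unit_vol T = measure lborel {v. norm (T v) \<le> 1}"

context
  fixes T :: "'e::euclidean_space \<Rightarrow> 'a::real_normed_vector"
  assumes T: "bounded_linear T" "inj T"
begin

interpretation T: bounded_linear T by (fact T)

lemma unit_vol_set:
  "compact {v. norm (T v) \<le> 1}" "{v. norm (T v) \<le> 1} \<in> sets borel"
  "\<exists>r>0. ball 0 r \<subseteq> {v. norm (T v) \<le> 1}" "uminus ` {v. norm (T v) \<le> 1} = {v. norm (T v) \<le> 1}"
proof -
  obtain c where c: "0 < c" "\<And>v. c * norm v \<le> norm (T v)"
    using inj_linear_bounded_below[OF T] by blast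
  have "norm v \<le> 1 / c" if "norm (T v) \<le> 1" for v
    using c(2)[of v] c(1) that by (auto simp: field_simps intro: order_trans)
  then have "bounded {v. norm (T v) \<le> 1}"
    by (auto simp: bounded_iff)
  moreover have "closed {v. norm (T v) \<le> 1}"
    by (intro closed_Collect_le continuous_intros T.continuous_on)
  ultimately show 1: "compact {v. norm (T v) \<le> 1}"
    by (simp add: compact_eq_bounded_closed)
  then show "{v. norm (T v) \<le> 1} \<in> sets borel" by (rule borel_compact)
  obtain K where K: "0 < K" "\<And>v. norm (T v) \<le> norm v * K"
    using T.pos_bounded by blast
  have "norm (T v) \<le> 1" if "norm v < 1 / K" for v
    using K(2)[of v] K(1) that by (auto simp: field_simps)
  then show "\<exists>r>0. ball 0 r \<subseteq> {v. norm (T v) \<le> 1}"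
    using K(1) by (intro exI[of _ "1 / K"]) auto
  show "uminus ` {v. norm (T v) \<le> 1} = {v. norm (T v) \<le> 1}"
  proof (rule uminus_image_eqI)
    fix v assume "v \<in> {v. norm (T v) \<le> 1}"
    then show "- v \<in> {v. norm (T v) \<le> 1}"
      by (simp add: linear_neg[OF bounded_linear.linear[OF T(1)]])
  qed
qed

lemma emeasure_unit_vol: "emeasure lborel {v. norm (T v) \<le> 1} = ennreal (unit_vol T)"
  unfolding unit_vol_def
  using emeasure_compact_finite[OF unit_vol_set(1)] by (simp add: emeasure_eq_ennreal_measure)

lemma unit_vol_pos: "0 < unit_vol T"
proof -
  obtain r where r: "0 < r" "ball 0 r \<subseteq> {v. norm (T v) \<le> 1}"
    using unit_vol_set(3) by blast
  have "0 < ennreal (measure lborel (ball (0::'e) r))"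
    using r content_ball_pos[of r 0] by simp
  also have "\<dots> = emeasure lborel (ball (0::'e) r)"
    using emeasure_lborel_ball_finite[of "0::'e" r] by (simp add: emeasure_eq_ennreal_measure less_top)
  also have "\<dots> \<le> emeasure lborel {v. norm (T v) \<le> 1}"
    using r unit_vol_set(2) by (intro emeasure_mono) auto
  finally show ?thesis
    by (simp add: emeasure_unit_vol)
qed

end


lemma ennreal_mult_cancelD:
  assumes "a * ennreal c = b * ennreal c" "0 < c" shows "a = b"
proof -
  have "a * (ennreal c * ennreal (1 / c)) = b * (ennreal c * ennreal (1 / c))"
    using assms(1) by (simp add: mult.assoc[symmetric])
  then show ?thesis
    using assms(2) by (simp flip: ennreal_mult)
qed

text \<open>Pulling \<open>lborel\<close> back along \<open>L\<close> gives a translation invariant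
  measure, hence a multiple of \<open>lborel\<close>; the factor is read off on the unit
  ball.\<close>

lemma emeasure_linear_image:
  fixes L :: "real^'m::finite \<Rightarrow> real^'m"
  assumes L: "linear L" "inj L" and A: "A \<in> sets borel"
  shows "emeasure lborel (L ` A) = ennreal (vol_ratio L) * emeasure lborel A" 
    and "0 < vol_ratio L"
proof -
  obtain L' where L'0: "linear L'" "L' \<circ> L = id"
    using linear_injective_left_inverse[OF L] by blast
  then have "L \<circ> L' = id"
    using linear_inverse_left[OF L(1) L'0(1)] by blast
  then have L': "linear L'" "\<And>x. L' (L x) = x" "\<And>x. L (L' x) = x"
    using pointfree_idE[OF L'0(2)] pointfree_idE[of L L'] L'0(1) by blast+
  have bl: "bounded_linear L'" "bounded_linear L"
    using L'(1) L(1) linear_conv_bounded_linear[THEN iffD1] by blast+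
  have meas[measurable]: "L' \<in> borel_measurable borel"
    by (intro borel_measurable_continuous_onI linear_continuous_on bl)
  define m where "m = distr lborel borel L'"
  have vim: "L' -` X = L ` X" for X
  proof (intro equalityI subsetI)
    fix x assume "x \<in> L' -` X"
    then show "x \<in> L ` X" using L'(3)[of x] by (intro image_eqI[of _ _ "L' x"]) auto
  qed (auto simp: L'(2))
  have em: "emeasure m X = emeasure lborel (L ` X)" if "X \<in> sets borel" for X
    using that by (simp add: m_def emeasure_distr vim)
  have Lb: "L ` X \<in> sets borel" if "X \<in> sets borel" for X
    using measurable_sets_borel[OF meas that] by (simp add: vim)
  have cc: "compact (L ` cball 0 1)"
    by (intro compact_continuous_image linear_continuous_on bl) auto
  have "emeasure m A * emeasure lborel (cball (0::real^'m) 1) = emeasure lborel A * emeasure m (cball (0::real^'m) 1)"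
  proof (rule translation_invariant_unique[where r=1])
    fix v :: "real^'m" and X :: "(real^'m) set" assume X: "X \<in> sets borel"
    have "L ` (+) v ` X = (+) (L v) ` L ` X"
      using L by (simp add: linear_add image_image)
    moreover have "emeasure lborel ((+) (L v) ` Y) = emeasure lborel Y" if "Y \<in> sets borel" for Y
      using that by (rule emeasure_lborel_translation)
    ultimately show "emeasure m ((+) v ` X) = emeasure m X"
      using X Lb by (simp add: em translation_borel)
  next
    show "emeasure m (cball 0 1) < \<infinity>"
      using emeasure_compact_finite[OF cc] by (simp add: em)
    show "uminus ` cball 0 1 = cball (0::real^'m) 1"
      by (rule uminus_image_eqI) simp
  qed (auto simp: m_def A)
  moreover have cb: "emeasure lborel (cball (0::real^'m) 1) = ennreal (measure lborel (cball (0::real^'m) 1))"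
    "0 < measure lborel (cball (0::real^'m) 1)"
    using emeasure_compact_finite[of "cball (0::real^'m) 1"] content_cball_pos[of 1 "0::real^'m"]
    by (auto simp: emeasure_eq_ennreal_measure)
  moreover have Lcb: "emeasure m (cball (0::real^'m) 1) = ennreal (vol_ratio L) * ennreal (measure lborel (cball (0::real^'m) 1))"
    using emeasure_compact_finite[OF cc] cb(2)
    unfolding em[OF borel_closed[OF closed_cball]] vol_ratio_def
    by (simp add: emeasure_eq_ennreal_measure flip: ennreal_mult)
  ultimately have "emeasure m A * ennreal (measure lborel (cball (0::real^'m) 1))
      = (ennreal (vol_ratio L) * emeasure lborel A) * ennreal (measure lborel (cball (0::real^'m) 1))"
    by (simp add: mult_ac)
  then have "emeasure m A = ennreal (vol_ratio L) * emeasure lborel A"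
    by (rule ennreal_mult_cancelD) (rule cb(2))
  then show "emeasure lborel (L ` A) = ennreal (vol_ratio L) * emeasure lborel A"
    by (simp add: em A)
  \<comment> \<open>The image of the unit ball under \<open>L\<close> is its preimage under the
    inverse \<open>L'\<close>, so its positive volume is an instance of
    \<open>unit_vol_pos\<close>.\<close>
  have "0 < unit_vol L'"
    by (rule unit_vol_pos[OF bl(1)]) (rule inj_on_inverseI[of _ L], rule L'(3))
  also have "unit_vol L' = measure lborel (L ` cball 0 1)"
    unfolding unit_vol_def vim[symmetric] by (simp add: vimage_def)
  finally show "0 < vol_ratio L"
    using cb(2) by (simp add: vol_ratio_def)
qed

text \<open>A chain rule: \<open>L\<close> maps the unit set of \<open>T \<circ> L\<close> onto the
  unit set of \<open>T\<close>. Every change of parameter below goes through it.\<close>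

lemma unit_vol_compose:
  fixes T :: "real^'m::finite \<Rightarrow> 'a::real_normed_vector"
  assumes T: "bounded_linear T" "inj T" and L: "linear L" "inj L"
  shows "unit_vol T = vol_ratio L * unit_vol (T \<circ> L)"
proof -
  have TL: "bounded_linear (T \<circ> L)" "inj (T \<circ> L)"
    using T L by (auto simp: o_def linear_conv_bounded_linear intro!: bounded_linear_compose[of T L] inj_compose[of T L, unfolded o_def])
  have "surj L" using L linear_injective_imp_surjective by blast
  then have "L ` {v. norm ((T \<circ> L) v) \<le> 1} = {v. norm (T v) \<le> 1}"
    using surj_image_vimage_eq[of L "{v. norm (T v) \<le> 1}"] by (simp add: vimage_def)
  then have "ennreal (unit_vol T) = ennreal (vol_ratio L) * ennreal (unit_vol (T \<circ> L))"
    using emeasure_linear_image(1)[OF L unit_vol_set(2)[OF TL]]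
    by (simp add: emeasure_unit_vol[OF T] emeasure_unit_vol[OF TL, symmetric])
  then show ?thesis
    using emeasure_linear_image(2)[OF L, of "{}"] unit_vol_pos[OF TL] unit_vol_pos[OF T]
    by (simp flip: ennreal_mult)
qed

text \<open>The unit set of \<open>T\<close> lies in \<open>c\<close> times the unit set of
  \<open>S\<close>, and scaling by \<open>c\<close> multiplies volumes by
  \<open>c ^ DIM('e)\<close>.\<close>

lemma unit_vol_mono:
  fixes T S :: "'e::euclidean_space \<Rightarrow> 'a::real_normed_vector"
  assumes T: "bounded_linear T" "inj T" and S: "bounded_linear S" "inj S"
    and le: "\<And>v. norm (S v) \<le> c * norm (T v)" and "0 < c"
  shows "unit_vol T \<le> c ^ DIM('e) * unit_vol S"
proof -
  interpret S: bounded_linear S by fact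
  have sub: "{v. norm (T v) \<le> 1} \<subseteq> (\<lambda>v. c *\<^sub>R v + 0) ` {v. norm (S v) \<le> 1}"
  proof safe
    fix v assume "norm (T v) \<le> 1"
    have "norm (S v) \<le> c"
      using le[of v] mult_left_mono[OF \<open>norm (T v) \<le> 1\<close>, of c] \<open>0 < c\<close> by linarith
    then show "v \<in> (\<lambda>v. c *\<^sub>R v + 0) ` {v. norm (S v) \<le> 1}"
      using \<open>0 < c\<close> by (intro image_eqI[of _ _ "v /\<^sub>R c"]) (auto simp: S.scaleR field_simps)
  qed
  have c: "compact ((\<lambda>v. c *\<^sub>R v + 0) ` {v. norm (S v) \<le> 1})"
    using unit_vol_set(1)[OF S] by (intro compact_continuous_image continuous_intros)
  have "unit_vol T \<le> measure lborel ((\<lambda>v. c *\<^sub>R v + 0) ` {v. norm (S v) \<le> 1})"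
    unfolding unit_vol_def using sub unit_vol_set(2)[OF T] c
    by (intro measure_mono_fmeasurable fmeasurable_compact) auto
  also have "\<dots> = c ^ DIM('e) * unit_vol S"
    using measure_lebesgue_affine[of c 0 "{v. norm (S v) \<le> 1}"] borel_compact[OF c] unit_vol_set(2)[OF S] \<open>0 < c\<close>
    by (simp add: unit_vol_def)
  finally show ?thesis .
qed

text \<open>A relative error \<epsilon> traps the two unit sets between multiples of each other, so
  a comparison of norms replaces any expansion of determinants. The factor 2 absorbs
  \<open>ln (1 + \<epsilon>)\<close> and \<open>- ln (1 - \<epsilon>)\<close> for \<epsilon> at most
  1/2.\<close>

lemma ln_unit_vol_close:
  fixes T S :: "'e::euclidean_space \<Rightarrow> 'a::real_normed_vector"
    and \<epsilon> :: real
  assumes T: "bounded_linear T" "inj T" and S: "bounded_linear S"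
    and close: "\<And>v. norm (S v - T v) \<le> (\<epsilon>::real) * norm (T v)" and \<epsilon>: "0 \<le> \<epsilon>" "\<epsilon> \<le> 1 / 2"
  shows "inj S" "\<bar>ln (unit_vol S) - ln (unit_vol T)\<bar> \<le> 2 * DIM('e) * \<epsilon>"
proof -
  have ST: "norm (S v) \<le> (1 + \<epsilon>) * norm (T v)" for v
    using close[of v] norm_triangle_ineq2[of "S v" "T v"] by (simp add: algebra_simps)
  have TS: "(1 - \<epsilon>) * norm (T v) \<le> norm (S v)" for v
    using close[of v] norm_triangle_ineq3[of "S v" "T v"] by (simp add: algebra_simps)
  show inj: "inj S"
    unfolding linear_injective_0[OF bounded_linear.linear[OF S]]
  proof (intro allI impI)
    fix v assume "S v = 0"
    then have "norm (T v) \<le> 0"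
      using TS[of v] \<epsilon> by (auto simp: mult_le_0_iff)
    then show "v = 0"
      using T by (metis bounded_linear.linear injD linear_0 norm_le_zero_iff)
  qed
  note p = unit_vol_pos[OF T] unit_vol_pos[OF S inj]
  have TS': "norm (T v) \<le> (1 / (1 - \<epsilon>)) * norm (S v)" for v
    using TS[of v] \<epsilon> by (simp add: field_simps)
  have ln1: "ln (unit_vol T) \<le> DIM('e) * ln (1 + \<epsilon>) + ln (unit_vol S)"
    using ln_le_cancel_iff[THEN iffD2, OF _ _ unit_vol_mono[OF T S inj ST]] p \<epsilon>
    by (simp add: ln_mult ln_realpow)
  have ln2: "ln (unit_vol S) \<le> DIM('e) * ln (1 / (1 - \<epsilon>)) + ln (unit_vol T)"
    using ln_le_cancel_iff[THEN iffD2, OF _ _ unit_vol_mono[OF S inj T TS']] p \<epsilon>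
    by (simp add: ln_mult ln_realpow)
  have "ln (1 + \<epsilon>) \<le> 2 * \<epsilon>"
    using ln_add_one_self_le_self[of \<epsilon>] \<epsilon> by simp
  moreover have "ln (1 / (1 - \<epsilon>)) \<le> 2 * \<epsilon>"
  proof -
    have "ln (1 / (1 - \<epsilon>)) \<le> 1 / (1 - \<epsilon>) - 1"
      using \<epsilon> by (intro ln_le_minus_one) auto
    also have "\<dots> \<le> 2 * \<epsilon>"
    proof -
      have "\<epsilon> * (\<epsilon> * 2) \<le> \<epsilon> * 1" using \<epsilon> by (intro mult_left_mono) auto
      then show ?thesis using \<epsilon> by (simp add: field_simps)
    qed
    finally show ?thesis .
  qed
  ultimately have "DIM('e) * ln (1 + \<epsilon>) \<le> 2 * DIM('e) * \<epsilon>" "DIM('e) * ln (1 / (1 - \<epsilon>)) \<le> 2 * DIM('e) * \<epsilon>"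
    by simp_all
  with ln1 ln2 show "\<bar>ln (unit_vol S) - ln (unit_vol T)\<bar> \<le> 2 * DIM('e) * \<epsilon>"
    by linarith
qed

context
  fixes T :: "real^'k::finite \<Rightarrow> 'a::real_normed_vector"
  assumes T: "bounded_linear T" "inj T"
begin

lemma inv_measurable: "inv T \<in> borel_measurable (restrict_space borel (range T))"
proof (rule borel_measurable_continuous_on_restrict)
  obtain c where c: "0 < c" "\<And>v. c * norm v \<le> norm (T v)"
    using inj_linear_bounded_below[OF T] by blast
  have "(1 / c)-lipschitz_on (range T) (inv T)"
  proof (rule lipschitz_onI)
    fix x y assume "x \<in> range T" "y \<in> range T"
    then obtain u v where "x = T u" "y = T v" by blast
    then show "dist (inv T x) (inv T y) \<le> 1 / c * dist x y"
      using c(2)[of "u - v"] c(1) inv_f_f[OF T(2)]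
      by (simp add: dist_norm linear_diff[OF bounded_linear.linear[OF T(1)]] field_simps)
  qed (use c in simp)
  then show "continuous_on (range T) (inv T)"
    by (rule lipschitz_on_continuous_on)
qed

lemma image_sets_range:
  assumes "X \<in> sets borel"
  shows "T ` X \<in> sets (restrict_space borel (range T))"
proof -
  have "T ` X = inv T -` X \<inter> space (restrict_space borel (range T))"
    using inv_f_f[OF T(2)] by (auto simp: space_restrict_space)
  then show ?thesis
    using measurable_sets[OF inv_measurable assms] by simp
qed

lemma T_measurable: "T \<in> borel \<rightarrow>\<^sub>M restrict_space borel (range T)"
  using T(1) by (intro measurable_restrict_space2 borel_measurable_continuous_onI linear_continuous_on) auto

text \<open>The inverse of \<open>T\<close> transports \<open>m\<close> to a translation invariant
  measure on the coordinate space, where \<open>translation_invariant_unique\<close> fixes it by its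
  mass on the unit set of \<open>T\<close>.\<close>

lemma haar_unique:
  assumes sets: "sets m = sets (restrict_space borel (range T))"
    and inv: "\<forall>v\<in>range T. \<forall>X\<in>sets m. emeasure m ((+) v ` X) = emeasure m X"
    and unit: "emeasure m (range T \<inter> cball 0 1) = ennreal \<omega>" and "0 \<le> \<omega>"
    and X: "X \<in> sets borel"
  shows "emeasure m (T ` X) = ennreal (\<omega> / unit_vol T) * emeasure lborel X"
proof -
  define m' where "m' = distr m borel (inv T)"
  have sp: "space m = range T"
    using sets_eq_imp_space_eq[OF sets] by (simp add: space_restrict_space)
  have inv_meas: "inv T \<in> borel_measurable m"
    using inv_measurable measurable_cong_sets[OF sets refl] by blast
  have em: "emeasure m' Y = emeasure m (T ` Y)" if "Y \<in> sets borel" for Y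
  proof -
    have "inv T -` Y \<inter> space m = T ` Y"
      using inv_f_f[OF T(2)] by (auto simp: sp)
    then show ?thesis
      using that inv_meas by (simp add: m'_def emeasure_distr)
  qed
  have B: "T ` {v. norm (T v) \<le> 1} = range T \<inter> cball 0 1"
    by auto
  note U = unit_vol_set[OF T]
  obtain r where r: "0 < r" "ball 0 r \<subseteq> {v. norm (T v) \<le> 1}" using U(3) by blast
  have "emeasure m' X * emeasure lborel {v. norm (T v) \<le> 1} = emeasure lborel X * emeasure m' {v. norm (T v) \<le> 1}"
  proof (rule translation_invariant_unique[OF _ _ U(2) U(4) r(2) r(1)])
    show "sets m' = sets borel" by (simp add: m'_def)
    show "emeasure m' {v. norm (T v) \<le> 1} < \<infinity>"
      using em[OF U(2)] by (simp add: B unit)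
    fix v Y assume Y: "(Y :: (real^'k) set) \<in> sets borel"
    have "T ` (+) v ` Y = (+) (T v) ` T ` Y"
      by (simp add: image_image linear_add[OF bounded_linear.linear[OF T(1)]])
    then show "emeasure m' ((+) v ` Y) = emeasure m' Y"
      using inv image_sets_range[OF Y] by (simp add: em Y translation_borel sets)
  qed (rule X)
  then have "emeasure m (T ` X) * ennreal (unit_vol T) = emeasure lborel X * ennreal \<omega>"
    by (simp only: em[OF X] em[OF U(2)] B unit emeasure_unit_vol[OF T])
  moreover have "ennreal \<omega> = ennreal (\<omega> / unit_vol T) * ennreal (unit_vol T)"
    using unit_vol_pos[OF T] \<open>0 \<le> \<omega>\<close> by (simp flip: ennreal_mult)
  ultimately have "emeasure m (T ` X) * ennreal (unit_vol T) = (ennreal (\<omega> / unit_vol T) * emeasure lborel X) * ennreal (unit_vol T)"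
    by (simp only: mult_ac)
  then show ?thesis
    by (rule ennreal_mult_cancelD) (rule unit_vol_pos[OF T])
qed

text \<open>The definite description needs existence as well: the image of a scaled Lebesgue measure
  under \<open>T\<close> has the defining properties, and \<open>haar_unique\<close> shows that it
  is the only such measure.\<close>

lemma emeasure_haar_on:
  assumes X: "X \<in> sets borel"
  shows "emeasure (haar_on (range T)) (T ` X) = ennreal (unit_ball_vol (real CARD('k)) / unit_vol T) * emeasure lborel X"
proof -
  define \<omega> where "\<omega> = unit_ball_vol (real CARD('k))"
  have \<omega>: "0 \<le> \<omega>" by (simp add: \<omega>_def)
  have dim: "dim (range T) = CARD('k)"
    using eucl.dim_image_eq[of T UNIV] T bounded_linear.linear by auto
  define P where "P m \<longleftrightarrow> sets m = sets (restrict_space borel (range T)) \<and>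
     (\<forall>v\<in>range T. \<forall>X\<in>sets m. emeasure m ((+) v ` X) = emeasure m X) \<and>
     emeasure m (range T \<inter> cball 0 1) = ennreal \<omega>" for m
  define m where "m = distr (scale_measure (ennreal (\<omega> / unit_vol T)) lborel) (restrict_space borel (range T)) T"
  have Tm: "T \<in> scale_measure (ennreal (\<omega> / unit_vol T)) lborel \<rightarrow>\<^sub>M restrict_space borel (range T)"
    using T_measurable measurable_cong_sets[of "scale_measure (ennreal (\<omega> / unit_vol T)) lborel" borel] by simp
  have vim: "T -` T ` Y = Y" for Y by (rule inj_vimage_image_eq[OF T(2)])
  have em: "emeasure m (T ` Y) = ennreal (\<omega> / unit_vol T) * emeasure lborel Y" if "Y \<in> sets borel" for Y
    using image_sets_range[OF that] by (simp add: m_def emeasure_distr[OF Tm] vim space_scale_measure)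
  have sets_m: "sets m = sets (restrict_space borel (range T))"
    by (simp add: m_def)
  have rep: "\<exists>X\<in>sets borel. Y = T ` X" if "Y \<in> sets (restrict_space borel (range T))" for Y
  proof (rule bexI)
    have "Y \<subseteq> range T" using sets.sets_into_space[OF that] by (simp add: space_restrict_space)
    then show "Y = T ` (T -` Y)" by blast
    show "T -` Y \<in> sets borel"
      using measurable_sets[OF T_measurable that] by simp
  qed
  have "P m"
    unfolding P_def
  proof (intro conjI ballI)
    show "sets m = sets (restrict_space borel (range T))" by (rule sets_m)
    fix v Y assume "v \<in> range T" "Y \<in> sets m"
    then obtain u X where u: "v = T u" "X \<in> sets borel" "Y = T ` X"
      using rep sets_m by blast
    have "(+) v ` Y = T ` (+) u ` X"
      by (simp add: u image_image linear_add[OF bounded_linear.linear[OF T(1)]])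
    then show "emeasure m ((+) v ` Y) = emeasure m Y"
      by (simp add: u em translation_borel emeasure_lborel_translation)
  next
    have "range T \<inter> cball 0 1 = T ` {v. norm (T v) \<le> 1}" by auto
    then show "emeasure m (range T \<inter> cball 0 1) = ennreal \<omega>"
      using unit_vol_pos[OF T] \<omega>
      by (simp add: em[OF unit_vol_set(2)[OF T]] emeasure_unit_vol[OF T] flip: ennreal_mult)
  qed
  moreover have "m' = m" if "P m'" for m'
  proof (rule measure_eqI)
    show s: "sets m' = sets m" using that \<open>P m\<close> by (simp add: P_def)
    fix Y assume "Y \<in> sets m'"
    then obtain X where "X \<in> sets borel" "Y = T ` X"
      using rep s sets_m by blast
    then show "emeasure m' Y = emeasure m Y"
      using haar_unique[of m' \<omega> X] that \<omega> by (simp add: P_def em)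
  qed
  ultimately have "The P = m" by (rule the_equality)
  then have "haar_on (range T) = m"
    unfolding haar_on_def P_def dim \<omega>_def by simp
  then show ?thesis
    using em[OF X] by (simp add: \<omega>_def)
qed

lemma measure_haar_on:
  assumes X: "X \<in> sets borel"
  shows "measure (haar_on (range T)) (T ` X) = unit_ball_vol (real CARD('k)) / unit_vol T * measure lborel X"
  using unit_vol_pos[OF T] unfolding measure_def emeasure_haar_on[OF X]
  by (simp add: enn2real_mult)

lemma volume_jacobian_eq:
  assumes "(\<psi> has_derivative T) (at z)"
  shows "volume_jacobian \<psi> z = unit_ball_vol (real CARD('k)) / unit_vol T"
proof -
  have "frechet_derivative \<psi> (at z) = T"
    using frechet_derivative_at[OF assms] by simp
  then show ?thesis
    using measure_haar_on[of "cball 0 1"] content_cball_pos[of 1 "0::real^'k"]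
    by (simp add: volume_jacobian_def Let_def)
qed

end

text \<open>Both Haar measures carry the same constant \<open>unit_ball_vol\<close>, which cancels;
  what remains are the unit volumes of the parametrisation before and after
  \<open>A\<close>.\<close>

lemma det_on_range:
  fixes T :: "real^'k::finite \<Rightarrow> 'a::real_normed_vector"
  assumes T: "bounded_linear T" "inj T" and A: "bounded_linear A" "inj (A \<circ> T)"
  shows "det_on A (range T) = unit_vol T / unit_vol (A \<circ> T)"
proof -
  have AT: "bounded_linear (A \<circ> T)" "inj (A \<circ> T)"
    using A T by (simp_all add: o_def bounded_linear_compose)
  have 1: "A ` (range T \<inter> cball 0 1) = (A \<circ> T) ` {v. norm (T v) \<le> 1}" "range T \<inter> cball 0 1 = T ` {v. norm (T v) \<le> 1}"
    by auto
  have 2: "A ` range T = range (A \<circ> T)" by auto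
  have "measure (haar_on (A ` range T)) (A ` (range T \<inter> cball 0 1)) = unit_ball_vol (real CARD('k)) / unit_vol (A \<circ> T) * unit_vol T"
    unfolding 1(1) 2 measure_haar_on[OF AT unit_vol_set(2)[OF T]] unit_vol_def[of T] ..
  moreover have "measure (haar_on (range T)) (range T \<inter> cball 0 1) = unit_ball_vol (real CARD('k)) / unit_vol T * unit_vol T"
    unfolding 1(2) measure_haar_on[OF T unit_vol_set(2)[OF T]] unit_vol_def[of T] ..
  moreover have "unit_ball_vol (real CARD('k)) \<noteq> 0"
    using unit_ball_vol_pos[of "real CARD('k)"] by linarith
  ultimately show ?thesis
    using unit_vol_pos[OF T] unit_vol_pos[OF AT]
    by (simp add: det_on_def)
qed

lemma ennreal_le_if_le_mult:
  fixes a b :: ennreal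
  assumes "\<And>t::real. 1 < t \<Longrightarrow> a \<le> ennreal t * b"
  shows "a \<le> b"
proof (cases "b = \<top>")
  case False
  then obtain r where r: "b = ennreal r" "0 \<le> r" by (cases b) auto
  have "a \<le> ennreal (2 * r)"
    using assms[of 2] r by (simp add: ennreal_mult flip: ennreal_numeral)
  then obtain q where q: "a = ennreal q" "0 \<le> q"
    by (cases a) (auto simp: top_unique)
  have le: "q \<le> t * r" if "1 < t" for t
    using assms[OF that] that r q by (simp flip: ennreal_mult)
  have "q \<le> r"
  proof (cases "r = 0")
    case True
    then show ?thesis using le[of 2] by simp
  next
    case False
    show ?thesis
    proof (rule field_le_epsilon)
      fix e :: real assume "0 < e"
      then show "q \<le> r + e"
        using le[of "1 + e / r"] False r(2) by (simp add: distrib_right)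
    qed
  qed
  then show ?thesis using r q by (simp add: ennreal_leI)
qed simp

text \<open>Cut \<open>X\<close> into the countably many sets on which \<open>D\<close> lies between
  consecutive powers of \<open>t\<close>. There the two one-sided bounds determine the volume of the
  image up to the factor \<open>t\<close>; then \<open>t\<close> tends to 1.\<close>

lemma emeasure_image_eq_nn_integral:
  fixes P :: "'e::euclidean_space \<Rightarrow> 'e" and D :: "'e \<Rightarrow> real"
  assumes X: "X \<in> sets borel" and D[measurable]: "D \<in> borel_measurable borel"
    and pos: "\<And>x. x \<in> X \<Longrightarrow> 0 < D x" and inj: "inj_on P X"
    and im: "\<And>Y. Y \<in> sets borel \<Longrightarrow> Y \<subseteq> X \<Longrightarrow> P ` Y \<in> sets borel"
    and upper: "\<And>Y c. \<lbrakk>Y \<in> sets borel; Y \<subseteq> X; 0 < c; \<forall>x\<in>Y. D x \<le> c\<rbrakk> \<Longrightarrow> emeasure lborel (P ` Y) \<le> ennreal c * emeasure lborel Y"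
    and lower: "\<And>Y c. \<lbrakk>Y \<in> sets borel; Y \<subseteq> X; 0 < c; \<forall>x\<in>Y. c \<le> D x\<rbrakk> \<Longrightarrow> ennreal c * emeasure lborel Y \<le> emeasure lborel (P ` Y)"
  shows "emeasure lborel (P ` X) = (\<integral>\<^sup>+x\<in>X. ennreal (D x) \<partial>lborel)"
proof -
  note [measurable] = X
  define N where "N = density lborel (\<lambda>x. ennreal (D x))"
  have N: "emeasure N Y = (\<integral>\<^sup>+x\<in>Y. ennreal (D x) \<partial>lborel)" if "Y \<in> sets borel" for Y
    using that by (simp add: N_def emeasure_density)
  have main: "emeasure lborel (P ` X) \<le> ennreal t * emeasure N X \<and> emeasure N X \<le> ennreal t * emeasure lborel (P ` X)"
    if t: "1 < t" for t :: real
  proof -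
    define Y where "Y j = {x \<in> X. t powr (real_of_int j) \<le> D x \<and> D x < t powr (real_of_int j + 1)}" for j :: int
    have Ym[measurable]: "Y j \<in> sets borel" for j
      unfolding Y_def by measurable
    have YX: "Y j \<subseteq> X" for j by (auto simp: Y_def)
    have iff: "x \<in> Y j \<longleftrightarrow> x \<in> X \<and> j = \<lfloor>log t (D x)\<rfloor>" for x j
    proof (cases "x \<in> X")
      case True
      then show ?thesis
        using le_log_iff[of t "D x" "real_of_int j"] log_less_iff[of t "D x" "real_of_int j + 1"]
          floor_eq_iff[of "log t (D x)" j] pos[OF True] t
        by (auto simp: Y_def)
    qed (auto simp: Y_def)
    have XY: "X = (\<Union>j\<in>UNIV. Y j)" using iff by auto
    have disj: "disjoint_family_on Y UNIV" using iff by (auto simp: disjoint_family_on_def)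
    have disj': "disjoint_family_on (\<lambda>j. P ` Y j) UNIV"
      using inj disj YX unfolding disjoint_family_on_def by (metis image_empty inj_on_image_Int)
    have bounds: "ennreal (t powr j) * emeasure lborel (Y j) \<le> emeasure N (Y j)"
       "emeasure N (Y j) \<le> ennreal (t powr (j + 1)) * emeasure lborel (Y j)" for j :: int
    proof -
      have "ennreal (t powr j) * emeasure lborel (Y j) = (\<integral>\<^sup>+x\<in>Y j. ennreal (t powr j) \<partial>lborel)"
        by (simp add: nn_integral_cmult_indicator)
      also have "\<dots> \<le> emeasure N (Y j)"
        unfolding N[OF Ym] by (intro nn_integral_mono) (auto simp: Y_def indicator_def intro!: ennreal_leI)
      finally show "ennreal (t powr j) * emeasure lborel (Y j) \<le> emeasure N (Y j)" .
      have "emeasure N (Y j) \<le> (\<integral>\<^sup>+x\<in>Y j. ennreal (t powr (j + 1)) \<partial>lborel)"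
        unfolding N[OF Ym] by (intro nn_integral_mono) (auto simp: Y_def indicator_def intro!: ennreal_leI)
      also have "\<dots> = ennreal (t powr (j + 1)) * emeasure lborel (Y j)"
        by (simp add: nn_integral_cmult_indicator)
      finally show "emeasure N (Y j) \<le> ennreal (t powr (j + 1)) * emeasure lborel (Y j)" .
    qed
    have tt: "ennreal (t powr (j + 1)) = ennreal t * ennreal (t powr j)" for j :: real
      using t by (simp add: powr_add mult.commute flip: ennreal_mult)
    have "emeasure lborel (P ` Y j) \<le> ennreal t * emeasure N (Y j)" for j
    proof -
      have "emeasure lborel (P ` Y j) \<le> ennreal (t powr (j + 1)) * emeasure lborel (Y j)"
        using t by (intro upper YX Ym) (auto simp: Y_def)
      also have "\<dots> = ennreal t * (ennreal (t powr j) * emeasure lborel (Y j))"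
        by (simp add: tt mult.assoc)
      also have "\<dots> \<le> ennreal t * emeasure N (Y j)"
        by (intro mult_left_mono bounds) simp
      finally show ?thesis .
    qed
    moreover have "emeasure N (Y j) \<le> ennreal t * emeasure lborel (P ` Y j)" for j
    proof -
      have "emeasure N (Y j) \<le> ennreal t * (ennreal (t powr j) * emeasure lborel (Y j))"
        using bounds(2)[of j] by (simp add: tt mult.assoc)
      also have "\<dots> \<le> ennreal t * emeasure lborel (P ` Y j)"
        using t by (intro mult_left_mono lower YX Ym) (auto simp: Y_def)
      finally show ?thesis .
    qed
    moreover have "emeasure lborel (P ` X) = (\<integral>\<^sup>+j. emeasure lborel (P ` Y j) \<partial>count_space UNIV)"
    proof -
      have "P ` X = (\<Union>j\<in>UNIV. P ` Y j)" using XY by blast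
      then show ?thesis
        using emeasure_UN_countable[OF _ _ disj', of lborel] im[OF Ym YX] by simp
    qed
    moreover have "emeasure N X = (\<integral>\<^sup>+j. emeasure N (Y j) \<partial>count_space UNIV)"
      using emeasure_UN_countable[OF _ _ disj, of N] XY by (simp add: N_def)
    ultimately show ?thesis
      by (simp add: nn_integral_mono flip: nn_integral_cmult)
  qed
  have "emeasure lborel (P ` X) \<le> emeasure N X"
    by (rule ennreal_le_if_le_mult) (rule main[THEN conjunct1])
  moreover have "emeasure N X \<le> emeasure lborel (P ` X)"
    by (rule ennreal_le_if_le_mult) (rule main[THEN conjunct2])
  ultimately show ?thesis
    unfolding N[OF X] by (rule antisym)
qed


section \<open>Expanding discs in hyperbolic charts\<close>

text \<open>An axiomatic form of Lyapunov charts along a family of reference orbits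
  \<open>xs i\<close>. \<open>Np\<close> and \<open>Nm\<close> are the adapted seminorms of the
  unstable and stable parts; \<open>co\<close> reads off unstable coordinates and \<open>sec\<close>
  is a section of it without stable part. The distortion \<open>l0 * E ^ n\<close> relates adapted
  and ambient norms. The rate \<open>a0\<close> is the linear contraction, \<open>a\<close> includes
  the nonlinear error, \<open>g\<close> is the expansion and \<open>b\<close> the rate at which
  pieces shrink. The rate \<open>\<kappa>\<close> bounds the decay of slopes: the nonlinear error
  decays like \<open>E * b\<close>, the slope itself contracts by \<open>a / g\<close>.\<close>

locale hyperbolic_charts =
  fixes f :: "'a::real_normed_vector \<Rightarrow> 'a" and f' :: "'a \<Rightarrow> 'a \<Rightarrow>\<^sub>L 'a"
    and U :: "'i set" and xs :: "'i \<Rightarrow> nat \<Rightarrow> 'a" and Np Nm N :: "'i \<Rightarrow> nat \<Rightarrow> 'a \<Rightarrow> real"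
    and co :: "'i \<Rightarrow> nat \<Rightarrow> 'a \<Rightarrow> real^'k::finite" and sec :: "'i \<Rightarrow> nat \<Rightarrow> real^'k \<Rightarrow> 'a"
    and l0 E a0 a b g \<kappa> \<delta> r :: real
  assumes df: "(f has_derivative blinfun_apply (f' z)) (at z)" "continuous_on UNIV f'"
    and N_def: "N i n v = max (Np i n v) (Nm i n v)"
    and Np_add: "i \<in> U \<Longrightarrow> Np i n (u + v) \<le> Np i n u + Np i n v"
    and Np_scale: "i \<in> U \<Longrightarrow> Np i n (c *\<^sub>R v) = \<bar>c\<bar> * Np i n v"
    and Nm_add: "i \<in> U \<Longrightarrow> Nm i n (u + v) \<le> Nm i n u + Nm i n v"
    and Nm_scale: "i \<in> U \<Longrightarrow> Nm i n (c *\<^sub>R v) = \<bar>c\<bar> * Nm i n v"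
    and norm_le: "i \<in> U \<Longrightarrow> norm v \<le> 2 * N i n v"
    and le_norm: "i \<in> U \<Longrightarrow> N i n v \<le> l0 * E ^ n * norm v"
    and co: "i \<in> U \<Longrightarrow> bounded_linear (co i n)" "\<lbrakk>i \<in> U; co i n v = 0\<rbrakk> \<Longrightarrow> Np i n v = 0"
    and sec: "i \<in> U \<Longrightarrow> bounded_linear (sec i n)" "i \<in> U \<Longrightarrow> co i n (sec i n e) = e" "i \<in> U \<Longrightarrow> Nm i n (sec i n e) = 0"
    and cone_step: "\<lbrakk>i \<in> U; N i n (z - xs i n) \<le> \<delta> / (l0 * E ^ n); N i n (z' - xs i n) \<le> \<delta> / (l0 * E ^ n);
        Nm i n (z - z') \<le> Np i n (z - z')\<rbrakk> \<Longrightarrow>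
        g * Np i n (z - z') \<le> Np i (Suc n) (f z - f z') \<and> Nm i (Suc n) (f z - f z') \<le> a * Np i n (z - z')"
    and dstep: "\<lbrakk>i \<in> U; N i n (z - xs i n) \<le> \<delta> / (l0 * E ^ n); Nm i n v \<le> t * Np i n v; 0 \<le> t; t \<le> 1\<rbrakk> \<Longrightarrow>
        g * Np i n v \<le> Np i (Suc n) (f' z v) \<and>
        Nm i (Suc n) (f' z v) \<le> (a0 * t + l0 * E ^ n * N i n (z - xs i n)) * Np i n v"
    and dstep0: "\<lbrakk>i \<in> U; N i n (z - xs i n) \<le> \<delta> / (l0 * E ^ n); Np i n v = 0\<rbrakk> \<Longrightarrow> N i (Suc n) (f' z v) \<le> a * Nm i n v"
    and dlip: "\<lbrakk>i \<in> U; N i n (z - xs i n) \<le> \<delta> / (l0 * E ^ n); N i n (z' - xs i n) \<le> \<delta> / (l0 * E ^ n)\<rbrakk> \<Longrightarrow>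
        N i (Suc n) (f' z v - f' z' v) \<le> l0 * E ^ n * N i n (z - z') * N i n v"
    and params: "1 \<le> l0" "1 \<le> E" "0 < a0" "0 < \<delta>" "a = a0 + \<delta>" "E ^ (CARD('k) + 2) * a < b" "b < g" "E * (E * b) < 1"
      "\<kappa> = max (E * b) (a / g)" "0 < r" "l0 * r \<le> \<delta>"
begin

lemma const_facts:
  "0 < a" "0 < b" "0 < g" "a < b" "a < g" "E * a < b" "b \<le> 1" "E * b \<le> 1" "0 < \<kappa>" "\<kappa> \<le> 1" "0 \<le> \<kappa> * E" "\<kappa> * E < 1" "E * b \<le> \<kappa>" "a \<le> g * \<kappa>"
  "0 < l0 * E ^ n"
proof -
  show a: "0 < a" using params by simp
  have p: "1 \<le> E ^ (CARD('k) + 1)" using params by (intro one_le_power)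
  have "E * a \<le> E ^ (CARD('k) + 2) * a"
    using mult_left_mono[OF p, of "E * a"] params a by (simp add: mult_ac)
  then show Eab: "E * a < b" using params(6) by (rule order.strict_trans1)
  have "1 * a \<le> E * a" using params a by (intro mult_right_mono) auto
  with Eab show ab: "a < b" by simp
  show b: "0 < b" using a ab by simp
  show g: "0 < g" using b params by simp
  show "a < g" using ab params by simp
  have "E * b \<le> E * (E * b)" using params b by simp
  with params(8) show Eb: "E * b \<le> 1" by linarith
  have "b \<le> E * b" using params b by simp
  with Eb show "b \<le> 1" by linarith
  show k: "0 < \<kappa>" using params a g by (simp add: less_max_iff_disj)
  have "a / g * E < 1" using Eab params g by (simp add: field_simps)
  then have "\<kappa> * E < 1" using params by (auto simp: max_def mult_ac)
  then show "\<kappa> * E < 1" .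
  moreover have "\<kappa> * 1 \<le> \<kappa> * E" using k params(2) by (intro mult_left_mono) auto
  ultimately show "\<kappa> \<le> 1" by linarith
  show "0 \<le> \<kappa> * E" using k params by simp
  show "E * b \<le> \<kappa>" using params by simp
  have "a / g \<le> \<kappa>" using params by simp
  then show "a \<le> g * \<kappa>" using g by (simp add: field_simps)
  show "0 < l0 * E ^ n" using params by simp
qed

lemma Np_zero: "i \<in> U \<Longrightarrow> Np i n 0 = 0" and Nm_zero: "i \<in> U \<Longrightarrow> Nm i n 0 = 0"
  using Np_scale[of i n 0 0] Nm_scale[of i n 0 0] by simp_all

lemma Np_minus: "i \<in> U \<Longrightarrow> Np i n (- v) = Np i n v" and Nm_minus: "i \<in> U \<Longrightarrow> Nm i n (- v) = Nm i n v"
  using Np_scale[of i n "-1" v] Nm_scale[of i n "-1" v] by simp_all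

lemma Np_nonneg: "i \<in> U \<Longrightarrow> 0 \<le> Np i n v" and Nm_nonneg: "i \<in> U \<Longrightarrow> 0 \<le> Nm i n v"
  using Np_add[of i n v "- v"] Nm_add[of i n v "- v"] by (simp_all add: Np_minus Nm_minus Np_zero Nm_zero)

lemma N_nonneg: "i \<in> U \<Longrightarrow> 0 \<le> N i n v"
  using Np_nonneg by (simp add: N_def le_max_iff_disj)

lemma N_minus: "i \<in> U \<Longrightarrow> N i n (- v) = N i n v"
  by (simp add: N_def Np_minus Nm_minus)

lemma N_commute: "i \<in> U \<Longrightarrow> N i n (u - v) = N i n (v - u)"
  using N_minus[of i n "u - v"] by simp

lemma Np_commute: "i \<in> U \<Longrightarrow> Np i n (u - v) = Np i n (v - u)"
  using Np_minus[of i n "u - v"] by simp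

lemma N_add: "i \<in> U \<Longrightarrow> N i n (u + v) \<le> N i n u + N i n v"
  using Np_add[of i n u v] Nm_add[of i n u v] by (simp add: N_def max_def)

lemma N_triangle: "i \<in> U \<Longrightarrow> N i n (u - w) \<le> N i n (u - v) + N i n (v - w)"
  using N_add[of i n "u - v" "v - w"] by simp

lemma Np_triangle: "i \<in> U \<Longrightarrow> Np i n (u - w) \<le> Np i n (u - v) + Np i n (v - w)"
  using Np_add[of i n "u - v" "v - w"] by simp

lemma Np_le_N: "Np i n v \<le> N i n v" and Nm_le_N: "Nm i n v \<le> N i n v"
  by (simp_all add: N_def)

lemma Np_le_norm: "i \<in> U \<Longrightarrow> Np i n v \<le> l0 * E ^ n * norm v" and Nm_le_norm: "i \<in> U \<Longrightarrow> Nm i n v \<le> l0 * E ^ n * norm v"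
  using le_norm[of i n v] by (simp_all add: N_def)

lemma Np_eq_iff: "i \<in> U \<Longrightarrow> co i n u = co i n v \<Longrightarrow> Np i n (u - v) = 0"
  using co(2)[of i n "u - v"] bounded_linear.linear[OF co(1)[of i n]] by (simp add: linear_diff)

lemma Np_eq: "i \<in> U \<Longrightarrow> co i n u = co i n v \<Longrightarrow> Np i n u = Np i n v"
  using Np_eq_iff[of i n u v] Np_add[of i n "u - v" v] Np_add[of i n "v - u" u] Np_commute[of i n u v] by simp

lemma seminorm_continuous:
  assumes add: "\<And>u v. S (u + v) \<le> S u + S v" and le: "\<And>v. S v \<le> c * norm v" "0 \<le> c"
  shows "continuous_on X (S :: 'a \<Rightarrow> real)"
proof -
  have *: "S u - S v \<le> c * norm (u - v)" for u v
    using add[of "u - v" v] le(1)[of "u - v"] by simp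
  have "c-lipschitz_on X S"
    using *[of _ _] le(2) by (intro lipschitz_onI) (auto simp: dist_norm abs_le_iff norm_minus_commute, metis norm_minus_commute)
  then show ?thesis by (rule lipschitz_on_continuous_on)
qed

lemma continuous_Np: "i \<in> U \<Longrightarrow> continuous_on X (Np i n)" and continuous_Nm: "i \<in> U \<Longrightarrow> continuous_on X (Nm i n)"
  and continuous_N: "i \<in> U \<Longrightarrow> continuous_on X (N i n)"
  by (rule seminorm_continuous[where c="l0 * E ^ n"]; use Np_add Np_le_norm Nm_add Nm_le_norm N_add le_norm const_facts(15)[of n] in force)+

text \<open>The tolerance \<open>r * b ^ k\<close> shrinks fast enough to beat the distortion:
  multiplied by \<open>l0 * E ^ k\<close> it is still at most
  \<open>\<delta> * \<kappa> ^ k\<close>, by \<open>slow_small\<close>. A slow orbit therefore stays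
  in the charts, and the derivatives along it are exponentially close to those along the reference
  orbit.\<close>

definition slow :: "'i \<Rightarrow> nat \<Rightarrow> (nat \<Rightarrow> 'a) \<Rightarrow> bool" where
  "slow i n z \<longleftrightarrow> (\<forall>k\<le>n. N i k (z k - xs i k) \<le> r * b ^ k)"

lemma slow_small:
  assumes "N i k v \<le> r * b ^ k"
  shows "N i k v \<le> \<delta> / (l0 * E ^ k)" "l0 * E ^ k * N i k v \<le> \<delta> * \<kappa> ^ k"
proof -
  have "l0 * E ^ k * N i k v \<le> l0 * E ^ k * (r * b ^ k)"
    using assms const_facts(15)[of k] by (intro mult_left_mono) auto
  also have "\<dots> = (l0 * r) * (E * b) ^ k" by (simp add: power_mult_distrib)
  finally have 1: "l0 * E ^ k * N i k v \<le> (l0 * r) * (E * b) ^ k" .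
  have "(l0 * r) * (E * b) ^ k \<le> \<delta> * \<kappa> ^ k"
    using params const_facts by (intro mult_mono power_mono) auto
  with 1 show 2: "l0 * E ^ k * N i k v \<le> \<delta> * \<kappa> ^ k" by simp
  have "\<delta> * \<kappa> ^ k \<le> \<delta> * 1"
    using params const_facts by (intro mult_left_mono power_le_one) auto
  with 2 show "N i k v \<le> \<delta> / (l0 * E ^ k)"
    using const_facts(15)[of k] by (simp add: field_simps)
qed

lemma slowD: "slow i n z \<Longrightarrow> k \<le> n \<Longrightarrow> N i k (z k - xs i k) \<le> \<delta> / (l0 * E ^ k)"
  unfolding slow_def using slow_small(1) by blast

definition orb :: "(real^'k \<Rightarrow> 'a) \<Rightarrow> real^'k \<Rightarrow> nat \<Rightarrow> 'a" where
  "orb \<psi> \<zeta> n = (f ^^ n) (\<psi> \<zeta>)"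

lemma orb_simps [simp]: "orb \<psi> \<zeta> 0 = \<psi> \<zeta>" "orb \<psi> \<zeta> (Suc n) = f (orb \<psi> \<zeta> n)"
  by (simp_all add: orb_def)

text \<open>The derivative of the iterate is built as a bounded operator so that its continuity in
  the parameter holds in operator norm.\<close>

primrec dorb :: "(real^'k \<Rightarrow> 'a) \<Rightarrow> (real^'k \<Rightarrow> (real^'k) \<Rightarrow>\<^sub>L 'a) \<Rightarrow> real^'k \<Rightarrow> nat \<Rightarrow> (real^'k) \<Rightarrow>\<^sub>L 'a" where
  "dorb \<psi> B \<zeta> 0 = B \<zeta>"
| "dorb \<psi> B \<zeta> (Suc n) = f' (orb \<psi> \<zeta> n) o\<^sub>L dorb \<psi> B \<zeta> n"

text \<open>The cone condition is demanded for chords and for every label, because points of one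
  leaf will be viewed in the charts of neighbouring leaves. The lower bound \<open>c\<close> turns
  smallness in the ambient space into smallness of parameters.\<close>

definition disc :: "(real^'k \<Rightarrow> 'a) \<Rightarrow> (real^'k \<Rightarrow> (real^'k) \<Rightarrow>\<^sub>L 'a) \<Rightarrow> (real^'k) set \<Rightarrow> real \<Rightarrow> bool" where
  "disc \<psi> B Q c \<longleftrightarrow> open Q \<and> continuous_on Q B \<and> 0 < c \<and>
     (\<forall>\<zeta>\<in>Q. (\<psi> has_derivative blinfun_apply (B \<zeta>)) (at \<zeta>)) \<and>
     (\<forall>\<zeta>\<in>Q. \<forall>\<zeta>'\<in>Q. c * norm (\<zeta> - \<zeta>') \<le> norm (\<psi> \<zeta> - \<psi> \<zeta>')) \<and>
     (\<forall>i\<in>U. \<forall>\<zeta>\<in>Q. \<forall>\<zeta>'\<in>Q. Nm i 0 (\<psi> \<zeta> - \<psi> \<zeta>') \<le> Np i 0 (\<psi> \<zeta> - \<psi> \<zeta>'))"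

context
  fixes \<psi> B Q c
  assumes disc: "disc \<psi> B Q c"
begin

lemma openQ: "open Q" using disc by (simp add: disc_def)

lemma orb_derivative:
  assumes "\<zeta> \<in> Q"
  shows "((\<lambda>\<zeta>. orb \<psi> \<zeta> n) has_derivative dorb \<psi> B \<zeta> n) (at \<zeta>)"
proof (induction n)
  case 0
  then show ?case using disc assms by (simp add: disc_def)
next
  case (Suc n)
  have "(f has_derivative f' (orb \<psi> \<zeta> n)) (at (orb \<psi> \<zeta> n))" by (rule df)
  from has_derivative_compose[OF Suc.IH this] show ?case
    by simp
qed

lemma orb_continuous: "continuous_on Q (\<lambda>\<zeta>. orb \<psi> \<zeta> n)"
  using orb_derivative by (meson continuous_at_imp_continuous_on has_derivative_continuous)

lemma dorb_continuous: "continuous_on Q (\<lambda>\<zeta>. dorb \<psi> B \<zeta> n)"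
proof (induction n)
  case 0
  then show ?case using disc by (simp add: disc_def)
next
  case (Suc n)
  have "continuous_on Q (\<lambda>\<zeta>. f' (orb \<psi> \<zeta> n))"
    by (rule continuous_on_compose2[OF df(2) orb_continuous]) simp
  then show ?case
    using Suc.IH by (simp add: bounded_bilinear.continuous_on[OF bounded_bilinear_blinfun_compose])
qed

text \<open>Closed conditions pass from chords to tangent vectors; positive \<open>h\<close> suffice
  because the limit of the difference quotients can be taken from the right.\<close>

lemma diff_quotient_closed:
  assumes "\<zeta> \<in> Q" "closed S" "\<And>h u. 0 < h \<Longrightarrow> \<zeta> + h *\<^sub>R v \<in> Q \<Longrightarrow> (\<psi> (\<zeta> + h *\<^sub>R v) - \<psi> \<zeta>) /\<^sub>R h \<in> S"
  shows "B \<zeta> v \<in> S"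
proof -
  have der: "(\<psi> has_derivative B \<zeta>) (at \<zeta>)" using disc assms by (simp add: disc_def)
  have "((\<lambda>h. \<psi> (\<zeta> + h *\<^sub>R v)) has_derivative (\<lambda>h. B \<zeta> (h *\<^sub>R v))) (at 0)"
  proof -
    have "((\<lambda>h. \<zeta> + h *\<^sub>R v) has_derivative (\<lambda>h. h *\<^sub>R v)) (at 0)"
      by (auto intro!: derivative_eq_intros)
    from has_derivative_compose[OF this, of \<psi> "B \<zeta>"] der show ?thesis by simp
  qed
  then have "((\<lambda>h. norm (\<psi> (\<zeta> + h *\<^sub>R v) - \<psi> \<zeta> - h *\<^sub>R B \<zeta> v) / norm h) \<longlongrightarrow> 0) (at 0)"
    by (simp add: has_derivative_iff_norm blinfun.scaleR_right)
  moreover have "\<forall>\<^sub>F h in at (0::real). norm (\<psi> (\<zeta> + h *\<^sub>R v) - \<psi> \<zeta> - h *\<^sub>R B \<zeta> v) / norm h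
      = norm ((\<psi> (\<zeta> + h *\<^sub>R v) - \<psi> \<zeta>) /\<^sub>R h - B \<zeta> v)"
  proof -
    have "norm (w - h *\<^sub>R u) / norm h = norm (w /\<^sub>R h - u)" if "h \<noteq> 0" for h :: real and w u :: 'a
    proof -
      have "w /\<^sub>R h - u = (w - h *\<^sub>R u) /\<^sub>R h" using that by (simp add: scaleR_diff_right)
      then show ?thesis by (simp add: divide_inverse mult.commute)
    qed
    then show ?thesis by (auto simp: eventually_at_filter)
  qed
  ultimately have "((\<lambda>h. norm ((\<psi> (\<zeta> + h *\<^sub>R v) - \<psi> \<zeta>) /\<^sub>R h - B \<zeta> v)) \<longlongrightarrow> 0) (at 0)"
    by (simp only: tendsto_cong)
  then have "((\<lambda>h. (\<psi> (\<zeta> + h *\<^sub>R v) - \<psi> \<zeta>) /\<^sub>R h) \<longlongrightarrow> B \<zeta> v) (at 0)"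
    unfolding tendsto_norm_zero_iff by (rule LIM_zero_cancel)
  then have lim: "((\<lambda>h. (\<psi> (\<zeta> + h *\<^sub>R v) - \<psi> \<zeta>) /\<^sub>R h) \<longlongrightarrow> B \<zeta> v) (at_right 0)"
    using filterlim_at_split by blast
  have "((\<lambda>h. \<zeta> + h *\<^sub>R v) \<longlongrightarrow> \<zeta> + 0 *\<^sub>R v) (at_right 0)"
    by (intro tendsto_intros)
  then have "\<forall>\<^sub>F h in at_right 0. \<zeta> + h *\<^sub>R v \<in> Q"
    using topological_tendstoD[OF _ openQ] assms(1) by fastforce
  moreover have "\<forall>\<^sub>F h in at_right (0::real). 0 < h"
    by (auto simp: eventually_at_right_field intro: exI[of _ 1])
  ultimately have "\<forall>\<^sub>F h in at_right 0. (\<psi> (\<zeta> + h *\<^sub>R v) - \<psi> \<zeta>) /\<^sub>R h \<in> S"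
    by eventually_elim (rule assms(3))
  then show ?thesis
    by (rule Lim_in_closed_set[OF assms(2) _ _ lim]) simp
qed

lemma dorb_cone0:
  assumes "i \<in> U" "\<zeta> \<in> Q"
  shows "Nm i 0 (B \<zeta> v) \<le> Np i 0 (B \<zeta> v)" 
proof -
  have "B \<zeta> v \<in> {u. Nm i 0 u \<le> Np i 0 u}"
  proof (rule diff_quotient_closed[OF assms(2)])
    show "closed {u. Nm i 0 u \<le> Np i 0 u}"
      by (intro closed_Collect_le continuous_Np continuous_Nm assms)
    fix h :: real assume h: "0 < h" "\<zeta> + h *\<^sub>R v \<in> Q"
    then have "Nm i 0 (\<psi> (\<zeta> + h *\<^sub>R v) - \<psi> \<zeta>) \<le> Np i 0 (\<psi> (\<zeta> + h *\<^sub>R v) - \<psi> \<zeta>)"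
      using disc assms by (simp add: disc_def)
    then show "(\<psi> (\<zeta> + h *\<^sub>R v) - \<psi> \<zeta>) /\<^sub>R h \<in> {u. Nm i 0 u \<le> Np i 0 u}"
      using h by (simp add: Np_scale Nm_scale assms)
  qed
  then show ?thesis by simp
qed

lemma dorb_lower0:
  assumes "\<zeta> \<in> Q"
  shows "c * norm v \<le> norm (B \<zeta> v)" 
proof -
  have "B \<zeta> v \<in> {u. c * norm v \<le> norm u}"
  proof (rule diff_quotient_closed[OF assms(1)])
    show "closed {u::'a. c * norm v \<le> norm u}"
      by (intro closed_Collect_le continuous_intros)
    fix h :: real assume h: "0 < h" "\<zeta> + h *\<^sub>R v \<in> Q"
    then have "c * norm (\<zeta> + h *\<^sub>R v - \<zeta>) \<le> norm (\<psi> (\<zeta> + h *\<^sub>R v) - \<psi> \<zeta>)"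
      using disc assms unfolding disc_def by blast
    then have "c * norm v \<le> norm (\<psi> (\<zeta> + h *\<^sub>R v) - \<psi> \<zeta>) / h"
      using h by (simp add: pos_le_divide_eq mult_ac)
    then show "(\<psi> (\<zeta> + h *\<^sub>R v) - \<psi> \<zeta>) /\<^sub>R h \<in> {u. c * norm v \<le> norm u}"
      using h by (simp add: divide_inverse mult.commute)
  qed
  then show ?thesis by simp
qed

text \<open>The unstable part of a chord grows by at least \<open>g\<close>, while the new stable
  part is at most \<open>a\<close> times the old unstable part, and \<open>a < g\<close>.\<close>

lemma orb_cone:
  assumes i: "i \<in> U" and Q: "\<zeta> \<in> Q" "\<zeta>' \<in> Q" and s: "slow i n (orb \<psi> \<zeta>)" "slow i n (orb \<psi> \<zeta>')" and "k \<le> n"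
  shows "Nm i k (orb \<psi> \<zeta> k - orb \<psi> \<zeta>' k) \<le> Np i k (orb \<psi> \<zeta> k - orb \<psi> \<zeta>' k)"
  using \<open>k \<le> n\<close>
proof (induction k)
  case 0
  then show ?case using disc i Q by (simp add: disc_def)
next
  case (Suc k)
  let ?d = "orb \<psi> \<zeta> k - orb \<psi> \<zeta>' k"
  have st: "g * Np i k ?d \<le> Np i (Suc k) (f (orb \<psi> \<zeta> k) - f (orb \<psi> \<zeta>' k))"
    "Nm i (Suc k) (f (orb \<psi> \<zeta> k) - f (orb \<psi> \<zeta>' k)) \<le> a * Np i k ?d"
    using cone_step[OF i slowD[OF s(1)] slowD[OF s(2)]] Suc by auto
  have "a * Np i k ?d \<le> g * Np i k ?d"
    using const_facts Np_nonneg[OF i] by (intro mult_right_mono) auto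
  with st show ?case by simp
qed

lemma orb_growth:
  assumes i: "i \<in> U" and Q: "\<zeta> \<in> Q" "\<zeta>' \<in> Q" and s: "slow i n (orb \<psi> \<zeta>)" "slow i n (orb \<psi> \<zeta>')" and "k \<le> n"
  shows "g ^ (n - k) * Np i k (orb \<psi> \<zeta> k - orb \<psi> \<zeta>' k) \<le> Np i n (orb \<psi> \<zeta> n - orb \<psi> \<zeta>' n)"
  using \<open>k \<le> n\<close>
proof (induction k rule: inc_induct)
  case (step k)
  let ?d = "orb \<psi> \<zeta> k - orb \<psi> \<zeta>' k"
  have "g * Np i k ?d \<le> Np i (Suc k) (f (orb \<psi> \<zeta> k) - f (orb \<psi> \<zeta>' k))"
    using step(1,2) cone_step[OF i slowD[OF s(1)] slowD[OF s(2)] orb_cone[OF i Q s]] by auto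
  then have "g ^ (n - Suc k) * (g * Np i k ?d) \<le> g ^ (n - Suc k) * Np i (Suc k) (orb \<psi> \<zeta> (Suc k) - orb \<psi> \<zeta>' (Suc k))"
    using const_facts by (intro mult_left_mono) auto
  also have "\<dots> \<le> Np i n (orb \<psi> \<zeta> n - orb \<psi> \<zeta>' n)" by (rule step.IH)
  also have "g ^ (n - Suc k) * (g * Np i k ?d) = g ^ (n - k) * Np i k ?d"
    using step(2) by (simp add: Suc_diff_Suc flip: power_Suc2 mult.assoc)
  finally show ?case .
qed simp

text \<open>Expansion read backwards: the unstable displacement at time \<open>n\<close> controls
  the chord at all earlier times. Since \<open>b < g\<close>, this implies the second form, which
  compares with the scale \<open>b ^ k\<close> of slow orbits.\<close>

lemma orb_diff:
  assumes i: "i \<in> U" and Q: "\<zeta> \<in> Q" "\<zeta>' \<in> Q" and s: "slow i n (orb \<psi> \<zeta>)" "slow i n (orb \<psi> \<zeta>')" and k: "k \<le> n"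
  shows "N i k (orb \<psi> \<zeta> k - orb \<psi> \<zeta>' k) \<le> Np i n (orb \<psi> \<zeta> n - orb \<psi> \<zeta>' n) / g ^ (n - k)"
    "N i k (orb \<psi> \<zeta> k - orb \<psi> \<zeta>' k) \<le> Np i n (orb \<psi> \<zeta> n - orb \<psi> \<zeta>' n) / b ^ n * b ^ k"
proof -
  show 1: "N i k (orb \<psi> \<zeta> k - orb \<psi> \<zeta>' k) \<le> Np i n (orb \<psi> \<zeta> n - orb \<psi> \<zeta>' n) / g ^ (n - k)"
    using orb_growth[OF assms] orb_cone[OF assms] const_facts(3) by (simp add: N_def field_simps)
  also have "\<dots> \<le> Np i n (orb \<psi> \<zeta> n - orb \<psi> \<zeta>' n) / b ^ (n - k)"
    using const_facts params Np_nonneg[OF i] by (intro divide_left_mono power_mono mult_pos_pos) auto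
  also have "\<dots> = Np i n (orb \<psi> \<zeta> n - orb \<psi> \<zeta>' n) / b ^ n * b ^ k"
    using k const_facts(2) by (simp add: power_diff)
  finally show "N i k (orb \<psi> \<zeta> k - orb \<psi> \<zeta>' k) \<le> Np i n (orb \<psi> \<zeta> n - orb \<psi> \<zeta>' n) / b ^ n * b ^ k" .
qed

text \<open>One step sends a slope \<open>\<kappa> ^ k\<close> to at most
  \<open>(a0 * \<kappa> ^ k + \<delta> * \<kappa> ^ k) / g\<close>, where the second term is the
  nonlinear error along a slow orbit. This equals \<open>a / g * \<kappa> ^ k\<close> and is at most
  \<open>\<kappa> ^ Suc k\<close>.\<close>

lemma dorb_cone:
  assumes i: "i \<in> U" and Q: "\<zeta> \<in> Q" and s: "slow i n (orb \<psi> \<zeta>)" and "k \<le> n"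
  shows "Nm i k (dorb \<psi> B \<zeta> k v) \<le> \<kappa> ^ k * Np i k (dorb \<psi> B \<zeta> k v)"
  using \<open>k \<le> n\<close>
proof (induction k)
  case 0
  then show ?case using dorb_cone0[OF i Q] by simp
next
  case (Suc k)
  let ?v = "dorb \<psi> B \<zeta> k v" and ?z = "orb \<psi> \<zeta> k"
  have k1: "0 \<le> \<kappa> ^ k" "\<kappa> ^ k \<le> 1" using const_facts by (auto intro: power_le_one)
  have st: "g * Np i k ?v \<le> Np i (Suc k) (f' ?z ?v)"
    "Nm i (Suc k) (f' ?z ?v) \<le> (a0 * \<kappa> ^ k + l0 * E ^ k * N i k (?z - xs i k)) * Np i k ?v"
    using dstep[OF i slowD[OF s] Suc.IH k1] Suc.prems by auto
  have "a0 * \<kappa> ^ k + l0 * E ^ k * N i k (?z - xs i k) \<le> a0 * \<kappa> ^ k + \<delta> * \<kappa> ^ k"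
    using slow_small(2) s Suc.prems by (simp add: slow_def)
  also have "\<dots> = a * \<kappa> ^ k" using params by (simp add: algebra_simps)
  also have "\<dots> \<le> (g * \<kappa>) * \<kappa> ^ k"
    using const_facts k1 by (intro mult_right_mono) auto
  finally have "Nm i (Suc k) (f' ?z ?v) \<le> ((g * \<kappa>) * \<kappa> ^ k) * Np i k ?v"
    using st(2) Np_nonneg[OF i] by (meson mult_right_mono order_trans)
  also have "\<dots> = \<kappa> ^ Suc k * (g * Np i k ?v)" by simp
  also have "\<dots> \<le> \<kappa> ^ Suc k * Np i (Suc k) (f' ?z ?v)"
    using st(1) const_facts by (intro mult_left_mono) auto
  finally show ?case by simp
qed

lemma dorb_growth:
  assumes i: "i \<in> U" and Q: "\<zeta> \<in> Q" and s: "slow i n (orb \<psi> \<zeta>)" and "k \<le> n"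
  shows "g * Np i k (dorb \<psi> B \<zeta> k v) \<le> Np i (Suc k) (f' (orb \<psi> \<zeta> k) (dorb \<psi> B \<zeta> k v))"
  using dstep[OF i slowD[OF s] dorb_cone[OF assms]] \<open>k \<le> n\<close> const_facts by (auto simp: power_le_one)

lemma dorb_N:
  assumes i: "i \<in> U" and Q: "\<zeta> \<in> Q" and s: "slow i n (orb \<psi> \<zeta>)" and "k \<le> n"
  shows "N i k (dorb \<psi> B \<zeta> k v) = Np i k (dorb \<psi> B \<zeta> k v)"
proof -
  have "\<kappa> ^ k * Np i k (dorb \<psi> B \<zeta> k v) \<le> 1 * Np i k (dorb \<psi> B \<zeta> k v)"
    using const_facts Np_nonneg[OF i] by (intro mult_right_mono power_le_one) auto
  then show ?thesis using dorb_cone[OF assms, of v] by (simp add: N_def)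
qed

lemma dorb_pos:
  assumes i: "i \<in> U" and Q: "\<zeta> \<in> Q" and s: "slow i n (orb \<psi> \<zeta>)" and "k \<le> n" and "v \<noteq> 0"
  shows "0 < Np i k (dorb \<psi> B \<zeta> k v)"
  using \<open>k \<le> n\<close>
proof (induction k)
  case 0
  have "0 < norm (dorb \<psi> B \<zeta> 0 v)"
    using dorb_lower0[OF Q, of v] \<open>v \<noteq> 0\<close> disc by (auto simp: disc_def) (smt (verit) mult_pos_pos zero_less_norm_iff norm_zero)
  with norm_le[OF i, of "dorb \<psi> B \<zeta> 0 v" 0] dorb_N[OF i Q s, of 0 v] show ?case by linarith
next
  case (Suc k)
  then have "0 < g * Np i k (dorb \<psi> B \<zeta> k v)" using const_facts by simp
  also have "\<dots> \<le> Np i (Suc k) (f' (orb \<psi> \<zeta> k) (dorb \<psi> B \<zeta> k v))"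
    using Suc.prems by (intro dorb_growth[OF i Q s]) simp
  finally show ?case by simp
qed

text \<open>A tangent vector in the kernel of the unstable coordinates would have vanishing
  \<open>Np\<close>, which \<open>dorb_pos\<close> excludes. This makes the unstable coordinates at
  time \<open>k\<close> usable as coordinates on the disc.\<close>

lemma dorb_inj:
  assumes i: "i \<in> U" and Q: "\<zeta> \<in> Q" and s: "slow i n (orb \<psi> \<zeta>)" and "k \<le> n"
  shows "inj (dorb \<psi> B \<zeta> k)" "inj (co i k \<circ> dorb \<psi> B \<zeta> k)" "linear (co i k \<circ> dorb \<psi> B \<zeta> k)"
    "bounded_linear (dorb \<psi> B \<zeta> k)"
proof -
  show bl: "bounded_linear (dorb \<psi> B \<zeta> k)" by (rule blinfun.bounded_linear_right)
  show lin: "linear (co i k \<circ> dorb \<psi> B \<zeta> k)"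
    using bounded_linear_compose[OF co(1)[OF i] bl] by (simp add: bounded_linear.linear o_def)
  show "inj (co i k \<circ> dorb \<psi> B \<zeta> k)"
    unfolding linear_injective_0[OF lin]
  proof (intro allI impI)
    fix v assume "(co i k \<circ> dorb \<psi> B \<zeta> k) v = 0"
    then have "Np i k (dorb \<psi> B \<zeta> k v) = 0" using co(2)[OF i] by simp
    then show "v = 0" using dorb_pos[OF assms, of v] by auto
  qed
  then show "inj (dorb \<psi> B \<zeta> k)" by (rule inj_on_imageI2)
qed

end

end


section \<open>Comparison of the volume growth along two orbits\<close>

context hyperbolic_charts
begin

abbreviation lnvol :: "(real^'k \<Rightarrow> 'a) \<Rightarrow> (real^'k \<Rightarrow> (real^'k) \<Rightarrow>\<^sub>L 'a) \<Rightarrow> real^'k \<Rightarrow> nat \<Rightarrow> real" where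
  "lnvol \<psi> B \<zeta> n \<equiv> ln (unit_vol (blinfun_apply (dorb \<psi> B \<zeta> n)))"

text \<open>The constant is the one that \<open>lnvol_step\<close> produces: 4 from two error terms
  of size \<open>2 * \<kappa> ^ k\<close>, 2 from \<open>norm_le\<close>, and \<open>l0 * E\<close>
  from the distortion \<open>l0 * E ^ Suc k\<close>. The rate \<open>\<theta>\<close> is the decay
  of slopes times the growth of the distortion.\<close>

definition C_slope :: real where "C_slope = 8 * l0 * E"
definition \<theta> :: real where "\<theta> = \<kappa> * E"

lemma C_slope: "0 < C_slope" "0 \<le> \<theta>" "\<theta> < 1" "\<theta> ^ k \<ge> 0" "4 * l0 \<le> C_slope"
proof -
  have "l0 * 1 \<le> l0 * E" using params by (intro mult_left_mono) auto
  then show "4 * l0 \<le> C_slope" using params by (simp add: C_slope_def)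
qed (use params(1,2) const_facts(11,12) in \<open>auto simp: C_slope_def \<theta>_def\<close>)

context
  fixes \<psi>1 B1 Q1 c1 \<psi>2 B2 Q2 c2 i \<zeta> \<omega> n
  assumes disc1: "disc \<psi>1 B1 Q1 c1" and disc2: "disc \<psi>2 B2 Q2 c2" and i: "i \<in> U"
    and Q: "\<zeta> \<in> Q1" "\<omega> \<in> Q2" and s1: "slow i n (orb \<psi>1 \<zeta>)" and s2: "slow i n (orb \<psi>2 \<omega>)"
begin

text \<open>\<open>L\<close> identifies the tangent vectors of both discs that have equal unstable
  coordinates. Their images differ by a purely stable vector, whose relative size is the sum of two
  slopes, at most \<open>2 * \<kappa> ^ k\<close>.\<close>

lemma match:
  assumes k: "k \<le> n"
  obtains L where "linear L" "inj L"
    "(co i k \<circ> dorb \<psi>2 B2 \<omega> k) \<circ> L = co i k \<circ> dorb \<psi>1 B1 \<zeta> k"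
    "\<And>v. Np i k (dorb \<psi>2 B2 \<omega> k (L v) - dorb \<psi>1 B1 \<zeta> k v) = 0"
    "\<And>v. Nm i k (dorb \<psi>2 B2 \<omega> k (L v) - dorb \<psi>1 B1 \<zeta> k v) \<le> 2 * \<kappa> ^ k * Np i k (dorb \<psi>1 B1 \<zeta> k v)"
    "\<And>v. norm (dorb \<psi>2 B2 \<omega> k (L v) - dorb \<psi>1 B1 \<zeta> k v) \<le> C_slope * \<theta> ^ k * norm (dorb \<psi>1 B1 \<zeta> k v)"
proof -
  let ?c1 = "co i k \<circ> dorb \<psi>1 B1 \<zeta> k" and ?c2 = "co i k \<circ> dorb \<psi>2 B2 \<omega> k"
  note d1 = dorb_inj[OF disc1 i Q(1) s1 k] and d2 = dorb_inj[OF disc2 i Q(2) s2 k]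
  obtain M where M: "linear M" "M \<circ> ?c2 = id"
    using linear_injective_left_inverse[OF d2(3) d2(2)] by blast
  then have M2: "?c2 \<circ> M = id"
    using linear_inverse_left[OF d2(3) M(1)] by blast
  define L where "L = M \<circ> ?c1"
  have c2L: "?c2 \<circ> L = ?c1"
  proof
    fix v
    show "(?c2 \<circ> L) v = ?c1 v"
      using fun_cong[OF M2, of "?c1 v"] by (simp add: L_def)
  qed
  have co_eq: "co i k (dorb \<psi>2 B2 \<omega> k (L v)) = co i k (dorb \<psi>1 B1 \<zeta> k v)" for v
    using fun_cong[OF c2L, of v] by simp
  have lin: "linear L"
    unfolding L_def using d1(3) M(1) by (rule linear_compose)
  have inj: "inj L"
  proof (rule inj_on_imageI2[of ?c2])
    show "inj (?c2 \<circ> L)" using c2L d1(2) by simp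
  qed
  let ?e = "\<lambda>v. dorb \<psi>2 B2 \<omega> k (L v) - dorb \<psi>1 B1 \<zeta> k v"
  have Np0: "Np i k (?e v) = 0" for v
    by (rule Np_eq_iff[OF i co_eq])
  have NpL: "Np i k (dorb \<psi>2 B2 \<omega> k (L v)) = Np i k (dorb \<psi>1 B1 \<zeta> k v)" for v
    by (rule Np_eq[OF i co_eq])
  have Nm_e: "Nm i k (?e v) \<le> 2 * \<kappa> ^ k * Np i k (dorb \<psi>1 B1 \<zeta> k v)" for v
  proof -
    have "Nm i k (?e v) \<le> Nm i k (dorb \<psi>2 B2 \<omega> k (L v)) + Nm i k (dorb \<psi>1 B1 \<zeta> k v)"
      using Nm_add[OF i, of k "dorb \<psi>2 B2 \<omega> k (L v)" "- dorb \<psi>1 B1 \<zeta> k v"] by (simp add: Nm_minus[OF i])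
    also have "\<dots> \<le> \<kappa> ^ k * Np i k (dorb \<psi>2 B2 \<omega> k (L v)) + \<kappa> ^ k * Np i k (dorb \<psi>1 B1 \<zeta> k v)"
      by (intro add_mono dorb_cone[OF disc1 i Q(1) s1 k] dorb_cone[OF disc2 i Q(2) s2 k])
    finally show ?thesis by (simp add: NpL)
  qed
  have norm_e: "norm (?e v) \<le> C_slope * \<theta> ^ k * norm (dorb \<psi>1 B1 \<zeta> k v)" for v
  proof -
    have "N i k (?e v) \<le> 2 * \<kappa> ^ k * Np i k (dorb \<psi>1 B1 \<zeta> k v)"
      using Np0[of v] Nm_e[of v] Nm_nonneg[OF i, of k "?e v"] by (simp add: N_def)
    then have "norm (?e v) \<le> 4 * \<kappa> ^ k * Np i k (dorb \<psi>1 B1 \<zeta> k v)"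
      using norm_le[OF i, of "?e v" k] by simp
    also have "\<dots> \<le> 4 * \<kappa> ^ k * (l0 * E ^ k * norm (dorb \<psi>1 B1 \<zeta> k v))"
      using const_facts by (intro mult_left_mono Np_le_norm[OF i]) auto
    also have "\<dots> = 4 * l0 * (\<theta> ^ k * norm (dorb \<psi>1 B1 \<zeta> k v))"
      by (simp add: \<theta>_def power_mult_distrib)
    also have "\<dots> \<le> C_slope * (\<theta> ^ k * norm (dorb \<psi>1 B1 \<zeta> k v))"
      using C_slope by (intro mult_right_mono mult_nonneg_nonneg) auto
    finally show ?thesis by (simp add: mult.assoc)
  qed
  show thesis
    by (rule that[OF lin inj c2L Np0 Nm_e norm_e])
qed

text \<open>By \<open>unit_vol_compose\<close>, \<open>vol_ratio L\<close> is the quotient of the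
  unit volumes of the second tangent map and of its composition with \<open>L\<close>. The latter is
  relatively close to the first tangent map, so \<open>ln_unit_vol_close\<close> applies. The
  equation \<open>eq\<close> determines \<open>L\<close>, because the second tangent map is
  injective in unstable coordinates.\<close>

lemma ln_vol_ratio_le:
  assumes k: "k \<le> n" and small: "C_slope * \<theta> ^ k \<le> 1 / 2" and L: "linear L" "inj L"
    and eq: "(co i k \<circ> dorb \<psi>2 B2 \<omega> k) \<circ> L = co i k \<circ> dorb \<psi>1 B1 \<zeta> k"
  shows "\<bar>ln (vol_ratio L) - (lnvol \<psi>2 B2 \<omega> k - lnvol \<psi>1 B1 \<zeta> k)\<bar> \<le> 2 * real CARD('k) * (C_slope * \<theta> ^ k)"
proof -
  note d1 = dorb_inj[OF disc1 i Q(1) s1 k] and d2 = dorb_inj[OF disc2 i Q(2) s2 k]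
  obtain L' where L': "linear L'" "inj L'"
    "(co i k \<circ> dorb \<psi>2 B2 \<omega> k) \<circ> L' = co i k \<circ> dorb \<psi>1 B1 \<zeta> k"
    "\<And>v. norm (dorb \<psi>2 B2 \<omega> k (L' v) - dorb \<psi>1 B1 \<zeta> k v) \<le> C_slope * \<theta> ^ k * norm (dorb \<psi>1 B1 \<zeta> k v)"
    using match[OF k] by metis
  have "L = L'"
  proof
    fix v
    have "(co i k \<circ> dorb \<psi>2 B2 \<omega> k) (L v) = (co i k \<circ> dorb \<psi>2 B2 \<omega> k) (L' v)"
      using fun_cong[OF eq, of v] fun_cong[OF L'(3), of v] by simp
    then show "L v = L' v" using d2(2) by (rule injD[rotated])
  qed
  then have cl: "norm ((dorb \<psi>2 B2 \<omega> k \<circ> L) v - dorb \<psi>1 B1 \<zeta> k v) \<le> C_slope * \<theta> ^ k * norm (dorb \<psi>1 B1 \<zeta> k v)" for v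
    using L'(4) by simp
  have bl: "bounded_linear (dorb \<psi>2 B2 \<omega> k \<circ> L)"
    using bounded_linear_compose[OF d2(4), of L] linear_conv_bounded_linear[THEN iffD1, OF L(1)] by (simp add: o_def)
  have nn: "0 \<le> C_slope * \<theta> ^ k" using C_slope by simp
  note cmp = ln_unit_vol_close[OF d1(4,1) bl cl nn small]
  have "unit_vol (dorb \<psi>2 B2 \<omega> k) = vol_ratio L * unit_vol (dorb \<psi>2 B2 \<omega> k \<circ> L)"
    by (rule unit_vol_compose[OF d2(4,1) L])
  then have lnS: "lnvol \<psi>2 B2 \<omega> k = ln (vol_ratio L) + ln (unit_vol (dorb \<psi>2 B2 \<omega> k \<circ> L))"
    using ln_mult_pos[OF emeasure_linear_image(2)[OF L, of "{}"] unit_vol_pos[OF bl cmp(1)]] by (simp only: sets.empty_sets)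
  show ?thesis using cmp(2) lnS unfolding o_def DIM_cart DIM_real by simp
qed

text \<open>One \<open>L\<close>, matched at time \<open>k\<close>, serves at times \<open>k\<close>
  and \<open>Suc k\<close>, so its volume ratio cancels. At time \<open>Suc k\<close> the error
  splits into the stable difference, contracted by the derivative, and the change of the derivative
  between the two base points, which are both close to the reference orbit.\<close>

lemma lnvol_step:
  assumes k: "Suc k \<le> n" and small: "C_slope * \<theta> ^ k \<le> 1 / 2"
  shows "\<bar>(lnvol \<psi>2 B2 \<omega> (Suc k) - lnvol \<psi>1 B1 \<zeta> (Suc k)) - (lnvol \<psi>2 B2 \<omega> k - lnvol \<psi>1 B1 \<zeta> k)\<bar>
    \<le> 4 * real CARD('k) * (C_slope * \<theta> ^ k)"
proof -
  have k': "k \<le> n" using k by simp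
  obtain L where L: "linear L" "inj L"
    "(co i k \<circ> dorb \<psi>2 B2 \<omega> k) \<circ> L = co i k \<circ> dorb \<psi>1 B1 \<zeta> k"
    "\<And>v. Np i k (dorb \<psi>2 B2 \<omega> k (L v) - dorb \<psi>1 B1 \<zeta> k v) = 0"
    "\<And>v. Nm i k (dorb \<psi>2 B2 \<omega> k (L v) - dorb \<psi>1 B1 \<zeta> k v) \<le> 2 * \<kappa> ^ k * Np i k (dorb \<psi>1 B1 \<zeta> k v)"
    using match[OF k'] by metis
  note d1 = dorb_inj[OF disc1 i Q(1) s1 k] and d2 = dorb_inj[OF disc2 i Q(2) s2 k]
  let ?S1 = "dorb \<psi>1 B1 \<zeta> (Suc k)" and ?S2 = "dorb \<psi>2 B2 \<omega> (Suc k)"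
  let ?z1 = "orb \<psi>1 \<zeta> k" and ?z2 = "orb \<psi>2 \<omega> k"
  have close: "norm ((?S2 \<circ> L) v - ?S1 v) \<le> C_slope * \<theta> ^ k * norm (?S1 v)" for v
  proof -
    let ?t = "dorb \<psi>1 B1 \<zeta> k v" and ?u = "dorb \<psi>2 B2 \<omega> k (L v)"
    have "(?S2 \<circ> L) v - ?S1 v = f' ?z2 (?u - ?t) + (f' ?z2 ?t - f' ?z1 ?t)"
      by (simp add: blinfun.diff_right)
    then have "N i (Suc k) ((?S2 \<circ> L) v - ?S1 v) \<le> N i (Suc k) (f' ?z2 (?u - ?t)) + N i (Suc k) (f' ?z2 ?t - f' ?z1 ?t)"
      using N_add[OF i] by metis
    also have "N i (Suc k) (f' ?z2 (?u - ?t)) \<le> 2 * g * \<kappa> ^ k * Np i k ?t"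
    proof -
      have "N i (Suc k) (f' ?z2 (?u - ?t)) \<le> a * Nm i k (?u - ?t)"
        by (rule dstep0[OF i slowD[OF s2 k'] L(4)])
      also have "\<dots> \<le> g * (2 * \<kappa> ^ k * Np i k ?t)"
        using const_facts L(5)[of v] Nm_nonneg[OF i] by (intro mult_mono) auto
      finally show ?thesis by simp
    qed
    also have "N i (Suc k) (f' ?z2 ?t - f' ?z1 ?t) \<le> 2 * g * \<kappa> ^ k * Np i k ?t"
    proof -
      have "N i (Suc k) (f' ?z2 ?t - f' ?z1 ?t) \<le> l0 * E ^ k * N i k (?z2 - ?z1) * N i k ?t"
        by (rule dlip[OF i slowD[OF s2 k'] slowD[OF s1 k']])
      also have "\<dots> \<le> (2 * \<delta> * \<kappa> ^ k) * N i k ?t"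
      proof (rule mult_right_mono[OF _ N_nonneg[OF i]])
        have "l0 * E ^ k * N i k (?z2 - ?z1) \<le> l0 * E ^ k * N i k (?z2 - xs i k) + l0 * E ^ k * N i k (?z1 - xs i k)"
          using mult_left_mono[OF N_triangle[OF i, of k ?z2 ?z1 "xs i k"], of "l0 * E ^ k"] const_facts(15)[of k]
          by (simp add: distrib_left N_commute[OF i, of k ?z1])
        also have "\<dots> \<le> \<delta> * \<kappa> ^ k + \<delta> * \<kappa> ^ k"
          using s1 s2 k' by (intro add_mono slow_small) (auto simp: slow_def)
        finally show "l0 * E ^ k * N i k (?z2 - ?z1) \<le> 2 * \<delta> * \<kappa> ^ k" by simp
      qed
      also have "\<dots> \<le> (2 * g * \<kappa> ^ k) * N i k ?t"
        using params const_facts N_nonneg[OF i] by (intro mult_right_mono mult_left_mono) auto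
      also have "N i k ?t = Np i k ?t" by (rule dorb_N[OF disc1 i Q(1) s1 k'])
      finally show ?thesis .
    qed
    finally have "N i (Suc k) ((?S2 \<circ> L) v - ?S1 v) \<le> 4 * \<kappa> ^ k * (g * Np i k ?t)" by (simp add: mult_ac)
    also have "\<dots> \<le> 4 * \<kappa> ^ k * Np i (Suc k) (?S1 v)"
      using dorb_growth[OF disc1 i Q(1) s1 k', of v] const_facts by (intro mult_left_mono) auto
    also have "\<dots> \<le> 4 * \<kappa> ^ k * (l0 * E ^ Suc k * norm (?S1 v))"
      using const_facts by (intro mult_left_mono Np_le_norm[OF i]) auto
    finally have "norm ((?S2 \<circ> L) v - ?S1 v) \<le> 8 * \<kappa> ^ k * (l0 * E ^ Suc k * norm (?S1 v))"
      using norm_le[OF i, of "(?S2 \<circ> L) v - ?S1 v" "Suc k"] by simp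
    also have "\<dots> = C_slope * \<theta> ^ k * norm (?S1 v)"
      by (simp add: C_slope_def \<theta>_def power_mult_distrib)
    finally show ?thesis .
  qed
  have bl: "bounded_linear (?S2 \<circ> L)"
    using bounded_linear_compose[OF d2(4), of L] linear_conv_bounded_linear[THEN iffD1, OF L(1)] by (simp add: o_def)
  have nn: "0 \<le> C_slope * \<theta> ^ k" using C_slope by simp
  note cmp = ln_unit_vol_close[OF d1(4,1) bl close nn small]
  have "unit_vol ?S2 = vol_ratio L * unit_vol (?S2 \<circ> L)"
    by (rule unit_vol_compose[OF d2(4,1) L(1,2)])
  then have lnS: "lnvol \<psi>2 B2 \<omega> (Suc k) = ln (vol_ratio L) + ln (unit_vol (?S2 \<circ> L))"
    using ln_mult_pos[OF emeasure_linear_image(2)[OF L(1,2), of "{}"] unit_vol_pos[OF bl cmp(1)]] by (simp only: sets.empty_sets)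
  have e: "real (2 * DIM(real^'k)) * X = 2 * (real CARD('k) * X)" "2 * real CARD('k) * X = 2 * (real CARD('k) * X)"
    "4 * real CARD('k) * X = 4 * (real CARD('k) * X)" for X
    by simp_all
  show ?thesis
    using cmp(2) lnS ln_vol_ratio_le[OF k' small L(1-3)] unfolding o_def e by linarith
qed

text \<open>The steps sum to a geometric series. The bound is uniform over all pairs that are slow
  for a common label, and it is later applied to points that lie only approximately on one
  leaf.\<close>

lemma lnvol_tail:
  assumes "k0 \<le> k" "k \<le> n" and small: "C_slope * \<theta> ^ k0 \<le> 1 / 2"
  shows "\<bar>(lnvol \<psi>2 B2 \<omega> k - lnvol \<psi>1 B1 \<zeta> k) - (lnvol \<psi>2 B2 \<omega> k0 - lnvol \<psi>1 B1 \<zeta> k0)\<bar>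
    \<le> 4 * real CARD('k) * C_slope * (\<theta> ^ k0 / (1 - \<theta>))"
proof -
  let ?R = "\<lambda>k. lnvol \<psi>2 B2 \<omega> k - lnvol \<psi>1 B1 \<zeta> k" and ?C = "4 * real CARD('k) * C_slope"
  have C: "0 \<le> ?C" using C_slope by simp
  have "\<bar>?R k - ?R k0\<bar> \<le> ?C * ((\<theta> ^ k0 - \<theta> ^ k) / (1 - \<theta>))"
    using \<open>k0 \<le> k\<close> \<open>k \<le> n\<close>
  proof (induction k rule: dec_induct)
    case (step k)
    have "\<theta> ^ k \<le> \<theta> ^ k0" using C_slope step by (intro power_decreasing) auto
    then have "C_slope * \<theta> ^ k \<le> 1 / 2"
      using small mult_left_mono[of "\<theta> ^ k" "\<theta> ^ k0" C_slope] C_slope(1) by linarith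
    then have "\<bar>?R (Suc k) - ?R k\<bar> \<le> ?C * \<theta> ^ k"
      using lnvol_step[of k] step by (simp add: mult.assoc)
    moreover have "?C * ((\<theta> ^ k0 - \<theta> ^ k) / (1 - \<theta>)) + ?C * \<theta> ^ k = ?C * ((\<theta> ^ k0 - \<theta> ^ Suc k) / (1 - \<theta>))"
    proof -
      have "(\<theta> ^ k0 - \<theta> ^ k) / (1 - \<theta>) + \<theta> ^ k = (\<theta> ^ k0 - \<theta> ^ Suc k) / (1 - \<theta>)"
        using C_slope(3) by (simp add: field_simps)
      then show ?thesis by (metis distrib_left)
    qed
    ultimately show ?case using step by linarith
  qed simp
  also have "\<dots> \<le> ?C * (\<theta> ^ k0 / (1 - \<theta>))"
    using C_slope C by (intro mult_left_mono divide_right_mono) auto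
  finally show ?thesis .
qed

end

end


section \<open>Pieces of discs and their unstable charts\<close>

context hyperbolic_charts
begin

text \<open>This is the piece of the disc whose \<open>n\<close>-th image projects onto an unstable
  ball of radius \<open>s * b ^ n\<close> (see \<open>chart_surj\<close>). The ball of radius
  \<open>\<rho>\<close> keeps it inside the domain of the disc.\<close>

definition plaque :: "(real^'k \<Rightarrow> 'a) \<Rightarrow> 'i \<Rightarrow> nat \<Rightarrow> real \<Rightarrow> real \<Rightarrow> real^'k \<Rightarrow> (real^'k) set" where
  "plaque \<psi> i n \<rho> s \<zeta>1 = {\<zeta> \<in> ball \<zeta>1 \<rho>. slow i n (orb \<psi> \<zeta>) \<and> Np i n (orb \<psi> \<zeta> n - orb \<psi> \<zeta>1 n) < s * b ^ n}"

context
  fixes \<psi> B Q c i \<zeta>1 n \<rho> s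
  assumes disc: "disc \<psi> B Q c" and i: "i \<in> U" and \<rho>: "0 < \<rho>" "cball \<zeta>1 \<rho> \<subseteq> Q"
    and s: "0 < s" "2 * s \<le> c * \<rho>" "s < r" and orb1: "\<And>k. k \<le> n \<Longrightarrow> N i k (orb \<psi> \<zeta>1 k - xs i k) \<le> (r - s) * b ^ k"
begin

lemma center_slow: "slow i n (orb \<psi> \<zeta>1)"
  unfolding slow_def
proof (intro allI impI)
  fix k assume "k \<le> n"
  have "(r - s) * b ^ k \<le> r * b ^ k" using s const_facts by (intro mult_right_mono) auto
  then show "N i k (orb \<psi> \<zeta>1 k - xs i k) \<le> r * b ^ k" using orb1[OF \<open>k \<le> n\<close>] by simp
qed

text \<open>Backward contraction makes the constraints at earlier times hold with room to spare: the
  displacement from the centre is below \<open>s * b ^ k\<close>, and the centre lies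
  \<open>s * b ^ k\<close> inside the slow region. A piece can end only where its
  \<open>n\<close>-th image reaches the boundary of the unstable ball.\<close>

lemma plaque_strict:
  assumes \<zeta>: "\<zeta> \<in> Q" "slow i n (orb \<psi> \<zeta>)" and lt: "Np i n (orb \<psi> \<zeta> n - orb \<psi> \<zeta>1 n) < s * b ^ n"
  shows "\<zeta> \<in> ball \<zeta>1 \<rho>" "k \<le> n \<Longrightarrow> N i k (orb \<psi> \<zeta> k - orb \<psi> \<zeta>1 k) < s * b ^ k" 
    "k \<le> n \<Longrightarrow> N i k (orb \<psi> \<zeta> k - xs i k) < r * b ^ k"
proof -
  have Q: "\<zeta> \<in> Q" "\<zeta>1 \<in> Q" using \<zeta> \<rho> by auto
  have N: "N i k (orb \<psi> \<zeta> k - orb \<psi> \<zeta>1 k) < s * b ^ k" if "k \<le> n" for k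
  proof -
    have "N i k (orb \<psi> \<zeta> k - orb \<psi> \<zeta>1 k) \<le> Np i n (orb \<psi> \<zeta> n - orb \<psi> \<zeta>1 n) / b ^ n * b ^ k"
      by (rule orb_diff(2)[OF disc i Q \<zeta>(2) center_slow that])
    also have "\<dots> < (s * b ^ n) / b ^ n * b ^ k"
      using lt const_facts by (intro mult_strict_right_mono divide_strict_right_mono) auto
    finally show ?thesis using const_facts by simp
  qed
  then show "k \<le> n \<Longrightarrow> N i k (orb \<psi> \<zeta> k - orb \<psi> \<zeta>1 k) < s * b ^ k" .
  show "N i k (orb \<psi> \<zeta> k - xs i k) < r * b ^ k" if "k \<le> n"
    using N[OF that] orb1[OF that] N_triangle[OF i, of k "orb \<psi> \<zeta> k" "xs i k" "orb \<psi> \<zeta>1 k"]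
    by (simp add: algebra_simps)
  have "c * norm (\<zeta> - \<zeta>1) \<le> norm (\<psi> \<zeta> - \<psi> \<zeta>1)"
    using disc Q by (simp add: disc_def)
  also have "\<dots> \<le> 2 * N i 0 (\<psi> \<zeta> - \<psi> \<zeta>1)" by (rule norm_le[OF i])
  also have "\<dots> < 2 * s" using N[of 0] by simp
  finally have "c * norm (\<zeta> - \<zeta>1) < c * \<rho>" using s by simp
  then show "\<zeta> \<in> ball \<zeta>1 \<rho>"
    using disc by (simp add: disc_def dist_norm norm_minus_commute)
qed

lemma cont_on: "continuous_on (cball \<zeta>1 \<rho>) (\<lambda>\<zeta>. N i k (orb \<psi> \<zeta> k - xs i k))"
  "continuous_on (cball \<zeta>1 \<rho>) (\<lambda>\<zeta>. Np i k (orb \<psi> \<zeta> k - orb \<psi> \<zeta>1 k))"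
proof -
  have o: "continuous_on (cball \<zeta>1 \<rho>) (\<lambda>\<zeta>. orb \<psi> \<zeta> k)"
    using orb_continuous[OF disc] \<rho>(2) by (rule continuous_on_subset)
  show "continuous_on (cball \<zeta>1 \<rho>) (\<lambda>\<zeta>. N i k (orb \<psi> \<zeta> k - xs i k))"
    by (rule continuous_on_compose2[OF continuous_N[OF i, of UNIV]]) (auto intro!: continuous_intros o)
  show "continuous_on (cball \<zeta>1 \<rho>) (\<lambda>\<zeta>. Np i k (orb \<psi> \<zeta> k - orb \<psi> \<zeta>1 k))"
    by (rule continuous_on_compose2[OF continuous_Np[OF i, of UNIV]]) (auto intro!: continuous_intros o)
qed

text \<open>The inequalities in \<open>slow\<close> are not strict, but on a plaque they hold
  strictly by \<open>plaque_strict\<close>.\<close>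

lemma open_plaque: "open (plaque \<psi> i n \<rho> s \<zeta>1)"
proof -
  let ?A = "\<lambda>k. ball \<zeta>1 \<rho> \<inter> (\<lambda>\<zeta>. N i k (orb \<psi> \<zeta> k - xs i k)) -` {..< r * b ^ k}"
  let ?B = "ball \<zeta>1 \<rho> \<inter> (\<lambda>\<zeta>. Np i n (orb \<psi> \<zeta> n - orb \<psi> \<zeta>1 n)) -` {..< s * b ^ n}"
  have op: "open (?A k)" "open ?B" for k
    by (intro continuous_open_preimage continuous_on_subset[OF cont_on(1)] continuous_on_subset[OF cont_on(2)]; force)+
  have "plaque \<psi> i n \<rho> s \<zeta>1 = (\<Inter>k\<in>{..n}. ?A k) \<inter> ?B"
  proof (intro equalityI subsetI)
    fix \<zeta> assume "\<zeta> \<in> plaque \<psi> i n \<rho> s \<zeta>1"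
    then show "\<zeta> \<in> (\<Inter>k\<in>{..n}. ?A k) \<inter> ?B"
      using plaque_strict(3)[of \<zeta>] subsetD[OF \<rho>(2), of \<zeta>] by (auto simp: plaque_def)
  next
    fix \<zeta> assume "\<zeta> \<in> (\<Inter>k\<in>{..n}. ?A k) \<inter> ?B"
    then show "\<zeta> \<in> plaque \<psi> i n \<rho> s \<zeta>1"
      by (auto simp: plaque_def slow_def intro: less_imp_le)
  qed
  then show ?thesis
    by (simp only:) (intro open_Int open_INT ballI op finite_atMost)
qed

lemma plaque_slow: "\<zeta> \<in> plaque \<psi> i n \<rho> s \<zeta>1 \<Longrightarrow> \<zeta> \<in> Q \<and> slow i n (orb \<psi> \<zeta>)"
  using \<rho> by (auto simp: plaque_def)

text \<open>Equal unstable coordinates at time \<open>n\<close> leave no unstable displacement, and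
  \<open>orb_diff\<close> carries this back to time 0.\<close>

lemma chart_inj: "inj_on (\<lambda>\<zeta>. co i n (orb \<psi> \<zeta> n)) {\<zeta> \<in> Q. slow i n (orb \<psi> \<zeta>)}"
proof (rule inj_onI)
  fix \<zeta> \<zeta>' assume as: "\<zeta> \<in> {\<zeta> \<in> Q. slow i n (orb \<psi> \<zeta>)}" "\<zeta>' \<in> {\<zeta> \<in> Q. slow i n (orb \<psi> \<zeta>)}"
    and "co i n (orb \<psi> \<zeta> n) = co i n (orb \<psi> \<zeta>' n)"
  then have "Np i n (orb \<psi> \<zeta> n - orb \<psi> \<zeta>' n) = 0" using Np_eq_iff[OF i] by blast
  then have "N i 0 (\<psi> \<zeta> - \<psi> \<zeta>') \<le> 0"
    using orb_diff(1)[OF disc i, of \<zeta> \<zeta>' n 0] as by simp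
  then have "norm (\<psi> \<zeta> - \<psi> \<zeta>') \<le> 0" using norm_le[OF i, of "\<psi> \<zeta> - \<psi> \<zeta>'" 0] by linarith
  moreover have "c * norm (\<zeta> - \<zeta>') \<le> norm (\<psi> \<zeta> - \<psi> \<zeta>')" "0 < c"
    using disc as by (auto simp: disc_def)
  ultimately have "c * norm (\<zeta> - \<zeta>') \<le> 0" by linarith
  with \<open>0 < c\<close> show "\<zeta> = \<zeta>'" by (simp add: mult_le_0_iff)
qed

lemma chart_continuous: "continuous_on Q (\<lambda>\<zeta>. co i n (orb \<psi> \<zeta> n))"
  by (rule continuous_on_compose2[OF linear_continuous_on[OF co(1)[OF i], of UNIV n] orb_continuous[OF disc]]) auto

lemma chart_open:
  assumes "open W" "W \<subseteq> plaque \<psi> i n \<rho> s \<zeta>1"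
  shows "open ((\<lambda>\<zeta>. co i n (orb \<psi> \<zeta> n)) ` W)"
proof (rule invariance_of_domain[OF _ assms(1)])
  show "continuous_on W (\<lambda>\<zeta>. co i n (orb \<psi> \<zeta> n))"
    using plaque_slow assms(2) by (intro continuous_on_subset[OF chart_continuous]) auto
  show "inj_on (\<lambda>\<zeta>. co i n (orb \<psi> \<zeta> n)) W"
    using plaque_slow assms(2) by (intro inj_on_subset[OF chart_inj]) auto
qed

lemma chart_inverse_continuous:
  "continuous_on ((\<lambda>\<zeta>. co i n (orb \<psi> \<zeta> n)) ` plaque \<psi> i n \<rho> s \<zeta>1) (inv_into (plaque \<psi> i n \<rho> s \<zeta>1) (\<lambda>\<zeta>. co i n (orb \<psi> \<zeta> n)))"
proof -
  let ?G = "\<lambda>\<zeta>. co i n (orb \<psi> \<zeta> n)" and ?W = "plaque \<psi> i n \<rho> s \<zeta>1"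
  have inj: "inj_on ?G ?W"
    using plaque_slow by (intro inj_on_subset[OF chart_inj]) auto
  have "continuous_on ?W ?G"
    using plaque_slow by (intro continuous_on_subset[OF chart_continuous]) auto
  then obtain G' where "homeomorphism ?W (?G ` ?W) ?G G'"
    using invariance_of_domain_homeomorphism[OF open_plaque _ _ inj] by auto
  then have "continuous_on (?G ` ?W) G'" "\<And>x. x \<in> ?W \<Longrightarrow> G' (?G x) = x"
    by (auto simp: homeomorphism_def)
  moreover have "inv_into ?W ?G e = G' e" if "e \<in> ?G ` ?W" for e
    using that calculation(2) inv_into_f_f[OF inj] by auto
  ultimately show ?thesis
    by (simp cong: continuous_on_cong)
qed

lemma chart_derivative:
  assumes "\<zeta> \<in> Q"
  shows "((\<lambda>\<zeta>. co i n (orb \<psi> \<zeta> n)) has_derivative (co i n \<circ> dorb \<psi> B \<zeta> n)) (at \<zeta>)"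
  using bounded_linear.has_derivative[OF co(1)[OF i] orb_derivative[OF disc assms]] by (simp add: o_def)

text \<open>The image is open by invariance of domain, relatively closed by compactness and the strict
  inequalities of \<open>plaque_strict\<close>, and the target is convex, hence connected.\<close>

lemma chart_surj:
  assumes v: "Np i n (v - orb \<psi> \<zeta>1 n) < s * b ^ n"
  shows "\<exists>\<zeta>\<in>plaque \<psi> i n \<rho> s \<zeta>1. co i n (orb \<psi> \<zeta> n) = co i n v"
proof -
  let ?G = "\<lambda>\<zeta>. co i n (orb \<psi> \<zeta> n)" and ?W = "plaque \<psi> i n \<rho> s \<zeta>1" and ?p = "orb \<psi> \<zeta>1 n"
  define D where "D = co i n ` {v. Np i n (v - ?p) < s * b ^ n}"
  define C where "C = {\<zeta> \<in> cball \<zeta>1 \<rho>. slow i n (orb \<psi> \<zeta>)}"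
  have "convex {v. Np i n (v - ?p) < s * b ^ n}"
  proof (rule convexI)
    fix u v :: 'a and x y :: real
    assume uv: "u \<in> {v. Np i n (v - ?p) < s * b ^ n}" "v \<in> {v. Np i n (v - ?p) < s * b ^ n}" and xy: "0 \<le> x" "0 \<le> y" "x + y = 1"
    have "x *\<^sub>R u + y *\<^sub>R v - ?p = x *\<^sub>R (u - ?p) + y *\<^sub>R (v - ?p)"
      using xy(3) by (simp add: algebra_simps flip: scaleR_add_left)
    then have "Np i n (x *\<^sub>R u + y *\<^sub>R v - ?p) \<le> x * Np i n (u - ?p) + y * Np i n (v - ?p)"
      using Np_add[OF i, of n "x *\<^sub>R (u - ?p)" "y *\<^sub>R (v - ?p)"] xy by (simp add: Np_scale[OF i])
    also have "\<dots> < s * b ^ n"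
      using uv xy by (intro convex_bound_lt) auto
    finally show "x *\<^sub>R u + y *\<^sub>R v \<in> {v. Np i n (v - ?p) < s * b ^ n}" by simp
  qed
  then have "connected D"
    unfolding D_def using co(1)[OF i] by (intro convex_connected convex_linear_image) (auto simp: bounded_linear.linear)
  have WD: "?G ` ?W \<subseteq> D"
    by (auto simp: D_def plaque_def)
  have "\<zeta>1 \<in> ?W"
    using center_slow \<rho> s const_facts by (simp add: plaque_def Np_zero[OF i])
  have "openin (top_of_set D) (?G ` ?W)"
    using chart_open[OF open_plaque order_refl] WD by (rule open_subset[rotated])
  moreover have "closedin (top_of_set D) (?G ` ?W)"
  proof -
    have "closed C"
    proof -
      have "C = (\<Inter>k\<in>{..n}. cball \<zeta>1 \<rho> \<inter> (\<lambda>\<zeta>. N i k (orb \<psi> \<zeta> k - xs i k)) -` {.. r * b ^ k})"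
        by (auto simp: C_def slow_def)
      then show ?thesis
        by (simp only:) (intro closed_INT ballI continuous_closed_preimage cont_on closed_cball closed_atMost)
    qed
    then have "compact C"
      using closed_Int_compact[OF _ compact_cball[of \<zeta>1 \<rho>], of C] by (simp add: C_def Int_absorb2 subset_eq)
    moreover have "continuous_on C ?G"
      by (rule continuous_on_subset[OF chart_continuous]) (use \<rho> in \<open>auto simp: C_def\<close>)
    ultimately have "closed (?G ` C)"
      by (intro compact_imp_closed compact_continuous_image)
    moreover have "?G ` ?W = D \<inter> ?G ` C"
    proof (intro equalityI subsetI)
      fix e assume "e \<in> D \<inter> ?G ` C"
      then obtain u \<zeta> where u: "Np i n (u - ?p) < s * b ^ n" "e = co i n u" and \<zeta>: "\<zeta> \<in> C" "e = ?G \<zeta>"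
        by (auto simp: D_def)
      have "Np i n (orb \<psi> \<zeta> n - u) = 0" using u \<zeta> by (intro Np_eq_iff[OF i]) auto
      then have "Np i n (orb \<psi> \<zeta> n - ?p) < s * b ^ n"
        using u(1) Np_triangle[OF i, of n "orb \<psi> \<zeta> n" ?p u] by simp
      then have "\<zeta> \<in> ?W"
        using \<zeta> \<rho> plaque_strict(1)[of \<zeta>] by (auto simp: plaque_def C_def)
      then show "e \<in> ?G ` ?W" using \<zeta> by blast
    next
      fix e assume "e \<in> ?G ` ?W"
      then show "e \<in> D \<inter> ?G ` C" using WD by (auto simp: plaque_def C_def)
    qed
    ultimately show ?thesis by (metis closedin_closed_Int)
  qed
  ultimately have "?G ` ?W = D"
    using \<open>connected D\<close> \<open>\<zeta>1 \<in> ?W\<close> unfolding connected_clopen by blast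
  moreover have "co i n v \<in> D" using v by (auto simp: D_def)
  ultimately show ?thesis by force
qed

end

end


section \<open>Packing, separated nets and image measures\<close>

lemma card_separated_le:
  fixes \<nu> :: "'e::euclidean_space \<Rightarrow> real" and S :: "'e set"
  assumes add: "\<And>u v. \<nu> (u + v) \<le> \<nu> u + \<nu> v" and scale: "\<And>c v. \<nu> (c *\<^sub>R v) = \<bar>c\<bar> * \<nu> v"
    and lower: "0 < c0" "\<And>v. c0 * norm v \<le> \<nu> v" and upper: "0 \<le> C" "\<And>v. \<nu> v \<le> C * norm v"
    and S: "finite S" and t: "0 < t" "\<And>p q. \<lbrakk>p \<in> S; q \<in> S; p \<noteq> q\<rbrakk> \<Longrightarrow> t \<le> \<nu> (p - q)"
    and R: "0 \<le> R" "\<And>p. p \<in> S \<Longrightarrow> \<nu> (p - p0) \<le> R"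
  shows "real (card S) \<le> (1 + 2 * R / t) ^ DIM('e)"
proof -
  have minus: "\<nu> (- v) = \<nu> v" for v using scale[of "-1" v] by simp
  have nonneg: "0 \<le> \<nu> v" for v
    using lower(2)[of v] lower(1) by (meson mult_nonneg_nonneg norm_ge_zero order.trans less_imp_le)
  have sub: "\<nu> u - \<nu> v \<le> C * norm (u - v)" for u v
    using add[of "u - v" v] upper(2)[of "u - v"] by simp
  have cont: "continuous_on UNIV \<nu>"
  proof (rule lipschitz_on_continuous_on, rule lipschitz_onI[OF _ upper(1)])
    fix u v show "dist (\<nu> u) (\<nu> v) \<le> C * dist u v"
      using sub[of u v] sub[of v u] by (simp add: dist_norm norm_minus_commute abs_le_iff)
  qed
  define A where "A = {v. \<nu> v < 1}"
  have "open A" unfolding A_def by (intro open_Collect_less cont continuous_intros)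
  have "norm v \<le> 1 / c0" if "v \<in> A" for v
    using that lower(2)[of v] lower(1) by (simp add: A_def field_simps)
  then have "bounded A" by (auto simp: bounded_iff)
  have A: "A \<in> lmeasurable" using \<open>open A\<close> \<open>bounded A\<close> by (rule lmeasurable_open[rotated])
  have "0 \<in> A" using scale[of 0 0] by (simp add: A_def)
  have posA: "0 < measure lebesgue A"
  proof -
    have "\<not> negligible A" using \<open>open A\<close> \<open>0 \<in> A\<close> open_not_negligible by blast
    then show ?thesis using A by (metis negligible_iff_measure zero_less_measure_iff)
  qed
  define b where "b e \<rho> = (\<lambda>v. \<rho> *\<^sub>R v + e) ` A" for e \<rho>
  have b: "b e \<rho> = {x. \<nu> (x - e) < \<rho>}" if "0 < \<rho>" for e \<rho>
  proof (intro equalityI subsetI)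
    fix x assume x: "x \<in> {x. \<nu> (x - e) < \<rho>}"
    have "\<nu> ((x - e) /\<^sub>R \<rho>) = \<nu> (x - e) / \<rho>"
      unfolding scale using that by (simp add: divide_inverse mult.commute)
    then have "\<nu> ((x - e) /\<^sub>R \<rho>) < 1" using x that by simp
    then show "x \<in> b e \<rho>"
      using that unfolding b_def A_def by (intro image_eqI[of _ _ "(x - e) /\<^sub>R \<rho>"]) auto
  qed (use that in \<open>auto simp: b_def A_def scale\<close>)
  have mb: "measure lebesgue (b e \<rho>) = \<rho> ^ DIM('e) * measure lebesgue A" if "0 < \<rho>" for e \<rho>
    using measure_lebesgue_affine[of \<rho> e A] that by (simp add: b_def)
  have lb: "b e \<rho> \<in> lmeasurable" if "0 < \<rho>" for e \<rho>
  proof (rule lmeasurable_open)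
    have "norm x \<le> norm e + \<rho> / c0" if "x \<in> b e \<rho>" for x
    proof -
      have "c0 * norm (x - e) \<le> \<rho>" using lower(2)[of "x - e"] that b[OF \<open>0 < \<rho>\<close>] by auto
      then have "norm (x - e) \<le> \<rho> / c0" using lower(1) by (simp add: field_simps)
      then show ?thesis using norm_triangle_ineq[of e "x - e"] by simp
    qed
    then show "bounded (b e \<rho>)" by (auto simp: bounded_iff)
    show "open (b e \<rho>)" unfolding b[OF that]
      by (intro open_Collect_less continuous_on_compose2[OF cont] continuous_intros) auto
  qed
  have t2: "0 < t / 2" using t by simp
  have disj: "disjoint_family_on (\<lambda>p. b p (t / 2)) S"
    unfolding disjoint_family_on_def
  proof (intro ballI impI)
    fix p q assume pq: "p \<in> S" "q \<in> S" "p \<noteq> q"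
    show "b p (t / 2) \<inter> b q (t / 2) = {}"
    proof (rule ccontr)
      assume "b p (t / 2) \<inter> b q (t / 2) \<noteq> {}"
      then obtain x where "\<nu> (x - p) < t / 2" "\<nu> (x - q) < t / 2"
        using b[OF t2] by auto
      then have "\<nu> (p - q) < t"
        using add[of "p - x" "x - q"] minus[of "x - p"] by simp
      then show False using t(2)[OF pq] by simp
    qed
  qed
  have R2: "0 < R + t / 2" using R t by simp
  \<comment> \<open>Balls of radius \<open>t / 2\<close> about the separated points are disjoint and
    lie in one ball of radius \<open>R + t / 2\<close>; comparing volumes gives the count.\<close>
  have "real (card S) * ((t / 2) ^ DIM('e) * measure lebesgue A) = (\<Sum>p\<in>S. measure lebesgue (b p (t / 2)))"
    using mb[OF t2] by simp
  also have "\<dots> = measure lebesgue (\<Union>p\<in>S. b p (t / 2))"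
  proof (rule measure_finite_Union[symmetric, OF S _ disj])
    show "emeasure lebesgue (b p (t / 2)) \<noteq> \<infinity>" for p
      using fmeasurableD2[OF lb[OF t2]] by simp
  qed (use lb[OF t2] in auto)
  also have "\<dots> \<le> measure lebesgue (b p0 (R + t / 2))"
  proof (rule measure_mono_fmeasurable)
    show "(\<Union>p\<in>S. b p (t / 2)) \<subseteq> b p0 (R + t / 2)"
    proof (intro UN_least subsetI)
      fix p x assume "p \<in> S" "x \<in> b p (t / 2)"
      then show "x \<in> b p0 (R + t / 2)"
        using R(2)[of p] add[of "x - p" "p - p0"] by (simp add: b[OF t2] b[OF R2])
    qed
    show "(\<Union>p\<in>S. b p (t / 2)) \<in> sets lebesgue"
      using S lb[OF t2] by (intro sets.finite_UN) auto
  qed (rule lb[OF R2])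
  also have "\<dots> = (R + t / 2) ^ DIM('e) * measure lebesgue A" by (rule mb[OF R2])
  finally have "real (card S) * (t / 2) ^ DIM('e) \<le> (R + t / 2) ^ DIM('e)"
    using posA by simp
  then have "real (card S) \<le> (R + t / 2) ^ DIM('e) / (t / 2) ^ DIM('e)"
    using t by (simp add: pos_le_divide_eq)
  also have "\<dots> = ((R + t / 2) / (t / 2)) ^ DIM('e)" by (rule power_divide[symmetric])
  also have "(R + t / 2) / (t / 2) = 1 + 2 * R / t" using t by (simp add: field_simps)
  finally show ?thesis .
qed

text \<open>Since \<open>d\<close> is only a pseudometric, compactness is used through open sets of
  the given topology. Take a maximal separated subset of the centres of a finite cover by sets of
  radius \<open>\<sigma> / 2\<close>: every point is within \<open>\<sigma> / 2\<close> of a centre,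
  and every centre within \<open>\<sigma> / 2\<close> of the subset.\<close>

lemma finite_separated_net:
  fixes K :: "'e::metric_space set" and d :: "'e \<Rightarrow> 'e \<Rightarrow> real"
  assumes K: "compact K" and cont: "\<And>z. z \<in> K \<Longrightarrow> continuous_on K (\<lambda>\<zeta>. d \<zeta> z)"
    and d: "\<And>z. d z z = 0" "\<And>x y. d x y = d y x" "\<And>x y z. d x z \<le> d x y + d y z" and \<sigma>: "0 < \<sigma>"
  obtains Z where "finite Z" "Z \<subseteq> K" "\<And>\<zeta>. \<zeta> \<in> K \<Longrightarrow> \<exists>z\<in>Z. d \<zeta> z < \<sigma>"
    "\<And>z z'. \<lbrakk>z \<in> Z; z' \<in> Z; z \<noteq> z'\<rbrakk> \<Longrightarrow> \<sigma> / 2 \<le> d z z'"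
proof -
  have "\<exists>T. open T \<and> T \<inter> K = {\<zeta> \<in> K. d \<zeta> z < \<sigma> / 2}" if "z \<in> K" for z
  proof -
    have "openin (top_of_set K) (K \<inter> (\<lambda>\<zeta>. d \<zeta> z) -` {..<\<sigma> / 2})"
      by (intro continuous_openin_preimage_gen cont that) auto
    then obtain T where "open T" "K \<inter> (\<lambda>\<zeta>. d \<zeta> z) -` {..<\<sigma> / 2} = K \<inter> T"
      by (auto simp: openin_open)
    then show ?thesis by (intro exI[of _ T]) blast
  qed
  then obtain T where T: "\<And>z. z \<in> K \<Longrightarrow> open (T z)" "\<And>z. z \<in> K \<Longrightarrow> T z \<inter> K = {\<zeta> \<in> K. d \<zeta> z < \<sigma> / 2}"
    by metis
  have "K \<subseteq> (\<Union>z\<in>K. T z)"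
  proof
    fix z assume "z \<in> K"
    then have "z \<in> T z \<inter> K" using T(2)[of z] d(1)[of z] \<sigma> by simp
    with \<open>z \<in> K\<close> show "z \<in> (\<Union>z\<in>K. T z)" by blast
  qed
  then obtain Z0 where Z0: "Z0 \<subseteq> K" "finite Z0" "K \<subseteq> (\<Union>z\<in>Z0. T z)"
    using compactE_image[OF K, of K T] T(1) by metis
  define sep where "sep Z \<longleftrightarrow> (\<forall>z\<in>Z. \<forall>z'\<in>Z. z \<noteq> z' \<longrightarrow> \<sigma> / 2 \<le> d z z')" for Z
  define \<Z> where "\<Z> = {Z \<in> Pow Z0. sep Z}"
  have "finite \<Z>" "{} \<in> \<Z>" using Z0 by (auto simp: \<Z>_def sep_def)
  then obtain Z where Z: "Z \<in> \<Z>" "\<And>Y. Y \<in> \<Z> \<Longrightarrow> Z \<subseteq> Y \<Longrightarrow> Y = Z"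
    using finite_has_maximal2[of \<Z> "{}"] by (metis (no_types, lifting))
  show thesis
  proof (rule that)
    show "finite Z" "Z \<subseteq> K" using Z(1) Z0 finite_subset by (auto simp: \<Z>_def)
    show "\<sigma> / 2 \<le> d z z'" if "z \<in> Z" "z' \<in> Z" "z \<noteq> z'" for z z'
      using that Z(1) by (auto simp: \<Z>_def sep_def)
    fix \<zeta> assume "\<zeta> \<in> K"
    then obtain z0 where "z0 \<in> Z0" "\<zeta> \<in> T z0 \<inter> K" using Z0 by blast
    then have z0: "z0 \<in> Z0" "d \<zeta> z0 < \<sigma> / 2" using T(2)[of z0] Z0(1) by auto
    show "\<exists>z\<in>Z. d \<zeta> z < \<sigma>"
    proof (cases "z0 \<in> Z")
      case True
      then show ?thesis using z0 \<sigma> by (intro bexI[of _ z0]) auto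
    next
      case False
      then have "insert z0 Z \<notin> \<Z>" using Z(2)[of "insert z0 Z"] by blast
      then have "\<not> sep (insert z0 Z)" using z0(1) Z(1) by (auto simp: \<Z>_def)
      moreover have "sep Z" using Z(1) by (simp add: \<Z>_def)
      ultimately obtain z where "z \<in> Z" "d z0 z < \<sigma> / 2"
        unfolding sep_def by (metis d(2) insert_iff not_le)
      then show ?thesis using z0(2) d(3)[of \<zeta> z z0] by (intro bexI[of _ z]) auto
    qed
  qed
qed

text \<open>The assumption \<open>le\<close> says that the image measure is dominated by
  \<open>c\<close> times Lebesgue measure on \<open>V\<close>, and domination of measures passes to
  integrals.\<close>

lemma nn_integral_image_le:
  fixes \<Phi> :: "'e::euclidean_space \<Rightarrow> 'e" and h :: "'e \<Rightarrow> ennreal"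
  assumes B: "B \<in> sets borel" and \<Phi>: "\<Phi> \<in> borel_measurable (restrict_space borel B)" and V: "V \<in> sets borel"
    and le: "\<And>Y. Y \<in> sets borel \<Longrightarrow> emeasure lborel (B \<inter> \<Phi> -` Y) \<le> c * emeasure lborel (V \<inter> Y)"
    and h: "h \<in> borel_measurable borel"
  shows "(\<integral>\<^sup>+\<omega>\<in>B. h (\<Phi> \<omega>) \<partial>lborel) \<le> c * (\<integral>\<^sup>+\<zeta>\<in>V. h \<zeta> \<partial>lborel)"
proof -
  note [measurable] = B V h
  define M where "M = distr (restrict_space lborel B) borel \<Phi>"
  define N where "N = scale_measure c (density lborel (indicator V))"
  have \<Phi>': "\<Phi> \<in> borel_measurable (restrict_space lborel B)"
    using \<Phi> by (simp cong: measurable_cong_sets add: sets_restrict_space)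
  have "M \<le> N"
  proof (rule le_measure[THEN iffD2])
    show "sets M = sets N" by (simp add: M_def N_def)
    show "\<forall>Y\<in>sets M. emeasure M Y \<le> emeasure N Y"
    proof
      fix Y assume "Y \<in> sets M"
      then have Y[measurable]: "Y \<in> sets borel" by (simp add: M_def)
      have "emeasure M Y = emeasure lborel (B \<inter> \<Phi> -` Y)"
        using \<Phi>' Y B by (simp add: M_def emeasure_distr emeasure_restrict_space space_restrict_space Int_commute)
      also have "\<dots> \<le> c * emeasure lborel (V \<inter> Y)" by (rule le[OF Y])
      also have "\<dots> = emeasure N Y"
        by (simp add: N_def emeasure_density flip: indicator_inter_arith) 
      finally show "emeasure M Y \<le> emeasure N Y" .
    qed
  qed
  have "(\<integral>\<^sup>+\<omega>\<in>B. h (\<Phi> \<omega>) \<partial>lborel) = nn_integral M h"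
    using \<Phi>' B by (simp add: M_def nn_integral_distr nn_integral_restrict_space)
  also have "\<dots> \<le> nn_integral N h"
    by (rule nn_integral_mono_measure[OF _ \<open>M \<le> N\<close>]) (simp add: M_def N_def)
  also have "\<dots> = c * (\<integral>\<^sup>+\<zeta>\<in>V. h \<zeta> \<partial>lborel)"
    by (simp add: N_def nn_integral_scale_measure nn_integral_density mult.commute)
  finally show ?thesis .
qed

text \<open>Uniform continuity is applied on a compact neighbourhood of \<open>X\<close>, so that
  the second point may leave \<open>X\<close>.\<close>

lemma compact_nbhd_uniform:
  fixes F :: "'e::euclidean_space \<Rightarrow> 'b::metric_space"
  assumes X: "compact X" "X \<subseteq> Q" "open Q" and F: "continuous_on Q F" and "0 < e"
  obtains d where "0 < d" "\<And>x y. x \<in> X \<Longrightarrow> dist x y < d \<Longrightarrow> y \<in> Q \<and> dist (F x) (F y) < e"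
proof -
  obtain \<rho> where \<rho>: "0 < \<rho>" "(\<Union>x\<in>X. cball x \<rho>) \<subseteq> Q"
    using compact_subset_open_imp_cball_epsilon_subset[OF X(1,3,2)] by blast
  let ?K = "\<Union>x\<in>X. cball x \<rho>"
  have "?K = {x + y |x y. x \<in> X \<and> y \<in> cball 0 \<rho>}"
  proof (intro equalityI subsetI)
    fix z assume "z \<in> ?K"
    then obtain x where x: "x \<in> X" "dist x z \<le> \<rho>" by auto
    then show "z \<in> {x + y |x y. x \<in> X \<and> y \<in> cball 0 \<rho>}"
      by (intro CollectI exI[of _ x] exI[of _ "z - x"]) (simp add: dist_norm norm_minus_commute)
  next
    fix z assume "z \<in> {x + y |x y. x \<in> X \<and> y \<in> cball 0 \<rho>}"
    then obtain x y where "x \<in> X" "z = x + y" "norm y \<le> \<rho>" by auto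
    then show "z \<in> ?K" by (intro UN_I[of x]) (auto simp: dist_norm)
  qed
  then have "compact ?K" using compact_sums[OF X(1) compact_cball[of 0 \<rho>]] by simp
  moreover have "continuous_on ?K F" using F \<rho>(2) continuous_on_subset by blast
  ultimately have "uniformly_continuous_on ?K F" by (rule compact_uniformly_continuous[rotated])
  then obtain d where d: "0 < d" "\<And>x y. x \<in> ?K \<Longrightarrow> y \<in> ?K \<Longrightarrow> dist y x < d \<Longrightarrow> dist (F y) (F x) < e"
    unfolding uniformly_continuous_on_def using \<open>0 < e\<close> by metis
  show thesis
  proof (rule that[of "min d \<rho>"])
    fix x y assume "x \<in> X" and xy: "dist x y < min d \<rho>"
    then have "y \<in> ?K" by (intro UN_I[of x]) auto
    moreover have "x \<in> ?K" using \<open>x \<in> X\<close> \<rho>(1) by (intro UN_I[of x]) auto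
    moreover have "y \<in> Q" using \<open>y \<in> ?K\<close> \<rho>(2) by blast
    ultimately show "y \<in> Q \<and> dist (F x) (F y) < e"
      using d(2)[of y x] xy by simp
  qed (use d \<rho> in auto)
qed


section \<open>The Bowen metric\<close>

context hyperbolic_charts
begin

text \<open>Sum of the geometric series with ratio \<open>b / g\<close>, the loss in
  \<open>bowen_le\<close>.\<close>

definition cs :: real where "cs = 1 / (1 - b / g)"

lemma cs_pos: "0 < cs" "0 \<le> b / g" "b / g < 1"
  using const_facts params by (simp_all add: cs_def)

text \<open>The divisors \<open>b ^ k\<close> match the scale of slow orbits. The ambient norm makes
  the metric independent of the label, so that pieces belonging to different leaves can be
  compared.\<close>

definition bowen :: "(real^'k \<Rightarrow> 'a) \<Rightarrow> nat \<Rightarrow> real^'k \<Rightarrow> real^'k \<Rightarrow> real" where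
  "bowen \<psi> n \<zeta> \<zeta>' = (\<Sum>k\<le>n. norm (orb \<psi> \<zeta> k - orb \<psi> \<zeta>' k) / b ^ k)"

lemma bowen_self: "bowen \<psi> n \<zeta> \<zeta> = 0"
  by (simp add: bowen_def)

lemma bowen_commute: "bowen \<psi> n \<zeta> \<zeta>' = bowen \<psi> n \<zeta>' \<zeta>"
  by (simp add: bowen_def norm_minus_commute)

lemma bowen_triangle: "bowen \<psi> n x z \<le> bowen \<psi> n x y + bowen \<psi> n y z"
  unfolding bowen_def sum.distrib[symmetric]
proof (rule sum_mono)
  fix k
  have "norm (orb \<psi> x k - orb \<psi> z k) \<le> norm (orb \<psi> x k - orb \<psi> y k) + norm (orb \<psi> y k - orb \<psi> z k)"
    using norm_triangle_ineq[of "orb \<psi> x k - orb \<psi> y k" "orb \<psi> y k - orb \<psi> z k"] by simp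
  then show "norm (orb \<psi> x k - orb \<psi> z k) / b ^ k \<le> norm (orb \<psi> x k - orb \<psi> y k) / b ^ k + norm (orb \<psi> y k - orb \<psi> z k) / b ^ k"
    unfolding add_divide_distrib[symmetric] using const_facts by (intro divide_right_mono) auto
qed

lemma bowen_ge:
  assumes "k \<le> n" shows "norm (orb \<psi> \<zeta> k - orb \<psi> \<zeta>' k) \<le> bowen \<psi> n \<zeta> \<zeta>' * b ^ k"
proof -
  have "norm (orb \<psi> \<zeta> k - orb \<psi> \<zeta>' k) / b ^ k \<le> bowen \<psi> n \<zeta> \<zeta>'"
    unfolding bowen_def using assms const_facts
    by (intro member_le_sum[of k "{..n}" "\<lambda>k. norm (orb \<psi> \<zeta> k - orb \<psi> \<zeta>' k) / b ^ k"]) auto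
  then show ?thesis using const_facts(2) by (simp add: pos_divide_le_eq)
qed

text \<open>By \<open>orb_diff\<close> the \<open>k\<close>-th chord is controlled by the
  displacement at time \<open>n\<close> divided by \<open>g ^ (n - k)\<close>, so after division by
  \<open>b ^ k\<close> the terms form a geometric series in \<open>b / g\<close>, read from time
  \<open>n\<close> backwards.\<close>

lemma bowen_le:
  assumes "disc \<psi> B Q c" "i \<in> U" "\<zeta> \<in> Q" "\<zeta>' \<in> Q" "slow i n (orb \<psi> \<zeta>)" "slow i n (orb \<psi> \<zeta>')"
  shows "bowen \<psi> n \<zeta> \<zeta>' \<le> 2 * cs * (Np i n (orb \<psi> \<zeta> n - orb \<psi> \<zeta>' n) / b ^ n)"
proof -
  let ?M = "Np i n (orb \<psi> \<zeta> n - orb \<psi> \<zeta>' n)"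
  have "bowen \<psi> n \<zeta> \<zeta>' \<le> (\<Sum>k\<le>n. 2 * (?M / b ^ n) * (b / g) ^ (n - k))"
    unfolding bowen_def
  proof (rule sum_mono)
    fix k assume "k \<in> {..n}"
    then have k: "k \<le> n" by simp
    have "norm (orb \<psi> \<zeta> k - orb \<psi> \<zeta>' k) \<le> 2 * (?M / g ^ (n - k))"
      using norm_le[OF assms(2), of "orb \<psi> \<zeta> k - orb \<psi> \<zeta>' k" k] orb_diff(1)[OF assms k] by linarith
    then have "norm (orb \<psi> \<zeta> k - orb \<psi> \<zeta>' k) / b ^ k \<le> 2 * (?M / g ^ (n - k)) / b ^ k"
      using const_facts by (intro divide_right_mono) auto
    also have "\<dots> = 2 * (?M / b ^ n) * (b / g) ^ (n - k)"
      using k const_facts(2,3) by (simp add: power_divide power_diff)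
    finally show "norm (orb \<psi> \<zeta> k - orb \<psi> \<zeta>' k) / b ^ k \<le> 2 * (?M / b ^ n) * (b / g) ^ (n - k)" .
  qed
  also have "\<dots> = 2 * (?M / b ^ n) * (\<Sum>k\<le>n. (b / g) ^ (n - k))"
    by (simp add: sum_distrib_left)
  also have "(\<Sum>k\<le>n. (b / g) ^ (n - k)) = (\<Sum>k\<le>n. (b / g) ^ k)"
    by (rule sum.reindex_bij_witness[of _ "\<lambda>k. n - k" "\<lambda>k. n - k"]) auto
  also have "2 * (?M / b ^ n) * (\<Sum>k\<le>n. (b / g) ^ k) \<le> 2 * (?M / b ^ n) * cs"
  proof (rule mult_left_mono)
    have "(\<Sum>k\<le>n. (b / g) ^ k) = (1 - (b / g) ^ Suc n) / (1 - b / g)"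
      using cs_pos(3) by (simp only: sum_gp0 less_imp_neq[THEN eq_False[THEN iffD2]] if_False)
    also have "\<dots> \<le> cs"
      unfolding cs_def using cs_pos by (intro divide_right_mono) (auto simp del: power_Suc)
    finally show "(\<Sum>k\<le>n. (b / g) ^ k) \<le> cs" .
    show "0 \<le> 2 * (?M / b ^ n)" using Np_nonneg[OF assms(2)] const_facts by simp
  qed
  finally show ?thesis by (simp add: mult_ac)
qed

lemma bowen_continuous:
  assumes "disc \<psi> B Q c"
  shows "continuous_on Q (\<lambda>\<zeta>. bowen \<psi> n \<zeta> z)"
  unfolding bowen_def using const_facts(2)
  by (intro continuous_intros orb_continuous[OF assms]) auto

text \<open>Membership in a common leaf enters the estimates only as exponential approach to a
  common reference orbit.\<close>

definition leaf_pair :: "(real^'k \<Rightarrow> 'a) \<Rightarrow> (real^'k \<Rightarrow> 'a) \<Rightarrow> real \<Rightarrow> 'i \<Rightarrow> real^'k \<Rightarrow> real^'k \<Rightarrow> bool" where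
  "leaf_pair \<psi>1 \<psi>2 C0 i \<zeta> \<omega> \<longleftrightarrow> i \<in> U \<and> (\<forall>n. N i n (orb \<psi>1 \<zeta> n - xs i n) \<le> C0 * a ^ n \<and> N i n (orb \<psi>2 \<omega> n - xs i n) \<le> C0 * a ^ n)"

text \<open>The separation of the net makes the multiplicity of the cover grow only like \<open>E ^ (n * CARD('k))\<close>.\<close>

lemma card_bowen_separated:
  assumes disc: "disc \<psi> B Q c" and i: "i \<in> U" and J: "finite J" "J \<subseteq> Q" "\<zeta> \<in> Q"
    and s: "\<And>z. z \<in> J \<Longrightarrow> slow i n (orb \<psi> z)"
    and close: "\<And>z. z \<in> J \<Longrightarrow> bowen \<psi> n \<zeta> z \<le> 3 * \<sigma>" and "0 < \<sigma>"
    and sep: "\<And>z z'. \<lbrakk>z \<in> J; z' \<in> J; z \<noteq> z'\<rbrakk> \<Longrightarrow> \<sigma> / 2 \<le> bowen \<psi> n z z'"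
  shows "real (card J) \<le> (1 + 24 * cs * l0 * E ^ n) ^ CARD('k)"
proof -
  define p where "p z = co i n (orb \<psi> z n)" for z
  define \<nu> where "\<nu> e = Np i n (sec i n e)" for e
  have \<nu>p: "\<nu> (p z - p z') = Np i n (orb \<psi> z n - orb \<psi> z' n)" for z z'
    unfolding \<nu>_def p_def
    by (rule Np_eq[OF i]) (simp add: sec(2)[OF i] linear_diff[OF bounded_linear.linear[OF co(1)[OF i]]])
  note linsec = bounded_linear.linear[OF sec(1)[OF i, of n]]
  obtain Kc where Kc: "0 < Kc" "\<And>v. norm (co i n v) \<le> norm v * Kc"
    using bounded_linear.pos_bounded[OF co(1)[OF i]] by blast
  obtain Ks where Ks: "0 < Ks" "\<And>v. norm (sec i n v) \<le> norm v * Ks"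
    using bounded_linear.pos_bounded[OF sec(1)[OF i]] by blast
  let ?t = "\<sigma> * b ^ n / (4 * cs)" and ?R = "l0 * E ^ n * (3 * \<sigma> * b ^ n)"
  have t: "0 < ?t" using \<open>0 < \<sigma>\<close> const_facts cs_pos by simp
  have sepNp: "?t \<le> Np i n (orb \<psi> z n - orb \<psi> z' n)" if "z \<in> J" "z' \<in> J" "z \<noteq> z'" for z z'
  proof -
    have "\<sigma> / 2 \<le> 2 * cs * (Np i n (orb \<psi> z n - orb \<psi> z' n) / b ^ n)"
      using sep[OF that] bowen_le[OF disc i _ _ s s, of z z'] that J by fastforce
    then have "\<sigma> / 2 * b ^ n \<le> 2 * cs * Np i n (orb \<psi> z n - orb \<psi> z' n)"
      using const_facts(2) by (simp add: field_simps)
    then show ?thesis using cs_pos by (simp add: field_simps)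
  qed
  have inj: "inj_on p J"
  proof (rule inj_onI)
    fix z z' assume z: "z \<in> J" "z' \<in> J" "p z = p z'"
    show "z = z'"
    proof (rule ccontr)
      assume "z \<noteq> z'"
      then have "?t \<le> \<nu> (p z - p z')" unfolding \<nu>p by (rule sepNp[OF z(1,2)])
      then show False using t z(3) by (simp add: \<nu>_def linear_0[OF linsec] Np_zero[OF i])
    qed
  qed
  have "real (card (p ` J)) \<le> (1 + 2 * ?R / ?t) ^ DIM(real^'k)"
  proof (rule card_separated_le[where \<nu>=\<nu> and ?c0.0="1 / (2 * Kc)" and C="l0 * E ^ n * Ks" and ?p0.0="p \<zeta>"])
    show "\<nu> (u + v) \<le> \<nu> u + \<nu> v" for u v by (simp add: \<nu>_def linear_add[OF linsec] Np_add[OF i])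
    show "\<nu> (c *\<^sub>R v) = \<bar>c\<bar> * \<nu> v" for c v by (simp add: \<nu>_def linear_scale[OF linsec] Np_scale[OF i])
    show "1 / (2 * Kc) * norm v \<le> \<nu> v" for v
    proof -
      have "norm v \<le> norm (sec i n v) * Kc" using Kc(2)[of "sec i n v"] by (simp add: sec(2)[OF i])
      also have "norm (sec i n v) \<le> 2 * \<nu> v"
        using norm_le[OF i, of "sec i n v" n] Np_nonneg[OF i, of n "sec i n v"] by (simp add: \<nu>_def N_def sec(3)[OF i])
      finally show ?thesis using Kc(1) by (simp add: field_simps)
    qed
    show "\<nu> v \<le> l0 * E ^ n * Ks * norm v" for v
    proof -
      have "\<nu> v \<le> l0 * E ^ n * norm (sec i n v)" unfolding \<nu>_def by (rule Np_le_norm[OF i])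
      also have "\<dots> \<le> l0 * E ^ n * (norm v * Ks)"
        using const_facts(15)[of n] Ks(2)[of v] by (intro mult_left_mono) auto
      finally show ?thesis by (simp add: mult_ac)
    qed
    show "?t \<le> \<nu> (u - v)" if uv: "u \<in> p ` J" "v \<in> p ` J" "u \<noteq> v" for u v
    proof -
      obtain z z' where z: "z \<in> J" "z' \<in> J" "u = p z" "v = p z'" using uv by blast
      then have "z \<noteq> z'" using uv(3) by blast
      then show ?thesis unfolding z(3,4) \<nu>p by (rule sepNp[OF z(1,2)])
    qed
    show "\<nu> (u - p \<zeta>) \<le> ?R" if u: "u \<in> p ` J" for u
    proof -
      from u obtain z where z: "z \<in> J" "u = p z" by auto
      have "norm (orb \<psi> z n - orb \<psi> \<zeta> n) \<le> 3 * \<sigma> * b ^ n"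
        using bowen_ge[of n n \<psi> z \<zeta>] bowen_commute[of \<psi> n z \<zeta>]
          mult_right_mono[OF close[OF z(1)] zero_le_power[OF less_imp_le[OF const_facts(2)]], of n] by simp
      from mult_left_mono[OF this less_imp_le[OF const_facts(15)[of n]]]
      have "Np i n (orb \<psi> z n - orb \<psi> \<zeta> n) \<le> ?R"
        using Np_le_norm[OF i, of n "orb \<psi> z n - orb \<psi> \<zeta> n"] by linarith
      then show ?thesis by (simp only: z(2) \<nu>p)
    qed
    show "0 \<le> l0 * E ^ n * Ks" using params(1,2) Ks(1) by (intro mult_nonneg_nonneg zero_le_power) auto
    show "0 \<le> ?R" using params(1,2) const_facts(2) \<open>0 < \<sigma>\<close> by (intro mult_nonneg_nonneg zero_le_power) auto
    show "0 < 1 / (2 * Kc)" using Kc(1) by simp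
  qed (use t J(1) in auto)
  also have "2 * ?R / ?t = 24 * cs * l0 * E ^ n"
    using \<open>0 < \<sigma>\<close> const_facts(2) cs_pos by (simp add: field_simps)
  finally show ?thesis using card_image[OF inj] by simp
qed

end


section \<open>The holonomy estimate at a fixed time\<close>

context hyperbolic_charts
begin

text \<open>In each piece \<open>P\<close> is replaced by a differentiable map:
  \<open>\<Phi> z\<close> sends \<open>P \<zeta>\<close> to the point of the first disc that has the
  same unstable coordinate at time \<open>n\<close> in the chart belonging to \<open>z\<close>. This
  point is within Bowen distance \<open>\<eta>\<close> of \<open>\<zeta>\<close>, so
  \<open>P\<close> followed by \<open>\<Phi> z\<close> is almost the identity, while the inverse of
  \<open>\<Phi> z\<close> is differentiable with Jacobian at most \<open>c'\<close>. Averaging over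
  the pieces with the weights \<open>h z\<close> yields the bound; \<open>q\<close> controls the
  number of overlapping pieces times \<open>\<eta> / \<sigma>\<close>.\<close>

lemma holonomy_estimate:
  fixes n :: nat and \<sigma> \<eta> s \<rho> q C0 c' :: real
  defines "\<sigma> \<equiv> s / (8 * (l0 * E ^ n))" and "\<eta> \<equiv> 8 * cs * l0 * C0 * (E * a / b) ^ n"
  assumes disc1: "disc \<psi>1 B1 Q1 c1" and disc2: "disc \<psi>2 B2 Q2 c2"
    and K: "compact K" "K \<subseteq> Q1" "continuous_on K P" "inj_on P K" "P ` K \<subseteq> Q2"
    and leaf: "\<And>\<zeta>. \<zeta> \<in> K \<Longrightarrow> \<exists>i. leaf_pair \<psi>1 \<psi>2 C0 i \<zeta> (P \<zeta>)" and C0: "0 < C0" "(4 * l0 + 3) * C0 \<le> r"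
    and \<rho>: "0 < \<rho>" "\<And>\<zeta>. \<zeta> \<in> K \<Longrightarrow> cball \<zeta> \<rho> \<subseteq> Q1" "\<And>\<zeta>. \<zeta> \<in> K \<Longrightarrow> cball (P \<zeta>) \<rho> \<subseteq> Q2"
    and s: "0 < s" "s \<le> C0" "2 * s \<le> c1 * \<rho>" "2 * s \<le> c2 * \<rho>"
    and h1: "4 * l0 * C0 * (E * a) ^ n + 2 * C0 * a ^ n < s / 2 * b ^ n" and \<eta>\<sigma>: "\<eta> \<le> \<sigma>"
    and q: "(1 + 24 * cs * l0 * E ^ n) ^ CARD('k) * \<eta> \<le> q * \<sigma>"
    and X: "compact X" "X \<subseteq> K" and V: "V \<in> sets borel" "\<And>\<zeta> \<zeta>'. \<lbrakk>\<zeta> \<in> X; \<zeta>' \<in> Q1; c1 * norm (\<zeta>' - \<zeta>) \<le> \<eta>\<rbrakk> \<Longrightarrow> \<zeta>' \<in> V"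
    and c': "0 \<le> c'" and jac: "\<And>\<zeta> \<zeta>' i L. \<lbrakk>\<zeta> \<in> X; \<zeta>' \<in> Q1; c1 * norm (\<zeta>' - \<zeta>) \<le> \<eta>; i \<in> U; slow i n (orb \<psi>1 \<zeta>); slow i n (orb \<psi>1 \<zeta>'); slow i n (orb \<psi>2 (P \<zeta>));
        linear L; inj L; (co i n \<circ> dorb \<psi>2 B2 (P \<zeta>) n) \<circ> L = co i n \<circ> dorb \<psi>1 B1 \<zeta>' n\<rbrakk> \<Longrightarrow> vol_ratio L \<le> c'"
  shows "ennreal (1 - q) * emeasure lborel (P ` X) \<le> ennreal ((1 + q) * c') * emeasure lborel V"
proof -
  let ?d = "bowen \<psi>1 n"
  have L: "0 < l0 * E ^ n" by (rule const_facts(15))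
  have \<sigma>: "0 < \<sigma>" using s L by (simp add: \<sigma>_def)
  have \<eta>0: "0 \<le> \<eta>" using cs_pos C0 params const_facts by (simp add: \<eta>_def)
  have q0: "0 \<le> q"
  proof -
    have "0 \<le> (1 + 24 * cs * l0 * E ^ n) ^ CARD('k) * \<eta>"
      using \<eta>0 cs_pos params by (intro mult_nonneg_nonneg zero_le_power add_nonneg_nonneg) auto
    then have "0 \<le> q * \<sigma>" using q by linarith
    then show ?thesis using \<sigma> by (simp add: zero_le_mult_iff)
  qed
  have apow: "C0 * a ^ k \<le> C0 * b ^ k" for k
    using C0 const_facts by (intro mult_left_mono power_mono) auto
  have Eapow: "4 * l0 * C0 * (E * a) ^ k \<le> 4 * l0 * C0 * b ^ k" for k
    using C0 const_facts params by (intro mult_left_mono power_mono) auto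
  have rbound: "x * b ^ k \<le> r * b ^ k" if "x \<le> (4 * l0 + 3) * C0" for x k
    using that C0 const_facts by (intro mult_right_mono) auto
  have l0C0: "C0 \<le> l0 * C0" "0 \<le> l0 * C0" using params C0 by (simp_all add: mult_le_cancel_right1)
  have r0: "(4 * l0 + 3) * C0 = 4 * (l0 * C0) + 3 * C0" by (simp add: algebra_simps)
  have leafD: "i \<in> U" "N i k (orb \<psi>1 \<zeta> k - xs i k) \<le> C0 * a ^ k" "N i k (orb \<psi>2 (P \<zeta>) k - xs i k) \<le> C0 * a ^ k"
     if "leaf_pair \<psi>1 \<psi>2 C0 i \<zeta> (P \<zeta>)" for i k \<zeta>
    using that by (auto simp: leaf_pair_def)
  \<comment> \<open>The choice of \<open>\<sigma>\<close> makes Bowen distance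
    \<open>4 * \<sigma>\<close> correspond to adapted distance \<open>s / 2 * b ^ k\<close> in every
    chart.\<close>
  have near: "N i k (orb \<psi>1 \<zeta> k - orb \<psi>1 y k) \<le> s / 2 * b ^ k"
    if "i \<in> U" "?d \<zeta> y \<le> 4 * \<sigma>" "k \<le> n" for i \<zeta> y k
  proof -
    have "N i k (orb \<psi>1 \<zeta> k - orb \<psi>1 y k) \<le> l0 * E ^ k * norm (orb \<psi>1 \<zeta> k - orb \<psi>1 y k)"
      by (rule le_norm[OF that(1)])
    also have "\<dots> \<le> l0 * E ^ n * (4 * \<sigma> * b ^ k)"
    proof (rule mult_mono)
      show "l0 * E ^ k \<le> l0 * E ^ n" using params that(3) by (intro mult_left_mono power_increasing) auto
      show "norm (orb \<psi>1 \<zeta> k - orb \<psi>1 y k) \<le> 4 * \<sigma> * b ^ k"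
        using bowen_ge[OF that(3), of \<psi>1 \<zeta> y] mult_right_mono[OF that(2) zero_le_power[OF less_imp_le[OF const_facts(2)]], of k] by linarith
    qed (use L in auto)
    also have "\<dots> = s / 2 * b ^ k" using params(1,2) by (auto simp: \<sigma>_def)
    finally show ?thesis .
  qed
  have near_slow: "slow i n (orb \<psi>1 \<zeta>)" if "leaf_pair \<psi>1 \<psi>2 C0 i y (P y)" "?d \<zeta> y \<le> 4 * \<sigma>" for i \<zeta> y
    unfolding slow_def
  proof (intro allI impI)
    fix k assume k: "k \<le> n"
    have "N i k (orb \<psi>1 \<zeta> k - xs i k) \<le> s / 2 * b ^ k + C0 * b ^ k"
      using N_triangle[OF leafD(1)[OF that(1)], of k "orb \<psi>1 \<zeta> k" "xs i k" "orb \<psi>1 y k"]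
        near[OF leafD(1)[OF that(1)] that(2) k] leafD(2)[OF that(1), of k] apow[of k] by linarith
    also have "\<dots> = (s / 2 + C0) * b ^ k" by (simp add: algebra_simps)
    also have "\<dots> \<le> r * b ^ k" by (intro rbound, unfold r0) (use s l0C0 C0 in linarith)
    finally show "N i k (orb \<psi>1 \<zeta> k - xs i k) \<le> r * b ^ k" .
  qed
  \<comment> \<open>Decay is known in the chart \<open>j\<close> of the leaf through
    \<open>\<zeta>\<close>. It is transferred to chart \<open>i\<close> through the ambient norm, at
    the cost of the distortion \<open>l0 * E ^ k\<close>.\<close>
  have pair: "N i k (orb \<psi>2 (P \<zeta>) k - orb \<psi>1 \<zeta> k) \<le> 4 * l0 * C0 * (E * a) ^ k" if pi: "i \<in> U" "\<zeta> \<in> K" for i \<zeta> k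
  proof -
    obtain j where j: "leaf_pair \<psi>1 \<psi>2 C0 j \<zeta> (P \<zeta>)" using leaf[OF pi(2)] by blast
    have "N j k (orb \<psi>2 (P \<zeta>) k - orb \<psi>1 \<zeta> k) \<le> 2 * C0 * a ^ k"
      using N_triangle[OF leafD(1)[OF j], of k "orb \<psi>2 (P \<zeta>) k" "orb \<psi>1 \<zeta> k" "xs j k"] leafD(2,3)[OF j, of k]
        N_commute[OF leafD(1)[OF j], of k "xs j k" "orb \<psi>1 \<zeta> k"] by linarith
    then have "norm (orb \<psi>2 (P \<zeta>) k - orb \<psi>1 \<zeta> k) \<le> 4 * C0 * a ^ k"
      using norm_le[OF leafD(1)[OF j], of "orb \<psi>2 (P \<zeta>) k - orb \<psi>1 \<zeta> k" k] by linarith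
    then have "l0 * E ^ k * norm (orb \<psi>2 (P \<zeta>) k - orb \<psi>1 \<zeta> k) \<le> l0 * E ^ k * (4 * C0 * a ^ k)"
      using const_facts(15)[of k] by (intro mult_left_mono) auto
    then show ?thesis
      using le_norm[OF pi(1), of k "orb \<psi>2 (P \<zeta>) k - orb \<psi>1 \<zeta> k"] by (simp add: power_mult_distrib mult_ac)
  qed
  obtain Z where Z: "finite Z" "Z \<subseteq> K" "\<And>\<zeta>. \<zeta> \<in> K \<Longrightarrow> \<exists>z\<in>Z. ?d \<zeta> z < \<sigma>"
    "\<And>z z'. \<lbrakk>z \<in> Z; z' \<in> Z; z \<noteq> z'\<rbrakk> \<Longrightarrow> \<sigma> / 2 \<le> ?d z z'"
    using finite_separated_net[OF K(1) continuous_on_subset[OF bowen_continuous[OF disc1] K(2)] bowen_self bowen_commute bowen_triangle \<sigma>] by metis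
  define lab where "lab z = (SOME i. leaf_pair \<psi>1 \<psi>2 C0 i z (P z))" for z
  have lab: "leaf_pair \<psi>1 \<psi>2 C0 (lab z) z (P z)" if "z \<in> Z" for z
    unfolding lab_def by (rule someI_ex[OF leaf[OF subsetD[OF Z(2) that]]])
  define p1 where "p1 z = plaque \<psi>1 (lab z) n \<rho> s z" for z
  define p2 where "p2 z = plaque \<psi>2 (lab z) n \<rho> s (P z)" for z
  define G1 where "G1 z \<zeta> = co (lab z) n (orb \<psi>1 \<zeta> n)" for z \<zeta>
  define G2 where "G2 z \<omega> = co (lab z) n (orb \<psi>2 \<omega> n)" for z \<omega>
  have leaf_r: "C0 * a ^ k \<le> (r - s) * b ^ k" for k
  proof -
    have "C0 * a ^ k \<le> C0 * b ^ k" by (rule apow)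
    also have "\<dots> \<le> (r - s) * b ^ k"
      using C0(2)[unfolded r0] s l0C0 const_facts(2) C0(1) by (intro mult_right_mono zero_le_power) linarith+
    finally show ?thesis .
  qed
  have sr: "s < r" using C0 s l0C0 unfolding r0 by linarith
  have orb1: "N (lab z) k (orb \<psi>1 z k - xs (lab z) k) \<le> (r - s) * b ^ k"
    and orb2: "N (lab z) k (orb \<psi>2 (P z) k - xs (lab z) k) \<le> (r - s) * b ^ k" if "z \<in> Z" for z k
    using leafD(2,3)[OF lab[OF that], of k] leaf_r[of k] by linarith+
  note iU = leafD(1)[OF lab]
  have zK: "z \<in> K" if "z \<in> Z" for z using that Z(2) by blast
  \<comment> \<open>Near the net point \<open>z\<close> everything happens inside the two plaques of
    \<open>z\<close>: assumption \<open>h1\<close> leaves room for the distance between the leaves,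
    and \<open>chart_surj\<close> supplies the point with equal unstable coordinate.\<close>
  have hat: "P \<zeta> \<in> p2 z" "\<exists>\<zeta>'\<in>p1 z. G1 z \<zeta>' = G2 z (P \<zeta>)"
    "\<And>\<zeta>'. \<zeta>' \<in> p1 z \<Longrightarrow> G1 z \<zeta>' = G2 z (P \<zeta>) \<Longrightarrow> ?d \<zeta>' \<zeta> \<le> \<eta>"
    if z: "z \<in> Z" and \<zeta>: "\<zeta> \<in> K" and dz: "?d \<zeta> z < 2 * \<sigma>" for z \<zeta>
  proof -
    note i = iU[OF z]
    have dz4: "?d \<zeta> z \<le> 4 * \<sigma>" using dz \<sigma> by simp
    have slow2: "slow (lab z) n (orb \<psi>2 (P \<zeta>))"
      unfolding slow_def
    proof (intro allI impI)
      fix k assume k: "k \<le> n"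
      have "N (lab z) k (orb \<psi>2 (P \<zeta>) k - xs (lab z) k) \<le> 4 * l0 * C0 * b ^ k + (s / 2 * b ^ k + C0 * b ^ k)"
        using N_triangle[OF i, of k "orb \<psi>2 (P \<zeta>) k" "xs (lab z) k" "orb \<psi>1 \<zeta> k"]
          N_triangle[OF i, of k "orb \<psi>1 \<zeta> k" "xs (lab z) k" "orb \<psi>1 z k"]
          near[OF i dz4 k] leafD(2)[OF lab[OF z], of k] apow[of k] pair[OF i \<zeta>, of k] Eapow[of k] by linarith
      also have "\<dots> = (4 * l0 * C0 + s / 2 + C0) * b ^ k" by (simp add: algebra_simps)
      also have "\<dots> \<le> r * b ^ k" by (intro rbound, unfold r0) (use s l0C0 C0 in linarith)
      finally show "N (lab z) k (orb \<psi>2 (P \<zeta>) k - xs (lab z) k) \<le> r * b ^ k" .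
    qed
    have Np1: "Np (lab z) n (orb \<psi>2 (P \<zeta>) n - orb \<psi>1 z n) \<le> 4 * l0 * C0 * (E * a) ^ n + s / 2 * b ^ n"
      using N_triangle[OF i, of n "orb \<psi>2 (P \<zeta>) n" "orb \<psi>1 z n" "orb \<psi>1 \<zeta> n"] near[OF i dz4 order_refl]
        pair[OF i \<zeta>, of n] Np_le_N[of "lab z" n "orb \<psi>2 (P \<zeta>) n - orb \<psi>1 z n"] by linarith
    have "N (lab z) n (orb \<psi>1 z n - orb \<psi>2 (P z) n) \<le> 2 * C0 * a ^ n"
      using N_triangle[OF i, of n "orb \<psi>1 z n" "orb \<psi>2 (P z) n" "xs (lab z) n"] leafD(2,3)[OF lab[OF z], of n]
        N_commute[OF i, of n "xs (lab z) n"] by simp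
    then have Np2: "Np (lab z) n (orb \<psi>2 (P \<zeta>) n - orb \<psi>2 (P z) n) < s * b ^ n"
      using Np1 h1 Np_triangle[OF i, of n "orb \<psi>2 (P \<zeta>) n" "orb \<psi>2 (P z) n" "orb \<psi>1 z n"]
        Np_le_N[of "lab z" n "orb \<psi>1 z n - orb \<psi>2 (P z) n"] by linarith
    have "P \<zeta> \<in> Q2" using \<zeta> K(5) by blast
    from plaque_strict(1)[OF disc2 iU[OF z] \<rho>(1) \<rho>(3)[OF zK[OF z]] s(1) s(4) sr orb2[OF z] this slow2 Np2]
    show "P \<zeta> \<in> p2 z" using slow2 Np2 by (simp add: p2_def plaque_def)
    have "0 \<le> 2 * C0 * a ^ n" using C0 const_facts by simp
    then have "Np (lab z) n (orb \<psi>2 (P \<zeta>) n - orb \<psi>1 z n) < s * b ^ n"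
      using Np1 h1 by linarith
    then show "\<exists>\<zeta>'\<in>p1 z. G1 z \<zeta>' = G2 z (P \<zeta>)"
      unfolding p1_def G1_def G2_def by (rule chart_surj[OF disc1 iU[OF z] \<rho>(1) \<rho>(2)[OF zK[OF z]] s(1) s(3) sr orb1[OF z]])
    fix \<zeta>' assume \<zeta>': "\<zeta>' \<in> p1 z" "G1 z \<zeta>' = G2 z (P \<zeta>)"
    have slow': "\<zeta>' \<in> Q1" "slow (lab z) n (orb \<psi>1 \<zeta>')"
      using plaque_slow[OF disc1 iU[OF z] \<rho>(1) \<rho>(2)[OF zK[OF z]] s(1) s(3) sr orb1[OF z]] \<zeta>'(1) by (auto simp: p1_def)
    have "Np (lab z) n (orb \<psi>1 \<zeta>' n - orb \<psi>1 \<zeta> n) \<le> 4 * l0 * C0 * (E * a) ^ n"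
    proof -
      have "Np (lab z) n (orb \<psi>1 \<zeta>' n - orb \<psi>2 (P \<zeta>) n) = 0"
        using \<zeta>'(2) by (intro Np_eq_iff[OF i]) (simp add: G1_def G2_def)
      then show ?thesis
        using Np_triangle[OF i, of n "orb \<psi>1 \<zeta>' n" "orb \<psi>1 \<zeta> n" "orb \<psi>2 (P \<zeta>) n"] pair[OF i \<zeta>, of n]
          Np_le_N[of "lab z" n "orb \<psi>2 (P \<zeta>) n - orb \<psi>1 \<zeta> n"] by linarith
    qed
    then have "2 * cs * (Np (lab z) n (orb \<psi>1 \<zeta>' n - orb \<psi>1 \<zeta> n) / b ^ n) \<le> 2 * cs * (4 * l0 * C0 * (E * a) ^ n / b ^ n)"
      using cs_pos const_facts by (intro mult_left_mono divide_right_mono) auto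
    also have "\<dots> = \<eta>" by (simp add: \<eta>_def power_divide)
    finally show "?d \<zeta>' \<zeta> \<le> \<eta>"
      using bowen_le[OF disc1 i slow'(1) _ slow'(2) near_slow[OF lab[OF z] dz4]] \<zeta> K(2) by force
  qed
  \<comment> \<open>Tent functions of height \<open>2 * \<sigma>\<close> and slope one in the Bowen
    metric. A point within \<open>\<sigma>\<close> of some net point has total weight at least
    \<open>\<sigma>\<close>.\<close>
  define w where "w z \<zeta> = (if \<zeta> \<in> Q1 then max 0 (2 * \<sigma> - ?d \<zeta> z) else 0)" for z \<zeta>
  define W where "W \<zeta> = (\<Sum>z\<in>Z. w z \<zeta>)" for \<zeta>
  define h where "h z \<zeta> = w z \<zeta> / W \<zeta>" for z \<zeta>
  have w0: "0 \<le> w z \<zeta>" and W0: "0 \<le> W \<zeta>" and h0: "0 \<le> h z \<zeta>" for z \<zeta>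
    by (simp_all add: w_def W_def h_def sum_nonneg)
  have wm[measurable]: "w z \<in> borel_measurable borel" for z
    unfolding w_def
  proof (rule borel_measurable_continuous_on_if)
    show "Q1 \<in> sets borel" using openQ[OF disc1] by simp
  qed (auto intro!: continuous_intros bowen_continuous[OF disc1])
  have hm[measurable]: "h z \<in> borel_measurable borel" for z
    unfolding h_def W_def by measurable
  \<comment> \<open>Where all weights vanish the quotient has the value 0, so the sum is at most 1
    everywhere, not only near \<open>K\<close>.\<close>
  have sum_h: "(\<Sum>z\<in>Z. h z \<zeta>) \<le> 1" for \<zeta>
  proof -
    have "(\<Sum>z\<in>Z. h z \<zeta>) = W \<zeta> / W \<zeta>" unfolding h_def by (simp add: W_def flip: sum_divide_distrib)
    then show ?thesis by simp
  qed
  define Pi where "Pi = inv_into K P"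
  have Pi: "Pi (P \<zeta>) = \<zeta>" if "\<zeta> \<in> K" for \<zeta> using K(4) that by (simp add: Pi_def)
  have contPi: "continuous_on (P ` K) Pi"
    using continuous_on_inv[OF K(3,1)] Pi by blast
  have cPX: "compact (P ` X)"
    using X K(3) by (metis compact_continuous_image continuous_on_subset)
  define Bs where "Bs z = {\<omega> \<in> P ` X. ?d (Pi \<omega>) z < 2 * \<sigma>}" for z
  define \<Phi> where "\<Phi> z \<omega> = inv_into (p1 z) (G1 z) (G2 z \<omega>)" for z \<omega>
  have \<Phi>: "\<Phi> z \<omega> \<in> p1 z" "G1 z (\<Phi> z \<omega>) = G2 z \<omega>" "?d (\<Phi> z \<omega>) (Pi \<omega>) \<le> \<eta>" "\<omega> \<in> p2 z" "Pi \<omega> \<in> X" "P (Pi \<omega>) = \<omega>" "?d (Pi \<omega>) z < 2 * \<sigma>"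
     if z: "z \<in> Z" and \<omega>: "\<omega> \<in> Bs z" for z \<omega>
  proof -
    obtain \<zeta> where \<zeta>: "\<zeta> \<in> X" "\<omega> = P \<zeta>" using \<omega> by (auto simp: Bs_def)
    have Pi\<zeta>: "Pi \<omega> = \<zeta>" using \<zeta> X Pi by auto
    show "?d (Pi \<omega>) z < 2 * \<sigma>" using \<omega> by (simp add: Bs_def)
    then have dz: "?d \<zeta> z < 2 * \<sigma>" by (simp add: Pi\<zeta>)
    have \<zeta>K: "\<zeta> \<in> K" using \<zeta> X by blast
    note H = hat[OF z \<zeta>K dz]
    obtain y where "y \<in> p1 z" "G1 z y = G2 z (P \<zeta>)" using H(2) by blast
    then have mem: "G2 z \<omega> \<in> G1 z ` p1 z"
      using image_eqI[of "G2 z \<omega>" "G1 z" y "p1 z"] \<zeta>(2) by simp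
    show 1: "\<Phi> z \<omega> \<in> p1 z" "G1 z (\<Phi> z \<omega>) = G2 z \<omega>"
      unfolding \<Phi>_def using inv_into_into[OF mem] f_inv_into_f[OF mem] by auto
    show "?d (\<Phi> z \<omega>) (Pi \<omega>) \<le> \<eta>" using H(3)[OF 1(1)] 1(2) \<zeta>(2) Pi\<zeta> by simp
    show "\<omega> \<in> p2 z" using H(1) \<zeta>(2) by simp
    show "Pi \<omega> \<in> X" "P (Pi \<omega>) = \<omega>" using \<zeta> Pi\<zeta> by auto
  qed
  have inj1: "inj_on (G1 z) (p1 z)" and inj2: "inj_on (G2 z) (p2 z)" if z: "z \<in> Z" for z
  proof -
    show "inj_on (G1 z) (p1 z)"
      unfolding G1_def p1_def using plaque_slow[OF disc1 iU[OF z] \<rho>(1) \<rho>(2)[OF zK[OF z]] s(1) s(3) sr orb1[OF z]]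
      by (intro inj_on_subset[OF chart_inj[OF disc1 iU[OF z] \<rho>(1) \<rho>(2)[OF zK[OF z]] s(1) s(3) sr orb1[OF z]]]) auto
    show "inj_on (G2 z) (p2 z)"
      unfolding G2_def p2_def using plaque_slow[OF disc2 iU[OF z] \<rho>(1) \<rho>(3)[OF zK[OF z]] s(1) s(4) sr orb2[OF z]]
      by (intro inj_on_subset[OF chart_inj[OF disc2 iU[OF z] \<rho>(1) \<rho>(3)[OF zK[OF z]] s(1) s(4) sr orb2[OF z]]]) auto
  qed
  have Bm: "Bs z \<in> sets borel" for z
  proof -
    have "continuous_on (P ` X) (\<lambda>\<omega>. ?d (Pi \<omega>) z)"
      by (rule continuous_on_compose2[OF bowen_continuous[OF disc1]]) (use contPi X(2) Pi K(2) in \<open>auto simp: subset_eq intro: continuous_on_subset\<close>)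
    then have "openin (top_of_set (P ` X)) (P ` X \<inter> (\<lambda>\<omega>. ?d (Pi \<omega>) z) -` {..<2 * \<sigma>})"
      by (intro continuous_openin_preimage_gen) auto
    moreover have "P ` X \<inter> (\<lambda>\<omega>. ?d (Pi \<omega>) z) -` {..<2 * \<sigma>} = Bs z"
      by (auto simp: Bs_def)
    ultimately obtain T where "open T" "Bs z = P ` X \<inter> T" by (auto simp: openin_open)
    then show ?thesis using borel_compact[OF cPX] by auto
  qed
  have \<Phi>m: "\<Phi> z \<in> borel_measurable (restrict_space borel (Bs z))" if z: "z \<in> Z" for z
  proof (rule borel_measurable_continuous_on_restrict)
    have G2c: "continuous_on (Bs z) (G2 z)"
      unfolding G2_def using \<Phi>(4)[OF z] plaque_slow[OF disc2 iU[OF z] \<rho>(1) \<rho>(3)[OF zK[OF z]] s(1) s(4) sr orb2[OF z]]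
      by (intro continuous_on_subset[OF chart_continuous[OF disc2 iU[OF z] \<rho>(1) \<rho>(3)[OF zK[OF z]] s(1) s(4) sr orb2[OF z]]]) (auto simp: p2_def)
    have sub: "G2 z ` Bs z \<subseteq> G1 z ` p1 z"
    proof (intro image_subsetI)
      fix \<omega> assume "\<omega> \<in> Bs z"
      then show "G2 z \<omega> \<in> G1 z ` p1 z"
        using \<Phi>(1,2)[OF z, of \<omega>] image_eqI[of "G2 z \<omega>" "G1 z" "\<Phi> z \<omega>" "p1 z"] by simp
    qed
    have inv1c: "continuous_on (G1 z ` p1 z) (inv_into (p1 z) (G1 z))"
      using chart_inverse_continuous[OF disc1 iU[OF z] \<rho>(1) \<rho>(2)[OF zK[OF z]] s(1) s(3) sr orb1[OF z]] by (simp add: G1_def[abs_def] p1_def)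
    show "continuous_on (Bs z) (\<Phi> z)"
      unfolding \<Phi>_def[abs_def] by (rule continuous_on_compose2[OF inv1c G2c sub])
  qed
  \<comment> \<open>Change of variables for \<open>\<Psi>\<close>, the chart of the first disc
    followed by the inverse chart of the second. It inverts \<open>\<Phi> z\<close> and is
    differentiable, whereas \<open>P\<close> is only continuous; this is the place where Jacobians
    enter.\<close>
  have local_le: "(\<integral>\<^sup>+\<omega>\<in>Bs z. ennreal (h z (\<Phi> z \<omega>)) \<partial>lborel) \<le> ennreal c' * (\<integral>\<^sup>+\<zeta>\<in>V. ennreal (h z \<zeta>) \<partial>lborel)" if z: "z \<in> Z" for z
  proof (rule nn_integral_image_le[OF Bm _ V(1)])
    show "\<Phi> z \<in> borel_measurable (restrict_space borel (Bs z))" by (rule \<Phi>m[OF z])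
    have vimm: "Bs z \<inter> \<Phi> z -` Y \<in> sets borel" if "Y \<in> sets borel" for Y
      using measurable_sets[OF \<Phi>m[OF z] that] Bm[of z] by (simp add: space_restrict_space sets_restrict_space_iff Int_commute)
    define S where "S = p1 z \<inter> G1 z -` (G2 z ` p2 z)"
    define \<Psi> where "\<Psi> = inv_into (p2 z) (G2 z) \<circ> G1 z"
    have op1: "open (p1 z)"
      unfolding p1_def by (rule open_plaque[OF disc1 iU[OF z] \<rho>(1) \<rho>(2)[OF zK[OF z]] s(1) s(3) sr orb1[OF z]])
    have op2: "open (p2 z)"
      unfolding p2_def by (rule open_plaque[OF disc2 iU[OF z] \<rho>(1) \<rho>(3)[OF zK[OF z]] s(1) s(4) sr orb2[OF z]])
    have op2': "open (G2 z ` p2 z)"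
      using chart_open[OF disc2 iU[OF z] \<rho>(1) \<rho>(3)[OF zK[OF z]] s(1) s(4) sr orb2[OF z] op2] by (simp add: p2_def G2_def[abs_def])
    have G1c: "continuous_on (p1 z) (G1 z)"
      unfolding G1_def using plaque_slow[OF disc1 iU[OF z] \<rho>(1) \<rho>(2)[OF zK[OF z]] s(1) s(3) sr orb1[OF z]]
      by (intro continuous_on_subset[OF chart_continuous[OF disc1 iU[OF z] \<rho>(1) \<rho>(2)[OF zK[OF z]] s(1) s(3) sr orb1[OF z]]]) (auto simp: p1_def)
    have opS: "open S" unfolding S_def by (rule continuous_open_preimage[OF G1c op1 op2'])
    have inv2c: "continuous_on (G2 z ` p2 z) (inv_into (p2 z) (G2 z))"
      using chart_inverse_continuous[OF disc2 iU[OF z] \<rho>(1) \<rho>(3)[OF zK[OF z]] s(1) s(4) sr orb2[OF z]] by (simp add: G2_def[abs_def] p2_def)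
    have \<Psi>c: "continuous_on S \<Psi>"
      unfolding \<Psi>_def o_def
    proof (rule continuous_on_compose2[OF inv2c])
      show "continuous_on S (G1 z)" by (rule continuous_on_subset[OF G1c]) (auto simp: S_def)
      show "G1 z ` S \<subseteq> G2 z ` p2 z" by (auto simp: S_def)
    qed
    have \<Psi>\<Phi>: "\<Psi> (\<Phi> z \<omega>) = \<omega>" "\<Phi> z \<omega> \<in> S" if "\<omega> \<in> Bs z" for \<omega>
      using \<Phi>[OF z that] inj2[OF z] by (auto simp: \<Psi>_def S_def)
    have img: "\<Phi> z ` Bs z = S \<inter> \<Psi> -` Bs z"
    proof (intro equalityI subsetI)
      fix \<zeta> assume "\<zeta> \<in> S \<inter> \<Psi> -` Bs z"
      then have \<zeta>: "\<zeta> \<in> p1 z" "G1 z \<zeta> \<in> G2 z ` p2 z" "\<Psi> \<zeta> \<in> Bs z" by (auto simp: S_def)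
      have "G1 z (\<Phi> z (\<Psi> \<zeta>)) = G1 z \<zeta>"
        using \<Phi>(2)[OF z \<zeta>(3)] f_inv_into_f[OF \<zeta>(2)] by (simp add: \<Psi>_def)
      then have "\<Phi> z (\<Psi> \<zeta>) = \<zeta>" using inj1[OF z] \<Phi>(1)[OF z \<zeta>(3)] \<zeta>(1) by (auto dest: inj_onD)
      then show "\<zeta> \<in> \<Phi> z ` Bs z" using \<zeta>(3) by (metis image_eqI)
    qed (use \<Psi>\<Phi> in auto)
    have imgm: "\<Phi> z ` Bs z \<in> sets borel"
    proof -
      have "\<Psi> -` Bs z \<inter> space (restrict_space borel S) \<in> sets (restrict_space borel S)"
        by (rule measurable_sets[OF borel_measurable_continuous_on_restrict[OF \<Psi>c] Bm])
      then show ?thesis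
        using opS by (simp add: img space_restrict_space sets_restrict_space_iff Int_commute)
    qed
    fix Y :: "(real^'k) set" assume Y: "Y \<in> sets borel"
    let ?S = "\<Phi> z ` Bs z \<inter> Y"
    have \<Psi>S: "\<Psi> ` (\<Phi> z ` Bs z \<inter> T) = Bs z \<inter> \<Phi> z -` T" for T
    proof (intro equalityI subsetI)
      fix \<omega> assume "\<omega> \<in> Bs z \<inter> \<Phi> z -` T"
      then show "\<omega> \<in> \<Psi> ` (\<Phi> z ` Bs z \<inter> T)"
        using \<Psi>\<Phi>(1)[of \<omega>] by (intro image_eqI[of _ _ "\<Phi> z \<omega>"]) auto
    qed (auto simp: \<Psi>\<Phi>)
    \<comment> \<open>The derivative of \<open>\<Psi>\<close> is the linear map matching unstable
      coordinates, as assumption \<open>jac\<close> requires.\<close>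
    define L where "L \<zeta> = inv (co (lab z) n \<circ> dorb \<psi>2 B2 (\<Psi> \<zeta>) n) \<circ> (co (lab z) n \<circ> dorb \<psi>1 B1 \<zeta> n)" for \<zeta>
    have der: "(\<Psi> has_derivative L \<zeta>) (at \<zeta>) \<and> vol_ratio (L \<zeta>) \<le> c' \<and> \<zeta> \<in> V" if \<zeta>: "\<zeta> \<in> \<Phi> z ` Bs z" for \<zeta>
    proof -
      obtain \<omega> where \<omega>: "\<omega> \<in> Bs z" "\<zeta> = \<Phi> z \<omega>" using \<zeta> by blast
      note F = \<Phi>[OF z \<omega>(1)]
      have \<Psi>\<zeta>: "\<Psi> \<zeta> = \<omega>" using \<Psi>\<Phi>(1)[OF \<omega>(1)] \<omega>(2) by simp
      have q1: "\<zeta> \<in> Q1" "slow (lab z) n (orb \<psi>1 \<zeta>)" using plaque_slow[OF disc1 iU[OF z] \<rho>(1) \<rho>(2)[OF zK[OF z]] s(1) s(3) sr orb1[OF z]] F(1) \<omega>(2) by (auto simp: p1_def)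
      have q2: "\<omega> \<in> Q2" "slow (lab z) n (orb \<psi>2 \<omega>)" using plaque_slow[OF disc2 iU[OF z] \<rho>(1) \<rho>(3)[OF zK[OF z]] s(1) s(4) sr orb2[OF z]] F(4) by (auto simp: p2_def)
      let ?M1 = "co (lab z) n \<circ> dorb \<psi>1 B1 \<zeta> n" and ?M2 = "co (lab z) n \<circ> dorb \<psi>2 B2 \<omega> n"
      note d1 = dorb_inj[OF disc1 iU[OF z] q1 order_refl] and d2 = dorb_inj[OF disc2 iU[OF z] q2 order_refl]
      have surj: "surj ?M2" by (rule linear_injective_imp_surjective[OF d2(3,2)]) simp
      have lininv: "linear (inv ?M2)" using inj_linear_imp_inv_linear[OF d2(3,2)] .
      have M2L: "?M2 \<circ> L \<zeta> = ?M1"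
        unfolding L_def \<Psi>\<zeta> using surj by (simp add: fun_eq_iff surj_f_inv_f del: o_apply) (simp add: o_def surj_f_inv_f[OF surj, unfolded o_def])
      have linL: "linear (L \<zeta>)" unfolding L_def \<Psi>\<zeta> by (rule linear_compose[OF d1(3) lininv])
      have injL: "inj (L \<zeta>)"
      proof (rule inj_on_imageI2[of ?M2])
        show "inj (?M2 \<circ> L \<zeta>)" unfolding M2L by (rule d1(2))
      qed
      have "G1 z \<zeta> = G2 z \<omega>" using F(2) \<omega>(2) by simp
      have "(inv_into (p2 z) (G2 z) has_derivative inv ?M2) (at (G1 z \<zeta>))"
      proof (rule has_derivative_inverse_basic[where f="G2 z" and T="G2 z ` p2 z"])
        show "(G2 z has_derivative ?M2) (at (inv_into (p2 z) (G2 z) (G1 z \<zeta>)))"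
          using chart_derivative[OF disc2 iU[OF z] \<rho>(1) \<rho>(3)[OF zK[OF z]] s(1) s(4) sr orb2[OF z] q2(1)] \<Psi>\<zeta> by (simp add: \<Psi>_def G2_def[abs_def])
        show "bounded_linear (inv ?M2)" using lininv linear_conv_bounded_linear by blast
        show "inv ?M2 \<circ> ?M2 = id" by (rule inv_o_cancel[OF d2(2)])
        show "open (G2 z ` p2 z)" by (rule op2')
        show mem: "G1 z \<zeta> \<in> G2 z ` p2 z" using \<open>G1 z \<zeta> = G2 z \<omega>\<close> F(4) by blast
        show "continuous (at (G1 z \<zeta>)) (inv_into (p2 z) (G2 z))"
          using inv2c op2' mem continuous_on_eq_continuous_at by blast
      qed (rule f_inv_into_f)
      moreover have "(G1 z has_derivative ?M1) (at \<zeta>)"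
        using chart_derivative[OF disc1 iU[OF z] \<rho>(1) \<rho>(2)[OF zK[OF z]] s(1) s(3) sr orb1[OF z] q1(1)] by (simp add: G1_def[abs_def])
      ultimately have "(\<Psi> has_derivative L \<zeta>) (at \<zeta>)"
        unfolding \<Psi>_def L_def \<Psi>\<zeta>[unfolded \<Psi>_def] by (intro diff_chain_at)
      moreover have cl: "c1 * norm (\<zeta> - Pi \<omega>) \<le> \<eta>"
      proof -
        have PiQ: "Pi \<omega> \<in> Q1" using F(5) X K by blast
        have "c1 * norm (\<zeta> - Pi \<omega>) \<le> norm (\<psi>1 \<zeta> - \<psi>1 (Pi \<omega>))"
          using disc1 q1(1) PiQ by (simp add: disc_def)
        also have "\<dots> \<le> ?d \<zeta> (Pi \<omega>)" using bowen_ge[of 0 n \<psi>1 \<zeta> "Pi \<omega>"] by simp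
        finally show ?thesis using F(3) \<omega>(2) by simp
      qed
      moreover have "slow (lab z) n (orb \<psi>1 (Pi \<omega>))"
        using near_slow[OF lab[OF z]] F(7) \<sigma> by simp
      ultimately show ?thesis
        using jac[OF F(5) q1(1) cl iU[OF z] _ q1(2) _ linL injL] q2(2) M2L F(6) V(2)[OF F(5) q1(1) cl] by simp
    qed
    have "emeasure lborel (\<Psi> ` ?S) \<le> ennreal c' * emeasure lborel ?S"
    proof (rule emeasure_differentiable_image_le[where g'=L])
      show "?S \<in> sets borel" using imgm Y by simp
      show "(\<Psi> has_derivative L \<zeta>) (at \<zeta> within ?S)" if "\<zeta> \<in> ?S" for \<zeta>
        using der that has_derivative_at_withinI by blast
      show "vol_ratio (L \<zeta>) \<le> c'" if "\<zeta> \<in> ?S" for \<zeta> using der that by blast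
      show "0 \<le> c'" by (rule c')
      fix k :: nat
      show "\<Psi> ` (?S \<inter> cball 0 (real k)) \<in> sets borel"
        unfolding Int_assoc \<Psi>S using Y by (intro vimm) auto
    qed
    also have "\<dots> \<le> ennreal c' * emeasure lborel (V \<inter> Y)"
      using der V Y by (intro mult_left_mono emeasure_mono) auto
    finally show "emeasure lborel (Bs z \<inter> \<Phi> z -` Y) \<le> ennreal c' * emeasure lborel (V \<inter> Y)"
      by (simp only: \<Psi>S)
  qed measurable
  \<comment> \<open>On the image of \<open>X\<close> the weights at the displaced points
    \<open>\<Phi> z \<omega>\<close> still sum to at least \<open>(1 - q) / (1 + q)\<close>.\<close>
  have pointwise: "ennreal (1 - q) * indicator (P ` X) \<omega> \<le> ennreal (1 + q) * (\<Sum>z\<in>Z. ennreal (h z (\<Phi> z \<omega>)) * indicator (Bs z) \<omega>)" for \<omega>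
  proof (cases "\<omega> \<in> P ` X")
    case True
    then obtain \<zeta> where \<zeta>: "\<zeta> \<in> X" "\<omega> = P \<zeta>" by blast
    have \<zeta>K: "\<zeta> \<in> K" "\<zeta> \<in> Q1" using \<zeta> X K by auto
    have Pi\<zeta>: "Pi \<omega> = \<zeta>" using \<zeta> \<zeta>K Pi by auto
    define A where "A = {z \<in> Z. ?d \<zeta> z < 2 * \<sigma>}"
    \<comment> \<open>A displacement by \<open>\<eta> \<le> \<sigma>\<close> enlarges the relevant
      radius from \<open>2 * \<sigma>\<close> to \<open>3 * \<sigma>\<close>: only net points in
      \<open>J\<close> can have positive weight at a displaced point.\<close>
    define J where "J = {z \<in> Z. ?d \<zeta> z < 3 * \<sigma>}"
    have fin: "finite A" "finite J" "A \<subseteq> J" using Z(1) \<sigma> by (auto simp: A_def J_def)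
    have BA: "\<omega> \<in> Bs z \<longleftrightarrow> z \<in> A" if "z \<in> Z" for z
      using that True Pi\<zeta> by (auto simp: Bs_def A_def)
    obtain i where i: "leaf_pair \<psi>1 \<psi>2 C0 i \<zeta> (P \<zeta>)" using leaf[OF \<zeta>K(1)] by blast
    have "real (card J) \<le> (1 + 24 * cs * l0 * E ^ n) ^ CARD('k)"
    proof (rule card_bowen_separated[OF disc1 leafD(1)[OF i] fin(2) _ \<zeta>K(2) _ _ \<sigma>])
      show "J \<subseteq> Q1" using Z(2) K(2) by (auto simp: J_def)
      show "slow i n (orb \<psi>1 z)" if "z \<in> J" for z
        using that bowen_commute[of \<psi>1 n z \<zeta>] \<sigma> by (intro near_slow[OF i]) (simp add: J_def)
    qed (use Z(4) in \<open>auto simp: J_def\<close>)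
    then have cJ: "real (card J) * \<eta> \<le> q * \<sigma>"
      using q mult_right_mono[OF _ \<eta>0] by fastforce
    have W\<sigma>: "\<sigma> \<le> W \<zeta>"
    proof -
      obtain z where z: "z \<in> Z" "?d \<zeta> z < \<sigma>" using Z(3)[OF \<zeta>K(1)] by blast
      have "\<sigma> \<le> w z \<zeta>" using z \<zeta>K by (simp add: w_def)
      also have "\<dots> \<le> W \<zeta>" unfolding W_def using z Z(1) w0 by (intro member_le_sum) auto
      finally show ?thesis .
    qed
    \<comment> \<open>Passing to the displaced point changes each weight by at most
      \<open>\<eta>\<close> and raises the total weight by at most
      \<open>real (card J) * \<eta>\<close>.\<close>
    have key: "w z \<zeta> \<le> h z (\<Phi> z \<omega>) * (W \<zeta> + real (card J) * \<eta>) + \<eta>" if zA: "z \<in> A" for z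
    proof -
      have z: "z \<in> Z" using zA by (simp add: A_def)
      have \<omega>B: "\<omega> \<in> Bs z" using BA[OF z] zA by simp
      let ?\<zeta> = "\<Phi> z \<omega>"
      note F = \<Phi>[OF z \<omega>B]
      have Q: "?\<zeta> \<in> Q1" using plaque_slow[OF disc1 iU[OF z] \<rho>(1) \<rho>(2)[OF zK[OF z]] s(1) s(3) sr orb1[OF z]] F(1) by (auto simp: p1_def)
      have d\<eta>: "?d ?\<zeta> \<zeta> \<le> \<eta>" using F(3) Pi\<zeta> by simp
      have wle: "w y ?\<zeta> \<le> w y \<zeta> + \<eta>" "w y \<zeta> \<le> w y ?\<zeta> + \<eta>" for y
        using bowen_triangle[of \<psi>1 n \<zeta> y ?\<zeta>] bowen_triangle[of \<psi>1 n ?\<zeta> y \<zeta>] d\<eta> bowen_commute[of \<psi>1 n \<zeta> ?\<zeta>] Q \<zeta>K(2) \<eta>0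
        by (auto simp: w_def)
      have wJ: "w y ?\<zeta> = 0" if "y \<in> Z" "y \<notin> J" for y
      proof -
        have "3 * \<sigma> \<le> ?d \<zeta> y" using that by (auto simp: J_def)
        then have "2 * \<sigma> \<le> ?d ?\<zeta> y"
          using bowen_triangle[of \<psi>1 n \<zeta> y ?\<zeta>] d\<eta> bowen_commute[of \<psi>1 n \<zeta> ?\<zeta>] \<eta>\<sigma> by linarith
        then show ?thesis by (simp add: w_def)
      qed
      have "W ?\<zeta> = (\<Sum>y\<in>J. w y ?\<zeta>)"
        unfolding W_def using Z(1) wJ by (intro sum.mono_neutral_right) (auto simp: J_def)
      also have "\<dots> \<le> (\<Sum>y\<in>J. w y \<zeta> + \<eta>)" by (intro sum_mono wle)
      also have "\<dots> = (\<Sum>y\<in>J. w y \<zeta>) + real (card J) * \<eta>" by (simp add: sum.distrib)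
      also have "(\<Sum>y\<in>J. w y \<zeta>) \<le> W \<zeta>"
        unfolding W_def using Z(1) w0 by (intro sum_mono2) (auto simp: J_def)
      finally have WW: "W ?\<zeta> \<le> W \<zeta> + real (card J) * \<eta>" by simp
      have "w z ?\<zeta> = h z ?\<zeta> * W ?\<zeta>"
      proof (cases "W ?\<zeta> = 0")
        case True
        then have "w z ?\<zeta> = 0"
          using z Z(1) w0 unfolding W_def by (subst (asm) sum_nonneg_eq_0_iff) auto
        then show ?thesis by (simp add: h_def)
      qed (simp add: h_def)
      also have "\<dots> \<le> h z ?\<zeta> * (W \<zeta> + real (card J) * \<eta>)"
        using WW h0 by (intro mult_left_mono)
      finally show ?thesis using wle(2)[of z] by simp
    qed
    let ?\<Gamma> = "\<Sum>z\<in>A. h z (\<Phi> z \<omega>)"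
    have "W \<zeta> = (\<Sum>z\<in>A. w z \<zeta>)"
      unfolding W_def using Z(1) by (intro sum.mono_neutral_right) (auto simp: A_def w_def)
    also have "\<dots> \<le> (\<Sum>z\<in>A. h z (\<Phi> z \<omega>) * (W \<zeta> + real (card J) * \<eta>) + \<eta>)"
      by (intro sum_mono key)
    also have "\<dots> = ?\<Gamma> * (W \<zeta> + real (card J) * \<eta>) + real (card A) * \<eta>"
      by (simp add: sum.distrib sum_distrib_right)
    also have "\<dots> \<le> ?\<Gamma> * (W \<zeta> + q * W \<zeta>) + q * W \<zeta>"
    proof (intro add_mono mult_left_mono)
      have "q * \<sigma> \<le> q * W \<zeta>" using W\<sigma> q0 by (intro mult_left_mono)
      then show J: "real (card J) * \<eta> \<le> q * W \<zeta>" using cJ by simp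
      have "real (card A) * \<eta> \<le> real (card J) * \<eta>"
        using fin \<eta>0 by (intro mult_right_mono) (auto intro: card_mono)
      then show "real (card A) * \<eta> \<le> q * W \<zeta>" using J by simp
    qed (auto intro: sum_nonneg h0)
    finally have "W \<zeta> * (1 - q) \<le> W \<zeta> * ((1 + q) * ?\<Gamma>)" by (simp add: algebra_simps)
    then have real: "1 - q \<le> (1 + q) * ?\<Gamma>" using W\<sigma> \<sigma> by (simp add: mult_le_cancel_left)
    have "(\<Sum>z\<in>Z. ennreal (h z (\<Phi> z \<omega>)) * indicator (Bs z) \<omega>) = (\<Sum>z\<in>A. ennreal (h z (\<Phi> z \<omega>)))"
      using Z(1) BA by (intro sum.mono_neutral_cong_right) (auto simp: A_def indicator_def)
    also have "\<dots> = ennreal ?\<Gamma>" using h0 by (simp add: sum_ennreal)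
    finally have sum_eq: "(\<Sum>z\<in>Z. ennreal (h z (\<Phi> z \<omega>)) * indicator (Bs z) \<omega>) = ennreal ?\<Gamma>" .
    have "ennreal (1 + q) * ennreal ?\<Gamma> = ennreal ((1 + q) * ?\<Gamma>)"
      using q0 by (intro ennreal_mult[symmetric] sum_nonneg h0) simp
    then show ?thesis
      unfolding sum_eq using ennreal_leI[OF real] True by simp
  qed simp
  \<comment> \<open>After integration of the pointwise bound, the local change of variables moves
    the weights back to the first disc, where they sum to at most 1 on \<open>V\<close>.\<close>
  have "ennreal (1 - q) * emeasure lborel (P ` X) = (\<integral>\<^sup>+\<omega>. ennreal (1 - q) * indicator (P ` X) \<omega> \<partial>lborel)"
    using borel_compact[OF cPX] by (simp add: nn_integral_cmult_indicator)
  also have "\<dots> \<le> (\<integral>\<^sup>+\<omega>. ennreal (1 + q) * (\<Sum>z\<in>Z. ennreal (h z (\<Phi> z \<omega>)) * indicator (Bs z) \<omega>) \<partial>lborel)"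
    by (intro nn_integral_mono pointwise)
  also have "\<dots> = ennreal (1 + q) * (\<Sum>z\<in>Z. \<integral>\<^sup>+\<omega>\<in>Bs z. ennreal (h z (\<Phi> z \<omega>)) \<partial>lborel)"
  proof -
    have m: "(\<lambda>\<omega>. ennreal (h z (\<Phi> z \<omega>)) * indicator (Bs z) \<omega>) \<in> borel_measurable borel" if "z \<in> Z" for z
      using Bm[of z] measurable_compose[OF \<Phi>m[OF that], of "\<lambda>\<zeta>. ennreal (h z \<zeta>)" borel]
      by (subst borel_measurable_restrict_space_iff_ennreal[symmetric]) auto
    have "(\<integral>\<^sup>+\<omega>. ennreal (1 + q) * (\<Sum>z\<in>Z. ennreal (h z (\<Phi> z \<omega>)) * indicator (Bs z) \<omega>) \<partial>lborel)
      = ennreal (1 + q) * (\<integral>\<^sup>+\<omega>. (\<Sum>z\<in>Z. ennreal (h z (\<Phi> z \<omega>)) * indicator (Bs z) \<omega>) \<partial>lborel)"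
      by (rule nn_integral_cmult) (use m in \<open>auto intro!: borel_measurable_sum\<close>)
    then show ?thesis
      using m by (simp add: nn_integral_sum)
  qed
  also have "\<dots> \<le> ennreal (1 + q) * (\<Sum>z\<in>Z. ennreal c' * (\<integral>\<^sup>+\<zeta>\<in>V. ennreal (h z \<zeta>) \<partial>lborel))"
    by (intro mult_left_mono sum_mono local_le) auto
  also have "\<dots> = ennreal (1 + q) * (ennreal c' * (\<integral>\<^sup>+\<zeta>\<in>V. (\<Sum>z\<in>Z. ennreal (h z \<zeta>)) \<partial>lborel))"
    using V(1) by (simp add: nn_integral_sum[symmetric] sum_distrib_left[symmetric] sum_distrib_right)
  also have "\<dots> \<le> ennreal (1 + q) * (ennreal c' * (\<integral>\<^sup>+\<zeta>\<in>V. 1 \<partial>lborel))"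
    using sum_h by (intro mult_left_mono nn_integral_mono mult_right_mono) (auto simp: sum_ennreal h0)
  also have "\<dots> = ennreal ((1 + q) * c') * emeasure lborel V"
    using q0 c' V(1) by (simp add: ennreal_mult mult.assoc)
  finally show ?thesis .
qed

end


section \<open>Passage to the limit: upper bounds on compact sets\<close>

context hyperbolic_charts
begin

lemma dorb_lower:
  assumes disc: "disc \<psi> B Q c" and i: "i \<in> U" and Q: "\<zeta> \<in> Q" and s: "slow i n (orb \<psi> \<zeta>)" and "k \<le> n"
  shows "g ^ k * c / (2 * (l0 * E ^ k)) * norm v \<le> norm (dorb \<psi> B \<zeta> k v)"
proof -
  have "g ^ k * Np i 0 (B \<zeta> v) \<le> Np i k (dorb \<psi> B \<zeta> k v)"
    using \<open>k \<le> n\<close>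
  proof (induction k)
    case (Suc k)
    have "g * (g ^ k * Np i 0 (B \<zeta> v)) \<le> g * Np i k (dorb \<psi> B \<zeta> k v)"
      using Suc const_facts by (intro mult_left_mono) auto
    then show ?case
      using dorb_growth[OF disc i Q s, of k v] Suc.prems by (simp add: mult.assoc)
  qed simp
  moreover have "c * norm v / 2 \<le> Np i 0 (B \<zeta> v)"
    using dorb_lower0[OF disc Q, of v] norm_le[OF i, of "B \<zeta> v" 0] dorb_N[OF disc i Q s, of 0 v] by simp
  then have "g ^ k * (c * norm v / 2) \<le> g ^ k * Np i 0 (B \<zeta> v)"
    using const_facts by (intro mult_left_mono) auto
  ultimately have "g ^ k * (c * norm v / 2) \<le> l0 * E ^ k * norm (dorb \<psi> B \<zeta> k v)"
    using Np_le_norm[OF i, of k "dorb \<psi> B \<zeta> k v"] by linarith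
  then have "g ^ k * (c * norm v / 2) / (l0 * E ^ k) \<le> norm (dorb \<psi> B \<zeta> k v)"
    using const_facts(15)[of k] by (simp add: pos_divide_le_eq mult.commute)
  then show ?thesis by simp
qed

context
  fixes \<psi>1 B1 Q1 c1 \<psi>2 B2 Q2 c2 K P C0
  assumes disc1: "disc \<psi>1 B1 Q1 c1" and disc2: "disc \<psi>2 B2 Q2 c2"
    and K: "compact K" "K \<subseteq> Q1" "continuous_on K P" "inj_on P K" "P ` K \<subseteq> Q2"
    and leaf: "\<And>\<zeta>. \<zeta> \<in> K \<Longrightarrow> \<exists>i. leaf_pair \<psi>1 \<psi>2 C0 i \<zeta> (P \<zeta>)" and C0: "0 < C0" "(4 * l0 + 3) * C0 \<le> r"
begin

abbreviation R :: "nat \<Rightarrow> real^'k \<Rightarrow> real" where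
  "R n \<zeta> \<equiv> lnvol \<psi>2 B2 (P \<zeta>) n - lnvol \<psi>1 B1 \<zeta> n"

definition T :: "nat \<Rightarrow> real" where "T k = 4 * real CARD('k) * C_slope * (\<theta> ^ k / (1 - \<theta>))"

lemma T_lim: "T \<longlonglongrightarrow> 0" "(\<lambda>k. C_slope * \<theta> ^ k) \<longlonglongrightarrow> 0"
proof -
  have p: "(\<lambda>k. \<theta> ^ k) \<longlonglongrightarrow> 0" using C_slope by (intro LIMSEQ_power_zero) auto
  show "T \<longlonglongrightarrow> 0" unfolding T_def[abs_def]
    using tendsto_mult_left[OF tendsto_divide[OF p tendsto_const[of "1 - \<theta>"]], of "4 * real CARD('k) * C_slope"] C_slope by simp
  show "(\<lambda>k. C_slope * \<theta> ^ k) \<longlonglongrightarrow> 0" using tendsto_mult_left[OF p, of C_slope] by simp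
qed

lemma leaf_slow:
  assumes "\<zeta> \<in> K" obtains i where "i \<in> U" "\<And>n. slow i n (orb \<psi>1 \<zeta>)" "\<And>n. slow i n (orb \<psi>2 (P \<zeta>))"
proof -
  obtain i where i: "leaf_pair \<psi>1 \<psi>2 C0 i \<zeta> (P \<zeta>)" using leaf[OF assms] by blast
  have "C0 * a ^ k \<le> r * b ^ k" for k
  proof (rule mult_mono)
    have "0 \<le> l0 * C0" using params C0 by simp
    then show "C0 \<le> r" using C0 by (simp add: algebra_simps)
  qed (use C0 const_facts params in \<open>auto intro: power_mono\<close>)
  then show thesis using i that[of i] unfolding leaf_pair_def slow_def by (meson order_trans)
qed

lemma R_tail:
  assumes "\<zeta> \<in> K" "k0 \<le> k" "C_slope * \<theta> ^ k0 \<le> 1 / 2"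
  shows "\<bar>R k \<zeta> - R k0 \<zeta>\<bar> \<le> T k0"
proof -
  obtain i where i: "i \<in> U" "slow i k (orb \<psi>1 \<zeta>)" "slow i k (orb \<psi>2 (P \<zeta>))"
    using leaf_slow[OF assms(1)] by metis
  have "\<zeta> \<in> Q1" "P \<zeta> \<in> Q2" using assms(1) K by auto
  from lnvol_tail[OF disc1 disc2 i(1) this i(2,3) assms(2) order_refl assms(3)]
  show ?thesis by (simp add: T_def)
qed

lemma R_convergent: "\<zeta> \<in> K \<Longrightarrow> (\<lambda>n. R n \<zeta>) \<longlonglongrightarrow> lim (\<lambda>n. R n \<zeta>)"
  and R_lim: "\<zeta> \<in> K \<Longrightarrow> C_slope * \<theta> ^ k0 \<le> 1 / 2 \<Longrightarrow> \<bar>lim (\<lambda>n. R n \<zeta>) - R k0 \<zeta>\<bar> \<le> T k0"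
proof -
  assume \<zeta>: "\<zeta> \<in> K"
  have "Cauchy (\<lambda>n. R n \<zeta>)"
  proof (rule metric_CauchyI)
    fix e :: real assume e: "0 < e"
    have "\<forall>\<^sub>F k in sequentially. C_slope * \<theta> ^ k < 1 / 2 \<and> T k < e / 2"
      using order_tendstoD(2)[OF T_lim(2), of "1/2"] order_tendstoD(2)[OF T_lim(1), of "e/2"] e
      by (intro eventually_conj) auto
    then obtain k where k: "C_slope * \<theta> ^ k < 1 / 2" "T k < e / 2"
      unfolding eventually_sequentially by blast
    have "dist (R m \<zeta>) (R n \<zeta>) < e" if "m \<ge> k" "n \<ge> k" for m n
      using R_tail[OF \<zeta> that(1)] R_tail[OF \<zeta> that(2)] k by (simp add: dist_real_def)
    then show "\<exists>M. \<forall>m\<ge>M. \<forall>n\<ge>M. dist (R m \<zeta>) (R n \<zeta>) < e" by blast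
  qed
  then show c: "(\<lambda>n. R n \<zeta>) \<longlonglongrightarrow> lim (\<lambda>n. R n \<zeta>)"
    using Cauchy_convergent convergent_LIMSEQ_iff by blast
  assume k0: "C_slope * \<theta> ^ k0 \<le> 1 / 2"
  have l: "(\<lambda>n. \<bar>R n \<zeta> - R k0 \<zeta>\<bar>) \<longlonglongrightarrow> \<bar>lim (\<lambda>n. R n \<zeta>) - R k0 \<zeta>\<bar>"
    by (intro tendsto_intros c)
  have "\<forall>n\<ge>k0. \<bar>R n \<zeta> - R k0 \<zeta>\<bar> \<le> T k0" using R_tail[OF \<zeta> _ k0] by blast
  then show "\<bar>lim (\<lambda>n. R n \<zeta>) - R k0 \<zeta>\<bar> \<le> T k0"
    by (intro LIMSEQ_le_const2[OF l]) blast
qed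

text \<open>A time \<open>k0\<close> is fixed first, beyond which the differences of
  \<open>ln unit_vol\<close> vary by at most \<open>\<epsilon>\<close>, uniformly over slow pairs;
  then \<open>n\<close> is taken so large that displaced points are close enough for continuity of
  the tangent map at time \<open>k0\<close>. The Jacobian at time \<open>n\<close> is compared with
  the limit at a cost of \<open>\<epsilon>\<close> in each of four steps: matching of tangents at
  \<open>n\<close>, return from \<open>n\<close> to \<open>k0\<close>, exchange of
  \<open>\<zeta>'\<close> for \<open>\<zeta>\<close> at \<open>k0\<close>, and passage from
  \<open>k0\<close> to the limit.\<close>

lemma holonomy_bound_open:
  fixes c \<epsilon> q :: real
  assumes X: "compact X" "X \<subseteq> K" and c: "0 < c" "\<And>\<zeta>. \<zeta> \<in> X \<Longrightarrow> lim (\<lambda>n. R n \<zeta>) \<le> ln c"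
    and V: "open V" "X \<subseteq> V" and \<epsilon>: "0 < \<epsilon>" and q: "0 < q" "q \<le> 1"
  shows "ennreal (1 - q) * emeasure lborel (P ` X) \<le> ennreal ((1 + q) * (c * exp (4 * \<epsilon>))) * emeasure lborel V"
proof -
  let ?m = "real CARD('k)"
  have m: "0 < ?m" by simp
  have "\<forall>\<^sub>F k in sequentially. C_slope * \<theta> ^ k < min (1 / 2) (\<epsilon> / (2 * ?m)) \<and> T k < \<epsilon>"
    using order_tendstoD(2)[OF T_lim(2), of "min (1 / 2) (\<epsilon> / (2 * ?m))"] order_tendstoD(2)[OF T_lim(1), of \<epsilon>] \<epsilon>
    by (intro eventually_conj) auto
  then obtain k0 where k0: "C_slope * \<theta> ^ k0 < min (1 / 2) (\<epsilon> / (2 * ?m))" "T k0 < \<epsilon>"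
    unfolding eventually_sequentially by blast
  have c12: "0 < c1" "0 < c2" using disc1 disc2 by (auto simp: disc_def)
  obtain \<rho>1 where \<rho>1: "0 < \<rho>1" "(\<Union>x\<in>K. cball x \<rho>1) \<subseteq> Q1"
    using compact_subset_open_imp_cball_epsilon_subset[OF K(1) openQ[OF disc1] K(2)] by blast
  obtain \<rho>2 where \<rho>2: "0 < \<rho>2" "(\<Union>x\<in>P ` K. cball x \<rho>2) \<subseteq> Q2"
    using compact_subset_open_imp_cball_epsilon_subset[OF compact_continuous_image[OF K(3,1)] openQ[OF disc2] K(5)] by blast
  define \<rho> where "\<rho> = min \<rho>1 \<rho>2"
  define s where "s = min C0 (min (c1 * \<rho> / 2) (c2 * \<rho> / 2))"
  have \<rho>: "0 < \<rho>" "\<And>\<zeta>. \<zeta> \<in> K \<Longrightarrow> cball \<zeta> \<rho> \<subseteq> Q1" "\<And>\<zeta>. \<zeta> \<in> K \<Longrightarrow> cball (P \<zeta>) \<rho> \<subseteq> Q2"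
  proof -
    show "cball \<zeta> \<rho> \<subseteq> Q1" if "\<zeta> \<in> K" for \<zeta>
      using \<rho>1(2) that subset_cball[of \<rho> \<rho>1 \<zeta>] by (force simp: \<rho>_def)
    show "cball (P \<zeta>) \<rho> \<subseteq> Q2" if "\<zeta> \<in> K" for \<zeta>
      using \<rho>2(2) that subset_cball[of \<rho> \<rho>2 "P \<zeta>"] by (force simp: \<rho>_def)
  qed (use \<rho>1 \<rho>2 in \<open>auto simp: \<rho>_def\<close>)
  have s: "0 < s" "s \<le> C0" "2 * s \<le> c1 * \<rho>" "2 * s \<le> c2 * \<rho>"
    using C0 c12 \<rho> by (auto simp: s_def)
  define lb where "lb = g ^ k0 * c1 / (2 * (l0 * E ^ k0))"
  have lb: "0 < lb" using const_facts c12 const_facts(15)[of k0] by (simp add: lb_def)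
  define e1 where "e1 = min (1 / 2) (\<epsilon> / (2 * ?m))"
  have e1: "0 < e1" "e1 \<le> 1 / 2" "2 * ?m * e1 \<le> \<epsilon>" using \<epsilon> m by (auto simp: e1_def field_simps min_def)
  have "X \<subseteq> Q1 \<inter> V" "open (Q1 \<inter> V)" using X K V openQ[OF disc1] by auto
  moreover have "continuous_on (Q1 \<inter> V) (\<lambda>\<zeta>. dorb \<psi>1 B1 \<zeta> k0)"
    using dorb_continuous[OF disc1] by (rule continuous_on_subset) auto
  ultimately obtain d0 where d0: "0 < d0"
    "\<And>x y. x \<in> X \<Longrightarrow> dist x y < d0 \<Longrightarrow> y \<in> Q1 \<inter> V \<and> dist (dorb \<psi>1 B1 x k0) (dorb \<psi>1 B1 y k0) < lb * e1"
    using compact_nbhd_uniform[OF X(1), of "Q1 \<inter> V" "\<lambda>\<zeta>. dorb \<psi>1 B1 \<zeta> k0" "lb * e1"] lb e1 by (metis mult_pos_pos)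
  \<comment> \<open>At the fixed time \<open>k0\<close> the tangent map is bounded below by
    \<open>lb\<close> on \<open>X\<close>, so continuity in operator norm becomes a small relative
    error.\<close>
  have lnclose: "\<bar>lnvol \<psi>1 B1 \<zeta>' k0 - lnvol \<psi>1 B1 \<zeta> k0\<bar> \<le> \<epsilon>" if \<zeta>: "\<zeta> \<in> X" "dist \<zeta> \<zeta>' < d0" for \<zeta> \<zeta>'
  proof -
    have \<zeta>K: "\<zeta> \<in> K" "\<zeta> \<in> Q1" using \<zeta> X K by auto
    obtain i where i: "i \<in> U" "slow i k0 (orb \<psi>1 \<zeta>)" using leaf_slow[OF \<zeta>K(1)] by metis
    have close: "norm (dorb \<psi>1 B1 \<zeta>' k0 v - dorb \<psi>1 B1 \<zeta> k0 v) \<le> e1 * norm (dorb \<psi>1 B1 \<zeta> k0 v)" for v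
    proof -
      have "norm (dorb \<psi>1 B1 \<zeta>' k0 v - dorb \<psi>1 B1 \<zeta> k0 v) = norm ((dorb \<psi>1 B1 \<zeta>' k0 - dorb \<psi>1 B1 \<zeta> k0) v)"
        by (simp add: blinfun.diff_left)
      also have "\<dots> \<le> norm (dorb \<psi>1 B1 \<zeta>' k0 - dorb \<psi>1 B1 \<zeta> k0) * norm v" by (rule norm_blinfun)
      also have "\<dots> \<le> (lb * e1) * norm v"
        using d0(2)[OF \<zeta>] by (intro mult_right_mono) (auto simp: dist_norm norm_minus_commute)
      also have "\<dots> = e1 * (lb * norm v)" by simp
      also have "\<dots> \<le> e1 * norm (dorb \<psi>1 B1 \<zeta> k0 v)"
        using dorb_lower[OF disc1 i(1) \<zeta>K(2) i(2) order_refl, of v] e1 unfolding lb_def by (intro mult_left_mono) auto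
      finally show ?thesis .
    qed
    have "\<bar>lnvol \<psi>1 B1 \<zeta>' k0 - lnvol \<psi>1 B1 \<zeta> k0\<bar> \<le> real (2 * DIM(real^'k)) * e1"
      using e1 dorb_inj[OF disc1 i(1) \<zeta>K(2) i(2) order_refl]
      by (intro ln_unit_vol_close(2)[OF _ _ _ close]) (auto simp: blinfun.bounded_linear_right)
    then show ?thesis using e1(3) by simp
  qed
  have x: "E ^ (CARD('k) + 2) * a / b < 1" "0 \<le> E ^ (CARD('k) + 2) * a / b" "E * a / b < 1" "0 \<le> E * a / b" "a / b < 1" "0 \<le> a / b"
    using const_facts params by (auto simp: divide_simps)
  \<comment> \<open>Collects the constants of \<open>card_bowen_separated\<close>,
    \<open>\<eta>\<close> and \<open>\<sigma>\<close>; 64 is the 8 in \<open>\<eta>\<close> times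
    the 8 in \<open>\<sigma>\<close>.\<close>
  define Cst where "Cst = (1 + 24 * cs * l0) ^ CARD('k) * (64 * cs * l0 * l0 * C0)"
  have l1: "(\<lambda>n. 4 * l0 * C0 * (E * a / b) ^ n + 2 * C0 * (a / b) ^ n) \<longlonglongrightarrow> 4 * l0 * C0 * 0 + 2 * C0 * 0"
    using x by (intro tendsto_intros LIMSEQ_power_zero) auto
  have l2: "(\<lambda>n. Cst * (E ^ (CARD('k) + 2) * a / b) ^ n) \<longlonglongrightarrow> Cst * 0"
    using x by (intro tendsto_intros LIMSEQ_power_zero) auto
  have l3: "(\<lambda>n. 8 * cs * l0 * C0 * (E * a / b) ^ n) \<longlonglongrightarrow> 8 * cs * l0 * C0 * 0"
    using x by (intro tendsto_intros LIMSEQ_power_zero) auto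
  have "\<forall>\<^sub>F n in sequentially. (4 * l0 * C0 * (E * a / b) ^ n + 2 * C0 * (a / b) ^ n < s / 2 \<and>
     Cst * (E ^ (CARD('k) + 2) * a / b) ^ n < q * s) \<and> (8 * cs * l0 * C0 * (E * a / b) ^ n < c1 * d0 \<and> k0 \<le> n)"
    using order_tendstoD(2)[OF l1, of "s / 2"] order_tendstoD(2)[OF l2, of "q * s"] order_tendstoD(2)[OF l3, of "c1 * d0"] s q c12 d0(1)
    by (intro eventually_conj eventually_ge_at_top) auto
  then obtain n where n: "4 * l0 * C0 * (E * a / b) ^ n + 2 * C0 * (a / b) ^ n < s / 2"
     "Cst * (E ^ (CARD('k) + 2) * a / b) ^ n < q * s" "8 * cs * l0 * C0 * (E * a / b) ^ n < c1 * d0" "k0 \<le> n"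
    unfolding eventually_sequentially by blast
  define \<eta> where "\<eta> = 8 * cs * l0 * C0 * (E * a / b) ^ n"
  define \<sigma> where "\<sigma> = s / (8 * (l0 * E ^ n))"
  have \<eta>0: "0 \<le> \<eta>" using cs_pos params C0 x by (simp add: \<eta>_def)
  have E1: "1 \<le> E ^ n" using params by (intro one_le_power)
  have cl: "0 \<le> 24 * cs * l0" using cs_pos params by simp
  have mult: "(1 + 24 * cs * l0 * E ^ n) ^ CARD('k) * \<eta> \<le> q * \<sigma>"
  proof -
    have "1 + 24 * cs * l0 * E ^ n \<le> (1 + 24 * cs * l0) * E ^ n" using E1 by (simp add: distrib_right)
    then have "(1 + 24 * cs * l0 * E ^ n) ^ CARD('k) \<le> ((1 + 24 * cs * l0) * E ^ n) ^ CARD('k)"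
      using cs_pos params E1 by (intro power_mono add_nonneg_nonneg mult_nonneg_nonneg zero_le_power) auto
    then have "(1 + 24 * cs * l0 * E ^ n) ^ CARD('k) * \<eta> * (8 * (l0 * E ^ n)) \<le> ((1 + 24 * cs * l0) * E ^ n) ^ CARD('k) * \<eta> * (8 * (l0 * E ^ n))"
      using \<eta>0 const_facts(15)[of n] by (intro mult_right_mono) auto
    also have "\<dots> = Cst * (E ^ (CARD('k) + 2) * a / b) ^ n"
      by (simp add: Cst_def \<eta>_def power_mult_distrib power_divide power_add power2_eq_square mult_ac flip: power_mult)
    also have "\<dots> \<le> q * s" using n(2) by simp
    finally show ?thesis using const_facts(15)[of n] by (simp add: \<sigma>_def pos_le_divide_eq)
  qed
  have \<eta>\<sigma>: "\<eta> \<le> \<sigma>"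
  proof -
    have "0 \<le> 24 * cs * l0 * E ^ n" using cs_pos params E1 by (intro mult_nonneg_nonneg zero_le_power) auto
    then have "1 * \<eta> \<le> (1 + 24 * cs * l0 * E ^ n) ^ CARD('k) * \<eta>"
      using \<eta>0 by (intro mult_right_mono one_le_power) auto
    also have "\<dots> \<le> 1 * \<sigma>"
    proof -
      have "0 \<le> \<sigma>" using s const_facts(15)[of n] unfolding \<sigma>_def by (intro divide_nonneg_nonneg) linarith+
      then have "q * \<sigma> \<le> 1 * \<sigma>" using q by (intro mult_right_mono)
      then show ?thesis using mult by linarith
    qed
    finally show ?thesis by simp
  qed
  have h1: "4 * l0 * C0 * (E * a) ^ n + 2 * C0 * a ^ n < s / 2 * b ^ n"
  proof -
    have "(4 * l0 * C0 * (E * a / b) ^ n + 2 * C0 * (a / b) ^ n) * b ^ n < s / 2 * b ^ n"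
      using n(1) const_facts by (intro mult_strict_right_mono) auto
    then show ?thesis using const_facts(2) by (simp add: distrib_right power_divide)
  qed
  show ?thesis
  proof (rule holonomy_estimate[OF disc1 disc2 K leaf C0 \<rho> s h1 \<eta>\<sigma>[unfolded \<eta>_def \<sigma>_def] mult[unfolded \<eta>_def \<sigma>_def] X])
    show "V \<in> sets borel" using V by simp
    have dd: "dist \<zeta> \<zeta>' < d0" if "c1 * norm (\<zeta>' - \<zeta>) \<le> 8 * cs * l0 * C0 * (E * a / b) ^ n" for \<zeta> \<zeta>' :: "real^'k"
    proof -
      have "c1 * norm (\<zeta>' - \<zeta>) < c1 * d0" using that n(3) by simp
      then show ?thesis using c12 by (simp add: dist_norm norm_minus_commute)
    qed
    show "\<zeta>' \<in> V" if "\<zeta> \<in> X" "\<zeta>' \<in> Q1" "c1 * norm (\<zeta>' - \<zeta>) \<le> 8 * cs * l0 * C0 * (E * a / b) ^ n" for \<zeta> \<zeta>'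
      using d0(2)[OF that(1) dd[OF that(3)]] by simp
    show "0 \<le> c * exp (4 * \<epsilon>)" using c by simp
    fix \<zeta> \<zeta>' i L
    assume \<zeta>: "\<zeta> \<in> X" "\<zeta>' \<in> Q1" and near: "c1 * norm (\<zeta>' - \<zeta>) \<le> 8 * cs * l0 * C0 * (E * a / b) ^ n" and i: "i \<in> U"
      and slow: "slow i n (orb \<psi>1 \<zeta>)" "slow i n (orb \<psi>1 \<zeta>')" "slow i n (orb \<psi>2 (P \<zeta>))"
      and L: "linear L" "inj L" "(co i n \<circ> dorb \<psi>2 B2 (P \<zeta>) n) \<circ> L = co i n \<circ> dorb \<psi>1 B1 \<zeta>' n"
    have \<zeta>K: "\<zeta> \<in> K" "P \<zeta> \<in> Q2" using \<zeta> X K by auto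
    have "C_slope * \<theta> ^ n \<le> C_slope * \<theta> ^ k0"
      using C_slope n(4) by (intro mult_left_mono power_decreasing) auto
    then have small: "C_slope * \<theta> ^ n \<le> 1 / 2" "C_slope * \<theta> ^ k0 \<le> 1 / 2"
      and le: "C_slope * \<theta> ^ n \<le> \<epsilon> / (2 * ?m)"
      using k0(1) by auto
    have small3: "2 * ?m * (C_slope * \<theta> ^ n) \<le> \<epsilon>"
      using le m by (simp add: pos_le_divide_eq mult_ac)
    have 1: "\<bar>ln (vol_ratio L) - (lnvol \<psi>2 B2 (P \<zeta>) n - lnvol \<psi>1 B1 \<zeta>' n)\<bar> \<le> \<epsilon>"
      using ln_vol_ratio_le[OF disc1 disc2 i \<zeta>(2) \<zeta>K(2) slow(2,3) order_refl small(1) L] small3 by linarith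
    have 2: "\<bar>(lnvol \<psi>2 B2 (P \<zeta>) n - lnvol \<psi>1 B1 \<zeta>' n) - (lnvol \<psi>2 B2 (P \<zeta>) k0 - lnvol \<psi>1 B1 \<zeta>' k0)\<bar> \<le> \<epsilon>"
      using lnvol_tail[OF disc1 disc2 i \<zeta>(2) \<zeta>K(2) slow(2,3) n(4) order_refl small(2)] k0(2) by (simp add: T_def)
    have 3: "\<bar>lnvol \<psi>1 B1 \<zeta>' k0 - lnvol \<psi>1 B1 \<zeta> k0\<bar> \<le> \<epsilon>"
      by (rule lnclose[OF \<zeta>(1) dd[OF near]])
    have 4: "\<bar>lim (\<lambda>n. R n \<zeta>) - R k0 \<zeta>\<bar> \<le> \<epsilon>"
      using R_lim[OF \<zeta>K(1) small(2)] k0(2) by linarith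
    have "ln (vol_ratio L) \<le> ln c + 4 * \<epsilon>"
      using 1 2 3 4 c(2)[OF \<zeta>(1)] by linarith
    then have "exp (ln (vol_ratio L)) \<le> exp (ln c + 4 * \<epsilon>)" by simp
    then show "vol_ratio L \<le> c * exp (4 * \<epsilon>)"
      using emeasure_linear_image(2)[OF L(1,2), of "{}"] c(1) by (simp add: exp_add)
  qed
qed

text \<open>Three limits in turn: \<open>q\<close> to 0, then the open set \<open>V\<close> down to
  \<open>X\<close> by outer regularity, then \<open>\<epsilon>\<close> to 0.\<close>

lemma holonomy_bound:
  fixes c :: real
  assumes X: "compact X" "X \<subseteq> K" and c: "0 < c" "\<And>\<zeta>. \<zeta> \<in> X \<Longrightarrow> lim (\<lambda>n. R n \<zeta>) \<le> ln c"
  shows "emeasure lborel (P ` X) \<le> ennreal c * emeasure lborel X"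
proof -
  have fin: "emeasure lborel X < \<infinity>" by (rule emeasure_compact_finite[OF X(1)])
  have 1: "emeasure lborel (P ` X) \<le> ennreal (c * exp (4 * \<epsilon>)) * emeasure lborel V"
    if V: "open V" "X \<subseteq> V" and \<epsilon>: "0 < \<epsilon>" for V and \<epsilon> :: real
  proof (rule ennreal_le_if_le_mult)
    fix t :: real assume t: "1 < t"
    \<comment> \<open>Solves \<open>(1 + q) / (1 - q) = t\<close>.\<close>
    define q where "q = (t - 1) / (t + 1)"
    have q: "0 < q" "q \<le> 1" "1 - q = 2 / (t + 1)" "1 + q = 2 * t / (t + 1)" using t by (auto simp: q_def field_simps)
    have "ennreal ((t + 1) / 2) * (ennreal (1 - q) * emeasure lborel (P ` X)) \<le> ennreal ((t + 1) / 2) * (ennreal ((1 + q) * (c * exp (4 * \<epsilon>))) * emeasure lborel V)"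
      by (intro mult_left_mono holonomy_bound_open[OF X c V \<epsilon> q(1,2)]) auto
    moreover have "ennreal ((t + 1) / 2) * ennreal (1 - q) = 1"
      using t by (simp add: q(3) flip: ennreal_mult)
    moreover have "ennreal ((t + 1) / 2) * ennreal ((1 + q) * (c * exp (4 * \<epsilon>))) = ennreal t * ennreal (c * exp (4 * \<epsilon>))"
      using t c by (simp add: q(4) flip: ennreal_mult)
    ultimately show "emeasure lborel (P ` X) \<le> ennreal t * (ennreal (c * exp (4 * \<epsilon>)) * emeasure lborel V)"
      by (simp add: mult.assoc[symmetric])
  qed
  have 2: "emeasure lborel (P ` X) \<le> ennreal (c * exp (4 * \<epsilon>)) * emeasure lborel X" if \<epsilon>: "0 < \<epsilon>" for \<epsilon> :: real
  proof (rule ennreal_le_epsilon)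
    fix e :: real assume e: "0 < e"
    let ?c = "c * exp (4 * \<epsilon>)"
    have "0 < e / ?c" using e c by simp
    then obtain V where V: "X \<subseteq> V" "open V" "emeasure lborel (V - X) < ennreal (e / ?c)"
      using outer_regular_lborel[OF borel_compact[OF X(1)], of "e / ?c"] by metis
    have "emeasure lborel V \<le> emeasure lborel X + emeasure lborel (V - X)"
      using emeasure_subadditive[of X lborel "V - X"] V borel_compact[OF X(1)] by (simp add: Un_absorb1)
    also have "\<dots> \<le> emeasure lborel X + ennreal (e / ?c)" using V(3) by (intro add_left_mono) simp
    finally have V3: "emeasure lborel V \<le> emeasure lborel X + ennreal (e / ?c)" .
    have "emeasure lborel (P ` X) \<le> ennreal ?c * emeasure lborel V" by (rule 1[OF V(2,1) \<epsilon>])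
    also have "\<dots> \<le> ennreal ?c * (emeasure lborel X + ennreal (e / ?c))" by (intro mult_left_mono V3) auto
    also have "\<dots> = ennreal ?c * emeasure lborel X + ennreal e"
      using e c by (simp add: distrib_left flip: ennreal_mult)
    finally show "emeasure lborel (P ` X) \<le> ennreal ?c * emeasure lborel X + ennreal e" .
  qed
  show ?thesis
  proof (rule ennreal_le_if_le_mult)
    fix t :: real assume t: "1 < t"
    have "emeasure lborel (P ` X) \<le> ennreal (c * exp (4 * (ln t / 4))) * emeasure lborel X" using t by (intro 2) simp
    then show "emeasure lborel (P ` X) \<le> ennreal t * (ennreal c * emeasure lborel X)"
      using t c by (simp add: ennreal_mult mult_ac)
  qed
qed

end

end


section \<open>From upper bounds to the density of the holonomy\<close>

lemma ln_unit_vol_continuous: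
  fixes D :: "'x::metric_space \<Rightarrow> (real^'k::finite) \<Rightarrow>\<^sub>L 'a::real_normed_vector"
  assumes D: "continuous_on X D" and inj: "\<And>z. z \<in> X \<Longrightarrow> inj (D z)"
  shows "continuous_on X (\<lambda>z. ln (unit_vol (D z)))"
  unfolding continuous_on_iff
proof (intro ballI allI impI)
  fix \<zeta> and e :: real assume \<zeta>: "\<zeta> \<in> X" and e: "0 < e"
  obtain lb where lb: "0 < lb" "\<And>v. lb * norm v \<le> norm (D \<zeta> v)"
    using inj_linear_bounded_below[OF blinfun.bounded_linear_right inj[OF \<zeta>]] by blast
  define m where "m = real CARD('k)"
  have m: "0 < m" by (simp add: m_def)
  define e1 where "e1 = min (1 / 2) (e / (4 * m))"
  have e1: "0 < e1" "e1 \<le> 1 / 2" using e m by (auto simp: e1_def)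
  have "e1 \<le> e / (4 * m)" by (simp add: e1_def)
  then have e1': "2 * m * e1 \<le> e / 2" using m by (simp add: field_simps)
  have "0 < lb * e1" using lb e1 by simp
  then obtain d where d: "0 < d" "\<And>\<zeta>'. \<zeta>' \<in> X \<Longrightarrow> dist \<zeta>' \<zeta> < d \<Longrightarrow> dist (D \<zeta>') (D \<zeta>) < lb * e1"
    using D \<zeta> unfolding continuous_on_iff by blast
  have "dist (ln (unit_vol (D \<zeta>'))) (ln (unit_vol (D \<zeta>))) < e" if \<zeta>': "\<zeta>' \<in> X" "dist \<zeta>' \<zeta> < d" for \<zeta>'
  proof -
    have close: "norm (D \<zeta>' v - D \<zeta> v) \<le> e1 * norm (D \<zeta> v)" for v
    proof -
      have "norm (D \<zeta>' v - D \<zeta> v) = norm ((D \<zeta>' - D \<zeta>) v)"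
        by (simp add: blinfun.diff_left)
      also have "\<dots> \<le> norm (D \<zeta>' - D \<zeta>) * norm v" by (rule norm_blinfun)
      also have "\<dots> \<le> (lb * e1) * norm v"
        using d(2)[OF \<zeta>'] by (intro mult_right_mono) (auto simp: dist_norm)
      also have "\<dots> = e1 * (lb * norm v)" by simp
      also have "\<dots> \<le> e1 * norm (D \<zeta> v)"
        using lb(2)[of v] e1 by (intro mult_left_mono) auto
      finally show ?thesis .
    qed
    have "\<bar>ln (unit_vol (D \<zeta>')) - ln (unit_vol (D \<zeta>))\<bar> \<le> real (2 * DIM(real^'k)) * e1"
      using e1 inj[OF \<zeta>] by (intro ln_unit_vol_close(2)[OF _ _ _ close]) (auto simp: blinfun.bounded_linear_right)
    also have "\<dots> = 2 * m * e1" by (simp add: m_def)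
    also have "\<dots> < e" using e1' e by linarith
    finally show ?thesis by (simp add: dist_real_def)
  qed
  with d(1) show "\<exists>d>0. \<forall>\<zeta>'\<in>X. dist \<zeta>' \<zeta> < d \<longrightarrow> dist (ln (unit_vol (D \<zeta>'))) (ln (unit_vol (D \<zeta>))) < e" by blast
qed

context hyperbolic_charts
begin

lemma lnvol_continuous:
  assumes disc: "disc \<psi> B Q c" and X: "X \<subseteq> Q" and slow: "\<And>\<zeta>. \<zeta> \<in> X \<Longrightarrow> \<exists>i\<in>U. slow i n (orb \<psi> \<zeta>)"
  shows "continuous_on X (\<lambda>\<zeta>. lnvol \<psi> B \<zeta> n)"
proof (rule ln_unit_vol_continuous)
  show "continuous_on X (\<lambda>\<zeta>. dorb \<psi> B \<zeta> n)"
    using dorb_continuous[OF disc] X by (rule continuous_on_subset)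
  fix \<zeta> assume \<zeta>: "\<zeta> \<in> X"
  then obtain i where i: "i \<in> U" "slow i n (orb \<psi> \<zeta>)" using slow by blast
  have "\<zeta> \<in> Q" using \<zeta> X by blast
  then show "inj (dorb \<psi> B \<zeta> n)" by (rule dorb_inj(1)[OF disc i(1) _ i(2) order_refl])
qed

context
  fixes \<psi>1 B1 Q1 c1 \<psi>2 B2 Q2 c2 K P C0
  assumes disc1: "disc \<psi>1 B1 Q1 c1" and disc2: "disc \<psi>2 B2 Q2 c2"
    and K: "compact K" "K \<subseteq> Q1" "continuous_on K P" "inj_on P K" "P ` K \<subseteq> Q2"
    and leaf: "\<And>\<zeta>. \<zeta> \<in> K \<Longrightarrow> \<exists>i. leaf_pair \<psi>1 \<psi>2 C0 i \<zeta> (P \<zeta>)" and C0: "0 < C0" "(4 * l0 + 3) * C0 \<le> r"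
begin

abbreviation "lnD \<zeta> \<equiv> lim (\<lambda>n. lnvol \<psi>2 B2 (P \<zeta>) n - lnvol \<psi>1 B1 \<zeta> n)"

lemma inv_holonomy_continuous: "continuous_on (P ` K) (inv_into K P)"
  using continuous_on_inv[OF K(3,1)] K(4) by (metis inv_into_f_f)

lemma image_borel:
  assumes "Y \<in> sets borel" "Y \<subseteq> K"
  shows "P ` Y \<in> sets borel"
proof -
  have "P ` Y = inv_into K P -` Y \<inter> space (restrict_space borel (P ` K))"
    using assms(2) K(4) inv_into_into[of _ P K] f_inv_into_f[of _ P K]
    by (auto simp: space_restrict_space subset_eq)
  moreover have "\<dots> \<in> sets (restrict_space borel (P ` K))"
    by (rule measurable_sets[OF borel_measurable_continuous_on_restrict[OF inv_holonomy_continuous] assms(1)])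
  ultimately show ?thesis
    using borel_compact[OF compact_continuous_image[OF K(3,1)]] by (simp add: sets_restrict_space_iff)
qed

text \<open>The inner approximation is done in the image: absolute continuity of \<open>P\<close> is
  not yet known, so a compact subset filling most of \<open>Y\<close> could have a much smaller
  image. Compact subsets of the image pull back to compact sets by continuity of the
  inverse.\<close>

lemma holonomy_upper:
  assumes Y: "Y \<in> sets borel" "Y \<subseteq> K" and c: "0 < c" "\<And>\<zeta>. \<zeta> \<in> Y \<Longrightarrow> lnD \<zeta> \<le> ln c"
  shows "emeasure lborel (P ` Y) \<le> ennreal c * emeasure lborel Y"
proof (rule ennreal_le_epsilon)
  fix e :: real assume "0 < e"
  have PY: "P ` Y \<in> sets borel" by (rule image_borel[OF Y])
  then obtain T where T: "closed T" "T \<subseteq> P ` Y" "emeasure lebesgue (P ` Y - T) < ennreal e"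
    using sets_lebesgue_inner_closed[of "P ` Y" e] \<open>0 < e\<close> by auto
  have "compact (P ` K)" by (rule compact_continuous_image[OF K(3,1)])
  moreover have TK: "T \<subseteq> P ` K" using T(2) Y(2) by blast
  ultimately have cT: "compact T" using T(1) by (metis closed_Int_compact inf.absorb1)
  define X where "X = inv_into K P ` T"
  have X: "compact X" "X \<subseteq> Y"
  proof -
    show "compact X" unfolding X_def
      by (rule compact_continuous_image[OF continuous_on_subset[OF inv_holonomy_continuous TK] cT])
    show "X \<subseteq> Y"
    proof
      fix x assume "x \<in> X"
      then obtain t where t: "t \<in> T" "x = inv_into K P t" by (auto simp: X_def)
      then obtain y where y: "y \<in> Y" "t = P y" using T(2) by blast
      have "y \<in> K" using y Y(2) by blast
      then show "x \<in> Y" using t y K(4) by simp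
    qed
  qed
  have PX: "P ` X = T"
    unfolding X_def image_image using TK f_inv_into_f[of _ P K] by force
  have "emeasure lborel T \<le> ennreal c * emeasure lborel X"
    using holonomy_bound[OF disc1 disc2 K leaf C0 X(1) _ c(1) c(2)] X(2) Y(2) unfolding PX[symmetric] by blast
  also have "\<dots> \<le> ennreal c * emeasure lborel Y"
    using X(2) Y by (intro mult_left_mono emeasure_mono) auto
  finally have 1: "emeasure lborel T \<le> ennreal c * emeasure lborel Y" .
  have "emeasure lborel (P ` Y - T) \<le> ennreal e"
    using T(3) PY borel_closed[OF T(1)] by (simp add: less_imp_le)
  moreover have "emeasure lborel (P ` Y) \<le> emeasure lborel T + emeasure lborel (P ` Y - T)"
    using emeasure_subadditive[of T lborel "P ` Y - T"] T PY borel_closed[OF T(1)] by (simp add: Un_absorb1)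
  ultimately show "emeasure lborel (P ` Y) \<le> ennreal c * emeasure lborel Y + ennreal e"
    using 1 by (meson add_mono order_trans)
qed

lemma lnD_measurable: "(\<lambda>\<zeta>. if \<zeta> \<in> K then lnD \<zeta> else 0) \<in> borel_measurable borel"
proof (rule borel_measurable_LIMSEQ_real)
  let ?R = "\<lambda>n \<zeta>. lnvol \<psi>2 B2 (P \<zeta>) n - lnvol \<psi>1 B1 \<zeta> n"
  show "(\<lambda>n. if \<zeta> \<in> K then ?R n \<zeta> else 0) \<longlonglongrightarrow> (if \<zeta> \<in> K then lnD \<zeta> else 0)" for \<zeta>
    using R_convergent[OF disc1 disc2 K leaf C0] by simp
  show "(\<lambda>\<zeta>. if \<zeta> \<in> K then ?R n \<zeta> else 0) \<in> borel_measurable borel" for n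
  proof (rule borel_measurable_continuous_on_if)
    show "K \<in> sets borel" by (rule borel_compact[OF K(1)])
    have 1: "continuous_on K (\<lambda>\<zeta>. lnvol \<psi>1 B1 \<zeta> n)"
      by (rule lnvol_continuous[OF disc1 K(2)]) (metis leaf_slow[OF disc1 disc2 K leaf C0])
    have "continuous_on (P ` K) (\<lambda>\<omega>. lnvol \<psi>2 B2 \<omega> n)"
    proof (rule lnvol_continuous[OF disc2 K(5)])
      fix \<omega> assume "\<omega> \<in> P ` K"
      then show "\<exists>i\<in>U. slow i n (orb \<psi>2 \<omega>)" using leaf_slow[OF disc1 disc2 K leaf C0] by (metis imageE)
    qed
    then have 2: "continuous_on K (\<lambda>\<zeta>. lnvol \<psi>2 B2 (P \<zeta>) n)"
      by (rule continuous_on_compose2[OF _ K(3)]) simp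
    show "continuous_on K (?R n)" by (intro continuous_on_diff 1 2)
  qed (auto intro: continuous_intros)
qed

end

text \<open>The situation is symmetric in the two discs. Applied to the inverse holonomy, whose
  limit is \<open>- L\<close>, the upper bound becomes the lower bound that
  \<open>emeasure_image_eq_nn_integral\<close> asks for.\<close>

lemma holonomy_density:
  fixes P and K and Q1 Q2
  assumes disc1: "disc \<psi>1 B1 Q1 c1" and disc2: "disc \<psi>2 B2 Q2 c2"
    and K: "compact K" "K \<subseteq> Q1" "continuous_on K P" "inj_on P K" "P ` K \<subseteq> Q2"
    and leaf: "\<And>\<zeta>. \<zeta> \<in> K \<Longrightarrow> \<exists>i. leaf_pair \<psi>1 \<psi>2 C0 i \<zeta> (P \<zeta>)" and C0: "0 < C0" "(4 * l0 + 3) * C0 \<le> r"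
    and X: "X \<in> sets borel" "X \<subseteq> K"
  defines "L \<equiv> \<lambda>\<zeta>. lim (\<lambda>n. lnvol \<psi>2 B2 (P \<zeta>) n - lnvol \<psi>1 B1 \<zeta> n)"
  shows "emeasure lborel (P ` X) = (\<integral>\<^sup>+\<zeta>\<in>X. ennreal (exp (L \<zeta>)) \<partial>lborel)"
proof -
  define D where "D \<zeta> = exp (if \<zeta> \<in> K then L \<zeta> else 0)" for \<zeta>
  let ?K = "P ` K" and ?P = "inv_into K P"
  have Dm: "D \<in> borel_measurable borel"
    unfolding D_def L_def by (rule borel_measurable_exp[THEN measurable_compose[rotated]]) (rule lnD_measurable[OF disc1 disc2 K leaf C0])
  have K': "compact ?K" "?K \<subseteq> Q2" "continuous_on ?K ?P" "inj_on ?P ?K" "?P ` ?K \<subseteq> Q1"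
    using compact_continuous_image[OF K(3,1)] K inv_holonomy_continuous[OF disc1 disc2 K leaf C0]
    by (auto simp: inj_on_inv_into)
  have leaf': "\<exists>i. leaf_pair \<psi>2 \<psi>1 C0 i \<omega> (?P \<omega>)" if "\<omega> \<in> ?K" for \<omega>
    using leaf[of "?P \<omega>"] inv_into_into[OF that] f_inv_into_f[OF that] by (auto simp: leaf_pair_def)
  have "emeasure lborel (P ` X) = (\<integral>\<^sup>+\<zeta>\<in>X. ennreal (D \<zeta>) \<partial>lborel)"
  proof (rule emeasure_image_eq_nn_integral[OF X(1) Dm])
    show "inj_on P X" using K(4) X(2) by (rule inj_on_subset)
    show "0 < D \<zeta>" for \<zeta> by (simp add: D_def)
    fix Y :: "(real^'k) set" assume Y: "Y \<in> sets borel" "Y \<subseteq> X"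
    then have YK: "Y \<subseteq> K" using X by blast
    show PYm: "P ` Y \<in> sets borel" by (rule image_borel[OF disc1 disc2 K leaf C0 Y(1) YK])
    fix c :: real assume c: "0 < c"
    show "emeasure lborel (P ` Y) \<le> ennreal c * emeasure lborel Y" if le: "\<forall>\<zeta>\<in>Y. D \<zeta> \<le> c"
    proof (rule holonomy_upper[OF disc1 disc2 K leaf C0 Y(1) YK c])
      fix \<zeta> assume "\<zeta> \<in> Y"
      then have "D \<zeta> \<le> c" "\<zeta> \<in> K" using le YK by blast+
      then have "exp (L \<zeta>) \<le> c" by (simp add: D_def)
      then have "ln (exp (L \<zeta>)) \<le> ln c" using c by (subst ln_le_cancel_iff) auto
      then show "lim (\<lambda>n. lnvol \<psi>2 B2 (P \<zeta>) n - lnvol \<psi>1 B1 \<zeta> n) \<le> ln c" by (simp add: L_def)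
    qed
    show "ennreal c * emeasure lborel Y \<le> emeasure lborel (P ` Y)" if ge: "\<forall>\<zeta>\<in>Y. c \<le> D \<zeta>"
    proof -
      have "emeasure lborel (?P ` P ` Y) \<le> ennreal (1 / c) * emeasure lborel (P ` Y)"
      proof (rule holonomy_upper[OF disc2 disc1 K' leaf' C0 PYm])
        show "P ` Y \<subseteq> P ` K" using YK by blast
        show "0 < 1 / c" using c by simp
        fix \<omega> assume "\<omega> \<in> P ` Y"
        then obtain \<zeta> where \<zeta>: "\<zeta> \<in> Y" "\<omega> = P \<zeta>" by blast
        then have inv: "?P \<omega> = \<zeta>" using YK K(4) by auto
        have "c \<le> D \<zeta>" "\<zeta> \<in> K" using ge \<zeta> YK by blast+
        then have "c \<le> exp (L \<zeta>)" by (simp add: D_def)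
        then have lnc: "ln c \<le> ln (exp (L \<zeta>))" using c by (subst ln_le_cancel_iff) auto
        have lim: "(\<lambda>n. lnvol \<psi>2 B2 (P \<zeta>) n - lnvol \<psi>1 B1 \<zeta> n) \<longlonglongrightarrow> L \<zeta>"
          unfolding L_def using \<zeta> YK by (intro R_convergent[OF disc1 disc2 K leaf C0]) auto
        have "(\<lambda>n. lnvol \<psi>1 B1 (?P \<omega>) n - lnvol \<psi>2 B2 \<omega> n) \<longlonglongrightarrow> - L \<zeta>"
          using tendsto_minus[OF lim] unfolding inv by (simp add: \<zeta>(2))
        then have "lim (\<lambda>n. lnvol \<psi>1 B1 (?P \<omega>) n - lnvol \<psi>2 B2 \<omega> n) = - L \<zeta>" by (rule limI)
        with lnc show "lim (\<lambda>n. lnvol \<psi>1 B1 (?P \<omega>) n - lnvol \<psi>2 B2 \<omega> n) \<le> ln (1 / c)"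
          using c by (simp add: ln_div)
      qed
      moreover have "?P ` P ` Y = Y"
        using YK K(4) by (simp add: inv_into_image_cancel)
      ultimately have "ennreal c * emeasure lborel Y \<le> ennreal c * (ennreal (1 / c) * emeasure lborel (P ` Y))"
        by (metis mult_left_mono zero_le)
      also have "\<dots> = emeasure lborel (P ` Y)"
        using c by (simp add: mult.assoc[symmetric] flip: ennreal_mult)
      finally show ?thesis .
    qed
  qed
  also have "\<dots> = (\<integral>\<^sup>+\<zeta>\<in>X. ennreal (exp (L \<zeta>)) \<partial>lborel)"
    using X(2) by (intro nn_integral_cong) (auto simp: D_def indicator_def)
  finally show ?thesis .
qed

end


section \<open>The induced volume of a graph\<close>

text \<open>\<open>P\<close> transports the measure with density \<open>D\<close> on
  \<open>X\<close> to Lebesgue measure on the image; equality of these measures on Borel sets gives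
  equality of integrals.\<close>

lemma nn_integral_image:
  fixes P :: "'e::euclidean_space \<Rightarrow> 'e" and D :: "'e \<Rightarrow> ennreal"
  assumes X: "X \<in> sets borel" and PX: "P ` X \<in> sets borel" and P: "P \<in> borel_measurable (restrict_space borel X)" "inj_on P X"
    and D: "D \<in> borel_measurable borel"
    and em: "\<And>Y. Y \<in> sets borel \<Longrightarrow> Y \<subseteq> X \<Longrightarrow> emeasure lborel (P ` Y) = (\<integral>\<^sup>+x\<in>Y. D x \<partial>lborel)"
    and h: "h \<in> borel_measurable borel"
  shows "(\<integral>\<^sup>+\<omega>\<in>P ` X. h \<omega> \<partial>lborel) = (\<integral>\<^sup>+x\<in>X. D x * h (P x) \<partial>lborel)"
proof -
  note [measurable] = X PX D h
  let ?M = "density (restrict_space lborel X) D"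
  have P': "P \<in> borel_measurable (restrict_space lborel X)"
    using P(1) by (simp cong: measurable_cong_sets add: sets_restrict_space)
  have Dr: "D \<in> borel_measurable (restrict_space lborel X)"
    using D by (intro measurable_restrict_space1) simp
  define N where "N = distr ?M borel P"
  have Pm: "P \<in> borel_measurable ?M" using P' by simp
  have "N = density lborel (indicator (P ` X))"
  proof (rule measure_eqI)
    fix A assume "A \<in> sets N"
    then have A[measurable]: "A \<in> sets borel" by (simp add: N_def)
    let ?Y = "P -` A \<inter> X"
    have Y: "?Y \<in> sets borel"
      using measurable_sets[OF P(1) A] X by (simp add: space_restrict_space sets_restrict_space_iff)
    have "emeasure N A = emeasure ?M ?Y"
      using Pm A by (simp add: N_def emeasure_distr space_restrict_space)
    also have "\<dots> = (\<integral>\<^sup>+x. D x * indicator ?Y x \<partial>restrict_space lborel X)"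
      using Y X Dr by (intro emeasure_density) (auto simp: sets_restrict_space_iff)
    also have "\<dots> = (\<integral>\<^sup>+x\<in>?Y. D x \<partial>lborel)"
      using X by (simp add: nn_integral_restrict_space) (intro nn_integral_cong, auto simp: indicator_def)
    also have "\<dots> = emeasure lborel (P ` ?Y)"
      using Y by (intro em[symmetric]) auto
    also have "P ` ?Y = P ` X \<inter> A" by auto
    also have "emeasure lborel (P ` X \<inter> A) = emeasure (density lborel (indicator (P ` X))) A"
      by (simp add: emeasure_density flip: indicator_inter_arith)
    finally show "emeasure N A = emeasure (density lborel (indicator (P ` X))) A" .
  qed (simp add: N_def)
  then have "nn_integral N h = nn_integral (density lborel (indicator (P ` X))) h" by simp
  moreover have "nn_integral N h = (\<integral>\<^sup>+x\<in>X. D x * h (P x) \<partial>lborel)"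
    unfolding N_def using Pm P' X Dr
    by (simp add: nn_integral_distr nn_integral_density nn_integral_restrict_space)
  ultimately show ?thesis by (simp add: nn_integral_density mult.commute)
qed

lemma vol_ratio_inverse:
  fixes L M :: "real^'k::finite \<Rightarrow> real^'k"
  assumes "linear L" "inj L" "linear M" "inj M" "L \<circ> M = id"
  shows "vol_ratio M = 1 / vol_ratio L"
proof -
  have bl: "bounded_linear M" using assms(3) linear_conv_bounded_linear[THEN iffD1] by blast
  have "compact (M ` cball 0 1)"
    by (intro compact_continuous_image linear_continuous_on bl) auto
  then have "M ` cball 0 1 \<in> sets borel" by (rule borel_compact)
  from emeasure_linear_image(1)[OF assms(1,2) this]
  have "emeasure lborel (cball (0::real^'k) 1) = ennreal (vol_ratio L) * (ennreal (vol_ratio M) * emeasure lborel (cball (0::real^'k) 1))"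
    using assms(5) emeasure_linear_image(1)[OF assms(3,4), of "cball 0 1"] by (simp add: image_comp)
  moreover have cb: "emeasure lborel (cball (0::real^'k) 1) = ennreal (measure lborel (cball (0::real^'k) 1))"
    "0 < measure lborel (cball (0::real^'k) 1)"
    using emeasure_compact_finite[of "cball (0::real^'k) 1"] content_cball_pos[of 1 "0::real^'k"]
    by (auto simp: emeasure_eq_ennreal_measure)
  have p: "0 < vol_ratio L" "0 < vol_ratio M"
    using emeasure_linear_image(2)[OF assms(1,2), of "{}"] emeasure_linear_image(2)[OF assms(3,4), of "{}"] by auto
  ultimately have "measure lborel (cball (0::real^'k) 1) = vol_ratio L * (vol_ratio M * measure lborel (cball (0::real^'k) 1))"
    unfolding cb(1) by (simp add: flip: ennreal_mult)
  then show ?thesis using p cb(2) by (simp add: field_simps)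
qed

text \<open>A manifold that one chart covers up to its boundary. The map \<open>\<rho>\<close>
  inverts \<open>\<psi>\<close> at all parametrised points and is defined on the whole ambient
  space, so transition maps arise as \<open>\<rho>\<close> after another parametrisation. The
  condition \<open>trans\<close> also says that no parametrisation reaches a point outside the
  chart.\<close>

locale volume_chart =
  fixes W :: "'a::real_normed_vector set" and Q :: "(real^'k::finite) set" and \<psi> :: "real^'k \<Rightarrow> 'a"
    and \<rho> :: "'a \<Rightarrow> real^'k"
  assumes W: "W \<in> sets borel" and chart: "local_param W Q \<psi>"
    and trans: "\<And>Q' (\<psi>' :: real^'k \<Rightarrow> 'a) z. local_param W Q' \<psi>' \<Longrightarrow> z \<in> Q' \<Longrightarrow>
      \<rho> (\<psi>' z) \<in> Q \<and> \<psi> (\<rho> (\<psi>' z)) = \<psi>' z \<and> (\<exists>u'. ((\<lambda>z. \<rho> (\<psi>' z)) has_derivative u') (at z))"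
begin

definition dpar :: "(real^'k) set \<Rightarrow> (real^'k \<Rightarrow> 'a) \<Rightarrow> real^'k \<Rightarrow> (real^'k) \<Rightarrow>\<^sub>L 'a" where
  "dpar Q' \<psi>' = (SOME D. continuous_on Q' D \<and> (\<forall>z\<in>Q'. (\<psi>' has_derivative blinfun_apply (D z)) (at z) \<and> inj (blinfun_apply (D z))))"

lemma dpar:
  fixes \<psi>' :: "real^'k \<Rightarrow> 'a"
  assumes "local_param W Q' \<psi>'"
  shows "continuous_on Q' (dpar Q' \<psi>')" "\<And>z. z \<in> Q' \<Longrightarrow> (\<psi>' has_derivative dpar Q' \<psi>' z) (at z)" "\<And>z. z \<in> Q' \<Longrightarrow> inj (dpar Q' \<psi>' z)"
proof -
  have "\<exists>D. continuous_on Q' D \<and> (\<forall>z\<in>Q'. (\<psi>' has_derivative blinfun_apply (D z)) (at z) \<and> inj (blinfun_apply (D z)))"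
    using assms by (simp add: local_param_def)
  from someI_ex[OF this] show "continuous_on Q' (dpar Q' \<psi>')" "\<And>z. z \<in> Q' \<Longrightarrow> (\<psi>' has_derivative dpar Q' \<psi>' z) (at z)" "\<And>z. z \<in> Q' \<Longrightarrow> inj (dpar Q' \<psi>' z)"
    unfolding dpar_def[symmetric] by auto
qed

lemma param_open:
  fixes \<psi>' :: "real^'k \<Rightarrow> 'a"
  shows "local_param W Q' \<psi>' \<Longrightarrow> open Q'"
  by (simp add: local_param_def)

lemma param_inj:
  fixes \<psi>' :: "real^'k \<Rightarrow> 'a"
  shows "local_param W Q' \<psi>' \<Longrightarrow> inj_on \<psi>' Q'"
  unfolding local_param_def homeomorphism_def by (auto intro: inj_on_inverseI)

lemma param_continuous:
  fixes \<psi>' :: "real^'k \<Rightarrow> 'a"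
  shows "local_param W Q' \<psi>' \<Longrightarrow> continuous_on Q' \<psi>'"
  unfolding local_param_def homeomorphism_def by blast

lemma jacobian:
  fixes \<psi>' :: "real^'k \<Rightarrow> 'a"
  assumes "local_param W Q' \<psi>'" "z \<in> Q'"
  shows "volume_jacobian \<psi>' z = unit_ball_vol (real CARD('k)) / unit_vol (dpar Q' \<psi>' z)"
  by (rule volume_jacobian_eq[OF blinfun.bounded_linear_right dpar(3)[OF assms] dpar(2)[OF assms]])

lemma jacobian_pos:
  fixes \<psi>' :: "real^'k \<Rightarrow> 'a"
  assumes "local_param W Q' \<psi>'" "z \<in> Q'"
  shows "0 < volume_jacobian \<psi>' z"
  unfolding jacobian[OF assms] using unit_vol_pos[OF blinfun.bounded_linear_right dpar(3)[OF assms]] unit_ball_vol_pos[of "real CARD('k)"]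
  by (intro divide_pos_pos) auto

lemma jacobian_continuous:
  fixes \<psi>' :: "real^'k \<Rightarrow> 'a"
  assumes "local_param W Q' \<psi>'"
  shows "continuous_on Q' (volume_jacobian \<psi>')"
proof -
  have "continuous_on Q' (\<lambda>z. unit_ball_vol (real CARD('k)) * exp (- ln (unit_vol (dpar Q' \<psi>' z))))"
    by (intro continuous_on_mult_left continuous_on_exp continuous_on_minus ln_unit_vol_continuous dpar[OF assms])
  moreover have "volume_jacobian \<psi>' z = unit_ball_vol (real CARD('k)) * exp (- ln (unit_vol (dpar Q' \<psi>' z)))" if "z \<in> Q'" for z
    unfolding jacobian[OF assms that] using unit_vol_pos[OF blinfun.bounded_linear_right dpar(3)[OF assms that]]
    by (simp add: exp_minus divide_inverse)
  ultimately show ?thesis by (simp cong: continuous_on_cong)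
qed

context
  fixes Q' and \<psi>' :: "real^'k \<Rightarrow> 'a"
  assumes chart': "local_param W Q' \<psi>'"
begin

definition "tr z = \<rho> (\<psi>' z)"

lemma tr: "z \<in> Q' \<Longrightarrow> tr z \<in> Q" "z \<in> Q' \<Longrightarrow> \<psi> (tr z) = \<psi>' z"
  using trans[OF chart'] by (auto simp: tr_def)

lemma tr_inj: "inj_on tr Q'"
  using param_inj[OF chart'] tr(2) by (metis inj_onI inj_onD)

lemma tr_derivative:
  assumes "z \<in> Q'"
  obtains u' where "(tr has_derivative u') (at z)" "linear u'" "inj u'" "blinfun_apply (dpar Q' \<psi>' z) = dpar Q \<psi> (tr z) \<circ> u'"
proof -
  obtain u' where u': "(tr has_derivative u') (at z)"
    using trans[OF chart' assms] by (auto simp: tr_def[abs_def])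
  have "((\<lambda>z. \<psi> (tr z)) has_derivative (\<lambda>v. dpar Q \<psi> (tr z) (u' v))) (at z)"
    by (rule has_derivative_compose[OF u' dpar(2)[OF chart tr(1)[OF assms]]])
  then have "(\<psi>' has_derivative (\<lambda>v. dpar Q \<psi> (tr z) (u' v))) (at z)"
    using param_open[OF chart'] assms tr(2) by (rule has_derivative_transform_within_open)
  then have eq: "blinfun_apply (dpar Q' \<psi>' z) = dpar Q \<psi> (tr z) \<circ> u'"
    using has_derivative_unique[OF dpar(2)[OF chart' assms]] by (simp add: o_def)
  then have "inj u'" using dpar(3)[OF chart' assms] by (metis inj_on_imageI2)
  then show thesis using that[OF u' has_derivative_linear[OF u'] _ eq] by blast
qed

lemma tr_continuous: "continuous_on Q' tr"
proof (rule continuous_at_imp_continuous_on, rule ballI)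
  fix z assume "z \<in> Q'"
  then obtain u' where "(tr has_derivative u') (at z)" using tr_derivative by blast
  then show "isCont tr z" by (rule has_derivative_continuous)
qed

lemma tr_homeo:
  obtains v where "homeomorphism Q' (tr ` Q') tr v"
  using invariance_of_domain_homeomorphism[OF param_open[OF chart'] tr_continuous _ tr_inj] by auto

lemma tr_open: "open T \<Longrightarrow> T \<subseteq> Q' \<Longrightarrow> open (tr ` T)"
  using invariance_of_domain[OF continuous_on_subset[OF tr_continuous] _ inj_on_subset[OF tr_inj]] by blast

text \<open>The two tangent parametrisations differ by the derivative of the transition map, so
  \<open>unit_vol_compose\<close> applies, and the constant \<open>unit_ball_vol\<close>
  cancels.\<close>

lemma tr_vol_ratio:
  assumes "z \<in> Q'" "(tr has_derivative u') (at z)"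
  shows "linear u'" "inj u'" "vol_ratio u' = volume_jacobian \<psi>' z / volume_jacobian \<psi> (tr z)"
proof -
  obtain u'' where u: "(tr has_derivative u'') (at z)" "linear u''" "inj u''" "blinfun_apply (dpar Q' \<psi>' z) = dpar Q \<psi> (tr z) \<circ> u''"
    using tr_derivative[OF assms(1)] by blast
  have [simp]: "u'' = u'" using has_derivative_unique[OF u(1) assms(2)] .
  show "linear u'" "inj u'" using u by auto
  note z = tr(1)[OF assms(1)]
  note bl = blinfun.bounded_linear_right
  have "unit_vol (dpar Q \<psi> (tr z)) = vol_ratio u' * unit_vol (dpar Q' \<psi>' z)"
    using unit_vol_compose[OF bl dpar(3)[OF chart z] u(2,3)] u(4) by simp
  moreover have "0 < unit_vol (dpar Q \<psi> (tr z))" "0 < unit_vol (dpar Q' \<psi>' z)" "unit_ball_vol (real CARD('k)) \<noteq> 0"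
    using unit_vol_pos[OF bl dpar(3)[OF chart z]] unit_vol_pos[OF bl dpar(3)[OF chart' assms(1)]]
      unit_ball_vol_pos[of "real CARD('k)"] by (auto simp del: unit_ball_vol_pos)
  ultimately show "vol_ratio u' = volume_jacobian \<psi>' z / volume_jacobian \<psi> (tr z)"
    by (simp add: jacobian[OF chart' assms(1)] jacobian[OF chart z])
qed

lemma tr_borel:
  assumes "Y \<in> sets borel" "Y \<subseteq> Q'" shows "tr ` Y \<in> sets borel"
proof -
  obtain v where v: "homeomorphism Q' (tr ` Q') tr v" using tr_homeo by blast
  have op: "open (tr ` Q')" using tr_open[OF param_open[OF chart'] order_refl] .
  have "tr ` Y = v -` Y \<inter> space (restrict_space borel (tr ` Q'))"
    using v assms(2) by (auto simp: homeomorphism_def space_restrict_space)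
  moreover have "v -` Y \<inter> space (restrict_space borel (tr ` Q')) \<in> sets (restrict_space borel (tr ` Q'))"
    using v by (intro measurable_sets[OF borel_measurable_continuous_on_restrict assms(1)]) (simp add: homeomorphism_def)
  ultimately show ?thesis using op by (simp add: sets_restrict_space_iff)
qed

text \<open>This is the independence of the parametrisation. Upper bounds for volumes of images come
  from the derivative of the transition map, lower bounds from the same inequality for its
  inverse.\<close>

lemma tr_volume:
  assumes X: "X \<in> sets borel" "X \<subseteq> Q'"
  shows "(\<integral>\<^sup>+\<omega>\<in>tr ` X. ennreal (volume_jacobian \<psi> \<omega>) \<partial>lborel) = (\<integral>\<^sup>+z\<in>X. ennreal (volume_jacobian \<psi>' z) \<partial>lborel)"
proof -
  \<comment> \<open>Extended by 1 off the domains, so that both functions are Borel on the whole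
    space and \<open>D\<close> is positive everywhere.\<close>
  define J where "J z = (if z \<in> Q then volume_jacobian \<psi> z else 1)" for z
  define D where "D z = (if z \<in> Q' then volume_jacobian \<psi>' z / volume_jacobian \<psi> (tr z) else 1)" for z
  have Jm[measurable]: "J \<in> borel_measurable borel"
    unfolding J_def using param_open[OF chart] by (intro borel_measurable_continuous_on_if jacobian_continuous[OF chart]) auto
  have "continuous_on Q' (\<lambda>z. volume_jacobian \<psi> (tr z))"
    by (rule continuous_on_compose2[OF jacobian_continuous[OF chart] tr_continuous]) (use tr in auto)
  then have Dm[measurable]: "D \<in> borel_measurable borel"
    unfolding D_def using param_open[OF chart'] jacobian_pos[OF chart tr(1)] less_irrefl
    by (intro borel_measurable_continuous_on_if continuous_on_divide jacobian_continuous[OF chart']) (auto, metis less_irrefl)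
  have Dpos: "0 < D z" for z
    using jacobian_pos[OF chart'] jacobian_pos[OF chart tr(1)] by (simp add: D_def)
  define u' where "u' z = (SOME u'. (tr has_derivative u') (at z))" for z
  have u': "(tr has_derivative u' z) (at z)" if zq: "z \<in> Q'" for z
  proof -
    obtain w where "(tr has_derivative w) (at z)" using tr_derivative[OF zq] by blast
    then show ?thesis unfolding u'_def by (rule someI[of "\<lambda>u'. (tr has_derivative u') (at z)"])
  qed
  have vr: "vol_ratio (u' z) = D z" if "z \<in> Q'" for z
    using tr_vol_ratio(3)[OF that u'[OF that]] that by (simp add: D_def)
  obtain v where v: "homeomorphism Q' (tr ` Q') tr v" using tr_homeo by blast
  have v_tr: "v (tr z) = z" if "z \<in> Q'" for z using v that by (simp add: homeomorphism_def)
  have contv: "continuous_on (tr ` Q') v" using v by (simp add: homeomorphism_def)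
  have op: "open (tr ` Q')" using tr_open[OF param_open[OF chart'] order_refl] .
  have em: "emeasure lborel (tr ` Y) = (\<integral>\<^sup>+z\<in>Y. ennreal (D z) \<partial>lborel)" if Y: "Y \<in> sets borel" "Y \<subseteq> Q'" for Y
  proof (rule emeasure_image_eq_nn_integral[OF Y(1) Dm Dpos])
    show "inj_on tr Y" using tr_inj Y(2) by (rule inj_on_subset)
    fix Z assume Z: "Z \<in> sets borel" "Z \<subseteq> Y"
    then have ZQ: "Z \<subseteq> Q'" using Y by blast
    show Zm: "tr ` Z \<in> sets borel" by (rule tr_borel[OF Z(1) ZQ])
    fix c :: real assume c: "0 < c"
    show "emeasure lborel (tr ` Z) \<le> ennreal c * emeasure lborel Z" if "\<forall>z\<in>Z. D z \<le> c"
    proof (rule emeasure_differentiable_image_le[where g'=u'])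
      show "tr ` (Z \<inter> cball 0 (real n)) \<in> sets borel" for n
        using Z ZQ by (intro tr_borel) auto
      show "vol_ratio (u' z) \<le> c" if "z \<in> Z" for z
        using vr[of z] \<open>\<forall>z\<in>Z. D z \<le> c\<close> that ZQ by auto
      show "(tr has_derivative u' z) (at z within Z)" if "z \<in> Z" for z
        by (rule has_derivative_at_withinI[OF u']) (use ZQ that in blast)
    qed (use Z c in auto)
    show "ennreal c * emeasure lborel Z \<le> emeasure lborel (tr ` Z)" if ge: "\<forall>z\<in>Z. c \<le> D z"
    proof -
      have "emeasure lborel (v ` tr ` Z) \<le> ennreal (1 / c) * emeasure lborel (tr ` Z)"
      proof (rule emeasure_differentiable_image_le[where g'="\<lambda>\<omega>. inv (u' (v \<omega>))"])
        fix \<omega> assume "\<omega> \<in> tr ` Z"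
        then obtain z where z: "z \<in> Z" "\<omega> = tr z" by blast
        then have zQ: "z \<in> Q'" using ZQ by blast
        note L = tr_vol_ratio[OF zQ u'[OF zQ]]
        have surj: "surj (u' z)" by (rule linear_injective_imp_surjective[OF L(1,2)]) simp
        have lin: "linear (inv (u' z))" using inj_linear_imp_inv_linear[OF L(1,2)] .
        have "(v has_derivative inv (u' z)) (at \<omega>)"
        proof (rule has_derivative_inverse_basic[where f=tr and T="tr ` Q'"])
          show "(tr has_derivative u' z) (at (v \<omega>))" using u'[OF zQ] z v_tr[OF zQ] by simp
          show "bounded_linear (inv (u' z))" using lin linear_conv_bounded_linear[THEN iffD1] by blast
          show "inv (u' z) \<circ> u' z = id" by (rule inv_o_cancel[OF L(2)])
          show "open (tr ` Q')" by (rule op)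
          show mem: "\<omega> \<in> tr ` Q'" using z zQ by blast
          show "continuous (at \<omega>) v" using contv mem unfolding continuous_on_eq_continuous_at[OF op] by blast
          show "tr (v y) = y" if "y \<in> tr ` Q'" for y using that v_tr by auto
        qed
        then have "(v has_derivative inv (u' z)) (at \<omega> within tr ` Z)"
          by (rule has_derivative_at_withinI)
        then show "(v has_derivative inv (u' (v \<omega>))) (at \<omega> within tr ` Z)"
          unfolding z(2) v_tr[OF zQ] .
        have "vol_ratio (inv (u' z)) = 1 / vol_ratio (u' z)"
          by (rule vol_ratio_inverse[OF L(1,2) lin surj_imp_inj_inv[OF surj]]) (simp add: fun_eq_iff surj_f_inv_f[OF surj])
        moreover have "c \<le> vol_ratio (u' z)" using ge z vr[OF zQ] by simp
        ultimately show "vol_ratio (inv (u' (v \<omega>))) \<le> 1 / c"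
          using c z v_tr[OF zQ] by (simp add: frac_le)
      next
        fix n :: nat
        define T where "T = tr ` Z \<inter> cball 0 (real n)"
        then have T: "tr ` Z \<inter> cball 0 (real n) = T" "T \<in> sets borel" "T \<subseteq> tr ` Q'"
          using Zm ZQ by (auto intro!: sets.Int)
        have "v ` T = Q' \<inter> tr -` T"
        proof (intro equalityI subsetI)
          fix y assume "y \<in> v ` T"
          then obtain \<omega> z where "y = v \<omega>" "\<omega> \<in> T" "\<omega> = tr z" "z \<in> Q'" using T(3) by blast
          then show "y \<in> Q' \<inter> tr -` T" using v_tr[of z] by simp
        next
          fix y assume "y \<in> Q' \<inter> tr -` T"
          then show "y \<in> v ` T" using v_tr[of y] by (metis IntD1 IntD2 image_eqI vimageD)
        qed
        moreover have "Q' \<inter> tr -` T \<in> sets borel"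
          using measurable_sets[OF borel_measurable_continuous_on_restrict[OF tr_continuous] T(2)] param_open[OF chart']
          by (simp add: space_restrict_space sets_restrict_space_iff Int_commute)
        ultimately show "v ` (tr ` Z \<inter> cball 0 (real n)) \<in> sets borel" using T(1) by simp
      qed (use Zm c in auto)
      moreover have "v ` tr ` Z = Z"
      proof -
        have "v (tr z) = z" if "z \<in> Z" for z using v_tr that ZQ by blast
        then show ?thesis by (simp add: image_image)
      qed
      ultimately have "ennreal c * emeasure lborel Z \<le> ennreal c * (ennreal (1 / c) * emeasure lborel (tr ` Z))"
        by (intro mult_left_mono) simp_all
      also have "\<dots> = emeasure lborel (tr ` Z)"
        using c by (simp add: mult.assoc[symmetric] flip: ennreal_mult)
      finally show ?thesis .
    qed
  qed
  have "(\<integral>\<^sup>+\<omega>\<in>tr ` X. ennreal (J \<omega>) \<partial>lborel) = (\<integral>\<^sup>+z\<in>X. ennreal (D z) * ennreal (J (tr z)) \<partial>lborel)"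
  proof (rule nn_integral_image[OF X(1) tr_borel[OF X]])
    show "tr \<in> borel_measurable (restrict_space borel X)"
      by (intro borel_measurable_continuous_on_restrict continuous_on_subset[OF tr_continuous X(2)])
    show "inj_on tr X" using tr_inj X(2) by (rule inj_on_subset)
  qed (use em X in auto)
  moreover have "(\<integral>\<^sup>+\<omega>\<in>tr ` X. ennreal (J \<omega>) \<partial>lborel) = (\<integral>\<^sup>+\<omega>\<in>tr ` X. ennreal (volume_jacobian \<psi> \<omega>) \<partial>lborel)"
    using tr(1) X(2) by (intro nn_integral_cong) (auto simp: J_def indicator_def)
  moreover have "(\<integral>\<^sup>+z\<in>X. ennreal (D z) * ennreal (J (tr z)) \<partial>lborel) = (\<integral>\<^sup>+z\<in>X. ennreal (volume_jacobian \<psi>' z) \<partial>lborel)"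
  proof (intro nn_integral_cong)
    fix z
    show "ennreal (D z) * ennreal (J (tr z)) * indicator X z = ennreal (volume_jacobian \<psi>' z) * indicator X z"
    proof (cases "z \<in> X")
      case True
      then have z: "z \<in> Q'" using X by blast
      have "D z * J (tr z) = volume_jacobian \<psi>' z"
        using z tr(1)[OF z] jacobian_pos[OF chart tr(1)[OF z]] by (simp add: D_def J_def)
      moreover have "0 \<le> D z" "0 \<le> J (tr z)" using Dpos[of z] z tr(1)[OF z] jacobian_pos[OF chart tr(1)[OF z]] by (auto simp: J_def)
      ultimately show ?thesis by (simp flip: ennreal_mult)
    qed simp
  qed
  ultimately show ?thesis by simp
qed

lemma tr_image: "X \<subseteq> Q' \<Longrightarrow> \<psi>' ` X = \<psi> ` tr ` X"
  using tr(2) by (auto simp: image_image subset_iff intro!: image_cong)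

end

lemma inverse_measurable: "inv_into Q \<psi> \<in> borel_measurable (restrict_space borel (\<psi> ` Q))"
proof -
  obtain v where v: "homeomorphism Q (\<psi> ` Q) \<psi> v" using chart by (auto simp: local_param_def)
  have "v y = inv_into Q \<psi> y" if "y \<in> \<psi> ` Q" for y
    using v that param_inj[OF chart] by (auto simp: homeomorphism_def)
  then have "continuous_on (\<psi> ` Q) (inv_into Q \<psi>)"
    using v by (simp add: homeomorphism_def cong: continuous_on_cong)
  then show ?thesis by (rule borel_measurable_continuous_on_restrict)
qed

lemma image_chart_borel: "\<psi> ` Q \<in> sets borel"
proof -
  have "openin (top_of_set W) (\<psi> ` Q)" using chart by (simp add: local_param_def)
  then obtain T where "open T" "\<psi> ` Q = W \<inter> T" by (auto simp: openin_open)
  then show ?thesis using W by simp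
qed

lemma image_chart_subset: "\<psi> ` Q \<subseteq> W"
  using chart by (auto simp: local_param_def dest: openin_imp_subset)

lemma image_borel:
  assumes "X \<in> sets borel" "X \<subseteq> Q" shows "\<psi> ` X \<in> sets borel"
proof -
  have "\<psi> ` X = inv_into Q \<psi> -` X \<inter> space (restrict_space borel (\<psi> ` Q))"
    using assms(2) param_inj[OF chart] by (auto simp: space_restrict_space subset_eq)
  then show ?thesis
    using measurable_sets[OF inverse_measurable assms(1)] image_chart_borel by (simp add: sets_restrict_space_iff)
qed

text \<open>All parametrisations together cover exactly the image of \<open>Q\<close>, so the clause
  about uncovered points fixes the measure off this image, and the formula in the chart fixes it on
  the image. Existence comes from the image measure under \<open>\<psi>\<close>, which
  \<open>tr_volume\<close> makes consistent with the other parametrisations.\<close>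

lemma induced_volume:
  "sets (induced_volume TYPE('k) W) = sets (restrict_space borel W)"
  "X \<in> sets borel \<Longrightarrow> X \<subseteq> Q \<Longrightarrow> emeasure (induced_volume TYPE('k) W) (\<psi> ` X) = (\<integral>\<^sup>+z\<in>X. ennreal (volume_jacobian \<psi> z) \<partial>lborel)"
proof -
  define IV where "IV \<nu> \<longleftrightarrow> sets \<nu> = sets (restrict_space borel W) \<and>
     (\<forall>Q (\<psi> :: real^'k \<Rightarrow> 'a). local_param W Q \<psi> \<longrightarrow>
        (\<forall>X\<in>sets borel. X \<subseteq> Q \<longrightarrow>
           emeasure \<nu> (\<psi> ` X) = (\<integral>\<^sup>+ z\<in>X. ennreal (volume_jacobian \<psi> z) \<partial>lborel))) \<and>
     emeasure \<nu> (W - \<Union>{\<psi> ` Q | Q (\<psi> :: real^'k \<Rightarrow> 'a). local_param W Q \<psi>}) = 0" for \<nu>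
  have U: "\<Union>{\<psi> ` Q | Q (\<psi> :: real^'k \<Rightarrow> 'a). local_param W Q \<psi>} = \<psi> ` Q"
  proof (intro equalityI subsetI)
    fix y assume "y \<in> \<Union>{\<psi> ` Q | Q (\<psi> :: real^'k \<Rightarrow> 'a). local_param W Q \<psi>}"
    then obtain Q' and \<psi>' :: "real^'k \<Rightarrow> 'a" and z where "local_param W Q' \<psi>'" "z \<in> Q'" "y = \<psi>' z" by auto
    then show "y \<in> \<psi> ` Q" using trans[of Q' \<psi>' z] by (metis image_eqI)
  qed (use chart in blast)
  have Qo: "open Q" by (rule param_open[OF chart])
  have Qb: "Q \<in> sets borel" using Qo by simp
  have sets_r: "A \<in> sets (restrict_space borel W) \<longleftrightarrow> A \<in> sets borel \<and> A \<subseteq> W" for A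
    using W by (auto simp: sets_restrict_space_iff)
  define M where "M = density (restrict_space lborel Q) (\<lambda>z. ennreal (volume_jacobian \<psi> z))"
  have Jm: "(\<lambda>z. ennreal (volume_jacobian \<psi> z)) \<in> borel_measurable (restrict_space lborel Q)"
    using borel_measurable_continuous_on_restrict[OF jacobian_continuous[OF chart]]
    by (simp cong: measurable_cong_sets add: sets_restrict_space)
  have "\<psi> \<in> restrict_space borel Q \<rightarrow>\<^sub>M restrict_space borel W"
    using image_chart_subset borel_measurable_continuous_on_restrict[OF param_continuous[OF chart]]
    by (intro measurable_restrict_space2) (auto simp: space_restrict_space)
  then have \<psi>m: "\<psi> \<in> M \<rightarrow>\<^sub>M restrict_space borel W"
    by (simp add: M_def cong: measurable_cong_sets)
  define \<nu>0 where "\<nu>0 = distr M (restrict_space borel W) \<psi>"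
  have spM: "space M = Q" by (simp add: M_def space_restrict_space)
  have emM: "emeasure M X = (\<integral>\<^sup>+z\<in>X. ennreal (volume_jacobian \<psi> z) \<partial>lborel)" if "X \<in> sets borel" "X \<subseteq> Q" for X
  proof -
    have "emeasure M X = (\<integral>\<^sup>+z. ennreal (volume_jacobian \<psi> z) * indicator X z \<partial>restrict_space lborel Q)"
      unfolding M_def using that Qb Jm by (intro emeasure_density) (auto simp: sets_restrict_space_iff)
    also have "\<dots> = (\<integral>\<^sup>+z\<in>X. ennreal (volume_jacobian \<psi> z) \<partial>lborel)"
      using Qb that by (simp add: nn_integral_restrict_space) (intro nn_integral_cong, auto simp: indicator_def)
    finally show ?thesis .
  qed
  have em0: "emeasure \<nu>0 A = emeasure M (\<psi> -` A \<inter> Q)" if "A \<in> sets borel" "A \<subseteq> W" for A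
    using that \<psi>m sets_r by (simp add: \<nu>0_def emeasure_distr spM)
  have em\<psi>: "emeasure \<nu>0 (\<psi> ` X) = (\<integral>\<^sup>+z\<in>X. ennreal (volume_jacobian \<psi> z) \<partial>lborel)" if "X \<in> sets borel" "X \<subseteq> Q" for X
  proof -
    have "\<psi> -` \<psi> ` X \<inter> Q = X" using param_inj[OF chart] that(2) by (auto dest: inj_onD)
    moreover have "\<psi> ` X \<subseteq> W" using image_chart_subset that(2) by blast
    ultimately show ?thesis using em0[OF image_borel[OF that]] emM[OF that] by simp
  qed
  have IV0: "IV \<nu>0"
    unfolding IV_def U
  proof (intro conjI allI impI ballI)
    show "sets \<nu>0 = sets (restrict_space borel W)" by (simp add: \<nu>0_def)
    fix Q' and \<psi>' :: "real^'k \<Rightarrow> 'a" and X assume c: "local_param W Q' \<psi>'" and X: "X \<in> sets borel" "X \<subseteq> Q'"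
    have "tr \<psi>' ` X \<subseteq> Q" using tr(1)[OF c] X(2) by blast
    then have "emeasure \<nu>0 (\<psi> ` tr \<psi>' ` X) = (\<integral>\<^sup>+z\<in>tr \<psi>' ` X. ennreal (volume_jacobian \<psi> z) \<partial>lborel)"
      by (intro em\<psi> tr_borel[OF c X])
    then show "emeasure \<nu>0 (\<psi>' ` X) = (\<integral>\<^sup>+z\<in>X. ennreal (volume_jacobian \<psi>' z) \<partial>lborel)"
      by (simp only: tr_image[OF c X(2)] tr_volume[OF c X])
  next
    have "\<psi> -` (W - \<psi> ` Q) \<inter> Q = {}" by auto
    then show "emeasure \<nu>0 (W - \<psi> ` Q) = 0" using em0[of "W - \<psi> ` Q"] W image_chart_borel by simp
  qed
  have "\<nu> = \<nu>0" if "IV \<nu>" for \<nu>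
  proof (rule measure_eqI)
    show s: "sets \<nu> = sets \<nu>0" using that by (simp add: IV_def \<nu>0_def)
    have eq: "emeasure \<nu>' A = emeasure M (\<psi> -` A \<inter> Q)" if \<nu>': "IV \<nu>'" and A: "A \<in> sets borel" "A \<subseteq> W" for \<nu>' A
    proof -
      have \<nu>s: "B \<in> sets \<nu>' \<longleftrightarrow> B \<in> sets borel \<and> B \<subseteq> W" for B using \<nu>' sets_r by (simp add: IV_def)
      have X: "\<psi> -` A \<inter> Q \<in> sets borel"
        using measurable_sets[OF \<psi>m, of A] A sets_r Qb by (simp add: spM) (simp add: M_def sets_restrict_space_iff)
      have "A \<inter> \<psi> ` Q = \<psi> ` (\<psi> -` A \<inter> Q)" by auto
      then have 1: "emeasure \<nu>' (A \<inter> \<psi> ` Q) = emeasure M (\<psi> -` A \<inter> Q)"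
        using \<nu>' chart X emM[OF X] unfolding IV_def by auto
      have "emeasure \<nu>' (A - \<psi> ` Q) \<le> emeasure \<nu>' (W - \<psi> ` Q)"
        using A W image_chart_borel by (intro emeasure_mono) (auto simp: \<nu>s)
      then have 2: "emeasure \<nu>' (A - \<psi> ` Q) = 0" using \<nu>' unfolding IV_def U by simp
      have "emeasure \<nu>' A = emeasure \<nu>' (A \<inter> \<psi> ` Q) + emeasure \<nu>' (A - \<psi> ` Q)"
        using A image_chart_borel by (subst plus_emeasure) (auto simp: \<nu>s intro!: arg_cong[of _ _ "emeasure \<nu>'"])
      then show ?thesis using 1 2 by simp
    qed
    fix A assume "A \<in> sets \<nu>"
    then have "A \<in> sets borel" "A \<subseteq> W" using that sets_r by (auto simp: IV_def)
    then show "emeasure \<nu> A = emeasure \<nu>0 A" using eq[OF that] em0 by simp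
  qed
  with IV0 have "The IV = \<nu>0" by (intro the_equality)
  then have "induced_volume TYPE('k) W = \<nu>0"
    unfolding induced_volume_def IV_def by simp
  then show "sets (induced_volume TYPE('k) W) = sets (restrict_space borel W)"
    "X \<in> sets borel \<Longrightarrow> X \<subseteq> Q \<Longrightarrow> emeasure (induced_volume TYPE('k) W) (\<psi> ` X) = (\<integral>\<^sup>+z\<in>X. ennreal (volume_jacobian \<psi> z) \<partial>lborel)"
    using em\<psi> by (simp_all add: \<nu>0_def)
qed

text \<open>Any other parametrisation through the point has a derivative that factors through
  \<open>dpar Q \<psi> z\<close>, hence contributes no further tangent vectors.\<close>

lemma tangent_space_eq:
  assumes "z \<in> Q" shows "tangent_space TYPE('k) W (\<psi> z) = range (dpar Q \<psi> z)"
proof (intro equalityI subsetI)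
  fix v assume "v \<in> tangent_space TYPE('k) W (\<psi> z)"
  then obtain Q' and \<psi>' :: "real^'k \<Rightarrow> 'a" and y where c: "local_param W Q' \<psi>'" and y: "y \<in> Q'" "\<psi>' y = \<psi> z"
    and v: "v \<in> range (frechet_derivative \<psi>' (at y))"
    by (auto simp: tangent_space_def)
  have "tr \<psi>' y = z"
    using tr[OF c y(1)] y(2) param_inj[OF chart] assms by (metis inj_onD)
  obtain u' where "blinfun_apply (dpar Q' \<psi>' y) = dpar Q \<psi> z \<circ> u'"
    using tr_derivative[OF c y(1)] \<open>tr \<psi>' y = z\<close> by metis
  moreover have "frechet_derivative \<psi>' (at y) = dpar Q' \<psi>' y"
    using frechet_derivative_at[OF dpar(2)[OF c y(1)]] by simp
  ultimately show "v \<in> range (dpar Q \<psi> z)" using v by auto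
next
  fix v assume v: "v \<in> range (dpar Q \<psi> z)"
  have "frechet_derivative \<psi> (at z) = dpar Q \<psi> z"
    using frechet_derivative_at[OF dpar(2)[OF chart assms]] by simp
  then show "v \<in> tangent_space TYPE('k) W (\<psi> z)"
    using v chart assms unfolding tangent_space_def by (intro CollectI exI[of _ Q] exI[of _ \<psi>]) auto
qed

end


section \<open>Adapted norms\<close>

lemma proj_along_eqI:
  assumes "subspace U" "subspace V" "U \<inter> V = {0}" "u \<in> U" "v - u \<in> V"
  shows "proj_along U V v = u"
  unfolding proj_along_def
proof (rule the_equality)
  show "u \<in> U \<and> v - u \<in> V" using assms by blast
  fix u' assume u': "u' \<in> U \<and> v - u' \<in> V"
  have "u' - u \<in> U" using subspace_diff[OF assms(1)] u' assms(4) by blast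
  moreover have "(v - u) - (v - u') \<in> V" using subspace_diff[OF assms(2)] u' assms(5) by blast
  ultimately have "u' - u \<in> U \<inter> V" by simp
  then show "u' = u" using assms(3) by simp
qed

lemma dim_linear_image:
  assumes "linear L" "inj L" shows "dim (L ` V) = dim V"
proof -
  obtain B where B: "B \<subseteq> V" "independent B" "V \<subseteq> span B" "card B = dim V"
    using real_vector.basis_exists[of V] by blast
  show ?thesis
  proof (rule real_vector.dim_unique[of "L ` B"])
    show "L ` B \<subseteq> L ` V" using B by blast
    show "L ` V \<subseteq> span (L ` B)" using B(3) by (simp add: linear_span_image[OF assms(1)] image_mono)
    show "independent (L ` B)" using linear_independent_injective_image[OF assms(1) B(2)] assms(2) inj_on_subset by blast
    show "card (L ` B) = dim V" using B(4) card_image[OF inj_on_subset[OF assms(2) subset_UNIV]] by simp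
  qed
qed

locale lyapunov_system =
  fixes f :: "'a::banach \<Rightarrow> 'a" and f' :: "'a \<Rightarrow> 'a \<Rightarrow>\<^sub>L 'a" and \<mu> :: "'a measure" and A :: "'a set"
    and la :: "'a \<Rightarrow> real" and M :: "'a met_splitting" and ls :: real and m p :: nat and G :: "'a set"
  assumes f': "(f has_derivative blinfun_apply (f' x)) (at x)" and f'_cont: "continuous_on UNIV f'"
    and inj_f: "inj f" and inj_f': "inj (blinfun_apply (f' x))"
    and split: "lyapunov_splitting f \<mu> A la M" and p: "0 < p" and G: "G = Gamma_set M la ls m p"
begin

lemma frechet_f: "frechet_derivative f (at x) = f' x"
  using frechet_derivative_at[OF f'] by simp

lemma iter_derivative: "((f ^^ n) has_derivative diter f n x) (at x)"
proof -
  have "(f ^^ n) differentiable (at x)" for x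
  proof (induction n)
    case 0
    then show ?case using has_derivative_id[of "at x"] by (auto simp: differentiable_def id_def)
  next
    case (Suc n)
    have "f differentiable (at ((f ^^ n) x))" using f' by (auto simp: differentiable_def)
    from differentiable_chain_at[OF Suc this] show ?case by (simp only: funpow.simps)
  qed
  then show ?thesis unfolding diter_def by (simp add: frechet_derivative_works[symmetric])
qed

lemma diter_0: "diter f 0 x = id"
  using frechet_derivative_at[OF has_derivative_id, of x] by (simp add: diter_def)

lemma diter_1: "diter f (Suc 0) x = f' x"
  using frechet_f by (simp add: diter_def)

lemma diter_add: "diter f (k + n) x v = diter f k ((f ^^ n) x) (diter f n x v)"
proof -
  have "((f ^^ k) \<circ> (f ^^ n) has_derivative diter f k ((f ^^ n) x) \<circ> diter f n x) (at x)"
    by (rule diff_chain_at[OF iter_derivative iter_derivative])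
  then show ?thesis using has_derivative_unique[OF iter_derivative[of "k + n" x]] by (simp add: funpow_add)
qed

lemma diter_Suc: "diter f (Suc n) x v = f' ((f ^^ n) x) (diter f n x v)"
  using diter_add[of "Suc 0" n x v] by (simp add: diter_1)

lemma diter_Suc_left: "diter f (Suc n) x v = diter f n (f x) (f' x v)"
  using diter_add[of n "Suc 0" x v] by (simp add: diter_1)

lemma diter_linear: "linear (diter f n x)"
  by (rule has_derivative_linear[OF iter_derivative])

lemma diter_inj: "inj (diter f n x)"
proof (induction n)
  case 0 then show ?case by (simp add: diter_0)
next
  case (Suc n)
  have "diter f (Suc n) x = f' ((f ^^ n) x) \<circ> diter f n x" by (rule ext) (simp add: diter_Suc)
  then show ?case using inj_compose[OF inj_f' Suc] by (simp only:)
qed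

lemma diter_eq_0: "diter f n x v = 0 \<longleftrightarrow> v = 0"
  using linear_0[OF diter_linear[of n x]] injD[OF diter_inj[of n x], of v 0] by auto

definition Dom :: "'a set" where "Dom = msp_dom M"

lemma Dom_image: "f ` Dom = Dom" and Dom_A: "Dom \<subseteq> A" and la_f: "\<forall>x\<in>A. la (f x) = la x"
  and Dom_met: "\<forall>x\<in>Dom. met_at f la M x"
  by (insert split, unfold lyapunov_splitting_def Dom_def, (elim conjE, assumption)+)

lemma met: "x \<in> Dom \<Longrightarrow> met_at f la M x"
  using Dom_met by blast

lemma Dom_f: "x \<in> Dom \<Longrightarrow> f x \<in> Dom"
  using Dom_image by blast

lemma Dom_inv: "x \<in> Dom \<Longrightarrow> inv f x \<in> Dom \<and> f (inv f x) = x"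
proof -
  assume "x \<in> Dom"
  then obtain y where "y \<in> Dom" "x = f y" using Dom_image by blast
  then show ?thesis using inv_f_f[OF inj_f] by simp
qed

lemma Dom_iter: "x \<in> Dom \<Longrightarrow> (f ^^ n) x \<in> Dom"
  by (induction n) (auto intro: Dom_f)

lemma Dom_back: "x \<in> Dom \<Longrightarrow> (inv f ^^ k) x \<in> Dom \<and> (f ^^ k) ((inv f ^^ k) x) = x"
proof (induction k)
  case (Suc k)
  then have "(inv f ^^ k) x \<in> Dom" by blast
  from Dom_inv[OF this] Suc show ?case by (simp add: funpow_swap1)
qed simp

lemma msp_r_f: "x \<in> Dom \<Longrightarrow> msp_r M (f x) = msp_r M x"
  using met by (simp add: met_at_def)

lemma E_image: "x \<in> Dom \<Longrightarrow> i \<in> {1..msp_r M x} \<Longrightarrow> f' x ` msp_E M i x = msp_E M i (f x)"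
  using met[of x] by (simp add: met_at_def frechet_f)

lemma F_image: "x \<in> Dom \<Longrightarrow> f' x ` msp_F M x \<subseteq> msp_F M (f x)"
  using met[of x] by (simp add: met_at_def frechet_f)

lemma splits: "x \<in> Dom \<Longrightarrow> splits_at M x"
  using met[of x] by (simp add: met_at_def)

lemma growth:
  assumes "x \<in> Dom" "i \<in> {1..msp_r M x}" "v \<in> msp_E M i x" "v \<noteq> 0"
  shows "(\<lambda>n. ln (norm (diter f n x v)) / real n) \<longlonglongrightarrow> msp_lam M i x"
proof -
  have "((\<lambda>n. ln (norm (zderiv f (msp_E M i) n x v)) / real_of_int n) \<longlongrightarrow> msp_lam M i x) at_top"
    using met[OF assms(1)] assms(2-4) unfolding met_at_def by blast
  from filterlim_compose[OF this filterlim_int_sequentially] show ?thesis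
    by (simp add: zderiv_def)
qed

text \<open>The logarithmic growth of \<open>f' x v\<close> along the orbit of \<open>f x\<close> is
  that of \<open>v\<close> along the orbit of \<open>x\<close>, shifted by one step, and
  \<open>(n + 1) / n\<close> tends to 1. This invariance is not among the clauses of
  \<open>met_at\<close>.\<close>

lemma lam_f:
  assumes "x \<in> Dom" "i \<in> {1..msp_r M x}"
  shows "msp_lam M i (f x) = msp_lam M i x"
proof -
  have "msp_E M i x \<noteq> {0}" "subspace (msp_E M i x)"
    using splits[OF assms(1)] assms(2) by (auto simp: splits_at_def piece_def dest!: spec[of _ i])
  then obtain v where v: "v \<in> msp_E M i x" "v \<noteq> 0" using subspace_0 by blast
  have "f' x v \<in> msp_E M i (f x)" using E_image[OF assms] v by blast
  moreover have "f' x v \<noteq> 0" using diter_eq_0[of "Suc 0" x v] v by (simp add: diter_1)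
  ultimately have 1: "(\<lambda>n. ln (norm (diter f n (f x) (f' x v))) / real n) \<longlonglongrightarrow> msp_lam M i (f x)"
    using growth[of "f x" i] Dom_f[OF assms(1)] msp_r_f[OF assms(1)] assms(2) by simp
  have "(\<lambda>n. ln (norm (diter f (Suc n) x v)) / real (Suc n)) \<longlonglongrightarrow> msp_lam M i x"
    using LIMSEQ_Suc[OF growth[OF assms v]] .
  moreover have "(\<lambda>n. real (Suc n) / real n) \<longlonglongrightarrow> 1" using LIMSEQ_Suc_n_over_n .
  ultimately have "(\<lambda>n. ln (norm (diter f (Suc n) x v)) / real (Suc n) * (real (Suc n) / real n)) \<longlonglongrightarrow> msp_lam M i x * 1"
    by (rule tendsto_mult)
  moreover have "ln (norm (diter f (Suc n) x v)) / real (Suc n) * (real (Suc n) / real n) = ln (norm (diter f n (f x) (f' x v))) / real n" for n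
    by (simp add: diter_Suc_left del: of_nat_Suc)
  ultimately have "(\<lambda>n. ln (norm (diter f n (f x) (f' x v))) / real n) \<longlonglongrightarrow> msp_lam M i x * 1" by (simp only:)
  from LIMSEQ_unique[OF 1 this] show ?thesis by simp
qed

abbreviation "Ep \<equiv> Eplus M ls"
abbreviation "Em \<equiv> Eminus M ls"

definition P_idx :: "'a \<Rightarrow> nat set" where "P_idx x = {i \<in> {1..msp_r M x}. ls < msp_lam M i x}"
text \<open>Index 0 of \<open>piece\<close> is the space \<open>msp_F\<close>, which always belongs
  to the stable side.\<close>

definition M_idx :: "'a \<Rightarrow> nat set" where "M_idx x = insert 0 {i \<in> {1..msp_r M x}. msp_lam M i x < ls}"

lemma Ep_eq: "Ep x = span (\<Union>i\<in>P_idx x. piece M i x)"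
  unfolding Eplus_def P_idx_def by (intro arg_cong[of _ _ span]) (auto simp: piece_def)

lemma Em_eq: "Em x = span (\<Union>i\<in>M_idx x. piece M i x)"
  unfolding Eminus_def M_idx_def by (intro arg_cong[of _ _ span]) (auto simp: piece_def)

lemma subspace_E: "subspace (Ep x)" "subspace (Em x)"
  by (simp_all add: Ep_eq Em_eq)

lemma Ep_f: assumes "x \<in> Dom" shows "f' x ` Ep x = Ep (f x)"
proof -
  have "P_idx (f x) = P_idx x" using lam_f[OF assms] msp_r_f[OF assms] by (auto simp: P_idx_def)
  moreover have "f' x ` (\<Union>i\<in>P_idx x. piece M i x) = (\<Union>i\<in>P_idx x. piece M i (f x))"
    unfolding image_UN using E_image[OF assms] by (intro SUP_cong) (auto simp: P_idx_def piece_def)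
  ultimately show ?thesis
    by (simp add: Ep_eq linear_span_image[OF bounded_linear.linear[OF blinfun.bounded_linear_right], symmetric])
qed

lemma Em_f: assumes "x \<in> Dom" shows "f' x ` Em x \<subseteq> Em (f x)"
proof -
  have "M_idx (f x) = M_idx x" using lam_f[OF assms] msp_r_f[OF assms] by (auto simp: M_idx_def)
  moreover have "f' x ` (\<Union>i\<in>M_idx x. piece M i x) \<subseteq> (\<Union>i\<in>M_idx x. piece M i (f x))"
    using E_image[OF assms] F_image[OF assms] by (fastforce simp: M_idx_def piece_def)
  ultimately show ?thesis
    by (simp add: Em_eq linear_span_image[OF bounded_linear.linear[OF blinfun.bounded_linear_right], symmetric] span_mono)
qed

lemma G_Dom: "x \<in> G \<Longrightarrow> x \<in> Dom" and G_dim: "x \<in> G \<Longrightarrow> dim (Ep x) = m"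
  by (auto simp: G Gamma_set_def Dom_def)

lemma G_f: assumes "x \<in> G" shows "f x \<in> G"
proof -
  note D = G_Dom[OF assms]
  have "la (f x) = la x" using D Dom_A la_f by blast
  moreover have "dim (Ep (f x)) = m"
    using dim_linear_image[OF bounded_linear.linear[OF blinfun.bounded_linear_right] inj_f', of x "Ep x"] Ep_f[OF D] G_dim[OF assms] by simp
  ultimately show ?thesis
    using assms Dom_f[OF D] lam_f[OF D] msp_r_f[OF D] by (auto simp: G Gamma_set_def Dom_def)
qed

lemma G_iter: "x \<in> G \<Longrightarrow> (f ^^ n) x \<in> G"
  by (induction n) (auto intro: G_f)

lemma idx_G: assumes "x \<in> G" shows "P_idx x \<union> M_idx x = {..msp_r M x}" "P_idx x \<inter> M_idx x = {}"
proof -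
  have ne: "msp_lam M i x \<noteq> ls" if "i \<in> {1..msp_r M x}" for i
  proof
    assume "msp_lam M i x = ls"
    moreover have "1 / real p < \<bar>msp_lam M i x - ls\<bar>" using assms that unfolding G Gamma_set_def by blast
    moreover have "0 < 1 / real p" using p by simp
    ultimately show False by linarith
  qed
  have "i \<in> P_idx x \<union> M_idx x \<longleftrightarrow> i \<le> msp_r M x" for i
    using ne[of i] linorder_cases[of "msp_lam M i x" ls "i \<in> P_idx x \<union> M_idx x \<longleftrightarrow> i \<le> msp_r M x"]
    by (cases "i = 0") (simp_all add: P_idx_def M_idx_def, arith)
  then show "P_idx x \<union> M_idx x = {..msp_r M x}" by blast
  show "P_idx x \<inter> M_idx x = {}" by (auto simp: P_idx_def M_idx_def)
qed

text \<open>\<open>splits_at\<close> gives directness of each piece against the sum of all others.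
  Triviality of the intersection follows by adding the unstable pieces one at a time.\<close>

lemma E_complement:
  assumes "x \<in> G" shows "Ep x \<inter> Em x = {0}" "\<exists>u\<in>Ep x. v - u \<in> Em x"
proof -
  note s = splits[OF G_Dom[OF assms]]
  have pc: "piece M i x \<inter> copiece M i x = {0}" "subspace (piece M i x)" if "i \<le> msp_r M x" for i
    using s that by (auto simp: splits_at_def)
  have "span (\<Union>i\<in>J. piece M i x) \<inter> Em x = {0}" if "finite J" "J \<subseteq> P_idx x" for J
    using that
  proof (induction J)
    case empty then show ?case using subspace_0[OF subspace_E(2)[of x]] by auto
  next
    case (insert i J)
    have i: "i \<in> P_idx x" "i \<le> msp_r M x" using insert.prems by (auto simp: P_idx_def)
    have "u = 0" if u: "u \<in> span (\<Union>i\<in>insert i J. piece M i x)" "u \<in> Em x" for u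
    proof -
      obtain e u' where e: "u = e + u'" "e \<in> span (piece M i x)" and u': "u' \<in> span (\<Union>i\<in>J. piece M i x)"
        using u(1) by (auto simp: span_Un)
      have eE: "e \<in> piece M i x" using e(2) pc(2)[OF i(2)] by (simp add: span_eq_iff[THEN iffD2])
      have sub: "(\<Union>i\<in>J. piece M i x) \<subseteq> (\<Union>j\<in>{0..msp_r M x} - {i}. piece M j x)"
        "(\<Union>i\<in>M_idx x. piece M i x) \<subseteq> (\<Union>j\<in>{0..msp_r M x} - {i}. piece M j x)"
      proof -
        have "J \<subseteq> {0..msp_r M x} - {i}" using insert.hyps insert.prems by (auto simp: P_idx_def)
        then show "(\<Union>i\<in>J. piece M i x) \<subseteq> (\<Union>j\<in>{0..msp_r M x} - {i}. piece M j x)" by (rule UN_mono) simp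
        have "M_idx x \<subseteq> {0..msp_r M x} - {i}" using i(1) by (auto simp: P_idx_def M_idx_def)
        then show "(\<Union>i\<in>M_idx x. piece M i x) \<subseteq> (\<Union>j\<in>{0..msp_r M x} - {i}. piece M j x)" by (rule UN_mono) simp
      qed
      have "u' \<in> copiece M i x" "u \<in> copiece M i x"
        unfolding copiece_def using u' u(2)[unfolded Em_eq] span_mono[OF sub(1)] span_mono[OF sub(2)] by blast+
      then have "e \<in> copiece M i x" using e(1) span_diff[of u _ u'] by (simp add: copiece_def)
      then have "e = 0" using eE pc(1)[OF i(2)] by blast
      then have "u = u'" using e(1) by simp
      then have "u \<in> span (\<Union>i\<in>J. piece M i x) \<inter> Em x" using u' u(2) by blast
      then show "u = 0" using insert.IH insert.prems by blast
    qed
    moreover have "0 \<in> span (\<Union>i\<in>insert i J. piece M i x) \<inter> Em x"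
      using subspace_0[OF subspace_E(2)[of x]] span_zero by blast
    ultimately show ?case by blast
  qed
  from this[of "P_idx x"] show "Ep x \<inter> Em x = {0}" by (simp add: Ep_eq P_idx_def)
  have "v \<in> span (\<Union>i\<in>{..msp_r M x}. piece M i x)" using s by (simp add: splits_at_def)
  then have "v \<in> span ((\<Union>i\<in>P_idx x. piece M i x) \<union> (\<Union>i\<in>M_idx x. piece M i x))"
    using idx_G(1)[OF assms] by (metis UN_Un)
  then obtain u w where "v = u + w" "u \<in> Ep x" "w \<in> Em x" by (auto simp: span_Un Ep_eq Em_eq)
  then show "\<exists>u\<in>Ep x. v - u \<in> Em x" by (intro bexI[of _ u]) simp_all
qed

definition "pp x v = proj_along (Ep x) (Em x) v"
definition "pm x v = proj_along (Em x) (Ep x) v"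

lemma pp_eqI: "x \<in> G \<Longrightarrow> u \<in> Ep x \<Longrightarrow> v - u \<in> Em x \<Longrightarrow> pp x v = u"
  unfolding pp_def by (rule proj_along_eqI[OF subspace_E E_complement(1)])

lemma pp: assumes "x \<in> G" shows "pp x v \<in> Ep x" "v - pp x v \<in> Em x"
  using E_complement(2)[OF assms, of v] pp_eqI[OF assms] by metis+

lemma pm_eq: assumes "x \<in> G" shows "pm x v = v - pp x v"
  unfolding pm_def
  by (rule proj_along_eqI[OF subspace_E(2,1)]) (use E_complement(1)[OF assms] pp[OF assms] in \<open>simp_all add: Int_commute\<close>)

lemma pp_linear: assumes "x \<in> G" shows "linear (pp x)"
proof (rule linearI)
  show "pp x (u + v) = pp x u + pp x v" for u v
    using subspace_add[OF subspace_E(1) pp(1) pp(1), of x u v] subspace_add[OF subspace_E(2) pp(2) pp(2), of x u v] assms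
    by (intro pp_eqI) (auto simp: algebra_simps)
  show "pp x (c *\<^sub>R u) = c *\<^sub>R pp x u" for c u
    using subspace_mul[OF subspace_E(1) pp(1), of x c u] subspace_mul[OF subspace_E(2) pp(2), of x c u] assms
    by (intro pp_eqI) (auto simp: algebra_simps)
qed

lemma pp_Ep: "x \<in> G \<Longrightarrow> u \<in> Ep x \<Longrightarrow> pp x u = u"
  using subspace_0[OF subspace_E(2)] by (intro pp_eqI) auto

lemma pp_Em: "x \<in> G \<Longrightarrow> u \<in> Em x \<Longrightarrow> pp x u = 0"
  using subspace_0[OF subspace_E(1)] by (intro pp_eqI) auto

lemma pm_linear: assumes "x \<in> G" shows "linear (pm x)"
  using linear_compose_sub[OF linear_ident pp_linear[OF assms]] by (simp add: pm_eq[OF assms, abs_def])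

lemma pm_in: "x \<in> G \<Longrightarrow> pm x v \<in> Em x"
  using pp(2) pm_eq by simp

lemma pp_f: assumes "x \<in> G" shows "pp (f x) (f' x v) = f' x (pp x v)"
proof (rule pp_eqI[OF G_f[OF assms]])
  show "f' x (pp x v) \<in> Ep (f x)" using Ep_f[OF G_Dom[OF assms]] pp(1)[OF assms] by blast
  have "f' x (v - pp x v) \<in> Em (f x)" using Em_f[OF G_Dom[OF assms]] pp(2)[OF assms] by blast
  then show "f' x v - f' x (pp x v) \<in> Em (f x)" by (simp add: blinfun.diff_right)
qed

lemma pm_f: assumes "x \<in> G" shows "pm (f x) (f' x v) = f' x (pm x v)"
  using pp_f[OF assms] by (simp add: pm_eq[OF assms] pm_eq[OF G_f[OF assms]] blinfun.diff_right)

definition zback :: "nat \<Rightarrow> 'a \<Rightarrow> 'a \<Rightarrow> 'a" where "zback k x u = zderiv f Ep (- int k) x u"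

lemma norm_plus_eq: "norm_plus f M ls p x u = (\<Sum>\<^sub>\<infinity>k\<in>UNIV. exp (real k * lam_plus ls p) * norm (zback k x u))"
proof -
  have "bij_betw (\<lambda>k. - int k) UNIV {..0}"
    by (rule bij_betw_byWitness[where f'="\<lambda>n. nat (- n)"]) auto
  from infsum_reindex_bij_betw[OF this, of "\<lambda>n. exp (- real_of_int n * lam_plus ls p) * norm (zderiv f Ep n x u)"]
  show ?thesis by (simp add: norm_plus_def zback_def)
qed

lemma zback_eqI:
  assumes "u = diter f k ((inv f ^^ k) x) q" "q \<in> Ep ((inv f ^^ k) x)"
  shows "zback k x u = q"
proof (cases "k = 0")
  case True then show ?thesis using assms by (simp add: zback_def zderiv_def diter_0)
next
  case False
  then have "zback k x u = inv_into (Ep ((inv f ^^ k) x)) (diter f k ((inv f ^^ k) x)) u"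
    by (simp add: zback_def zderiv_def ziter_def)
  also have "\<dots> = q" using assms by (simp add: inv_into_f_eq[OF inj_on_subset[OF diter_inj subset_UNIV]])
  finally show ?thesis .
qed

lemma Ep_iter: assumes "x \<in> Dom" shows "diter f k x ` Ep x = Ep ((f ^^ k) x)"
proof (induction k)
  case 0 then show ?case by (simp add: diter_0)
next
  case (Suc k)
  have "diter f (Suc k) x ` Ep x = f' ((f ^^ k) x) ` diter f k x ` Ep x" by (simp add: diter_Suc image_image)
  then show ?case using Suc Ep_f[OF Dom_iter[OF assms]] by simp
qed

lemma zback: assumes "x \<in> Dom" "u \<in> Ep x" shows "zback k x u \<in> Ep ((inv f ^^ k) x)" "diter f k ((inv f ^^ k) x) (zback k x u) = u"
proof -
  have "u \<in> diter f k ((inv f ^^ k) x) ` Ep ((inv f ^^ k) x)"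
    using Ep_iter[of "(inv f ^^ k) x" k] Dom_back[OF assms(1), of k] assms(2) by simp
  then obtain q where "u = diter f k ((inv f ^^ k) x) q" "q \<in> Ep ((inv f ^^ k) x)" by blast
  with zback_eqI[OF this] show "zback k x u \<in> Ep ((inv f ^^ k) x)" "diter f k ((inv f ^^ k) x) (zback k x u) = u" by auto
qed

lemma zback_add: assumes "x \<in> Dom" "u \<in> Ep x" "v \<in> Ep x" shows "zback k x (u + v) = zback k x u + zback k x v"
  using zback[OF assms(1,2)] zback[OF assms(1,3)]
  by (intro zback_eqI subspace_add[OF subspace_E(1)]) (auto simp: linear_add[OF diter_linear])

lemma zback_scale: assumes "x \<in> Dom" "u \<in> Ep x" shows "zback k x (c *\<^sub>R u) = c *\<^sub>R zback k x u"
  using zback[OF assms] by (intro zback_eqI subspace_mul[OF subspace_E(1)]) (auto simp: linear_cmul[OF diter_linear])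

lemma zback_f: assumes "x \<in> Dom" "u \<in> Ep x" shows "zback (Suc k) (f x) (f' x u) = zback k x u"
proof -
  have eq: "(inv f ^^ Suc k) (f x) = (inv f ^^ k) x"
    using inv_f_f[OF inj_f] by (simp add: funpow_swap1)
  show ?thesis
    using zback[OF assms, of k] Dom_back[OF assms(1), of k]
    by (intro zback_eqI) (auto simp only: eq diter_Suc)
qed

end

locale lyapunov_chart_system = lyapunov_system +
  fixes \<delta>1 \<delta>2 :: real and l :: "'a \<Rightarrow> real"
  assumes charts: "lyapunov_charts f M ls p G \<delta>1 \<delta>2 l"
begin

abbreviation "AN x \<equiv> adapted_norm f M ls p x"
definition "NP x v = norm_plus f M ls p x (pp x v)"
definition "NM x v = norm_minus f ls p x (pm x v)"

lemma AN_eq: "AN x v = max (NP x v) (NM x v)"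
  by (simp add: adapted_norm_def NP_def NM_def pp_def pm_def)

lemma l_ge_1: "x \<in> G \<Longrightarrow> 1 \<le> l x" and l_f: "x \<in> G \<Longrightarrow> l (f x) \<le> exp \<delta>2 * l x"
  and norm_le_AN: "x \<in> G \<Longrightarrow> norm v / 2 \<le> AN x v" and AN_le_norm: "x \<in> G \<Longrightarrow> AN x v \<le> l x * norm v"
  using charts by (auto simp: lyapunov_charts_def)

text \<open>\<open>infsum\<close> has the value 0 for families that are not summable, so a positive
  value certifies summability.\<close>

lemma infsum_pos_summable: "0 < infsum h S \<Longrightarrow> h summable_on S" for h :: "'b \<Rightarrow> real"
  using infsum_not_exists by fastforce

text \<open>For a nonzero unstable vector the stable part of the adapted norm vanishes, so the lower
  bound \<open>norm_le_AN\<close> makes the series positive, and positivity gives convergence by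
  \<open>infsum_pos_summable\<close>. Convergence is what makes the triangle inequality and the
  shift arguments below available.\<close>

lemma summable_plus:
  assumes "x \<in> G" "u \<in> Ep x" shows "(\<lambda>k. exp (real k * lam_plus ls p) * norm (zback k x u)) summable_on UNIV"
proof (cases "u = 0")
  case True
  have "zback k x u = 0" for k
    using True by (intro zback_eqI subspace_0[OF subspace_E(1)]) (simp add: linear_0[OF diter_linear])
  then show ?thesis by simp
next
  case False
  have "pm x u = 0" using pm_eq[OF assms(1), of u] pp_Ep[OF assms] by simp
  then have "NM x u = 0" by (simp add: NM_def norm_minus_def linear_0[OF diter_linear])
  moreover have "0 < AN x u" using norm_le_AN[OF assms(1), of u] False by (smt (verit) half_gt_zero zero_less_norm_iff)
  ultimately have "0 < NP x u" by (simp add: AN_eq less_max_iff_disj)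
  then show ?thesis
    unfolding NP_def pp_Ep[OF assms] norm_plus_eq by (rule infsum_pos_summable)
qed

lemma summable_minus:
  assumes "x \<in> G" "w \<in> Em x" shows "(\<lambda>n. exp (- real n * lam_minus ls p) * norm (diter f n x w)) summable_on UNIV"
proof (cases "w = 0")
  case True
  then show ?thesis by (simp add: linear_0[OF diter_linear])
next
  case False
  have pm: "pp x w = 0" "pm x w = w" using pm_eq[OF assms(1), of w] pp_Em[OF assms] by simp_all
  have "zback k x 0 = 0" for k
    by (intro zback_eqI subspace_0[OF subspace_E(1)]) (simp add: linear_0[OF diter_linear])
  then have "NP x w = 0" by (simp add: NP_def norm_plus_eq pm)
  moreover have "0 < AN x w" using norm_le_AN[OF assms(1), of w] False by (smt (verit) half_gt_zero zero_less_norm_iff)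
  ultimately have "0 < NM x w" by (simp add: AN_eq less_max_iff_disj)
  then show ?thesis
    unfolding NM_def pm(2) norm_minus_def by (rule infsum_pos_summable)
qed

lemma NP_add: assumes "x \<in> G" shows "NP x (u + v) \<le> NP x u + NP x v"
proof -
  note D = G_Dom[OF assms]
  let ?t = "\<lambda>u k. exp (real k * lam_plus ls p) * norm (zback k x (pp x u))"
  have s: "?t u summable_on UNIV" for u using summable_plus[OF assms pp(1)[OF assms]] .
  have "NP x (u + v) \<le> (\<Sum>\<^sub>\<infinity>k. ?t u k + ?t v k)"
    unfolding NP_def norm_plus_eq
  proof (rule infsum_mono[OF s summable_on_add[OF s s]])
    fix k
    have "zback k x (pp x (u + v)) = zback k x (pp x u) + zback k x (pp x v)"
      by (simp add: linear_add[OF pp_linear[OF assms]] zback_add[OF D pp(1)[OF assms] pp(1)[OF assms]])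
    then show "?t (u + v) k \<le> ?t u k + ?t v k"
      by (simp add: norm_triangle_ineq flip: distrib_left)
  qed
  also have "\<dots> = NP x u + NP x v" unfolding NP_def norm_plus_eq by (rule infsum_add[OF s s])
  finally show ?thesis .
qed

lemma NM_add: assumes "x \<in> G" shows "NM x (u + v) \<le> NM x u + NM x v"
proof -
  let ?t = "\<lambda>u n. exp (- real n * lam_minus ls p) * norm (diter f n x (pm x u))"
  have s: "?t u summable_on UNIV" for u using summable_minus[OF assms pm_in[OF assms]] .
  have "NM x (u + v) \<le> (\<Sum>\<^sub>\<infinity>k. ?t u k + ?t v k)"
    unfolding NM_def norm_minus_def
  proof (rule infsum_mono[OF s summable_on_add[OF s s]])
    fix k
    have "diter f k x (pm x (u + v)) = diter f k x (pm x u) + diter f k x (pm x v)"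
      by (simp add: linear_add[OF pm_linear[OF assms]] linear_add[OF diter_linear])
    then show "?t (u + v) k \<le> ?t u k + ?t v k"
      by (simp add: norm_triangle_ineq flip: distrib_left)
  qed
  also have "\<dots> = NM x u + NM x v" unfolding NM_def norm_minus_def by (rule infsum_add[OF s s])
  finally show ?thesis .
qed

lemma NP_scale: assumes "x \<in> G" shows "NP x (c *\<^sub>R v) = \<bar>c\<bar> * NP x v"
  unfolding NP_def norm_plus_eq infsum_cmult_right'[symmetric]
  by (simp add: linear_cmul[OF pp_linear[OF assms]] zback_scale[OF G_Dom[OF assms] pp(1)[OF assms]] mult_ac)

lemma NM_scale: assumes "x \<in> G" shows "NM x (c *\<^sub>R v) = \<bar>c\<bar> * NM x v"
  unfolding NM_def norm_minus_def infsum_cmult_right'[symmetric]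
  by (simp add: linear_cmul[OF pm_linear[OF assms]] linear_cmul[OF diter_linear] mult_ac)

lemma NP_nonneg: "0 \<le> NP x v" and NM_nonneg: "0 \<le> NM x v"
  by (simp_all add: NP_def NM_def norm_plus_eq norm_minus_def infsum_nonneg)

text \<open>The series at \<open>f x\<close>, without its nonnegative term of index 0, is
  \<open>exp (lam_plus ls p)\<close> times the series at \<open>x\<close>.\<close>

lemma NP_f: assumes "x \<in> G" shows "exp (lam_plus ls p) * NP x v \<le> NP (f x) (f' x v)"
proof -
  let ?t = "\<lambda>k. exp (real k * lam_plus ls p) * norm (zback k x (pp x v))"
  let ?T = "\<lambda>k. exp (real k * lam_plus ls p) * norm (zback k (f x) (f' x (pp x v)))"
  have sT: "?T summable_on UNIV"
    using summable_plus[OF G_f[OF assms], of "f' x (pp x v)"] Ep_f[OF G_Dom[OF assms]] pp(1)[OF assms] by blast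
  have *: "exp (lam_plus ls p) * ?t k = ?T (Suc k)" for k
    by (simp add: zback_f[OF G_Dom[OF assms] pp(1)[OF assms]] algebra_simps exp_add)
  have re: "infsum ?T (range Suc) = infsum (?T \<circ> Suc) UNIV" by (rule infsum_reindex) simp
  have "exp (lam_plus ls p) * NP x v = (\<Sum>\<^sub>\<infinity>k. ?T (Suc k))"
    unfolding NP_def norm_plus_eq infsum_cmult_right'[symmetric] * ..
  also have "\<dots> = infsum ?T (range Suc)" unfolding re o_def ..
  also have "\<dots> \<le> infsum ?T UNIV"
    by (rule infsum_mono2[OF summable_on_subset_banach[OF sT subset_UNIV] sT]) auto
  also have "\<dots> = NP (f x) (f' x v)" by (simp add: NP_def norm_plus_eq pp_f[OF assms])
  finally show ?thesis .
qed

text \<open>The series at \<open>f x\<close> is \<open>exp (lam_minus ls p)\<close> times the series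
  at \<open>x\<close> without its term of index 0; restoring this term gives the inequality.\<close>

lemma NM_f: assumes "x \<in> G" shows "NM (f x) (f' x v) \<le> exp (lam_minus ls p) * NM x v"
proof -
  let ?t = "\<lambda>n. exp (- real n * lam_minus ls p) * norm (diter f n x (pm x v))"
  have s: "?t summable_on UNIV" using summable_minus[OF assms pm_in[OF assms]] .
  have *: "exp (- real n * lam_minus ls p) * norm (diter f n (f x) (f' x (pm x v))) = exp (lam_minus ls p) * ?t (Suc n)" for n
  proof -
    have "exp (- real n * lam_minus ls p) = exp (lam_minus ls p) * exp (- real (Suc n) * lam_minus ls p)"
      by (simp add: algebra_simps flip: exp_add)
    then show ?thesis by (simp only: diter_Suc_left mult.assoc)
  qed
  have re: "infsum ?t (range Suc) = infsum (?t \<circ> Suc) UNIV" by (rule infsum_reindex) simp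
  have "NM (f x) (f' x v) = exp (lam_minus ls p) * (\<Sum>\<^sub>\<infinity>n. ?t (Suc n))"
    unfolding NM_def norm_minus_def infsum_cmult_right'[symmetric] pm_f[OF assms] * ..
  also have "(\<Sum>\<^sub>\<infinity>n. ?t (Suc n)) = infsum ?t (range Suc)" unfolding re o_def ..
  also have "\<dots> \<le> infsum ?t UNIV"
    by (rule infsum_mono2[OF summable_on_subset_banach[OF s subset_UNIV] s]) auto
  also have "infsum ?t UNIV = NM x v" by (simp add: NM_def norm_minus_def)
  finally show ?thesis by simp
qed

lemma NP_Em: "x \<in> G \<Longrightarrow> w \<in> Em x \<Longrightarrow> NP x w = 0"
  using NP_scale[of x 0 0] pp_Em[of x w] pp_Em[of x 0] subspace_0[OF subspace_E(2)] by (simp add: NP_def)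

lemma NM_Ep: "x \<in> G \<Longrightarrow> u \<in> Ep x \<Longrightarrow> NM x u = 0"
  using NM_scale[of x 0 0] pm_eq[of x u] pp_Ep[of x u] pm_eq[of x 0] pp_Em[of x 0] subspace_0[OF subspace_E(2)] by (simp add: NM_def)

lemma NP_pp: "x \<in> G \<Longrightarrow> NP x (pp x v) = NP x v"
  by (simp add: NP_def pp_Ep pp)

lemma NM_pm: "x \<in> G \<Longrightarrow> NM x (pm x v) = NM x v"
  using pm_eq[of x "pm x v"] pp_Em[of x "pm x v"] pm_in[of x v] by (simp add: NM_def)

lemma AN_pp: "x \<in> G \<Longrightarrow> AN x (pp x v) = NP x v" and AN_pm: "x \<in> G \<Longrightarrow> AN x (pm x v) = NM x v"
  using NP_nonneg NM_nonneg by (simp_all add: AN_eq NP_pp NM_pm NP_Em NM_Ep pp pm_in)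

lemma norm_pp_le: "x \<in> G \<Longrightarrow> norm (pp x v) \<le> 2 * NP x v"
  using norm_le_AN[of x "pp x v"] by (simp add: AN_pp)

lemma pp_bounded_linear: assumes "x \<in> G" shows "bounded_linear (pp x)"
proof (rule bounded_linear_intro[where K="2 * l x"])
  show "norm (pp x v) \<le> norm v * (2 * l x)" for v
    using norm_pp_le[OF assms, of v] AN_le_norm[OF assms, of v] by (simp add: AN_eq mult_ac)
qed (simp_all add: linear_add[OF pp_linear[OF assms]] linear_cmul[OF pp_linear[OF assms]])

end


section \<open>Decay along the strong stable leaves\<close>

context lyapunov_chart_system
begin

lemma AN_0: "x \<in> G \<Longrightarrow> AN x 0 = 0"
  using AN_le_norm[of x 0] norm_le_AN[of x 0] by simp

lemma tball_mem: assumes "x \<in> G" "AN x v \<le> r" shows "v \<in> tball f M ls p x r"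
  unfolding tball_def
proof (intro CollectI exI conjI)
  show "v = pp x v + pm x v" by (simp add: pm_eq[OF assms(1)])
  show "pp x v \<in> tball_plus f M ls p x r" "pm x v \<in> tball_minus f M ls p x r"
    using assms pp(1)[OF assms(1)] pm_in[OF assms(1)]
    by (simp_all add: tball_plus_def tball_minus_def AN_pp AN_pm) (simp_all add: AN_eq)
qed

lemma frechet_chart: "frechet_derivative (in_chart f x) (at v) = f' (x + v)"
proof -
  have "((\<lambda>v. x + v) has_derivative (\<lambda>v. v)) (at v)"
    using has_derivative_add[OF has_derivative_const[of x] has_derivative_ident] by simp
  from has_derivative_compose[OF this f'] have "((\<lambda>v. f (x + v)) has_derivative f' (x + v)) (at v)" by simp
  from has_derivative_diff[OF this has_derivative_const[of "f x"]]
  have "(in_chart f x has_derivative f' (x + v)) (at v)" by (simp add: in_chart_def[abs_def])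
  then show ?thesis using frechet_derivative_at by metis
qed

lemma chart_lip:
  assumes x: "x \<in> G" and d: "0 < \<delta>" "\<delta> \<le> \<delta>1" and z: "AN x (z - x) \<le> \<delta> / l x" "AN x (z' - x) \<le> \<delta> / l x"
  shows "AN (f x) (f z - f z' - f' x (z - z')) \<le> \<delta> * AN x (z - z')"
    "AN (f x) (f' z w - f' z' w) \<le> l x * AN x w * AN x (z - z')"
proof -
  note t = tball_mem[OF x z(1)] tball_mem[OF x z(2)]
  have c: "lip_wrt (AN x) (AN (f x)) \<delta> (tball f M ls p x (\<delta> / l x))
             (\<lambda>v. in_chart f x v - frechet_derivative (in_chart f x) (at 0) v)"
    "\<forall>w. lip_wrt (AN x) (AN (f x)) (l x * AN x w) (tball f M ls p x (\<delta> / l x))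
             (\<lambda>v. frechet_derivative (in_chart f x) (at v) w)"
    using charts x d unfolding lyapunov_charts_def by blast+
  from c(1)[unfolded lip_wrt_def frechet_chart add_0_right, rule_format, OF t]
  have "AN (f x) ((in_chart f x (z - x) - f' x (z - x)) - (in_chart f x (z' - x) - f' x (z' - x))) \<le> \<delta> * AN x ((z - x) - (z' - x))" .
  moreover have "(in_chart f x (z - x) - f' x (z - x)) - (in_chart f x (z' - x) - f' x (z' - x)) = f z - f z' - f' x (z - z')"
    by (simp add: in_chart_def blinfun.diff_right)
  ultimately show "AN (f x) (f z - f z' - f' x (z - z')) \<le> \<delta> * AN x (z - z')" by simp
  from c(2) t have "AN (f x) (f' (x + (z - x)) w - f' (x + (z' - x)) w) \<le> l x * AN x w * AN x ((z - x) - (z' - x))"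
    unfolding lip_wrt_def frechet_chart by blast
  then show "AN (f x) (f' z w - f' z' w) \<le> l x * AN x w * AN x (z - z')" by simp
qed

lemma l_iter: "x \<in> G \<Longrightarrow> l ((f ^^ n) x) \<le> exp \<delta>2 ^ n * l x"
proof (induction n)
  case (Suc n)
  have "l ((f ^^ Suc n) x) \<le> exp \<delta>2 * l ((f ^^ n) x)" using l_f[OF G_iter[OF Suc.prems]] by simp
  also have "\<dots> \<le> exp \<delta>2 * (exp \<delta>2 ^ n * l x)" using Suc by (intro mult_left_mono) auto
  finally show ?case by simp
qed simp

context
  fixes \<delta>1' :: real and h :: "'a \<Rightarrow> 'a \<Rightarrow> 'a"
  assumes stable: "local_stable f M ls p G l \<delta>1' h"
begin

abbreviation "Wss \<equiv> Wss_loc f M ls p l \<delta>1' h"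

lemma stable_at:
  assumes "x \<in> G"
  shows "h x ` tball_minus f M ls p x (\<delta>1' / l x) \<subseteq> tball_plus f M ls p x (\<delta>1' / l x)" "h x 0 = 0"
    "lip_wrt (AN x) (AN x) (1 / 10) (tball_minus f M ls p x (\<delta>1' / l x)) (h x)"
    "in_chart f x ` graph_on (h x) (tball_minus f M ls p x (\<delta>1' / l x)) \<subseteq> graph_on (h (f x)) (tball_minus f M ls p (f x) (\<delta>1' / l (f x)))"
  using stable assms unfolding local_stable_def Let_def by blast+

lemma Wss_f: assumes "x \<in> G" "z \<in> Wss x" shows "f z \<in> Wss (f x)"
proof -
  obtain s where s: "s \<in> graph_on (h x) (tball_minus f M ls p x (\<delta>1' / l x))" "z = x + s"
    using assms(2) by (auto simp: Wss_loc_def)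
  then have "in_chart f x s \<in> graph_on (h (f x)) (tball_minus f M ls p (f x) (\<delta>1' / l (f x)))"
    using stable_at(4)[OF assms(1)] by blast
  moreover have "f z = f x + in_chart f x s" by (simp add: in_chart_def s(2))
  ultimately show ?thesis unfolding Wss_loc_def by blast
qed

text \<open>The graph map has slope at most 1/10 in adapted norms, so the stable component
  dominates.\<close>

lemma Wss_AN: assumes x: "x \<in> G" and "z \<in> Wss x" shows "AN x (z - x) = NM x (z - x)"
proof -
  obtain w where w: "w \<in> tball_minus f M ls p x (\<delta>1' / l x)" and z: "z - x = w + h x w"
    using assms(2) by (auto simp: Wss_loc_def graph_on_def)
  have wE: "w \<in> Em x" and hE: "h x w \<in> Ep x"
    using w stable_at(1)[OF x] by (auto simp: tball_minus_def tball_plus_def)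
  have "0 \<le> AN x w" using norm_le_AN[OF x, of w] norm_ge_zero[of w] by linarith
  then have "0 \<in> tball_minus f M ls p x (\<delta>1' / l x)"
    using w AN_0[OF x] subspace_0[OF subspace_E(2)] by (auto simp: tball_minus_def)
  then have "AN x (h x w - h x 0) \<le> 1 / 10 * AN x (w - 0)"
    using stable_at(3)[OF x] w unfolding lip_wrt_def by blast
  then have *: "AN x (h x w) \<le> 1 / 10 * AN x w" by (simp add: stable_at(2)[OF x])
  have p1: "pp x (z - x) = h x w" unfolding z using wE hE by (intro pp_eqI[OF x]) auto
  have p2: "pm x (z - x) = w" by (simp only: pm_eq[OF x] p1) (simp add: z)
  have "NP x (z - x) = AN x (h x w)" using AN_pp[OF x, of "z - x"] p1 by simp
  moreover have "NM x (z - x) = AN x w" using AN_pm[OF x, of "z - x"] p2 by simp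
  ultimately show ?thesis using * \<open>0 \<le> AN x w\<close> by (simp add: AN_eq[of x "z - x"])
qed

text \<open>The rate supplied by \<open>local_stable\<close> involves \<open>\<delta>1'\<close>,
  which need not fit below \<open>b\<close>, so a rate with a smaller \<open>\<delta>\<close> is
  derived afresh. Images stay on the leaves, where the norm equals its stable part by
  \<open>Wss_AN\<close>, and the linear part contracts that by \<open>exp (lam_minus ls p)\<close>.
  The second condition on \<open>\<delta>2\<close> keeps the distance to the orbit below the radius
  of the charts.\<close>

lemma Wss_decay:
  assumes x: "x \<in> G" and d: "0 < \<delta>" "\<delta> \<le> \<delta>1" and z: "z \<in> Wss x" "AN x (z - x) \<le> C"
    and l: "l x \<le> l0" "exp \<delta>2 * (exp (lam_minus ls p) + \<delta>) \<le> 1" "l0 * C \<le> \<delta>"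
  shows "AN ((f ^^ n) x) ((f ^^ n) z - (f ^^ n) x) \<le> C * (exp (lam_minus ls p) + \<delta>) ^ n"
proof -
  define c where "c = exp (lam_minus ls p) + \<delta>"
  have c0: "0 < c" using d by (simp add: c_def add_pos_pos)
  have C0: "0 \<le> C" using z(2) norm_le_AN[OF x, of "z - x"] norm_ge_zero[of "z - x"] by linarith
  have "(f ^^ n) z \<in> Wss ((f ^^ n) x) \<and> AN ((f ^^ n) x) ((f ^^ n) z - (f ^^ n) x) \<le> C * c ^ n"
  proof (induction n)
    case 0 then show ?case using z by simp
  next
    case (Suc n)
    define y q where "y = (f ^^ n) x" and "q = (f ^^ n) z"
    have y: "y \<in> G" using G_iter[OF x] by (simp add: y_def)
    have q: "q \<in> Wss y" "AN y (q - y) \<le> C * c ^ n" using Suc by (auto simp: y_def q_def)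
    have l1: "1 \<le> l y" by (rule l_ge_1[OF y])
    have "l y * AN y (q - y) \<le> (exp \<delta>2 ^ n * l0) * (C * c ^ n)"
    proof (rule mult_mono)
      have "l y \<le> exp \<delta>2 ^ n * l x" unfolding y_def by (rule l_iter[OF x])
      also have "\<dots> \<le> exp \<delta>2 ^ n * l0" using l(1) by (intro mult_left_mono) auto
      finally show "l y \<le> exp \<delta>2 ^ n * l0" .
      have "0 \<le> l0" using l(1) l_ge_1[OF x] by simp
      then show "0 \<le> exp \<delta>2 ^ n * l0" by simp
      show "0 \<le> AN y (q - y)" using norm_le_AN[OF y, of "q - y"] norm_ge_zero[of "q - y"] by linarith
    qed (rule q(2))
    also have "\<dots> = (l0 * C) * (exp \<delta>2 * c) ^ n" by (simp add: power_mult_distrib mult_ac)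
    also have "\<dots> \<le> \<delta> * 1"
      using l c0 d C0 l_ge_1[OF x] by (intro mult_mono power_le_one) (auto simp: c_def)
    finally have sm: "AN y (q - y) \<le> \<delta> / l y" using l1 by (simp add: field_simps)
    have W: "f q \<in> Wss (f y)" by (rule Wss_f[OF y q(1)])
    have "AN (f y) (f q - f y) = NM (f y) (f q - f y)" by (rule Wss_AN[OF G_f[OF y] W])
    also have "\<dots> \<le> NM (f y) (f' y (q - y)) + NM (f y) (f q - f y - f' y (q - y))"
      using NM_add[OF G_f[OF y], of "f' y (q - y)" "f q - f y - f' y (q - y)"] by simp
    also have "\<dots> \<le> exp (lam_minus ls p) * NM y (q - y) + \<delta> * AN y (q - y)"
    proof (rule add_mono[OF NM_f[OF y]])
      have "AN y (y - y) \<le> \<delta> / l y" using AN_0[OF y] d l1 by simp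
      from chart_lip(1)[OF y d sm this] show "NM (f y) (f q - f y - f' y (q - y)) \<le> \<delta> * AN y (q - y)"
        by (simp add: AN_eq)
    qed
    also have "NM y (q - y) = AN y (q - y)" using Wss_AN[OF y q(1)] by simp
    finally have "AN (f y) (f q - f y) \<le> c * AN y (q - y)" by (simp add: c_def algebra_simps)
    also have "\<dots> \<le> c * (C * c ^ n)" using q(2) c0 by (intro mult_left_mono) auto
    finally show ?case using W by (simp add: y_def q_def mult_ac)
  qed
  then show ?thesis by (simp add: c_def)
qed

end

end

section \<open>Continuity of the unstable subspaces\<close>

lemma finite_dim_param:
  fixes B :: "'a::real_normed_vector set"
  assumes B: "finite B" "independent B" "card B = CARD('k::finite)"
  obtains T :: "real^'k \<Rightarrow> 'a" where "bounded_linear T" "inj T" "range T = span B" "\<And>k. T (axis k 1) \<in> B"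
proof -
  obtain b where b: "bij_betw b (UNIV :: 'k set) B"
    using finite_same_card_bij[of "UNIV :: 'k set" B] B by auto
  define T where "T \<zeta> = (\<Sum>k\<in>UNIV. (\<zeta> $ k) *\<^sub>R b k)" for \<zeta> :: "real^'k"
  have lin: "linear T" by (rule linearI) (simp_all add: T_def scaleR_add_left sum.distrib scaleR_sum_right)
  have re: "(\<Sum>k\<in>UNIV. c (b k) *\<^sub>R b k) = (\<Sum>v\<in>B. c v *\<^sub>R v)" for c
    by (rule sum.reindex_bij_betw[OF b])
  have ib: "inv_into UNIV b (b k) = k" for k using bij_betw_inv_into_left[OF b] by simp
  have "\<zeta> = 0" if "T \<zeta> = 0" for \<zeta>
  proof -
    have "(\<Sum>v\<in>B. (\<zeta> $ inv_into UNIV b v) *\<^sub>R v) = 0"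
      using re[of "\<lambda>v. \<zeta> $ inv_into UNIV b v"] that by (simp add: T_def ib)
    then have "\<zeta> $ inv_into UNIV b v = 0" if "v \<in> B" for v
      using independentD[OF B(2,1) order_refl _ that, of "\<lambda>v. \<zeta> $ inv_into UNIV b v"] by blast
    then have "\<zeta> $ k = 0" for k using ib[of k] bij_betwE[OF b] by (metis UNIV_I)
    then show ?thesis by (simp add: vec_eq_iff)
  qed
  then have inj: "inj T" by (simp add: linear_injective_0[OF lin])
  have "v \<in> range T \<longleftrightarrow> v \<in> span B" for v
  proof
    assume "v \<in> range T"
    then obtain \<zeta> where "v = T \<zeta>" by blast
    then show "v \<in> span B"
      using bij_betwE[OF b] by (simp only: T_def) (intro span_sum span_scale span_base, blast)
  next
    assume "v \<in> span B"
    then obtain c where "v = (\<Sum>v\<in>B. c v *\<^sub>R v)" using span_finite[OF B(1)] by auto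
    then have "v = T (\<chi> k. c (b k))" using re[of c] by (simp add: T_def)
    then show "v \<in> range T" by blast
  qed
  moreover have "T (axis k 1) \<in> B" for k
  proof -
    have "T (axis k 1) = (\<Sum>j\<in>UNIV. if j = k then b j else 0)"
      unfolding T_def by (intro sum.cong) (auto simp: axis_def)
    then show ?thesis using bij_betwE[OF b] by simp
  qed
  ultimately show thesis using that[OF _ inj] lin linear_conv_bounded_linear[THEN iffD1, OF lin] by blast
qed

lemma bounded_linear_inv_compose:
  fixes T :: "real^'k::finite \<Rightarrow> 'a::real_normed_vector" and S :: "'b::real_normed_vector \<Rightarrow> 'a"
  assumes T: "bounded_linear T" "inj T" and S: "bounded_linear S" "range S \<subseteq> range T"
  shows "bounded_linear (\<lambda>v. inv T (S v))"
proof -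
  obtain c where c: "0 < c" "\<And>\<zeta>. c * norm \<zeta> \<le> norm (T \<zeta>)" using inj_linear_bounded_below[OF T] by blast
  have TS: "T (inv T (S v)) = S v" for v using S(2) by (intro f_inv_into_f) auto
  note lT = bounded_linear.linear[OF T(1)] and lS = bounded_linear.linear[OF S(1)]
  obtain K where K: "\<And>v. norm (S v) \<le> norm v * K" using bounded_linear.bounded[OF S(1)] by blast
  show ?thesis
  proof (rule bounded_linear_intro[where K="K / c"])
    show "inv T (S (u + v)) = inv T (S u) + inv T (S v)" for u v
      by (rule injD[OF T(2)]) (simp only: TS linear_add[OF lT], rule linear_add[OF lS])
    show "inv T (S (r *\<^sub>R v)) = r *\<^sub>R inv T (S v)" for r v
      by (rule injD[OF T(2)]) (simp only: TS linear_cmul[OF lT], rule linear_cmul[OF lS])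
    show "norm (inv T (S v)) \<le> norm v * (K / c)" for v
      using c(2)[of "inv T (S v)"] K[of v] c(1) by (simp add: TS field_simps)
  qed
qed

lemma independent_Un_direct:
  fixes B C :: "'a::real_vector set"
  assumes "finite C" "independent B" "independent C" "span B \<inter> span C = {0}"
  shows "independent (B \<union> C)"
  using assms
proof (induction C)
  case (insert c C)
  have C: "independent C" "c \<notin> span C"
    using insert.hyps(2) insert.prems(2) independent_insert[of c C] by auto
  have sub: "span C \<subseteq> span (insert c C)" by (intro span_mono) auto
  have "span B \<inter> span C = {0}" using insert.prems(3) sub span_zero by blast
  then have IH: "independent (B \<union> C)" using insert.IH insert.prems(1) C(1) by blast
  have "c \<notin> span (B \<union> C)"
  proof
    assume "c \<in> span (B \<union> C)"
    then obtain b c' where b: "c = b + c'" "b \<in> span B" "c' \<in> span C" by (auto simp: span_Un)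
    have "c - c' \<in> span (insert c C)" using b(3) sub by (intro span_diff) (auto intro: span_base)
    then have "b \<in> span B \<inter> span (insert c C)" using b by simp
    then have "b = 0" using insert.prems(3) by blast
    then show False using b C(2) by simp
  qed
  then show ?case using independent_insertI[OF _ IH] by simp
qed simp

lemma independent_UN_direct:
  fixes B :: "'i \<Rightarrow> 'a::real_vector set"
  assumes "finite I" "\<And>i. i \<in> I \<Longrightarrow> independent (B i) \<and> finite (B i)"
    and "\<And>i. i \<in> I \<Longrightarrow> span (B i) \<inter> span (\<Union>j\<in>I - {i}. B j) = {0}"
  shows "independent (\<Union>i\<in>I. B i) \<and> card (\<Union>i\<in>I. B i) = (\<Sum>i\<in>I. card (B i))"
  using assms
proof (induction I)
  case (insert k I)
  have "span (B i) \<inter> span (\<Union>j\<in>I - {i}. B j) = {0}" if "i \<in> I" for i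
  proof -
    have "span (\<Union>j\<in>I - {i}. B j) \<subseteq> span (\<Union>j\<in>insert k I - {i}. B j)" by (intro span_mono) auto
    then show ?thesis using insert.prems(2)[of i] that span_zero by blast
  qed
  then have IH: "independent (\<Union>i\<in>I. B i)" "card (\<Union>i\<in>I. B i) = (\<Sum>i\<in>I. card (B i))"
    using insert.IH insert.prems(1) by auto
  have eq: "insert k I - {k} = I" using insert.hyps by blast
  have dir: "span (\<Union>i\<in>I. B i) \<inter> span (B k) = {0}" using insert.prems(2)[of k] eq by (simp add: Int_commute)
  have fk: "independent (B k)" "finite (B k)" using insert.prems(1) by auto
  have "(\<Union>i\<in>I. B i) \<inter> B k \<subseteq> {0}" using dir span_superset[of "B k"] span_superset[of "\<Union>i\<in>I. B i"] by blast
  moreover have "0 \<notin> B k" using fk(1) dependent_zero by blast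
  ultimately have disj: "(\<Union>i\<in>I. B i) \<inter> B k = {}" by blast
  have "independent ((\<Union>i\<in>I. B i) \<union> B k)" by (rule independent_Un_direct[OF fk(2) IH(1) fk(1) dir])
  moreover have "card ((\<Union>i\<in>I. B i) \<union> B k) = card (\<Union>i\<in>I. B i) + card (B k)"
    using insert.hyps insert.prems(1) fk disj by (intro card_Un_disjoint) auto
  ultimately show ?case using IH insert.hyps by (simp add: Un_commute)
qed (simp add: independent_empty)

text \<open>The projection \<open>R\<close> onto \<open>W\<close> is injective on \<open>V\<close>:
  if \<open>R v = 0\<close> and \<open>u\<close> in \<open>W\<close> is within
  \<open>d * norm v\<close> of \<open>v\<close>, then \<open>norm u \<le> C * d * norm v\<close>, so
  \<open>norm v \<le> (1 + C) * d * norm v\<close>, which forces \<open>v = 0\<close>.\<close>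

lemma dim_le_near:
  fixes V W :: "'a::real_normed_vector set"
  assumes R: "bounded_linear R" "range R \<subseteq> W" "\<And>u. u \<in> W \<Longrightarrow> R u = u" "\<And>v. norm (R v) \<le> C * norm v"
    and V: "subspace V" and W: "finite F" "W \<subseteq> span F"
    and near: "\<And>v. v \<in> V \<Longrightarrow> \<exists>u\<in>W. norm (v - u) \<le> d * norm v" and d: "(1 + C) * d < 1" "0 \<le> C"
  shows "dim V \<le> dim W"
proof -
  note lR = bounded_linear.linear[OF R(1)]
  have z: "v = 0" if vV: "v \<in> V" and Rv: "R v = 0" for v
  proof (rule ccontr)
    assume "v \<noteq> 0"
    obtain u where u: "u \<in> W" "norm (v - u) \<le> d * norm v" using near[OF vV] by blast
    have "R (v - u) = - u" using Rv R(3)[OF u(1)] by (simp add: linear_diff[OF lR])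
    then have "norm u \<le> C * norm (v - u)" using R(4)[of "v - u"] by simp
    then have "norm v \<le> (1 + C) * norm (v - u)" using norm_triangle_sub[of v u] by (simp add: algebra_simps)
    also have "\<dots> \<le> (1 + C) * (d * norm v)" using u(2) d(2) by (intro mult_left_mono) auto
    also have "\<dots> < norm v" using d(1) \<open>v \<noteq> 0\<close> by (simp flip: mult.assoc)
    finally show False by simp
  qed
  obtain B where B: "B \<subseteq> V" "independent B" "V \<subseteq> span B" "card B = dim V" using real_vector.basis_exists[of V] by blast
  obtain D where D: "D \<subseteq> W" "independent D" "W \<subseteq> span D" "card D = dim W" using real_vector.basis_exists[of W] by blast
  have fD: "finite D" using independent_span_bound[OF W(1) D(2)] D(1) W(2) by blast
  have sB: "span B = V" using B V by (meson order_antisym span_minimal)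
  have inj: "inj_on R (span B)"
  proof (rule inj_onI)
    fix u v assume "u \<in> span B" "v \<in> span B" "R u = R v"
    then have "u - v = 0" using z[of "u - v"] subspace_diff[OF V] by (simp add: sB linear_diff[OF lR])
    then show "u = v" by simp
  qed
  have "independent (R ` B)" by (rule linear_independent_injective_image[OF lR B(2) inj])
  then have "card (R ` B) \<le> card D" using independent_span_bound[OF fD] R(2) D(3) by blast
  moreover have "card (R ` B) = card B" using card_image[OF inj_on_subset[OF inj span_superset]] .
  ultimately show ?thesis using B D by simp
qed

text \<open>The bound \<open>d \<le> 2\<close> rules out that the infimum is witnessed only by the
  extra element 2. The estimates extend from unit vectors by homogeneity.\<close>

lemma sphere_dist_near:
  assumes "sphere_dist U V < d" "d \<le> 2" "subspace U" "subspace V"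
  shows "u \<in> U \<Longrightarrow> \<exists>v\<in>V. norm (u - v) \<le> d * norm u" "v \<in> V \<Longrightarrow> \<exists>u\<in>U. norm (u - v) \<le> d * norm v"
proof -
  obtain e where "e < d" and e: "e = 2 \<or> (\<forall>u\<in>U \<inter> sphere 0 1. \<exists>v\<in>V \<inter> sphere 0 1. dist u v \<le> e) \<and>
       (\<forall>v\<in>V \<inter> sphere 0 1. \<exists>u\<in>U \<inter> sphere 0 1. dist u v \<le> e)"
    using cInf_lessD[OF _ assms(1)[unfolded sphere_dist_def]] by blast
  have near: "\<forall>u\<in>U \<inter> sphere 0 1. \<exists>v\<in>V. norm (u - v) \<le> d" "\<forall>v\<in>V \<inter> sphere 0 1. \<exists>u\<in>U. norm (v - u) \<le> d"
  proof -
    have "e \<noteq> 2" using \<open>e < d\<close> assms(2) by simp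
    with e have e': "\<forall>u\<in>U \<inter> sphere 0 1. \<exists>v\<in>V \<inter> sphere 0 1. dist u v \<le> e"
      "\<forall>v\<in>V \<inter> sphere 0 1. \<exists>u\<in>U \<inter> sphere 0 1. dist u v \<le> e" by blast+
    have le: "norm (u - v) \<le> d" "norm (v - u) \<le> d" if "dist u v \<le> e" for u v :: 'a
      using that \<open>e < d\<close> by (simp_all add: dist_norm norm_minus_commute)
    show "\<forall>u\<in>U \<inter> sphere 0 1. \<exists>v\<in>V. norm (u - v) \<le> d" using e'(1) le(1) by blast
    show "\<forall>v\<in>V \<inter> sphere 0 1. \<exists>u\<in>U. norm (v - u) \<le> d" using e'(2) le(2) by blast
  qed
  have *: "\<exists>v\<in>V. norm (u - v) \<le> d * norm u"
    if nr: "\<forall>u\<in>U \<inter> sphere 0 1. \<exists>v\<in>V. norm (u - v) \<le> d" "subspace U" "subspace V" "u \<in> U" for u and U V :: "'a set"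
  proof (cases "u = 0")
    case True then show ?thesis using subspace_0[OF nr(3)] by (intro bexI[of _ 0]) auto
  next
    case False
    then have "u /\<^sub>R norm u \<in> U \<inter> sphere 0 1" using subspace_mul[OF nr(2,4)] by simp
    then obtain v where v: "v \<in> V" "norm (u /\<^sub>R norm u - v) \<le> d" using nr(1) by blast
    have "u - norm u *\<^sub>R v = norm u *\<^sub>R (u /\<^sub>R norm u - v)" using False by (simp add: scaleR_diff_right)
    then have "norm (u - norm u *\<^sub>R v) \<le> d * norm u" using mult_left_mono[OF v(2) norm_ge_zero[of u]] by (simp add: mult.commute)
    then show ?thesis using subspace_mul[OF nr(3) v(1)] by blast
  qed
  show "u \<in> U \<Longrightarrow> \<exists>v\<in>V. norm (u - v) \<le> d * norm u" by (rule *[OF near(1) assms(3,4)])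
  assume "v \<in> V"
  from *[OF near(2) assms(4,3) this] show "\<exists>u\<in>U. norm (u - v) \<le> d * norm v" by (simp add: norm_minus_commute)
qed


context lyapunov_chart_system
begin

lemma K_continuity:
  "\<forall>n. continuous_on (msp_K M n) (msp_r M) \<and>
        (\<forall>x\<in>msp_K M n. \<forall>i\<le>msp_r M x.
           ((\<lambda>y. sphere_dist (piece M i y) (piece M i x)) \<longlongrightarrow> 0) (at x within msp_K M n))"
  by (insert split, unfold lyapunov_splitting_def, elim conjE, assumption)

text \<open>The limits are punctured at \<open>x0\<close>; \<open>Ep_near\<close> treats that point
  separately.\<close>

lemma pieces_near:
  assumes "x0 \<in> msp_K M n0" "0 < d"
  obtains \<epsilon> where "0 < \<epsilon>" "\<And>y. y \<in> msp_K M n0 \<Longrightarrow> norm (y - x0) < \<epsilon> \<Longrightarrow> y \<noteq> x0 \<Longrightarrow>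
    msp_r M y = msp_r M x0 \<and> (\<forall>i\<le>msp_r M x0. sphere_dist (piece M i y) (piece M i x0) < d)"
proof -
  have "continuous_on (msp_K M n0) (msp_r M)" using K_continuity by blast
  then have "(msp_r M \<longlongrightarrow> msp_r M x0) (at x0 within msp_K M n0)" using assms(1) by (simp add: continuous_on)
  then have "\<forall>\<^sub>F y in at x0 within msp_K M n0. msp_r M y = msp_r M x0" by (simp add: tendsto_discrete)
  moreover have "\<forall>\<^sub>F y in at x0 within msp_K M n0. \<forall>i\<in>{..msp_r M x0}. sphere_dist (piece M i y) (piece M i x0) < d"
  proof (rule eventually_ball_finite[OF finite_atMost], rule ballI)
    fix i assume "i \<in> {..msp_r M x0}"
    then have "((\<lambda>y. sphere_dist (piece M i y) (piece M i x0)) \<longlongrightarrow> 0) (at x0 within msp_K M n0)"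
      using K_continuity assms(1) by blast
    then show "\<forall>\<^sub>F y in at x0 within msp_K M n0. sphere_dist (piece M i y) (piece M i x0) < d"
      using assms(2) by (rule order_tendstoD)
  qed
  ultimately have "\<forall>\<^sub>F y in at x0 within msp_K M n0. msp_r M y = msp_r M x0 \<and> (\<forall>i\<in>{..msp_r M x0}. sphere_dist (piece M i y) (piece M i x0) < d)"
    by (rule eventually_conj)
  then obtain e where "0 < e" "\<forall>y\<in>msp_K M n0. y \<noteq> x0 \<and> dist y x0 < e \<longrightarrow>
      msp_r M y = msp_r M x0 \<and> (\<forall>i\<in>{..msp_r M x0}. sphere_dist (piece M i y) (piece M i x0) < d)"
    unfolding eventually_at by blast
  then show thesis using that[of e] by (auto simp: dist_norm)
qed

lemma piece_basis:
  assumes "x \<in> G" "i \<in> P_idx x"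
  shows "\<exists>B. independent B \<and> finite B \<and> span B = piece M i x \<and> card B = dim (piece M i x)"
proof -
  have i: "i \<in> {1..msp_r M x}" using assms(2) by (auto simp: P_idx_def)
  have s: "subspace (piece M i x)" "\<exists>F. finite F \<and> span F = piece M i x"
    using splits[OF G_Dom[OF assms(1)]] i by (auto simp: splits_at_def piece_def dest!: spec[of _ i])
  obtain F where F: "finite F" "span F = piece M i x" using s(2) by blast
  obtain B where B: "B \<subseteq> piece M i x" "independent B" "piece M i x \<subseteq> span B" "card B = dim (piece M i x)"
    using real_vector.basis_exists[of "piece M i x"] by blast
  have "finite B" using independent_span_bound[OF F(1) B(2)] B(1) F(2) by simp
  moreover have "span B = piece M i x" using B(1,3) s(1) by (meson order_antisym span_minimal)
  ultimately show ?thesis using B by blast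
qed

lemma piece_subspace: "x \<in> G \<Longrightarrow> i \<le> msp_r M x \<Longrightarrow> subspace (piece M i x)"
  using splits[OF G_Dom] by (simp add: splits_at_def)

lemma piece_dim_pos: assumes "x \<in> G" "i \<in> P_idx x" shows "0 < dim (piece M i x)"
proof (rule ccontr)
  assume "\<not> 0 < dim (piece M i x)"
  moreover obtain B where B: "independent B \<and> finite B \<and> span B = piece M i x \<and> card B = dim (piece M i x)"
    using piece_basis[OF assms] by blast
  ultimately have "B = {}" by (metis card_0_eq gr0I)
  then have "piece M i x = {0}" using B by (simp add: span_empty)
  moreover have "i \<in> {1..msp_r M x}" using assms(2) by (simp add: P_idx_def)
  ultimately show False using splits[OF G_Dom[OF assms(1)]] by (auto simp: splits_at_def piece_def)
qed

lemma dim_Ep: assumes "x \<in> G" shows "dim (Ep x) = (\<Sum>i\<in>P_idx x. dim (piece M i x))"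
proof -
  obtain B where B: "\<And>i. i \<in> P_idx x \<Longrightarrow> independent (B i) \<and> finite (B i) \<and> span (B i) = piece M i x \<and> card (B i) = dim (piece M i x)"
    using piece_basis[OF assms] by metis
  have fin: "finite (P_idx x)" by (simp add: P_idx_def)
  have sub: "span (\<Union>j\<in>J. B j) = span (\<Union>j\<in>J. piece M j x)" if "J \<subseteq> P_idx x" for J
  proof (rule antisym)
    have Bp: "B j \<subseteq> piece M j x" if "j \<in> J" for j using B[of j] that \<open>J \<subseteq> P_idx x\<close> span_superset[of "B j"] by auto
    show "span (\<Union>j\<in>J. B j) \<subseteq> span (\<Union>j\<in>J. piece M j x)" by (intro span_mono UN_mono order_refl Bp)
    have "piece M j x \<subseteq> span (\<Union>j\<in>J. B j)" if "j \<in> J" for j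
    proof -
      have "piece M j x = span (B j)" using B[of j] that \<open>J \<subseteq> P_idx x\<close> by auto
      also have "\<dots> \<subseteq> span (\<Union>j\<in>J. B j)" using that by (intro span_mono) blast
      finally show ?thesis .
    qed
    then show "span (\<Union>j\<in>J. piece M j x) \<subseteq> span (\<Union>j\<in>J. B j)" by (intro span_minimal) auto
  qed
  have "independent (\<Union>i\<in>P_idx x. B i) \<and> card (\<Union>i\<in>P_idx x. B i) = (\<Sum>i\<in>P_idx x. card (B i))"
  proof (rule independent_UN_direct[OF fin])
    show "independent (B i) \<and> finite (B i)" if "i \<in> P_idx x" for i using B[OF that] by blast
    fix i assume i: "i \<in> P_idx x"
    have "(\<Union>j\<in>P_idx x - {i}. piece M j x) \<subseteq> (\<Union>j\<in>{0..msp_r M x} - {i}. piece M j x)"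
      by (intro UN_mono) (auto simp: P_idx_def)
    then have "span (\<Union>j\<in>P_idx x - {i}. B j) \<subseteq> copiece M i x"
      unfolding sub[OF Diff_subset] copiece_def by (rule span_mono)
    moreover have "piece M i x \<inter> copiece M i x = {0}"
      using splits[OF G_Dom[OF assms]] i by (auto simp: splits_at_def P_idx_def)
    ultimately show "span (B i) \<inter> span (\<Union>j\<in>P_idx x - {i}. B j) = {0}"
      using B[OF i] span_zero[of "B i"] span_zero[of "\<Union>j\<in>P_idx x - {i}. B j"] by blast
  qed
  moreover have "(\<Sum>i\<in>P_idx x. card (B i)) = (\<Sum>i\<in>P_idx x. dim (piece M i x))"
    using B by (intro sum.cong) auto
  moreover have "span (\<Union>i\<in>P_idx x. B i) = span (Ep x)" using sub[OF order_refl] by (simp add: Ep_eq span_span)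
  ultimately show ?thesis using real_vector.dim_eq_card[of "\<Union>i\<in>P_idx x. B i" "Ep x"] by simp
qed

text \<open>Exponents decrease with the index, so the unstable indices form an initial
  segment.\<close>

lemma P_idx_down: assumes "x \<in> G" "j \<in> P_idx x" "i \<le> j" "1 \<le> i" shows "i \<in> P_idx x"
proof (cases "i = j")
  case False
  have "msp_lam M j x < msp_lam M i x"
    using met[OF G_Dom[OF assms(1)]] assms False by (auto simp: met_at_def P_idx_def)
  then show ?thesis using assms by (auto simp: P_idx_def)
qed (use assms in simp)

text \<open>The basis is taken inside the individual pieces, because continuity of the splitting is
  known only piece by piece.\<close>

lemma Ep_param:
  assumes "m = CARD('k::finite)" "x \<in> G"
  obtains T :: "real^'k \<Rightarrow> 'a" where "bounded_linear T" "inj T" "range T = Ep x" "\<And>k. \<exists>i\<in>P_idx x. T (axis k 1) \<in> piece M i x"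
proof -
  obtain F where F: "\<And>i. i \<in> P_idx x \<Longrightarrow> finite (F i) \<and> span (F i) = piece M i x"
    using piece_basis[OF assms(2)] by metis
  obtain B where B: "B \<subseteq> (\<Union>i\<in>P_idx x. piece M i x)" "independent B" "(\<Union>i\<in>P_idx x. piece M i x) \<subseteq> span B"
    using real_vector.maximal_independent_subset by blast
  have sB: "span B = Ep x"
  proof (rule antisym)
    show "span B \<subseteq> Ep x" unfolding Ep_eq by (rule span_mono[OF B(1)])
    show "Ep x \<subseteq> span B" unfolding Ep_eq by (rule span_minimal[OF B(3)]) simp
  qed
  have fB: "finite B"
  proof -
    have "piece M i x \<subseteq> span (\<Union>i\<in>P_idx x. F i)" if "i \<in> P_idx x" for i
    proof -
      have "span (F i) \<subseteq> span (\<Union>i\<in>P_idx x. F i)" using that by (intro span_mono) blast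
      then show ?thesis using F[OF that] by simp
    qed
    then have "B \<subseteq> span (\<Union>i\<in>P_idx x. F i)" using B(1) by blast
    moreover have "finite (\<Union>i\<in>P_idx x. F i)" using F by (auto simp: P_idx_def)
    ultimately show ?thesis using independent_span_bound[OF _ B(2)] by blast
  qed
  have "card B = CARD('k)"
    using real_vector.dim_eq_card[of B "Ep x"] B(2) sB G_dim[OF assms(2)] assms(1) by (simp add: span_eq_iff[THEN iffD2, OF subspace_E(1)])
  from finite_dim_param[OF fB B(2) this] obtain T :: "real^'k \<Rightarrow> 'a"
    where T: "bounded_linear T" "inj T" "range T = span B" "\<And>k. T (axis k 1) \<in> B" by metis
  show thesis
  proof (rule that[OF T(1,2)])
    show "range T = Ep x" using T(3) sB by simp
    show "\<exists>i\<in>P_idx x. T (axis k 1) \<in> piece M i x" for k using T(4)[of k] B(1) by blast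
  qed
qed

text \<open>In the coordinates \<open>co\<close> the image of \<open>V\<close> admits a linear
  retraction of the whole coordinate space, which finite dimension makes bounded.\<close>

lemma Ep_projection:
  fixes T :: "real^'k::finite \<Rightarrow> 'a"
  assumes x: "x \<in> G" and T: "bounded_linear T" "inj T" "range T = Ep x" and V: "subspace V" "V \<subseteq> Ep x"
  obtains R where "bounded_linear R" "range R \<subseteq> V" "\<And>u. u \<in> V \<Longrightarrow> R u = u"
proof -
  define co where "co v = inv T (pp x v)" for v
  have co: "bounded_linear co"
    unfolding co_def using pp(1)[OF x] T(3) by (intro bounded_linear_inv_compose[OF T(1,2) pp_bounded_linear[OF x]]) auto
  have Tco: "T (co v) = v" if "v \<in> V" for v
    using that V(2) T(3) pp_Ep[OF x, of v] by (auto simp: co_def f_inv_into_f)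
  have "subspace (co ` V)" by (rule linear_subspace_image[OF bounded_linear.linear[OF co] V(1)])
  from linear_exists_left_inverse_on[OF linear_id this] obtain g :: "real^'k \<Rightarrow> real^'k"
    where g: "range g \<subseteq> co ` V" "linear g" "\<And>\<zeta>. \<zeta> \<in> co ` V \<Longrightarrow> g \<zeta> = \<zeta>" by (auto simp: id_def)
  have bg: "bounded_linear g" using g(2) linear_conv_bounded_linear[THEN iffD1] by blast
  show thesis
  proof (rule that[of "\<lambda>v. T (g (co v))"])
    show "bounded_linear (\<lambda>v. T (g (co v)))"
      by (rule bounded_linear_compose[OF T(1) bounded_linear_compose[OF bg co]])
    show "range (\<lambda>v. T (g (co v))) \<subseteq> V"
    proof
      fix u assume "u \<in> range (\<lambda>v. T (g (co v)))"
      then obtain v where v: "u = T (g (co v))" by blast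
      have "g (co v) \<in> co ` V" using g(1) by blast
      then obtain w where "g (co v) = co w" "w \<in> V" by blast
      with v have "u = T (co w)" "w \<in> V" by simp_all
      then show "u \<in> V" using Tco by simp
    qed
    show "T (g (co u)) = u" if "u \<in> V" for u using g(3)[of "co u"] Tco[OF that] that by simp
  qed
qed

text \<open>The exponents are not assumed continuous, so the set of unstable indices might change
  nearby. Both sets are initial segments, so an index missing at \<open>y\<close> makes the set at
  \<open>y\<close> a proper subset. By \<open>dim_le_near\<close> its pieces have at most the
  dimensions they have at \<open>x\<close>, so the total dimension would drop, although it is
  \<open>m\<close> on all of \<open>G\<close>.\<close>

lemma P_idx_subset_near:
  fixes T :: "real^'k::finite \<Rightarrow> 'a"
  assumes x: "x \<in> G" and T: "bounded_linear T" "inj T" "range T = Ep x"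
  obtains d where "0 < d" "\<And>y. y \<in> G \<Longrightarrow> msp_r M y = msp_r M x \<Longrightarrow>
    (\<And>i. i \<le> msp_r M x \<Longrightarrow> sphere_dist (piece M i y) (piece M i x) < d) \<Longrightarrow> P_idx x \<subseteq> P_idx y"
proof -
  have "\<exists>R. bounded_linear R \<and> range R \<subseteq> piece M i x \<and> (\<forall>u\<in>piece M i x. R u = u)" if "i \<in> P_idx x" for i
  proof -
    have "piece M i x \<subseteq> Ep x" unfolding Ep_eq using that span_superset[of "\<Union>i\<in>P_idx x. piece M i x"] by blast
    moreover have "subspace (piece M i x)" using that by (intro piece_subspace[OF x]) (auto simp: P_idx_def)
    ultimately show ?thesis using Ep_projection[OF x T] by metis
  qed
  then obtain R where R: "\<And>i. i \<in> P_idx x \<Longrightarrow> bounded_linear (R i) \<and> range (R i) \<subseteq> piece M i x \<and> (\<forall>u\<in>piece M i x. R i u = u)"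
    by metis
  define C where "C = (\<Sum>i\<in>P_idx x. onorm (R i))"
  have C0: "0 \<le> C" unfolding C_def using R onorm_pos_le by (intro sum_nonneg) blast
  have C: "norm (R i v) \<le> C * norm v" if "i \<in> P_idx x" for i v
  proof -
    have "onorm (R i) \<le> C"
      unfolding C_def using that R onorm_pos_le by (intro member_le_sum) (auto simp: P_idx_def)
    then have "onorm (R i) * norm v \<le> C * norm v" by (rule mult_right_mono) simp
    then show ?thesis using onorm[of "R i" v] R[OF that] by simp
  qed
  define d where "d = 1 / (2 * (1 + C))"
  have d: "0 < d" "(1 + C) * d < 1" "d \<le> 2" using C0 by (auto simp: d_def field_simps)
  show thesis
  proof (rule that[OF d(1)], rule ccontr)
    fix y assume y: "y \<in> G" and r: "msp_r M y = msp_r M x"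
      and near: "\<And>i. i \<le> msp_r M x \<Longrightarrow> sphere_dist (piece M i y) (piece M i x) < d"
    assume "\<not> P_idx x \<subseteq> P_idx y"
    then obtain k where k: "k \<in> P_idx x" "k \<notin> P_idx y" by blast
    have sub: "P_idx y \<subseteq> P_idx x - {k}"
    proof
      fix i assume i: "i \<in> P_idx y"
      have "i < k"
      proof (rule ccontr)
        assume "\<not> i < k"
        then show False using P_idx_down[OF y i, of k] k by (auto simp: P_idx_def)
      qed
      then show "i \<in> P_idx x - {k}" using P_idx_down[OF x k(1), of i] i by (auto simp: P_idx_def)
    qed
    have "dim (piece M i y) \<le> dim (piece M i x)" if iy: "i \<in> P_idx y" for i
    proof -
      have i: "i \<in> P_idx x" "i \<le> msp_r M x" using sub iy by (auto simp: P_idx_def)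
      note ss = piece_subspace[OF y, of i] piece_subspace[OF x i(2)]
      obtain F where F: "finite F" "span F = piece M i x" using piece_basis[OF x i(1)] by blast
      note Ri = R[OF i(1)]
      show ?thesis
      proof (rule dim_le_near[where R="R i" and C=C and d=d])
        show "\<exists>u\<in>piece M i x. norm (v - u) \<le> d * norm v" if "v \<in> piece M i y" for v
          using sphere_dist_near(1)[OF near[OF i(2)] d(3) _ ss(2) that] ss(1) r i(2) by simp
      qed (use Ri C[OF i(1)] ss r i F d C0 in auto)
    qed
    then have "(\<Sum>i\<in>P_idx y. dim (piece M i y)) \<le> (\<Sum>i\<in>P_idx y. dim (piece M i x))" by (rule sum_mono)
    also have "\<dots> \<le> (\<Sum>i\<in>P_idx x - {k}. dim (piece M i x))" using sub by (intro sum_mono2) (auto simp: P_idx_def)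
    also have "\<dots> < (\<Sum>i\<in>P_idx x. dim (piece M i x))"
      using k(1) piece_dim_pos[OF x k(1)] by (subst (2) sum.remove[of _ k]) (auto simp: P_idx_def)
    finally have "dim (Ep y) < dim (Ep x)" by (simp add: dim_Ep[OF x] dim_Ep[OF y])
    then show False by (simp add: G_dim x y)
  qed
qed

text \<open>Each basis vector of \<open>Ep x0\<close> lies in one piece and is approximated in the
  corresponding piece at \<open>y\<close>, which is unstable by \<open>P_idx_subset_near\<close>.
  Linear combinations cost a factor \<open>S / c\<close>, which the choice of \<open>d\<close>
  absorbs.\<close>

lemma Ep_near:
  fixes T :: "real^'k::finite \<Rightarrow> 'a"
  assumes x: "x0 \<in> G" "x0 \<in> msp_K M n0" and \<kappa>: "0 < \<kappa>"
    and T: "bounded_linear T" "inj T" "range T = Ep x0" and ax: "\<And>k. \<exists>i\<in>P_idx x0. T (axis k 1) \<in> piece M i x0"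
  obtains \<epsilon> where "0 < \<epsilon>" "\<And>y u. y \<in> G \<Longrightarrow> y \<in> msp_K M n0 \<Longrightarrow> norm (y - x0) < \<epsilon> \<Longrightarrow> u \<in> Ep x0 \<Longrightarrow> \<exists>v\<in>Ep y. norm (u - v) \<le> \<kappa> * norm u"
proof -
  obtain d0 where d0: "0 < d0" "\<And>y. y \<in> G \<Longrightarrow> msp_r M y = msp_r M x0 \<Longrightarrow>
    (\<And>i. i \<le> msp_r M x0 \<Longrightarrow> sphere_dist (piece M i y) (piece M i x0) < d0) \<Longrightarrow> P_idx x0 \<subseteq> P_idx y"
    using P_idx_subset_near[OF x(1) T] by metis
  obtain c where c: "0 < c" "\<And>\<zeta>. c * norm \<zeta> \<le> norm (T \<zeta>)" using inj_linear_bounded_below[OF T(1,2)] by blast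
  define S where "S = (\<Sum>k\<in>UNIV. norm (T (axis k 1)))"
  have S0: "0 \<le> S" by (simp add: S_def sum_nonneg)
  define d where "d = min (min d0 2) (\<kappa> * c / (1 + S))"
  have d: "0 < d" "d \<le> d0" "d \<le> 2" "d * S \<le> \<kappa> * c"
  proof -
    show "0 < d" "d \<le> d0" "d \<le> 2" using d0(1) \<kappa> c(1) S0 by (auto simp: d_def)
    have "d \<le> \<kappa> * c / (1 + S)" by (simp add: d_def)
    then have "d * (1 + S) \<le> \<kappa> * c" using S0 by (simp add: field_simps)
    then show "d * S \<le> \<kappa> * c" using \<open>0 < d\<close> by (simp add: algebra_simps)
  qed
  obtain \<epsilon> where e: "0 < \<epsilon>" "\<And>y. y \<in> msp_K M n0 \<Longrightarrow> norm (y - x0) < \<epsilon> \<Longrightarrow> y \<noteq> x0 \<Longrightarrow>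
    msp_r M y = msp_r M x0 \<and> (\<forall>i\<le>msp_r M x0. sphere_dist (piece M i y) (piece M i x0) < d)"
    using pieces_near[OF x(2) d(1)] by metis
  show thesis
  proof (rule that[OF e(1)])
    fix y u assume y: "y \<in> G" "y \<in> msp_K M n0" "norm (y - x0) < \<epsilon>" and u: "u \<in> Ep x0"
    show "\<exists>v\<in>Ep y. norm (u - v) \<le> \<kappa> * norm u"
    proof (cases "y = x0")
      case True
      then show ?thesis using u \<kappa> by (intro bexI[of _ u]) auto
    next
      case False
      note near = e(2)[OF y(2,3) False]
      have P: "P_idx x0 \<subseteq> P_idx y"
      proof (rule d0(2)[OF y(1)])
        show "sphere_dist (piece M i y) (piece M i x0) < d0" if "i \<le> msp_r M x0" for i
          using near that d(2) by fastforce
      qed (use near in blast)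
      have "\<exists>v\<in>Ep y. norm (T (axis k 1) - v) \<le> d * norm (T (axis k 1))" for k
      proof -
        obtain i where i: "i \<in> P_idx x0" "T (axis k 1) \<in> piece M i x0" using ax by blast
        have ir: "i \<le> msp_r M x0" "i \<le> msp_r M y" using i(1) near by (auto simp: P_idx_def)
        have "sphere_dist (piece M i y) (piece M i x0) < d" using near ir(1) by blast
        from sphere_dist_near(2)[OF this d(3) piece_subspace[OF y(1) ir(2)] piece_subspace[OF x(1) ir(1)] i(2)]
        obtain v where v: "v \<in> piece M i y" "norm (v - T (axis k 1)) \<le> d * norm (T (axis k 1))" by blast
        have "v \<in> Ep y" unfolding Ep_eq using v(1) i(1) P by (intro span_base) blast
        then show ?thesis using v(2) by (auto simp: norm_minus_commute)
      qed
      then obtain w where w: "\<And>k. w k \<in> Ep y \<and> norm (T (axis k 1) - w k) \<le> d * norm (T (axis k 1))" by metis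
      obtain \<zeta> where \<zeta>: "u = T \<zeta>" using u T(3) by blast
      have "u = (\<Sum>k\<in>UNIV. (\<zeta> $ k) *\<^sub>R T (axis k 1))"
      proof -
        have "\<zeta> = (\<Sum>k\<in>UNIV. (\<zeta> $ k) *\<^sub>R axis k 1)"
          using basis_expansion[of \<zeta>] by (simp add: scalar_mult_eq_scaleR)
        then have "T \<zeta> = T (\<Sum>k\<in>UNIV. (\<zeta> $ k) *\<^sub>R axis k 1)" by simp
        then show ?thesis
          by (simp only: \<zeta> linear_sum[OF bounded_linear.linear[OF T(1)]] linear_cmul[OF bounded_linear.linear[OF T(1)]])
      qed
      then have "u - (\<Sum>k\<in>UNIV. (\<zeta> $ k) *\<^sub>R w k) = (\<Sum>k\<in>UNIV. (\<zeta> $ k) *\<^sub>R (T (axis k 1) - w k))"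
        by (simp only: scaleR_diff_right sum_subtractf)
      also have "norm \<dots> \<le> (\<Sum>k\<in>UNIV. norm \<zeta> * (d * norm (T (axis k 1))))"
        using w component_le_norm_cart[of \<zeta>] by (intro sum_norm_le) (auto intro!: mult_mono)
      also have "\<dots> = (d * S) * norm \<zeta>" by (simp add: S_def sum_distrib_left mult_ac)
      also have "\<dots> \<le> (\<kappa> * c) * norm \<zeta>" using d(4) by (rule mult_right_mono) simp
      also have "\<dots> \<le> \<kappa> * norm u" using c(2)[of \<zeta>] \<kappa> \<zeta> by simp
      finally have "norm (u - (\<Sum>k\<in>UNIV. (\<zeta> $ k) *\<^sub>R w k)) \<le> \<kappa> * norm u" .
      moreover have "(\<Sum>k\<in>UNIV. (\<zeta> $ k) *\<^sub>R w k) \<in> Ep y"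
        using w by (intro subspace_sum[OF subspace_E(1)] subspace_mul[OF subspace_E(1)]) blast
      ultimately show ?thesis by blast
    qed
  qed
qed

end


section \<open>Lyapunov charts along orbits\<close>

context lyapunov_chart_system
begin

definition Tp :: "'a \<Rightarrow> real^'k::finite \<Rightarrow> 'a" where
  "Tp x = (SOME T. bounded_linear T \<and> inj T \<and> range T = Ep x)"

lemma Tp:
  assumes "m = CARD('k::finite)" "x \<in> G"
  shows "bounded_linear (Tp x :: real^'k \<Rightarrow> 'a)" "inj (Tp x :: real^'k \<Rightarrow> 'a)" "range (Tp x :: real^'k \<Rightarrow> 'a) = Ep x"
proof -
  have "\<exists>T :: real^'k \<Rightarrow> 'a. bounded_linear T \<and> inj T \<and> range T = Ep x"
    using Ep_param[OF assms] by metis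
  from someI_ex[OF this] show "bounded_linear (Tp x :: real^'k \<Rightarrow> 'a)" "inj (Tp x :: real^'k \<Rightarrow> 'a)" "range (Tp x :: real^'k \<Rightarrow> 'a) = Ep x"
    unfolding Tp_def[symmetric] by blast+
qed

lemma NP_minus: "x \<in> G \<Longrightarrow> NP x (- v) = NP x v" and NM_minus: "x \<in> G \<Longrightarrow> NM x (- v) = NM x v"
  using NP_scale[of x "-1" v] NM_scale[of x "-1" v] by simp_all

lemma AN_perturb:
  assumes x: "x \<in> G" and e: "AN x (w - w0) \<le> e"
  shows "NP x w0 - e \<le> NP x w" "NP x w \<le> NP x w0 + e" "NM x w \<le> NM x w0 + e"
proof -
  have "NP x (w - w0) \<le> e" "NM x (w - w0) \<le> e" using e by (simp_all add: AN_eq)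
  moreover have "NP x (w0 - w) = NP x (w - w0)" using NP_minus[OF x, of "w - w0"] by simp
  ultimately show "NP x w0 - e \<le> NP x w" "NP x w \<le> NP x w0 + e" "NM x w \<le> NM x w0 + e"
    using NP_add[OF x, of w0 "w - w0"] NP_add[OF x, of w "w0 - w"] NM_add[OF x, of w0 "w - w0"] by simp_all
qed

text \<open>In charts of relative size \<open>\<delta>\<close> the map minus its derivative at the
  base point has Lipschitz constant \<open>\<delta>\<close>, which perturbs the linear rates to
  \<open>a\<close> and \<open>g\<close>. The slow variation of \<open>l\<close> along orbits gives
  the distortion \<open>l0 * exp \<delta>2 ^ n\<close>.\<close>

lemma hyperbolic_charts_orbits:
  fixes l0 b \<delta> r :: real and U :: "'a set"
  defines "a \<equiv> exp (lam_minus ls p) + \<delta>" and "g \<equiv> exp (lam_plus ls p) - \<delta>"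
  assumes m: "m = CARD('k::finite)" and U: "\<And>y. y \<in> U \<Longrightarrow> y \<in> G \<and> l y \<le> l0"
    and d: "0 < \<delta>" "\<delta> \<le> \<delta>1" and l0: "1 \<le> l0" and d2: "0 \<le> \<delta>2"
    and par: "exp \<delta>2 ^ (CARD('k) + 2) * a < b" "b < g" "exp \<delta>2 * (exp \<delta>2 * b) < 1" "0 < r" "l0 * r \<le> \<delta>"
  shows "hyperbolic_charts f f' U (\<lambda>y n. (f ^^ n) y) (\<lambda>y n. NP ((f ^^ n) y)) (\<lambda>y n. NM ((f ^^ n) y)) (\<lambda>y n. AN ((f ^^ n) y))
    (\<lambda>y n v. inv (Tp ((f ^^ n) y) :: real^'k \<Rightarrow> 'a) (pp ((f ^^ n) y) v)) (\<lambda>y n. Tp ((f ^^ n) y))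
    l0 (exp \<delta>2) (exp (lam_minus ls p)) a b g (max (exp \<delta>2 * b) (a / g)) \<delta> r"
proof -
  have GI: "(f ^^ n) y \<in> G" if "y \<in> U" for y n using G_iter U[OF that] by blast
  have lb: "l ((f ^^ n) y) \<le> l0 * exp \<delta>2 ^ n" if "y \<in> U" for y n
  proof -
    have "l ((f ^^ n) y) \<le> exp \<delta>2 ^ n * l y" using l_iter U[OF that] by blast
    also have "\<dots> \<le> exp \<delta>2 ^ n * l0" using U[OF that] by (intro mult_left_mono) auto
    finally show ?thesis by (simp add: mult.commute)
  qed
  have small: "AN ((f ^^ n) y) v \<le> \<delta> / l ((f ^^ n) y)" if y: "y \<in> U" and v: "AN ((f ^^ n) y) v \<le> \<delta> / (l0 * exp \<delta>2 ^ n)" for y n v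
  proof -
    have "\<delta> / (l0 * exp \<delta>2 ^ n) \<le> \<delta> / l ((f ^^ n) y)"
      using lb[OF y, of n] l_ge_1[OF GI[OF y], of n] d by (intro divide_left_mono) auto
    with v show ?thesis by linarith
  qed
  have center: "AN ((f ^^ n) y) ((f ^^ n) y - (f ^^ n) y) \<le> \<delta> / l ((f ^^ n) y)" if "y \<in> U" for y n
    using AN_0[OF GI[OF that]] d l_ge_1[OF GI[OF that], of n] by simp
  have AN0: "0 \<le> AN x v" for x v using NP_nonneg[of x v] by (simp add: AN_eq le_max_iff_disj)
  have dpert: "AN (f x) (f' z v - f' x v) \<le> l0 * exp \<delta>2 ^ n * AN x (z - x) * AN x v" "l0 * exp \<delta>2 ^ n * AN x (z - x) \<le> \<delta>"
    if y: "y \<in> U" and x: "x = (f ^^ n) y" and z: "AN x (z - x) \<le> \<delta> / (l0 * exp \<delta>2 ^ n)" for y n x z v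
  proof -
    have xG: "x \<in> G" using GI[OF y] x by simp
    have "AN (f x) (f' z v - f' x v) \<le> l x * AN x v * AN x (z - x)"
      using chart_lip(2)[OF xG d, of z x v] small[OF y, of n "z - x"] center[OF y, of n] z x by simp
    also have "\<dots> \<le> (l0 * exp \<delta>2 ^ n) * AN x v * AN x (z - x)"
      using lb[OF y, of n] x AN0 by (intro mult_right_mono) auto
    finally show "AN (f x) (f' z v - f' x v) \<le> l0 * exp \<delta>2 ^ n * AN x (z - x) * AN x v" by (simp add: mult_ac)
    show "l0 * exp \<delta>2 ^ n * AN x (z - x) \<le> \<delta>" using z l0 by (simp add: field_simps)
  qed
  show ?thesis
  proof (rule hyperbolic_charts.intro)
    show "(f has_derivative blinfun_apply (f' z)) (at z)" for z by (rule f')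
    show "continuous_on UNIV f'" by (rule f'_cont)
    show "AN ((f ^^ n) y) v = max (NP ((f ^^ n) y) v) (NM ((f ^^ n) y) v)" for y n v by (rule AN_eq)
  next
    fix y n and u v :: 'a assume y: "y \<in> U"
    note x = GI[OF y, of n]
    show "NP ((f ^^ n) y) (u + v) \<le> NP ((f ^^ n) y) u + NP ((f ^^ n) y) v" by (rule NP_add[OF x])
    show "NM ((f ^^ n) y) (u + v) \<le> NM ((f ^^ n) y) u + NM ((f ^^ n) y) v" by (rule NM_add[OF x])
    show "NP ((f ^^ n) y) (c *\<^sub>R v) = \<bar>c\<bar> * NP ((f ^^ n) y) v" for c by (rule NP_scale[OF x])
    show "NM ((f ^^ n) y) (c *\<^sub>R v) = \<bar>c\<bar> * NM ((f ^^ n) y) v" for c by (rule NM_scale[OF x])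
    show "norm v \<le> 2 * AN ((f ^^ n) y) v" using norm_le_AN[OF x, of v] by simp
    have "AN ((f ^^ n) y) v \<le> l ((f ^^ n) y) * norm v" by (rule AN_le_norm[OF x])
    also have "\<dots> \<le> l0 * exp \<delta>2 ^ n * norm v" by (rule mult_right_mono[OF lb[OF y]]) simp
    finally show "AN ((f ^^ n) y) v \<le> l0 * exp \<delta>2 ^ n * norm v" .
    note T = Tp[OF m x]
    have TR: "range (pp ((f ^^ n) y)) \<subseteq> range (Tp ((f ^^ n) y) :: real^'k \<Rightarrow> 'a)" using pp(1)[OF x] T(3) by auto
    show "bounded_linear (\<lambda>v. inv (Tp ((f ^^ n) y) :: real^'k \<Rightarrow> 'a) (pp ((f ^^ n) y) v))"
      by (rule bounded_linear_inv_compose[OF T(1,2) pp_bounded_linear[OF x] TR])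
    show "NP ((f ^^ n) y) v = 0" if "inv (Tp ((f ^^ n) y) :: real^'k \<Rightarrow> 'a) (pp ((f ^^ n) y) v) = 0"
    proof -
      have "pp ((f ^^ n) y) v \<in> range (Tp ((f ^^ n) y) :: real^'k \<Rightarrow> 'a)" using TR by blast
      from f_inv_into_f[OF this] have "pp ((f ^^ n) y) v = Tp ((f ^^ n) y) (0 :: real^'k)" unfolding that by simp
      then have "pp ((f ^^ n) y) v = 0" using linear_0[OF bounded_linear.linear[OF T(1)]] by simp
      then have "NP ((f ^^ n) y) v = NP ((f ^^ n) y) 0" using NP_pp[OF x, of v] by simp
      then show ?thesis using NP_scale[OF x, of 0 0] by simp
    qed
    show "bounded_linear (Tp ((f ^^ n) y) :: real^'k \<Rightarrow> 'a)" by (rule T(1))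
    have TE: "Tp ((f ^^ n) y) e \<in> Ep ((f ^^ n) y)" for e :: "real^'k" using T(3) by blast
    show "inv (Tp ((f ^^ n) y) :: real^'k \<Rightarrow> 'a) (pp ((f ^^ n) y) (Tp ((f ^^ n) y) e)) = e" for e :: "real^'k"
      by (simp add: pp_Ep[OF x TE] inv_f_f[OF T(2)])
    show "NM ((f ^^ n) y) (Tp ((f ^^ n) y) e) = 0" for e :: "real^'k" by (rule NM_Ep[OF x TE])
  next
    fix y n z z' assume y: "y \<in> U"
      and z: "AN ((f ^^ n) y) (z - (f ^^ n) y) \<le> \<delta> / (l0 * exp \<delta>2 ^ n)" "AN ((f ^^ n) y) (z' - (f ^^ n) y) \<le> \<delta> / (l0 * exp \<delta>2 ^ n)"
    define x where "x = (f ^^ n) y"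
    have x: "x \<in> G" using GI[OF y] by (simp add: x_def)
    note s = small[OF y z(1)] small[OF y z(2)]
    note cl = chart_lip[OF x d s[folded x_def]]
    { assume cone: "NM ((f ^^ n) y) (z - z') \<le> NP ((f ^^ n) y) (z - z')"
      then have "AN x (z - z') = NP x (z - z')" by (simp add: AN_eq x_def)
      with cl(1) have e: "AN (f x) ((f z - f z') - f' x (z - z')) \<le> \<delta> * NP x (z - z')" by simp
      note pt = AN_perturb[OF G_f[OF x] e]
      have "NM (f x) (f' x (z - z')) \<le> exp (lam_minus ls p) * NP x (z - z')"
        using order_trans[OF NM_f[OF x] mult_left_mono[OF cone[folded x_def] exp_ge_zero]] .
      then show "g * NP ((f ^^ n) y) (z - z') \<le> NP ((f ^^ Suc n) y) (f z - f z') \<and> NM ((f ^^ Suc n) y) (f z - f z') \<le> a * NP ((f ^^ n) y) (z - z')"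
        using pt NP_f[OF x, of "z - z'"] by (simp add: x_def g_def a_def algebra_simps) }
    show "AN ((f ^^ Suc n) y) (f' z v - f' z' v) \<le> l0 * exp \<delta>2 ^ n * AN ((f ^^ n) y) (z - z') * AN ((f ^^ n) y) v" for v
    proof -
      have "AN (f x) (f' z v - f' z' v) \<le> l x * AN x v * AN x (z - z')" by (rule cl(2))
      also have "\<dots> \<le> (l0 * exp \<delta>2 ^ n) * AN x v * AN x (z - z')"
        using lb[OF y, of n] AN0 by (intro mult_right_mono) (auto simp: x_def)
      finally show ?thesis by (simp add: x_def mult_ac)
    qed
  next
    fix y n z v and t :: real assume y: "y \<in> U" and z: "AN ((f ^^ n) y) (z - (f ^^ n) y) \<le> \<delta> / (l0 * exp \<delta>2 ^ n)"
      and t: "NM ((f ^^ n) y) v \<le> t * NP ((f ^^ n) y) v" "0 \<le> t" "t \<le> 1"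
    define x where "x = (f ^^ n) y"
    have x: "x \<in> G" using GI[OF y] by (simp add: x_def)
    note dp = dpert(1)[OF y x_def z[folded x_def], of v] dpert(2)[OF y x_def z[folded x_def]]
    have "t * NP x v \<le> 1 * NP x v" by (rule mult_right_mono[OF t(3) NP_nonneg])
    then have AN: "AN x v = NP x v" using t by (simp add: AN_eq x_def)
    note pt = AN_perturb[OF G_f[OF x] dp(1)]
    have "l0 * exp \<delta>2 ^ n * AN x (z - x) * AN x v \<le> \<delta> * NP x v"
      unfolding AN by (rule mult_right_mono[OF dp(2) NP_nonneg])
    moreover have "exp (lam_minus ls p) * NM x v \<le> exp (lam_minus ls p) * (t * NP x v)"
      using t by (intro mult_left_mono) (auto simp: x_def)
    ultimately have "exp (lam_plus ls p) * NP x v - \<delta> * NP x v \<le> NP (f x) (f' z v)"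
      "NM (f x) (f' z v) \<le> exp (lam_minus ls p) * (t * NP x v) + l0 * exp \<delta>2 ^ n * AN x (z - x) * AN x v"
      using pt(1,3) NP_f[OF x, of v] NM_f[OF x, of v] by linarith+
    then show "g * NP ((f ^^ n) y) v \<le> NP ((f ^^ Suc n) y) (f' z v) \<and>
        NM ((f ^^ Suc n) y) (f' z v) \<le> (exp (lam_minus ls p) * t + l0 * exp \<delta>2 ^ n * AN ((f ^^ n) y) (z - (f ^^ n) y)) * NP ((f ^^ n) y) v"
      by (simp add: AN x_def[symmetric] g_def algebra_simps)
  next
    fix y n z v assume y: "y \<in> U" and z: "AN ((f ^^ n) y) (z - (f ^^ n) y) \<le> \<delta> / (l0 * exp \<delta>2 ^ n)"
      and v: "NP ((f ^^ n) y) v = 0"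
    define x where "x = (f ^^ n) y"
    have x: "x \<in> G" using GI[OF y] by (simp add: x_def)
    note dp = dpert(1)[OF y x_def z[folded x_def], of v] dpert(2)[OF y x_def z[folded x_def]]
    have AN: "AN x v = NM x v" using v NM_nonneg[of x v] by (simp add: AN_eq x_def)
    have le: "l0 * exp \<delta>2 ^ n * AN x (z - x) * AN x v \<le> \<delta> * NM x v"
      unfolding AN by (rule mult_right_mono[OF dp(2) NM_nonneg])
    note pt = AN_perturb[OF G_f[OF x] order_trans[OF dp(1) le]]
    have "pp x v = 0" using norm_pp_le[OF x, of v] v by (simp add: x_def)
    then have "pp (f x) (f' x v) = 0" by (simp add: pp_f[OF x] blinfun.zero_right)
    then have "NP (f x) (f' x v) = 0" using NP_pp[OF G_f[OF x], of "f' x v"] NP_scale[OF G_f[OF x], of 0 0] by simp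
    moreover have "0 \<le> exp (lam_minus ls p) * NM x v" using NM_nonneg by simp
    ultimately show "AN ((f ^^ Suc n) y) (f' z v) \<le> a * NM ((f ^^ n) y) v"
      using pt NM_f[OF x, of v] by (simp add: AN_eq[of "f x"] x_def[symmetric] a_def algebra_simps)
  next
    show "1 \<le> l0" "0 < \<delta>" "b < g" "0 < r" "l0 * r \<le> \<delta>" "exp \<delta>2 * (exp \<delta>2 * b) < 1" "exp \<delta>2 ^ (CARD('k) + 2) * a < b"
      using l0 d par by auto
    show "1 \<le> exp \<delta>2" using d2 by simp
    show "0 < exp (lam_minus ls p)" by simp
    show "a = exp (lam_minus ls p) + \<delta>" by (simp add: a_def)
    show "max (exp \<delta>2 * b) (a / g) = max (exp \<delta>2 * b) (a / g)" ..
  qed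
qed

text \<open>Let \<open>u = T (\<zeta> - \<zeta>')\<close>. In the adapted norm at \<open>y\<close>
  the chord differs from a vector of \<open>Ep y\<close> by at most
  \<open>l0 * (1 / (10 * l0) + 1 / (40 * l0))\<close>, that is 1/8, times \<open>norm u\<close>,
  whereas that vector has adapted norm at least 9/20 of \<open>norm u\<close>. Hence the cone
  condition holds in all nearby charts at once.\<close>

lemma graph_chart:
  fixes T :: "real^'k::finite \<Rightarrow> 'a" and \<sigma> :: "'a \<Rightarrow> 'a" and x0 :: 'a and R l0 :: real
  defines "Q \<equiv> {\<zeta>. norm (T \<zeta>) < R}" and "\<psi> \<equiv> \<lambda>\<zeta>. x0 + T \<zeta> + \<sigma> (T \<zeta>)"
  assumes x0: "x0 \<in> G" and T: "bounded_linear T" "inj T" "range T = Ep x0"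
    and \<sigma>: "C1_Lip_on (ball_plus M ls x0 R) \<sigma>" "(1 / (40 * l0))-lipschitz_on (ball_plus M ls x0 R) \<sigma>"
    and l0: "1 \<le> l0" and U: "\<And>y. y \<in> U \<Longrightarrow> y \<in> G \<and> l y \<le> l0"
    and near: "\<And>y u. y \<in> U \<Longrightarrow> u \<in> Ep x0 \<Longrightarrow> \<exists>v\<in>Ep y. norm (u - v) \<le> 1 / (10 * l0) * norm u"
  obtains B :: "real^'k \<Rightarrow> (real^'k) \<Rightarrow>\<^sub>L 'a" and c where "open Q" "continuous_on Q B" "0 < c"
    "\<And>\<zeta>. \<zeta> \<in> Q \<Longrightarrow> (\<psi> has_derivative B \<zeta>) (at \<zeta>)"
    "\<And>\<zeta> \<zeta>'. \<zeta> \<in> Q \<Longrightarrow> \<zeta>' \<in> Q \<Longrightarrow> c * norm (\<zeta> - \<zeta>') \<le> norm (\<psi> \<zeta> - \<psi> \<zeta>')"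
    "\<And>y \<zeta> \<zeta>'. y \<in> U \<Longrightarrow> \<zeta> \<in> Q \<Longrightarrow> \<zeta>' \<in> Q \<Longrightarrow> NM y (\<psi> \<zeta> - \<psi> \<zeta>') \<le> NP y (\<psi> \<zeta> - \<psi> \<zeta>')"
proof -
  let ?S = "ball_plus M ls x0 R"
  obtain D :: "'a \<Rightarrow> 'a \<Rightarrow>\<^sub>L 'a" and L where D: "\<And>w. w \<in> ?S \<Longrightarrow> (\<sigma> has_derivative D w) (at w within ?S)" "L-lipschitz_on ?S D"
    using \<sigma>(1) unfolding C1_Lip_on_def by blast
  obtain c where c: "0 < c" "\<And>\<zeta>. c * norm \<zeta> \<le> norm (T \<zeta>)" using inj_linear_bounded_below[OF T(1,2)] by blast
  note lT = bounded_linear.linear[OF T(1)]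
  have TQ: "T ` Q \<subseteq> ?S" using T(3) by (auto simp: Q_def ball_plus_def)
  have Tc: "continuous_on X T" for X using T(1) by (rule linear_continuous_on)
  have Qo: "open Q" unfolding Q_def by (intro open_Collect_less continuous_on_norm Tc continuous_on_const)
  define B where "B \<zeta> = Blinfun T + (D (T \<zeta>) o\<^sub>L Blinfun T)" for \<zeta>
  have Bap: "blinfun_apply (B \<zeta>) = (\<lambda>v. T v + D (T \<zeta>) (T v))" for \<zeta>
    by (rule ext) (simp add: B_def blinfun.add_left bounded_linear_Blinfun_apply[OF T(1)])
  have st: "norm (\<sigma> (T \<zeta>) - \<sigma> (T \<zeta>')) \<le> 1 / (40 * l0) * norm (T (\<zeta> - \<zeta>'))" if "\<zeta> \<in> Q" "\<zeta>' \<in> Q" for \<zeta> \<zeta>'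
    using lipschitz_onD[OF \<sigma>(2), of "T \<zeta>" "T \<zeta>'"] TQ that by (auto simp: dist_norm linear_diff[OF lT])
  have df: "\<psi> \<zeta> - \<psi> \<zeta>' = T (\<zeta> - \<zeta>') + (\<sigma> (T \<zeta>) - \<sigma> (T \<zeta>'))" for \<zeta> \<zeta>'
    by (simp add: \<psi>_def linear_diff[OF lT])
  show thesis
  proof (rule that[OF Qo])
    have "continuous_on Q (\<lambda>\<zeta>. D (T \<zeta>))"
      by (rule continuous_on_compose2[OF lipschitz_on_continuous_on[OF D(2)] Tc TQ])
    then show "continuous_on Q B"
      unfolding B_def by (intro continuous_on_add continuous_on_const bounded_bilinear.continuous_on[OF bounded_bilinear_blinfun_compose])
    show "0 < c / 2" using c by simp
    show "(\<psi> has_derivative B \<zeta>) (at \<zeta>)" if z: "\<zeta> \<in> Q" for \<zeta>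
    proof -
      have Td: "(T has_derivative T) (at \<zeta> within Q)" by (rule bounded_linear_imp_has_derivative[OF T(1)])
      have "(\<sigma> has_derivative D (T \<zeta>)) (at (T \<zeta>) within T ` Q)"
        using has_derivative_subset[OF D(1) TQ] TQ z by blast
      from has_derivative_in_compose[OF Td this]
      have "((\<lambda>\<zeta>. x0 + T \<zeta> + \<sigma> (T \<zeta>)) has_derivative (\<lambda>v. 0 + T v + D (T \<zeta>) (T v))) (at \<zeta> within Q)"
        by (intro has_derivative_add has_derivative_const Td)
      then show ?thesis unfolding Bap \<psi>_def using at_within_open[OF z Qo] by simp
    qed
    fix \<zeta> \<zeta>' assume z: "\<zeta> \<in> Q" "\<zeta>' \<in> Q"
    define u s where "u = T (\<zeta> - \<zeta>')" and "s = \<sigma> (T \<zeta>) - \<sigma> (T \<zeta>')"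
    have eq: "\<psi> \<zeta> - \<psi> \<zeta>' = u + s" by (simp add: df u_def s_def)
    have su: "norm s \<le> 1 / (40 * l0) * norm u" using st[OF z] by (simp add: u_def s_def)
    have "1 / (40 * l0) * norm u \<le> 1 / 2 * norm u" using l0 by (intro mult_right_mono) (auto simp: field_simps)
    then have "norm u / 2 \<le> norm (u + s)" using su norm_triangle_ineq4[of "u + s" s] by simp
    moreover have "c * norm (\<zeta> - \<zeta>') \<le> norm u" using c(2)[of "\<zeta> - \<zeta>'"] by (simp add: u_def)
    ultimately show "c / 2 * norm (\<zeta> - \<zeta>') \<le> norm (\<psi> \<zeta> - \<psi> \<zeta>')" unfolding eq by simp
    fix y assume y: "y \<in> U"
    have yG: "y \<in> G" "l y \<le> l0" using U[OF y] by auto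
    have "u \<in> Ep x0" using T(3) by (auto simp: u_def)
    then obtain v where v: "v \<in> Ep y" "norm (u - v) \<le> 1 / (10 * l0) * norm u" using near[OF y] by blast
    have "AN y ((u + s) - v) \<le> l y * norm ((u + s) - v)" by (rule AN_le_norm[OF yG(1)])
    also have "\<dots> \<le> l0 * (1 / (10 * l0) * norm u + 1 / (40 * l0) * norm u)"
    proof (rule mult_mono[OF yG(2)])
      have "norm ((u + s) - v) \<le> norm (u - v) + norm s" using norm_triangle_ineq[of "u - v" s] by (simp add: algebra_simps)
      then show "norm ((u + s) - v) \<le> 1 / (10 * l0) * norm u + 1 / (40 * l0) * norm u" using v(2) su by linarith
    qed (use l0 in auto)
    also have "\<dots> = norm u / 8" using l0 by (simp add: field_simps)
    finally have e: "AN y ((u + s) - v) \<le> norm u / 8" .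
    note pt = AN_perturb[OF yG(1) e]
    have "1 / (10 * l0) * norm u \<le> 1 / 10 * norm u" using l0 by (intro mult_right_mono) (auto simp: field_simps)
    then have "9 / 10 * norm u \<le> norm v" using v(2) norm_triangle_ineq2[of u v] by simp
    moreover have "norm v / 2 \<le> NP y v" using norm_le_AN[OF yG(1), of v] NM_Ep[OF yG(1) v(1)] NP_nonneg[of y v] by (simp add: AN_eq)
    ultimately have "9 / 20 * norm u \<le> NP y v" by simp
    then show "NM y (\<psi> \<zeta> - \<psi> \<zeta>') \<le> NP y (\<psi> \<zeta> - \<psi> \<zeta>')"
      unfolding eq using pt NM_Ep[OF yG(1) v(1)] norm_ge_zero[of u] by linarith
  qed
qed

end


section \<open>Holonomy as a map between charts\<close>

text \<open>In coordinates the holonomy has density \<open>D\<close>. Passing to the induced volumes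
  multiplies it by the Jacobian of the second chart at the image point and divides it by that of the
  first.\<close>

lemma distr_holonomy:
  fixes \<psi>1 \<psi>2 :: "real^'k::finite \<Rightarrow> 'a::real_normed_vector" and D :: "real^'k \<Rightarrow> real"
  assumes V1: "volume_chart W1 Q1 \<psi>1 \<rho>1" and V2: "volume_chart W2 Q2 \<psi>2 \<rho>2"
    and K: "K \<in> sets borel" "K \<subseteq> Q1" "P ` K \<subseteq> Q2" "inj_on P K" "continuous_on K P"
    and PX: "\<And>X. X \<in> sets borel \<Longrightarrow> X \<subseteq> K \<Longrightarrow> P ` X \<in> sets borel"
    and D: "D \<in> borel_measurable borel" "\<And>\<zeta>. 0 < D \<zeta>"
    and em: "\<And>X. X \<in> sets borel \<Longrightarrow> X \<subseteq> K \<Longrightarrow> emeasure lborel (P ` X) = (\<integral>\<^sup>+\<zeta>\<in>X. ennreal (D \<zeta>) \<partial>lborel)"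
    and C: "C1 = \<psi>1 ` K" "C2 = \<psi>2 ` P ` K"
    and hol: "\<And>\<zeta>. \<zeta> \<in> K \<Longrightarrow> hol (\<psi>1 \<zeta>) = \<psi>2 (P \<zeta>)"
    and \<Delta>: "\<And>\<zeta>. \<zeta> \<in> K \<Longrightarrow> \<Delta> (\<psi>1 \<zeta>) = D \<zeta> * volume_jacobian \<psi>2 (P \<zeta>) / volume_jacobian \<psi>1 \<zeta>"
  defines "\<nu>1 \<equiv> restrict_space (induced_volume TYPE('k) W1) C1" and "\<nu>2 \<equiv> restrict_space (induced_volume TYPE('k) W2) C2"
  shows "\<Delta> \<in> borel_measurable \<nu>1"
    and "distr \<nu>2 (restrict_space borel C1) (inv_into C1 hol) = density \<nu>1 (\<lambda>y. ennreal (\<Delta> y))"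
proof -
  interpret V1: volume_chart W1 Q1 \<psi>1 \<rho>1 by (rule V1)
  interpret V2: volume_chart W2 Q2 \<psi>2 \<rho>2 by (rule V2)
  let ?J1 = "volume_jacobian \<psi>1" and ?J2 = "volume_jacobian \<psi>2"
  have inj1: "inj_on \<psi>1 Q1" and inj2: "inj_on \<psi>2 Q2" using V1.param_inj[OF V1.chart] V2.param_inj[OF V2.chart] .
  have K2b: "P ` K \<in> sets borel" by (rule PX[OF K(1) order_refl])
  have Cb: "C1 \<in> sets borel" "C2 \<in> sets borel" "C1 \<subseteq> W1" "C2 \<subseteq> W2"
  proof -
    show "C1 \<in> sets borel" "C2 \<in> sets borel" using V1.image_borel[OF K(1,2)] V2.image_borel[OF K2b K(3)] C by simp_all
    show "C1 \<subseteq> W1" unfolding C by (rule order_trans[OF image_mono[OF K(2)] V1.image_chart_subset])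
    show "C2 \<subseteq> W2" unfolding C by (rule order_trans[OF image_mono[OF K(3)] V2.image_chart_subset])
  qed
  have sets1: "A \<in> sets \<nu>1 \<longleftrightarrow> A \<in> sets borel \<and> A \<subseteq> C1" for A
  proof -
    have "C1 \<in> sets (induced_volume TYPE('k) W1)" using Cb V1.W by (simp add: V1.induced_volume(1) sets_restrict_space_iff)
    then have "A \<in> sets \<nu>1 \<longleftrightarrow> A \<in> sets (induced_volume TYPE('k) W1) \<and> A \<subseteq> C1"
      unfolding \<nu>1_def using sets.sets_into_space[of C1 "induced_volume TYPE('k) W1"] by (subst sets_restrict_space_iff) (auto simp: Int_absorb2)
    then show ?thesis using Cb V1.W by (auto simp: V1.induced_volume(1) sets_restrict_space_iff)
  qed
  have sets2: "A \<in> sets \<nu>2 \<longleftrightarrow> A \<in> sets borel \<and> A \<subseteq> C2" for A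
  proof -
    have "C2 \<in> sets (induced_volume TYPE('k) W2)" using Cb V2.W by (simp add: V2.induced_volume(1) sets_restrict_space_iff)
    then have "A \<in> sets \<nu>2 \<longleftrightarrow> A \<in> sets (induced_volume TYPE('k) W2) \<and> A \<subseteq> C2"
      unfolding \<nu>2_def using sets.sets_into_space[of C2 "induced_volume TYPE('k) W2"] by (subst sets_restrict_space_iff) (auto simp: Int_absorb2)
    then show ?thesis using Cb V2.W by (auto simp: V2.induced_volume(1) sets_restrict_space_iff)
  qed
  have rb: "A \<in> sets (restrict_space borel C1) \<longleftrightarrow> A \<in> sets borel \<and> A \<subseteq> C1" for A
    using Cb by (auto simp: sets_restrict_space_iff)
  have s1: "sets \<nu>1 = sets (restrict_space borel C1)" using sets1 rb by blast
  have sp: "space \<nu>1 = C1" "space \<nu>2 = C2"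
    using sets1[of C1] sets1[of "space \<nu>1"] sets2[of C2] sets2[of "space \<nu>2"] Cb sets.sets_into_space by blast+
  have em1: "emeasure \<nu>1 (\<psi>1 ` X) = (\<integral>\<^sup>+z\<in>X. ennreal (?J1 z) \<partial>lborel)" if "X \<in> sets borel" "X \<subseteq> K" for X
  proof -
    have "C1 \<in> sets (induced_volume TYPE('k) W1)" using Cb V1.W by (simp add: V1.induced_volume(1) sets_restrict_space_iff)
    then have "emeasure \<nu>1 (\<psi>1 ` X) = emeasure (induced_volume TYPE('k) W1) (\<psi>1 ` X)"
      unfolding \<nu>1_def using that C by (intro emeasure_restrict_space) auto
    then show ?thesis using V1.induced_volume(2)[OF that(1)] that K(2) by simp
  qed
  have em2: "emeasure \<nu>2 (\<psi>2 ` X) = (\<integral>\<^sup>+z\<in>X. ennreal (?J2 z) \<partial>lborel)" if "X \<in> sets borel" "X \<subseteq> P ` K" for X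
  proof -
    have "C2 \<in> sets (induced_volume TYPE('k) W2)" using Cb V2.W by (simp add: V2.induced_volume(1) sets_restrict_space_iff)
    then have "emeasure \<nu>2 (\<psi>2 ` X) = emeasure (induced_volume TYPE('k) W2) (\<psi>2 ` X)"
      unfolding \<nu>2_def using that C by (intro emeasure_restrict_space) auto
    then show ?thesis using V2.induced_volume(2)[OF that(1)] that K(3) by simp
  qed
  have \<psi>1c: "continuous_on K \<psi>1" by (rule continuous_on_subset[OF V1.param_continuous[OF V1.chart] K(2)])
  have pre: "{\<zeta> \<in> K. \<psi>1 \<zeta> \<in> A} \<in> sets borel" "A = \<psi>1 ` {\<zeta> \<in> K. \<psi>1 \<zeta> \<in> A}" if "A \<in> sets borel" "A \<subseteq> C1" for A
  proof -
    have "\<psi>1 -` A \<inter> space (restrict_space borel K) \<in> sets (restrict_space borel K)"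
      by (rule measurable_sets[OF borel_measurable_continuous_on_restrict[OF \<psi>1c] that(1)])
    moreover have "\<psi>1 -` A \<inter> space (restrict_space borel K) = {\<zeta> \<in> K. \<psi>1 \<zeta> \<in> A}" by (auto simp: space_restrict_space)
    ultimately show "{\<zeta> \<in> K. \<psi>1 \<zeta> \<in> A} \<in> sets borel" using K(1) by (simp add: sets_restrict_space_iff)
    show "A = \<psi>1 ` {\<zeta> \<in> K. \<psi>1 \<zeta> \<in> A}" using that(2) C(1) by blast
  qed
  define N where "N = density (restrict_space lborel K) (\<lambda>z. ennreal (?J1 z))"
  have J1c: "continuous_on K ?J1" by (rule continuous_on_subset[OF V1.jacobian_continuous[OF V1.chart] K(2)])
  have J1m: "(\<lambda>z. ennreal (?J1 z)) \<in> borel_measurable (restrict_space lborel K)"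
    using borel_measurable_continuous_on_restrict[OF J1c] by (simp cong: measurable_cong_sets add: sets_restrict_space)
  have \<psi>1m: "\<psi>1 \<in> N \<rightarrow>\<^sub>M restrict_space borel C1"
  proof (rule measurableI)
    show "\<psi>1 x \<in> space (restrict_space borel C1)" if "x \<in> space N" for x
      using that C(1) by (auto simp: N_def space_restrict_space)
    fix A assume "A \<in> sets (restrict_space borel C1)"
    then have A: "A \<in> sets borel" "A \<subseteq> C1" using rb by auto
    have "\<psi>1 -` A \<inter> space N = {\<zeta> \<in> K. \<psi>1 \<zeta> \<in> A}" by (auto simp: N_def space_restrict_space)
    then show "\<psi>1 -` A \<inter> space N \<in> sets N" using pre(1)[OF A] K(1) by (simp add: N_def sets_restrict_space_iff)
  qed
  have "\<nu>1 = distr N (restrict_space borel C1) \<psi>1"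
  proof (rule measure_eqI)
    show "sets \<nu>1 = sets (distr N (restrict_space borel C1) \<psi>1)" using s1 by simp
    fix A assume "A \<in> sets \<nu>1"
    then have A: "A \<in> sets borel" "A \<subseteq> C1" using sets1 by auto
    let ?X = "{\<zeta> \<in> K. \<psi>1 \<zeta> \<in> A}"
    have "emeasure (distr N (restrict_space borel C1) \<psi>1) A = emeasure N (\<psi>1 -` A \<inter> space N)"
      using A rb by (intro emeasure_distr \<psi>1m) auto
    also have "\<psi>1 -` A \<inter> space N = ?X" by (auto simp: N_def space_restrict_space)
    also have "emeasure N ?X = (\<integral>\<^sup>+z. ennreal (?J1 z) * indicator ?X z \<partial>restrict_space lborel K)"
      unfolding N_def using J1m pre(1)[OF A] K(1) by (intro emeasure_density) (auto simp: sets_restrict_space_iff)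
    also have "\<dots> = (\<integral>\<^sup>+z\<in>?X. ennreal (?J1 z) \<partial>lborel)"
      using K(1) by (simp add: nn_integral_restrict_space) (intro nn_integral_cong, auto simp: indicator_def)
    also have "\<dots> = emeasure \<nu>1 A" using em1[OF pre(1)[OF A]] pre(2)[OF A] by auto
    finally show "emeasure \<nu>1 A = emeasure (distr N (restrict_space borel C1) \<psi>1) A" by simp
  qed
  note \<nu>1_eq = this
  define H where "H \<zeta> = D \<zeta> * ?J2 (P \<zeta>) / ?J1 \<zeta>" for \<zeta>
  have J2P: "continuous_on K (\<lambda>\<zeta>. ?J2 (P \<zeta>))"
    by (rule continuous_on_compose2[OF V2.jacobian_continuous[OF V2.chart] K(5,3)])
  have Hm: "H \<in> borel_measurable (restrict_space borel K)"
    unfolding H_def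
    by (intro borel_measurable_divide borel_measurable_times measurable_restrict_space1[OF D(1)]
        borel_measurable_continuous_on_restrict[OF J1c] borel_measurable_continuous_on_restrict[OF J2P])
  have invm: "inv_into Q1 \<psi>1 \<in> restrict_space borel C1 \<rightarrow>\<^sub>M restrict_space borel K"
  proof (rule measurableI)
    show "inv_into Q1 \<psi>1 x \<in> space (restrict_space borel K)" if "x \<in> space (restrict_space borel C1)" for x
      using that C(1) K(2) inv_into_f_f[OF inj1] by (auto simp: space_restrict_space)
    fix X assume "X \<in> sets (restrict_space borel K)"
    then have X: "X \<in> sets borel" "X \<subseteq> K" using K(1) by (auto simp: sets_restrict_space_iff)
    have "inv_into Q1 \<psi>1 -` X \<inter> space (restrict_space borel C1) = \<psi>1 ` X"
      using X K(2) C(1) inv_into_f_f[OF inj1] by (auto simp: space_restrict_space subset_iff)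
    then show "inv_into Q1 \<psi>1 -` X \<inter> space (restrict_space borel C1) \<in> sets (restrict_space borel C1)"
      using V1.image_borel[OF X(1)] X K(2) C(1) rb by auto
  qed
  have "(\<lambda>y. H (inv_into Q1 \<psi>1 y)) \<in> borel_measurable (restrict_space borel C1)"
    by (rule measurable_compose[OF invm Hm])
  moreover have "\<Delta> y = H (inv_into Q1 \<psi>1 y)" if "y \<in> C1" for y
    using that C(1) K(2) inv_into_f_f[OF inj1] \<Delta> by (auto simp: H_def)
  ultimately have "\<Delta> \<in> borel_measurable (restrict_space borel C1)"
    by (subst measurable_cong[where g="\<lambda>y. H (inv_into Q1 \<psi>1 y)"]) (auto simp: space_restrict_space)
  then show \<Delta>m: "\<Delta> \<in> borel_measurable \<nu>1" using s1 by (simp cong: measurable_cong_sets)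
  have hol_inj: "inj_on hol C1"
  proof (rule inj_onI)
    fix y y' assume "y \<in> C1" "y' \<in> C1" "hol y = hol y'"
    then obtain \<zeta> \<zeta>' where z: "\<zeta> \<in> K" "\<zeta>' \<in> K" "y = \<psi>1 \<zeta>" "y' = \<psi>1 \<zeta>'" "\<psi>2 (P \<zeta>) = \<psi>2 (P \<zeta>')" using C(1) hol by auto
    then have "P \<zeta> = P \<zeta>'" using inj_onD[OF inj2] K(3) by blast
    then show "y = y'" using inj_onD[OF K(4)] z by blast
  qed
  have ih: "inv_into C1 hol (\<psi>2 (P \<zeta>)) = \<psi>1 \<zeta>" if "\<zeta> \<in> K" for \<zeta>
    using inv_into_f_f[OF hol_inj, of "\<psi>1 \<zeta>"] that C(1) hol by auto
  have pre2: "inv_into C1 hol -` A \<inter> C2 = \<psi>2 ` P ` {\<zeta> \<in> K. \<psi>1 \<zeta> \<in> A}" for A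
    using ih C(2) by auto
  have PXA: "P ` {\<zeta> \<in> K. \<psi>1 \<zeta> \<in> A} \<in> sets borel" if "A \<in> sets borel" "A \<subseteq> C1" for A
    by (rule PX[OF pre(1)[OF that]]) auto
  have hm: "inv_into C1 hol \<in> \<nu>2 \<rightarrow>\<^sub>M restrict_space borel C1"
  proof (rule measurableI)
    show "inv_into C1 hol x \<in> space (restrict_space borel C1)" if "x \<in> space \<nu>2" for x
      using that ih C by (auto simp: sp space_restrict_space)
    fix A assume "A \<in> sets (restrict_space borel C1)"
    then have A: "A \<in> sets borel" "A \<subseteq> C1" using rb by auto
    have "P ` {\<zeta> \<in> K. \<psi>1 \<zeta> \<in> A} \<subseteq> Q2" using K(3) by blast
    then have "\<psi>2 ` P ` {\<zeta> \<in> K. \<psi>1 \<zeta> \<in> A} \<in> sets borel" by (rule V2.image_borel[OF PXA[OF A]])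
    then show "inv_into C1 hol -` A \<inter> space \<nu>2 \<in> sets \<nu>2" unfolding sp pre2 sets2 using C(2) by auto
  qed
  show "distr \<nu>2 (restrict_space borel C1) (inv_into C1 hol) = density \<nu>1 (\<lambda>y. ennreal (\<Delta> y))"
  proof (rule measure_eqI)
    show "sets (distr \<nu>2 (restrict_space borel C1) (inv_into C1 hol)) = sets (density \<nu>1 (\<lambda>y. ennreal (\<Delta> y)))"
      using s1 by simp
    fix A assume "A \<in> sets (distr \<nu>2 (restrict_space borel C1) (inv_into C1 hol))"
    then have A: "A \<in> sets borel" "A \<subseteq> C1" "A \<in> sets (restrict_space borel C1)" using rb by auto
    let ?X = "{\<zeta> \<in> K. \<psi>1 \<zeta> \<in> A}"
    have X: "?X \<in> sets borel" "?X \<subseteq> K" using pre(1)[OF A(1,2)] by auto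
    define h2 where "h2 \<omega> = ennreal (if \<omega> \<in> Q2 then ?J2 \<omega> else 1)" for \<omega>
    have "(\<lambda>\<omega>. if \<omega> \<in> Q2 then ?J2 \<omega> else 1) \<in> borel_measurable borel"
      using V2.param_open[OF V2.chart] by (intro borel_measurable_continuous_on_if V2.jacobian_continuous[OF V2.chart]) auto
    then have h2m: "h2 \<in> borel_measurable borel" unfolding h2_def by simp
    have "emeasure (distr \<nu>2 (restrict_space borel C1) (inv_into C1 hol)) A = emeasure \<nu>2 (\<psi>2 ` P ` ?X)"
      using emeasure_distr[OF hm A(3)] by (simp only: sp pre2)
    also have "\<dots> = (\<integral>\<^sup>+\<omega>\<in>P ` ?X. ennreal (?J2 \<omega>) \<partial>lborel)" by (rule em2[OF PXA[OF A(1,2)]]) blast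
    also have "\<dots> = (\<integral>\<^sup>+\<omega>\<in>P ` ?X. h2 \<omega> \<partial>lborel)"
      using K(3) by (intro nn_integral_cong) (auto simp: h2_def indicator_def)
    also have "\<dots> = (\<integral>\<^sup>+\<zeta>\<in>?X. ennreal (D \<zeta>) * h2 (P \<zeta>) \<partial>lborel)"
    proof (rule nn_integral_image[OF X(1) PXA[OF A(1,2)] _ inj_on_subset[OF K(4) X(2)] _ _ h2m])
      show "P \<in> borel_measurable (restrict_space borel ?X)"
        by (intro borel_measurable_continuous_on_restrict continuous_on_subset[OF K(5) X(2)])
      show "(\<lambda>\<zeta>. ennreal (D \<zeta>)) \<in> borel_measurable borel" using D(1) by simp
      show "emeasure lborel (P ` Y) = (\<integral>\<^sup>+x\<in>Y. ennreal (D x) \<partial>lborel)" if "Y \<in> sets borel" "Y \<subseteq> ?X" for Y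
        using that X(2) by (intro em) auto
    qed
    also have "\<dots> = (\<integral>\<^sup>+\<zeta>. ennreal (?J1 \<zeta>) * (ennreal (\<Delta> (\<psi>1 \<zeta>)) * indicator A (\<psi>1 \<zeta>)) * indicator K \<zeta> \<partial>lborel)"
    proof (intro nn_integral_cong)
      fix \<zeta>
      show "ennreal (D \<zeta>) * h2 (P \<zeta>) * indicator ?X \<zeta> = ennreal (?J1 \<zeta>) * (ennreal (\<Delta> (\<psi>1 \<zeta>)) * indicator A (\<psi>1 \<zeta>)) * indicator K \<zeta>"
      proof (cases "\<zeta> \<in> K")
        case True
        have q: "P \<zeta> \<in> Q2" "\<zeta> \<in> Q1" using True K(2,3) by auto
        have J: "0 < ?J1 \<zeta>" "0 < ?J2 (P \<zeta>)" using V1.jacobian_pos[OF V1.chart q(2)] V2.jacobian_pos[OF V2.chart q(1)] .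
        have "D \<zeta> * ?J2 (P \<zeta>) = ?J1 \<zeta> * \<Delta> (\<psi>1 \<zeta>)" using \<Delta>[OF True] J by simp
        moreover have "0 \<le> \<Delta> (\<psi>1 \<zeta>)" using \<Delta>[OF True] J D(2)[of \<zeta>] by simp
        ultimately have "ennreal (D \<zeta>) * ennreal (?J2 (P \<zeta>)) = ennreal (?J1 \<zeta>) * ennreal (\<Delta> (\<psi>1 \<zeta>))"
          using J D(2)[of \<zeta>] by (simp flip: ennreal_mult)
        then show ?thesis using True q by (simp add: h2_def indicator_def)
      qed simp
    qed
    also have "\<dots> = (\<integral>\<^sup>+\<zeta>. ennreal (?J1 \<zeta>) * (ennreal (\<Delta> (\<psi>1 \<zeta>)) * indicator A (\<psi>1 \<zeta>)) \<partial>restrict_space lborel K)"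
      using K(1) by (simp add: nn_integral_restrict_space)
    also have "\<dots> = (\<integral>\<^sup>+\<zeta>. ennreal (\<Delta> (\<psi>1 \<zeta>)) * indicator A (\<psi>1 \<zeta>) \<partial>N)"
    proof -
      have "(\<lambda>y. ennreal (\<Delta> y) * indicator A y) \<in> borel_measurable (restrict_space borel C1)"
        using \<Delta>m A(3) s1 by (intro borel_measurable_times_ennreal borel_measurable_indicator measurable_compose[OF _ measurable_ennreal]) (simp_all cong: measurable_cong_sets)
      from measurable_compose[OF \<psi>1m this]
      have "(\<lambda>\<zeta>. ennreal (\<Delta> (\<psi>1 \<zeta>)) * indicator A (\<psi>1 \<zeta>)) \<in> borel_measurable (restrict_space lborel K)"
        by (simp add: N_def cong: measurable_cong_sets)
      from nn_integral_density[OF J1m this] show ?thesis by (simp add: N_def)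
    qed
    also have "\<dots> = (\<integral>\<^sup>+y. ennreal (\<Delta> y) * indicator A y \<partial>\<nu>1)"
    proof -
      have "(\<lambda>y. ennreal (\<Delta> y) * indicator A y) \<in> borel_measurable (restrict_space borel C1)"
        using \<Delta>m A(3) s1 by (intro borel_measurable_times_ennreal borel_measurable_indicator measurable_compose[OF _ measurable_ennreal]) (simp_all cong: measurable_cong_sets)
      then have "(\<lambda>y. ennreal (\<Delta> y) * indicator A y) \<in> borel_measurable (distr N (restrict_space borel C1) \<psi>1)" by simp
      from nn_integral_distr[OF \<psi>1m this] show ?thesis by (simp add: \<nu>1_eq)
    qed
    also have "\<dots> = emeasure (density \<nu>1 (\<lambda>y. ennreal (\<Delta> y))) A"
      using \<Delta>m A(3) s1 by (intro emeasure_density[symmetric]) auto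
    finally show "emeasure (distr \<nu>2 (restrict_space borel C1) (inv_into C1 hol)) A = emeasure (density \<nu>1 (\<lambda>y. ennreal (\<Delta> y))) A" .
  qed
qed

section \<open>Stacks of stable leaves in chart coordinates\<close>

text \<open>The rates are governed by an auxiliary chart size \<open>\<delta>s\<close>. It is
  separate from the size \<open>\<delta>\<close> of the stack, which the last condition makes small
  against it.\<close>

locale foliated_stack = lyapunov_chart_system f f' \<mu> A la M ls m p G \<delta>1 \<delta>2 l
  for f :: "'a::banach \<Rightarrow> 'a" and f' \<mu> A la M ls m p G \<delta>1 \<delta>2 l +
  fixes T :: "real^'k::finite \<Rightarrow> 'a" and \<delta>1' :: real and h :: "'a \<Rightarrow> 'a \<Rightarrow> 'a" and l0 :: real and n0 :: nat
    and x0 :: 'a and \<delta> \<epsilon>0 :: real and \<Theta> :: "'a \<Rightarrow> 'a \<Rightarrow> 'a" and U :: "'a set" and \<delta>s b :: real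
  assumes m: "m = CARD('k)" and stable: "local_stable f M ls p G l \<delta>1' h"
    and x0: "x0 \<in> G" and l0: "1 < l0"
    and family: "leaf_family M ls (Wss_loc f M ls p l \<delta>1' h) l0 x0 \<delta> (U_nbhd M G l l0 n0 x0 \<epsilon>0) \<Theta>"
    and U: "compact U" "U \<subseteq> U_nbhd M G l l0 n0 x0 \<epsilon>0"
    and T: "bounded_linear T" "inj T" "range T = Eplus M ls x0"
    and near: "\<And>y u. y \<in> U_nbhd M G l l0 n0 x0 \<epsilon>0 \<Longrightarrow> u \<in> Eplus M ls x0 \<Longrightarrow> \<exists>v\<in>Eplus M ls y. norm (u - v) \<le> 1 / (10 * l0) * norm u"
    and \<delta>: "0 < \<delta>" "\<epsilon>0 \<le> \<delta>"
    and par: "0 < \<delta>s" "\<delta>s \<le> \<delta>1" "0 \<le> \<delta>2" "exp \<delta>2 ^ (CARD('k) + 2) * (exp (lam_minus ls p) + \<delta>s) < b"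
      "b < exp (lam_plus ls p) - \<delta>s" "exp \<delta>2 * (exp \<delta>2 * b) < 1" "(4 * l0 + 3) * (3 * l0 * \<delta>) \<le> \<delta>s / l0"
begin

abbreviation "Unb \<equiv> U_nbhd M G l l0 n0 x0 \<epsilon>0"
abbreviation "Lf \<equiv> leaf M ls l0 x0 \<delta> \<Theta>"
abbreviation "Sm \<equiv> ball_minus M ls x0 (\<delta> / l0 ^ 3)"
abbreviation "Sp \<equiv> ball_plus M ls x0 (\<delta> / l0 ^ 3)"
abbreviation "trv \<sigma> \<equiv> transversal M ls l0 x0 \<delta> \<sigma>"
abbreviation "tmap \<sigma> \<equiv> transversal_map M ls l0 x0 \<delta> \<sigma>"

text \<open>A transversal is a graph over the closed ball \<open>Z\<close>; the open ball
  \<open>Q\<close> serves as the domain of its chart.\<close>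

definition "Z = {\<zeta>. norm (T \<zeta>) \<le> 2 * \<delta> / l0 ^ 3}"
definition "Q = {\<zeta>. norm (T \<zeta>) < 2 * \<delta> / l0 ^ 3}"
definition "\<psi> \<sigma> \<zeta> = x0 + T \<zeta> + \<sigma> (T \<zeta>)"
text \<open>A left inverse of \<open>\<psi> \<sigma>\<close> on \<open>Z\<close> for every
  transversal map at once: the unstable coordinate after projection along the stable space at
  \<open>x0\<close>.\<close>

definition "\<rho> z = inv T (pp x0 (z - x0))"

lemma Unb: "y \<in> Unb \<Longrightarrow> y \<in> G \<and> l y \<le> l0 \<and> norm (y - x0) < \<epsilon>0"
  by (simp add: U_nbhd_def Gamma_le_def)

lemma leaf_facts:
  assumes "y \<in> Unb"
  shows "\<Theta> y ` Sm \<subseteq> Sp" "(1 / 10)-lipschitz_on Sm (\<Theta> y)" "Lf y \<subseteq> Wss_loc f M ls p l \<delta>1' h y"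
    "uniform_limit Sm \<Theta> (\<Theta> y) (at y within Unb)"
    "y' \<in> Unb \<Longrightarrow> Lf y = Lf y' \<or> Lf y \<inter> Lf y' = {}"
  using family assms unfolding leaf_family_def by blast+

lemma r_pos: "0 < \<delta> / l0 ^ 3" "\<delta> / l0 ^ 3 < 2 * \<delta> / l0 ^ 3" "\<delta> / l0 ^ 3 \<le> \<delta>"
proof -
  show 1: "0 < \<delta> / l0 ^ 3" using \<delta> l0 by simp
  then show "\<delta> / l0 ^ 3 < 2 * \<delta> / l0 ^ 3" by simp
  have "1 \<le> l0 ^ 3" using l0 by simp
  then have "\<delta> / l0 ^ 3 \<le> \<delta> / 1" using \<delta>(1) l0 by (intro divide_left_mono) auto
  then show "\<delta> / l0 ^ 3 \<le> \<delta>" by simp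
qed

lemma TS: "\<zeta> \<in> Z \<Longrightarrow> T \<zeta> \<in> ball_plus M ls x0 (2 * \<delta> / l0 ^ 3)"
  using T(3) by (auto simp: Z_def ball_plus_def)

lemma Q_Z: "Q \<subseteq> Z" by (auto simp: Q_def Z_def)

lemma T_continuous: "continuous_on X T"
  using T(1) by (rule linear_continuous_on)

lemma T_compact: "compact {\<zeta>. norm (T \<zeta>) \<le> c}"
proof -
  obtain e where e: "0 < e" "\<And>\<zeta>. e * norm \<zeta> \<le> norm (T \<zeta>)" using inj_linear_bounded_below[OF T(1,2)] by blast
  have "{\<zeta>. norm (T \<zeta>) \<le> c} \<subseteq> cball 0 (c / e)"
  proof
    fix \<zeta> assume "\<zeta> \<in> {\<zeta>. norm (T \<zeta>) \<le> c}"
    then have "e * norm \<zeta> \<le> c" using e(2)[of \<zeta>] by simp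
    then show "\<zeta> \<in> cball 0 (c / e)" using e(1) by (simp add: field_simps)
  qed
  moreover have "closed {\<zeta>. norm (T \<zeta>) \<le> c}"
    by (intro closed_Collect_le continuous_on_norm T_continuous continuous_on_const)
  ultimately show ?thesis by (meson bounded_cball bounded_subset compact_eq_bounded_closed)
qed

lemma T_ball: "ball_plus M ls x0 c = T ` {\<zeta>. norm (T \<zeta>) \<le> c}"
proof (intro equalityI subsetI)
  fix u assume u: "u \<in> ball_plus M ls x0 c"
  then obtain \<zeta> where "u = T \<zeta>" using T(3) by (auto simp: ball_plus_def)
  then show "u \<in> T ` {\<zeta>. norm (T \<zeta>) \<le> c}" using u by (auto simp: ball_plus_def)
qed (use T(3) in \<open>auto simp: ball_plus_def\<close>)

lemma Sp_compact: "compact Sp"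
  unfolding T_ball using compact_continuous_image[OF T_continuous T_compact] .

lemma tmap_facts:
  assumes "tmap \<sigma>"
  shows "\<zeta> \<in> Z \<Longrightarrow> \<sigma> (T \<zeta>) \<in> Sm" "\<zeta> \<in> Z \<Longrightarrow> \<sigma> (T \<zeta>) \<in> Em x0"
    "(1 / (40 * l0))-lipschitz_on (ball_plus M ls x0 (2 * \<delta> / l0 ^ 3)) \<sigma>" "u \<in> Sp \<Longrightarrow> \<sigma> u \<in> Sm"
proof -
  have im: "\<sigma> ` ball_plus M ls x0 (2 * \<delta> / l0 ^ 3) \<subseteq> ball_minus M ls x0 (\<delta> / (2 * l0 ^ 4))"
    and "(1 / (40 * l0))-lipschitz_on (ball_plus M ls x0 (2 * \<delta> / l0 ^ 3)) \<sigma>"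
    using assms by (auto simp: transversal_map_def)
  then show "(1 / (40 * l0))-lipschitz_on (ball_plus M ls x0 (2 * \<delta> / l0 ^ 3)) \<sigma>" by blast
  have "l0 ^ 3 \<le> l0 ^ 4" using l0 by (intro power_increasing) auto
  moreover have "0 \<le> l0 ^ 4" using l0 by simp
  ultimately have "l0 ^ 3 \<le> 2 * l0 ^ 4" by linarith
  then have "\<delta> / (2 * l0 ^ 4) \<le> \<delta> / l0 ^ 3" using \<delta> l0 by (intro divide_left_mono) auto
  then have sub: "ball_minus M ls x0 (\<delta> / (2 * l0 ^ 4)) \<subseteq> Sm" by (auto simp: ball_minus_def)
  show "\<zeta> \<in> Z \<Longrightarrow> \<sigma> (T \<zeta>) \<in> Sm" using TS im sub by blast
  then show "\<zeta> \<in> Z \<Longrightarrow> \<sigma> (T \<zeta>) \<in> Em x0" by (simp add: ball_minus_def)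
  have "Sp \<subseteq> ball_plus M ls x0 (2 * \<delta> / l0 ^ 3)" using r_pos by (auto simp: ball_plus_def)
  then show "u \<in> Sp \<Longrightarrow> \<sigma> u \<in> Sm" using im sub by blast
qed

lemma pp_\<psi>: assumes "tmap \<sigma>" "\<zeta> \<in> Z" shows "pp x0 (\<psi> \<sigma> \<zeta> - x0) = T \<zeta>" "\<rho> (\<psi> \<sigma> \<zeta>) = \<zeta>"
proof -
  show 1: "pp x0 (\<psi> \<sigma> \<zeta> - x0) = T \<zeta>"
    using tmap_facts(2)[OF assms] T(3) by (intro pp_eqI[OF x0]) (auto simp: \<psi>_def)
  show "\<rho> (\<psi> \<sigma> \<zeta>) = \<zeta>" by (simp add: \<rho>_def 1 inv_f_f[OF T(2)])
qed

lemma \<rho>_affine: "bounded_linear (\<lambda>v. inv T (pp x0 v))"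
  using pp(1)[OF x0] T(3) by (intro bounded_linear_inv_compose[OF T(1,2) pp_bounded_linear[OF x0]]) auto

lemma \<rho>_continuous: "continuous_on X \<rho>"
  unfolding \<rho>_def
  by (rule continuous_on_compose2[OF linear_continuous_on[OF \<rho>_affine, of UNIV]]) (auto intro!: continuous_intros)

lemma trv_eq: "trv \<sigma> = \<psi> \<sigma> ` Z"
proof -
  have "ball_plus M ls x0 (2 * \<delta> / l0 ^ 3) = T ` Z" unfolding T_ball Z_def ..
  then show ?thesis by (simp add: transversal_def graph_on_def \<psi>_def image_image add.assoc)
qed

lemma \<psi>_continuous: assumes "tmap \<sigma>" shows "continuous_on Z (\<psi> \<sigma>)"
proof -
  have "continuous_on Z (\<lambda>\<zeta>. \<sigma> (T \<zeta>))"
    by (rule continuous_on_compose2[OF lipschitz_on_continuous_on[OF tmap_facts(3)[OF assms]] T_continuous]) (use TS in auto)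
  then show ?thesis unfolding \<psi>_def by (intro continuous_intros T_continuous)
qed

lemma Z_compact: "compact Z"
  unfolding Z_def by (rule T_compact)

text \<open>Intersection of transversal and leaf, written as a fixed point equation in the unstable
  space; see \<open>meets_iff\<close>.\<close>

definition "meets \<sigma> y \<zeta> \<longleftrightarrow> \<zeta> \<in> Z \<and> T \<zeta> = \<Theta> y (\<sigma> (T \<zeta>))"

lemma meets_iff:
  assumes \<sigma>: "tmap \<sigma>" and y: "y \<in> Unb" and \<zeta>: "\<zeta> \<in> Z"
  shows "\<psi> \<sigma> \<zeta> \<in> Lf y \<longleftrightarrow> meets \<sigma> y \<zeta>"
proof
  assume "\<psi> \<sigma> \<zeta> \<in> Lf y"
  then obtain w where w: "w \<in> Sm" "\<psi> \<sigma> \<zeta> = x0 + (w + \<Theta> y w)" by (auto simp: leaf_def graph_on_def)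
  have "\<Theta> y w \<in> Ep x0" "w \<in> Em x0" using leaf_facts(1)[OF y] w(1) by (auto simp: ball_plus_def ball_minus_def)
  then have "pp x0 (\<psi> \<sigma> \<zeta> - x0) = \<Theta> y w" unfolding w(2) by (intro pp_eqI[OF x0]) auto
  then have "T \<zeta> = \<Theta> y w" using pp_\<psi>(1)[OF \<sigma> \<zeta>] by simp
  moreover from this have "\<sigma> (T \<zeta>) = w" using w(2) by (simp add: \<psi>_def)
  ultimately show "meets \<sigma> y \<zeta>" using \<zeta> by (simp add: meets_def)
next
  assume "meets \<sigma> y \<zeta>"
  then have "\<psi> \<sigma> \<zeta> = x0 + (\<sigma> (T \<zeta>) + \<Theta> y (\<sigma> (T \<zeta>)))" by (simp add: meets_def \<psi>_def)
  then show "\<psi> \<sigma> \<zeta> \<in> Lf y" using tmap_facts(1)[OF \<sigma> \<zeta>] unfolding leaf_def graph_on_def by blast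
qed

text \<open>The unstable part of a leaf is at most \<open>\<delta> / l0 ^ 3\<close>, half the radius
  of the transversals, so intersections avoid the boundary of the transversal.\<close>

lemma meets_small: assumes "tmap \<sigma>" "y \<in> Unb" "meets \<sigma> y \<zeta>" shows "T \<zeta> \<in> Sp" "\<zeta> \<in> Q"
proof -
  have "\<sigma> (T \<zeta>) \<in> Sm" using tmap_facts(1)[OF assms(1)] assms(3) by (simp add: meets_def)
  then have "\<Theta> y (\<sigma> (T \<zeta>)) \<in> Sp" using leaf_facts(1)[OF assms(2)] by blast
  then show 1: "T \<zeta> \<in> Sp" using assms(3) by (simp add: meets_def)
  then show "\<zeta> \<in> Q" using r_pos by (simp add: Q_def ball_plus_def)
qed

text \<open>The composition of the two graph maps maps a compact ball into itself and contracts,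
  since both Lipschitz constants are small.\<close>

lemma meets_ex1: assumes \<sigma>: "tmap \<sigma>" and y: "y \<in> Unb" shows "\<exists>!\<zeta>. meets \<sigma> y \<zeta>"
proof -
  have sub: "Sp \<subseteq> ball_plus M ls x0 (2 * \<delta> / l0 ^ 3)" using r_pos by (auto simp: ball_plus_def)
  have "\<exists>!u. u \<in> Sp \<and> \<Theta> y (\<sigma> u) = u"
  proof (rule Banach_fix[OF compact_imp_complete[OF Sp_compact], where c="1/2"])
    have "0 \<in> Sp" using r_pos subspace_0[OF subspace_E(1)] by (simp add: ball_plus_def)
    then show "Sp \<noteq> {}" by blast
    show "(\<lambda>u. \<Theta> y (\<sigma> u)) ` Sp \<subseteq> Sp" using tmap_facts(4)[OF \<sigma>] leaf_facts(1)[OF y] by blast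
    fix u v assume uv: "u \<in> Sp" "v \<in> Sp"
    have "dist (\<Theta> y (\<sigma> u)) (\<Theta> y (\<sigma> v)) \<le> 1 / 10 * dist (\<sigma> u) (\<sigma> v)"
      using tmap_facts(4)[OF \<sigma>] uv by (intro lipschitz_onD[OF leaf_facts(2)[OF y]]) auto
    also have "\<dots> \<le> 1 / 10 * (1 / (40 * l0) * dist u v)"
      using uv sub by (intro mult_left_mono lipschitz_onD[OF tmap_facts(3)[OF \<sigma>]]) auto
    also have "\<dots> \<le> 1 / 10 * (1 * dist u v)"
      using l0 by (intro mult_left_mono mult_right_mono) (auto simp: field_simps)
    also have "\<dots> \<le> 1 / 2 * dist u v" by simp
    finally show "dist (\<Theta> y (\<sigma> u)) (\<Theta> y (\<sigma> v)) \<le> 1 / 2 * dist u v" .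
  qed auto
  then obtain u where u: "u \<in> Sp" "\<Theta> y (\<sigma> u) = u" "\<And>v. v \<in> Sp \<Longrightarrow> \<Theta> y (\<sigma> v) = v \<Longrightarrow> v = u" by blast
  obtain \<zeta> where \<zeta>: "u = T \<zeta>" using u(1) T(3) by (auto simp: ball_plus_def)
  have "\<zeta> \<in> Z" using u(1) r_pos by (simp add: \<zeta> Z_def ball_plus_def)
  then have "meets \<sigma> y \<zeta>" using u(2) by (simp add: meets_def \<zeta>)
  moreover have "\<zeta>' = \<zeta>" if "meets \<sigma> y \<zeta>'" for \<zeta>'
    using u(3)[OF meets_small(1)[OF \<sigma> y that]] that injD[OF T(2)] by (auto simp: meets_def \<zeta>)
  ultimately show ?thesis by blast
qed

text \<open>Uniform convergence in the leaf parameter and a common Lipschitz constant along the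
  leaves give joint continuity.\<close>

lemma \<Theta>_continuous: "continuous_on (Sm \<times> U) (\<lambda>(s, y). \<Theta> y s)"
  unfolding continuous_on_iff
proof (intro ballI allI impI)
  fix q and e :: real assume q: "q \<in> Sm \<times> U" and e: "0 < e"
  obtain s y where sy: "q = (s, y)" "s \<in> Sm" "y \<in> U" using q by auto
  have y: "y \<in> Unb" using sy U by blast
  have "\<forall>\<^sub>F y' in at y within Unb. \<forall>s'\<in>Sm. dist (\<Theta> y' s') (\<Theta> y s') < e / 2"
    using uniform_limitD[OF leaf_facts(4)[OF y], of "e / 2"] e by simp
  then obtain d where d: "0 < d" "\<forall>y'\<in>Unb. y' \<noteq> y \<and> dist y' y < d \<longrightarrow> (\<forall>s'\<in>Sm. dist (\<Theta> y' s') (\<Theta> y s') < e / 2)"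
    unfolding eventually_at by blast
  show "\<exists>d>0. \<forall>q'\<in>Sm \<times> U. dist q' q < d \<longrightarrow> dist (case q' of (s, y) \<Rightarrow> \<Theta> y s) (case q of (s, y) \<Rightarrow> \<Theta> y s) < e"
  proof (intro exI[of _ "min d e"] conjI ballI impI)
    show "0 < min d e" using d e by simp
    fix q' assume q': "q' \<in> Sm \<times> U" "dist q' q < min d e"
    obtain s' y' where sy': "q' = (s', y')" "s' \<in> Sm" "y' \<in> U" using q'(1) by auto
    have ds: "dist y' y < d" "dist s' s < e"
      using q'(2) dist_snd_le[of q' q] dist_fst_le[of q' q] by (auto simp: sy sy')
    have "dist (\<Theta> y' s') (\<Theta> y s') < e / 2"
      using d(2) ds(1) sy' U(2) e by (cases "y' = y") auto
    moreover have "dist (\<Theta> y s') (\<Theta> y s) \<le> 1 / 10 * dist s' s"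
      by (rule lipschitz_onD[OF leaf_facts(2)[OF y] sy'(2) sy(2)])
    moreover have "1 / 10 * dist s' s \<le> e / 2" using ds(2) zero_le_dist[of s' s] by linarith
    ultimately have "dist (\<Theta> y' s') (\<Theta> y s) < e" using dist_triangle[of "\<Theta> y' s'" "\<Theta> y s" "\<Theta> y s'"] by linarith
    then show "dist (case q' of (s, y) \<Rightarrow> \<Theta> y s) (case q of (s, y) \<Rightarrow> \<Theta> y s) < e" by (simp add: sy sy')
  qed
qed

lemma \<Theta>\<sigma>_continuous:
  assumes \<sigma>: "tmap \<sigma>" and g: "continuous_on X g" "g ` X \<subseteq> Z" and k: "continuous_on X k" "k ` X \<subseteq> U"
  shows "continuous_on X (\<lambda>q. T (g q) - \<Theta> (k q) (\<sigma> (T (g q))))"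
proof -
  have s: "continuous_on X (\<lambda>q. \<sigma> (T (g q)))"
  proof (rule continuous_on_compose2[OF lipschitz_on_continuous_on[OF tmap_facts(3)[OF \<sigma>]]])
    show "continuous_on X (\<lambda>q. T (g q))" by (rule continuous_on_compose2[OF T_continuous g(1) subset_UNIV])
    show "(\<lambda>q. T (g q)) ` X \<subseteq> ball_plus M ls x0 (2 * \<delta> / l0 ^ 3)" using g(2) TS by blast
  qed
  have "(\<lambda>q. (\<sigma> (T (g q)), k q)) ` X \<subseteq> Sm \<times> U"
  proof (rule image_subsetI, rule SigmaI)
    fix q assume q: "q \<in> X"
    then show "\<sigma> (T (g q)) \<in> Sm" using g(2) by (intro tmap_facts(1)[OF \<sigma>]) blast
    show "k q \<in> U" using q k(2) by blast
  qed
  from continuous_on_compose2[OF \<Theta>_continuous continuous_on_Pair[OF s k(1)] this]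
  have "continuous_on X (\<lambda>q. \<Theta> (k q) (\<sigma> (T (g q))))" by simp
  then show ?thesis
    by (intro continuous_on_diff continuous_on_compose2[OF T_continuous g(1) subset_UNIV])
qed

definition "rel \<sigma> \<sigma>' \<zeta> \<omega> \<longleftrightarrow> (\<exists>y\<in>U. meets \<sigma> y \<zeta> \<and> meets \<sigma>' y \<omega>)"
definition "crd \<sigma> = {\<zeta>. \<exists>y\<in>U. meets \<sigma> y \<zeta>}"
definition "hmap \<sigma> \<sigma>' \<zeta> = (THE \<omega>. rel \<sigma> \<sigma>' \<zeta> \<omega>)"

text \<open>Leaves are equal or disjoint, so a leaf may be named by any of its points in
  \<open>U\<close> without affecting its intersections; this makes \<open>hmap\<close> well
  defined.\<close>

lemma same_leaf:
  assumes "tmap \<sigma>" "tmap \<sigma>'" "y \<in> U" "y' \<in> U" "meets \<sigma> y \<zeta>" "meets \<sigma> y' \<zeta>" "meets \<sigma>' y \<omega>"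
  shows "Lf y = Lf y'" "meets \<sigma>' y' \<omega>"
proof -
  have y: "y \<in> Unb" "y' \<in> Unb" using assms U by auto
  have Zz: "\<zeta> \<in> Z" "\<omega> \<in> Z" using assms by (auto simp: meets_def)
  have "\<psi> \<sigma> \<zeta> \<in> Lf y" "\<psi> \<sigma> \<zeta> \<in> Lf y'" using meets_iff[OF assms(1) _ Zz(1)] y assms by auto
  then show eq: "Lf y = Lf y'" using leaf_facts(5)[OF y(1,2)] by blast
  have "\<psi> \<sigma>' \<omega> \<in> Lf y" using meets_iff[OF assms(2) y(1) Zz(2)] assms by blast
  then show "meets \<sigma>' y' \<omega>" unfolding eq using meets_iff[OF assms(2) y(2) Zz(2)] by blast
qed

lemma rel_ex1: assumes "tmap \<sigma>" "tmap \<sigma>'" "\<zeta> \<in> crd \<sigma>" shows "\<exists>!\<omega>. rel \<sigma> \<sigma>' \<zeta> \<omega>"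
proof -
  obtain y where y: "y \<in> U" "meets \<sigma> y \<zeta>" using assms(3) by (auto simp: crd_def)
  have yU: "y \<in> Unb" using y U by blast
  obtain \<omega> where \<omega>: "meets \<sigma>' y \<omega>" using meets_ex1[OF assms(2) yU] by blast
  have "rel \<sigma> \<sigma>' \<zeta> \<omega>" using y \<omega> by (auto simp: rel_def)
  moreover have "\<omega>' = \<omega>" if r: "rel \<sigma> \<sigma>' \<zeta> \<omega>'" for \<omega>'
  proof -
    obtain y' where y': "y' \<in> U" "meets \<sigma> y' \<zeta>" "meets \<sigma>' y' \<omega>'" using r by (auto simp: rel_def)
    from same_leaf(2)[OF assms(1,2) y'(1) y(1) y'(2) y(2) y'(3)] show ?thesis using meets_ex1[OF assms(2) yU] \<omega> by blast
  qed
  ultimately show ?thesis by blast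
qed

lemma rel_sym: "rel \<sigma> \<sigma>' \<zeta> \<omega> \<longleftrightarrow> rel \<sigma>' \<sigma> \<omega> \<zeta>"
  by (auto simp: rel_def)

lemma hmap: assumes "tmap \<sigma>" "tmap \<sigma>'" "\<zeta> \<in> crd \<sigma>" shows "rel \<sigma> \<sigma>' \<zeta> (hmap \<sigma> \<sigma>' \<zeta>)"
  unfolding hmap_def by (rule theI'[OF rel_ex1[OF assms]])

lemma hmap_iff: assumes "tmap \<sigma>" "tmap \<sigma>'" shows "rel \<sigma> \<sigma>' \<zeta> \<omega> \<longleftrightarrow> \<zeta> \<in> crd \<sigma> \<and> \<omega> = hmap \<sigma> \<sigma>' \<zeta>"
proof
  assume r: "rel \<sigma> \<sigma>' \<zeta> \<omega>"
  then have "\<zeta> \<in> crd \<sigma>" by (auto simp: rel_def crd_def)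
  then show "\<zeta> \<in> crd \<sigma> \<and> \<omega> = hmap \<sigma> \<sigma>' \<zeta>" using rel_ex1[OF assms] hmap[OF assms] r by blast
qed (use hmap[OF assms] in blast)

lemma hmap_inj: assumes "tmap \<sigma>" "tmap \<sigma>'" shows "inj_on (hmap \<sigma> \<sigma>') (crd \<sigma>)"
proof (rule inj_onI)
  fix \<zeta> \<zeta>' assume z: "\<zeta> \<in> crd \<sigma>" "\<zeta>' \<in> crd \<sigma>" "hmap \<sigma> \<sigma>' \<zeta> = hmap \<sigma> \<sigma>' \<zeta>'"
  have "rel \<sigma>' \<sigma> (hmap \<sigma> \<sigma>' \<zeta>) \<zeta>" "rel \<sigma>' \<sigma> (hmap \<sigma> \<sigma>' \<zeta>) \<zeta>'" using hmap[OF assms] z rel_sym by metis+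
  then show "\<zeta> = \<zeta>'" using hmap_iff[OF assms(2,1)] by metis
qed

lemma hmap_image: assumes "tmap \<sigma>" "tmap \<sigma>'" shows "hmap \<sigma> \<sigma>' ` crd \<sigma> = crd \<sigma>'"
proof (intro equalityI subsetI)
  fix \<omega> assume "\<omega> \<in> hmap \<sigma> \<sigma>' ` crd \<sigma>"
  then show "\<omega> \<in> crd \<sigma>'" using hmap[OF assms] by (auto simp: rel_def crd_def)
next
  fix \<omega> assume "\<omega> \<in> crd \<sigma>'"
  then have "rel \<sigma>' \<sigma> \<omega> (hmap \<sigma>' \<sigma> \<omega>)" by (rule hmap[OF assms(2,1)])
  then show "\<omega> \<in> hmap \<sigma> \<sigma>' ` crd \<sigma>" using rel_sym hmap_iff[OF assms] by (metis image_eqI)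
qed

lemma crd_Q: "tmap \<sigma> \<Longrightarrow> crd \<sigma> \<subseteq> Q"
  using meets_small(2) U by (auto simp: crd_def)

text \<open>The set is the projection to the first factor of a closed subset of the compact set
  \<open>Z \<times> U\<close>.\<close>

lemma crd_compact: assumes \<sigma>: "tmap \<sigma>" shows "compact (crd \<sigma>)"
proof -
  let ?D = "{q \<in> Z \<times> U. T (fst q) - \<Theta> (snd q) (\<sigma> (T (fst q))) = 0}"
  have "closed ?D"
    by (intro continuous_closed_preimage_constant[OF \<Theta>\<sigma>_continuous[OF \<sigma>]] continuous_intros compact_imp_closed compact_Times Z_compact U(1)) auto
  then have "compact ((Z \<times> U) \<inter> ?D)" by (intro compact_Int_closed compact_Times Z_compact U(1))
  then have "compact (fst ` ((Z \<times> U) \<inter> ?D))" by (intro compact_continuous_image continuous_intros)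
  moreover have "fst ` ((Z \<times> U) \<inter> ?D) = crd \<sigma>"
  proof (intro equalityI subsetI)
    fix \<zeta> assume "\<zeta> \<in> crd \<sigma>"
    then obtain y where "y \<in> U" "\<zeta> \<in> Z" "T \<zeta> = \<Theta> y (\<sigma> (T \<zeta>))" by (auto simp: crd_def meets_def)
    then show "\<zeta> \<in> fst ` ((Z \<times> U) \<inter> ?D)" by (intro image_eqI[of _ _ "(\<zeta>, y)"]) auto
  qed (auto simp: crd_def meets_def)
  ultimately show ?thesis by simp
qed

text \<open>The graph is a projection of a compact set of pairs together with their leaf, hence
  closed, and the values lie in a compact set.\<close>

lemma hmap_continuous: assumes \<sigma>: "tmap \<sigma>" "tmap \<sigma>'" shows "continuous_on (crd \<sigma>) (hmap \<sigma> \<sigma>')"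
proof (rule continuous_from_closed_graph[OF Z_compact])
  show "hmap \<sigma> \<sigma>' \<in> crd \<sigma> \<rightarrow> Z" using hmap_image[OF \<sigma>] crd_Q[OF \<sigma>(2)] Q_Z by blast
  let ?X = "(Z \<times> Z) \<times> U"
  let ?D1 = "{q \<in> ?X. T (fst (fst q)) - \<Theta> (snd q) (\<sigma> (T (fst (fst q)))) = 0}"
  let ?D2 = "{q \<in> ?X. T (snd (fst q)) - \<Theta> (snd q) (\<sigma>' (T (snd (fst q)))) = 0}"
  have cX: "compact ?X" by (intro compact_Times Z_compact U(1))
  have "closed ?D1" "closed ?D2"
    by (intro continuous_closed_preimage_constant[OF \<Theta>\<sigma>_continuous] \<sigma> continuous_intros compact_imp_closed[OF cX]; auto)+
  then have "compact (?X \<inter> (?D1 \<inter> ?D2))" by (intro compact_Int_closed closed_Int cX)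
  then have "compact (fst ` (?X \<inter> (?D1 \<inter> ?D2)))" by (intro compact_continuous_image continuous_intros)
  moreover have "fst ` (?X \<inter> (?D1 \<inter> ?D2)) = (\<lambda>\<zeta>. (\<zeta>, hmap \<sigma> \<sigma>' \<zeta>)) ` crd \<sigma>"
  proof -
    have "q \<in> fst ` (?X \<inter> (?D1 \<inter> ?D2)) \<longleftrightarrow> rel \<sigma> \<sigma>' (fst q) (snd q)" for q
    proof
      assume "rel \<sigma> \<sigma>' (fst q) (snd q)"
      then obtain y where "y \<in> U" "meets \<sigma> y (fst q)" "meets \<sigma>' y (snd q)" by (auto simp: rel_def)
      then show "q \<in> fst ` (?X \<inter> (?D1 \<inter> ?D2))" by (intro image_eqI[of _ _ "(q, y)"]) (auto simp: meets_def mem_Times_iff)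
    qed (auto simp: rel_def meets_def)
    moreover have "q \<in> (\<lambda>\<zeta>. (\<zeta>, hmap \<sigma> \<sigma>' \<zeta>)) ` crd \<sigma> \<longleftrightarrow> rel \<sigma> \<sigma>' (fst q) (snd q)" for q
      unfolding hmap_iff[OF \<sigma>] by (cases q) auto
    ultimately show ?thesis by blast
  qed
  ultimately show "closed ((\<lambda>\<zeta>. (\<zeta>, hmap \<sigma> \<sigma>' \<zeta>)) ` crd \<sigma>)" using compact_imp_closed by metis
qed

lemma crd_image: assumes \<sigma>: "tmap \<sigma>" shows "trv \<sigma> \<inter> (\<Union>x\<in>U. Lf x) = \<psi> \<sigma> ` crd \<sigma>"
proof (intro equalityI subsetI)
  fix z assume "z \<in> trv \<sigma> \<inter> (\<Union>x\<in>U. Lf x)"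
  then obtain \<zeta> y where z: "\<zeta> \<in> Z" "z = \<psi> \<sigma> \<zeta>" "y \<in> U" "z \<in> Lf y" unfolding trv_eq by blast
  then have "meets \<sigma> y \<zeta>" using meets_iff[OF \<sigma> _ z(1)] U by blast
  then show "z \<in> \<psi> \<sigma> ` crd \<sigma>" using z by (auto simp: crd_def)
next
  fix z assume "z \<in> \<psi> \<sigma> ` crd \<sigma>"
  then obtain \<zeta> y where z: "z = \<psi> \<sigma> \<zeta>" "y \<in> U" "meets \<sigma> y \<zeta>" by (auto simp: crd_def)
  moreover from z have "\<zeta> \<in> Z" by (simp add: meets_def)
  ultimately show "z \<in> trv \<sigma> \<inter> (\<Union>x\<in>U. Lf x)" using meets_iff[OF \<sigma>] U unfolding trv_eq by blast
qed

lemma holonomy_eq: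
  assumes \<sigma>: "tmap \<sigma>" "tmap \<sigma>'" and \<zeta>: "\<zeta> \<in> crd \<sigma>"
  shows "holonomy Lf U (trv \<sigma>') (\<psi> \<sigma> \<zeta>) = \<psi> \<sigma>' (hmap \<sigma> \<sigma>' \<zeta>)"
  unfolding holonomy_def
proof (rule the_equality)
  have Zz: "\<zeta> \<in> Z" using crd_Q[OF \<sigma>(1)] Q_Z \<zeta> by blast
  have r: "rel \<sigma> \<sigma>' \<zeta> (hmap \<sigma> \<sigma>' \<zeta>)" by (rule hmap[OF \<sigma> \<zeta>])
  then obtain y where y: "y \<in> U" "meets \<sigma> y \<zeta>" "meets \<sigma>' y (hmap \<sigma> \<sigma>' \<zeta>)" by (auto simp: rel_def)
  have "hmap \<sigma> \<sigma>' \<zeta> \<in> Z" using y(3) by (simp add: meets_def)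
  then show "\<exists>x\<in>U. \<psi> \<sigma> \<zeta> \<in> Lf x \<and> \<psi> \<sigma>' (hmap \<sigma> \<sigma>' \<zeta>) \<in> trv \<sigma>' \<inter> Lf x"
    using y meets_iff[OF \<sigma>(1) _ Zz] meets_iff[OF \<sigma>(2)] U unfolding trv_eq by blast
  fix z' assume "\<exists>x\<in>U. \<psi> \<sigma> \<zeta> \<in> Lf x \<and> z' \<in> trv \<sigma>' \<inter> Lf x"
  then obtain x \<omega> where x: "x \<in> U" "\<psi> \<sigma> \<zeta> \<in> Lf x" "\<omega> \<in> Z" "z' = \<psi> \<sigma>' \<omega>" "z' \<in> Lf x" unfolding trv_eq by blast
  have "meets \<sigma> x \<zeta>" "meets \<sigma>' x \<omega>" using x meets_iff[OF \<sigma>(1) _ Zz] meets_iff[OF \<sigma>(2) _ x(3)] U by blast+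
  then have "rel \<sigma> \<sigma>' \<zeta> \<omega>" using x(1) by (auto simp: rel_def)
  then have "\<omega> = hmap \<sigma> \<sigma>' \<zeta>" using hmap_iff[OF \<sigma>] by blast
  then show "z' = \<psi> \<sigma>' (hmap \<sigma> \<sigma>' \<zeta>)" using x(4) by simp
qed

end


section \<open>The holonomy between two transversals\<close>

context foliated_stack
begin

interpretation H: hyperbolic_charts f f' Unb "\<lambda>y n. (f ^^ n) y" "\<lambda>y n. NP ((f ^^ n) y)" "\<lambda>y n. NM ((f ^^ n) y)" "\<lambda>y n. AN ((f ^^ n) y)"
  "\<lambda>y n v. inv (Tp ((f ^^ n) y) :: real^'k \<Rightarrow> 'a) (pp ((f ^^ n) y) v)" "\<lambda>y n. Tp ((f ^^ n) y) :: real^'k \<Rightarrow> 'a"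
  l0 "exp \<delta>2" "exp (lam_minus ls p)" "exp (lam_minus ls p) + \<delta>s" b "exp (lam_plus ls p) - \<delta>s"
  "max (exp \<delta>2 * b) ((exp (lam_minus ls p) + \<delta>s) / (exp (lam_plus ls p) - \<delta>s))" \<delta>s "\<delta>s / l0"
  by (rule hyperbolic_charts_orbits) (use m Unb par l0 in auto)

lemma C0: "0 < 3 * l0 * \<delta>" "(4 * l0 + 3) * (3 * l0 * \<delta>) \<le> \<delta>s / l0"
  using \<delta> l0 par by simp_all

text \<open>At time 0 the unstable offset, the transversal offset and the distance of
  \<open>y\<close> from \<open>x0\<close> contribute at most \<open>\<delta>\<close> each, and
  \<open>l y \<le> l0\<close> converts to the adapted norm; this is the origin of
  \<open>3 * l0 * \<delta>\<close>.\<close>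

lemma leaf_decay:
  assumes \<sigma>: "tmap \<sigma>" and y: "y \<in> Unb" and \<zeta>: "meets \<sigma> y \<zeta>"
  shows "AN ((f ^^ n) y) ((f ^^ n) (\<psi> \<sigma> \<zeta>) - (f ^^ n) y) \<le> 3 * l0 * \<delta> * (exp (lam_minus ls p) + \<delta>s) ^ n"
proof (rule Wss_decay[OF stable _ par(1,2)])
  show yG: "y \<in> G" using Unb[OF y] by blast
  have \<zeta>Z: "\<zeta> \<in> Z" using \<zeta> by (simp add: meets_def)
  show "\<psi> \<sigma> \<zeta> \<in> Wss_loc f M ls p l \<delta>1' h y"
    using leaf_facts(3)[OF y] meets_iff[OF \<sigma> y \<zeta>Z] \<zeta> by blast
  show ly: "l y \<le> l0" using Unb[OF y] by blast
  have "norm (T \<zeta>) \<le> \<delta>" "norm (\<sigma> (T \<zeta>)) \<le> \<delta>"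
    using meets_small(1)[OF \<sigma> y \<zeta>] tmap_facts(1)[OF \<sigma> \<zeta>Z] r_pos(3) by (auto simp: ball_plus_def ball_minus_def)
  moreover have "norm (y - x0) \<le> \<delta>" using Unb[OF y] \<delta>(2) by simp
  moreover have "norm (\<psi> \<sigma> \<zeta> - y) \<le> norm (T \<zeta>) + norm (\<sigma> (T \<zeta>)) + norm (y - x0)"
    using norm_triangle_ineq[of "T \<zeta> + \<sigma> (T \<zeta>)" "x0 - y"] norm_triangle_ineq[of "T \<zeta>" "\<sigma> (T \<zeta>)"]
    by (simp add: \<psi>_def algebra_simps norm_minus_commute)
  ultimately have d: "norm (\<psi> \<sigma> \<zeta> - y) \<le> 3 * \<delta>" by linarith
  have "AN y (\<psi> \<sigma> \<zeta> - y) \<le> l y * norm (\<psi> \<sigma> \<zeta> - y)" by (rule AN_le_norm[OF yG])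
  also have "\<dots> \<le> l0 * (3 * \<delta>)" using ly d l0 by (intro mult_mono) auto
  finally show "AN y (\<psi> \<sigma> \<zeta> - y) \<le> 3 * l0 * \<delta>" by simp
  show "exp \<delta>2 * (exp (lam_minus ls p) + \<delta>s) \<le> 1"
    using H.const_facts(6,7) by linarith
  have "l0 * (3 * l0 * \<delta>) \<le> (4 * l0 + 3) * (3 * l0 * \<delta>)" using l0 C0(1) by (intro mult_right_mono) auto
  also have "\<dots> \<le> \<delta>s / l0" by (rule C0(2))
  also have "\<dots> \<le> \<delta>s / 1" using l0 par(1) by (intro divide_left_mono) auto
  finally show "l0 * (3 * l0 * \<delta>) \<le> \<delta>s" by simp
qed

lemma disc_ex:
  assumes \<sigma>: "tmap \<sigma>" obtains B c where "H.disc (\<psi> \<sigma>) B Q c"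
proof -
  have C: "C1_Lip_on (ball_plus M ls x0 (2 * \<delta> / l0 ^ 3)) \<sigma>" using \<sigma> by (simp add: transversal_map_def)
  have UG: "y \<in> G \<and> l y \<le> l0" if "y \<in> Unb" for y using Unb[OF that] by blast
  show thesis
  proof (rule graph_chart[OF x0 T C tmap_facts(3)[OF \<sigma>] less_imp_le[OF l0] UG near])
    fix B c
    assume "open {\<zeta>. norm (T \<zeta>) < 2 * \<delta> / l0 ^ 3}" "continuous_on {\<zeta>. norm (T \<zeta>) < 2 * \<delta> / l0 ^ 3} B" "0 < c"
      and "\<And>\<zeta>. \<zeta> \<in> {\<zeta>. norm (T \<zeta>) < 2 * \<delta> / l0 ^ 3} \<Longrightarrow> ((\<lambda>\<zeta>. x0 + T \<zeta> + \<sigma> (T \<zeta>)) has_derivative blinfun_apply (B \<zeta>)) (at \<zeta>)"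
      and "\<And>\<zeta> \<zeta>'. \<zeta> \<in> {\<zeta>. norm (T \<zeta>) < 2 * \<delta> / l0 ^ 3} \<Longrightarrow> \<zeta>' \<in> {\<zeta>. norm (T \<zeta>) < 2 * \<delta> / l0 ^ 3} \<Longrightarrow>
        c * norm (\<zeta> - \<zeta>') \<le> norm (x0 + T \<zeta> + \<sigma> (T \<zeta>) - (x0 + T \<zeta>' + \<sigma> (T \<zeta>')))"
      and "\<And>y \<zeta> \<zeta>'. y \<in> Unb \<Longrightarrow> \<zeta> \<in> {\<zeta>. norm (T \<zeta>) < 2 * \<delta> / l0 ^ 3} \<Longrightarrow> \<zeta>' \<in> {\<zeta>. norm (T \<zeta>) < 2 * \<delta> / l0 ^ 3} \<Longrightarrow>
        NM y (x0 + T \<zeta> + \<sigma> (T \<zeta>) - (x0 + T \<zeta>' + \<sigma> (T \<zeta>'))) \<le> NP y (x0 + T \<zeta> + \<sigma> (T \<zeta>) - (x0 + T \<zeta>' + \<sigma> (T \<zeta>')))"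
    note B = this
    have \<psi>': "\<psi> \<sigma> = (\<lambda>\<zeta>. x0 + T \<zeta> + \<sigma> (T \<zeta>))" by (rule ext) (simp add: \<psi>_def)
    have "H.disc (\<psi> \<sigma>) B Q c"
      unfolding H.disc_def Q_def \<psi>' funpow.simps id_apply
      by (intro conjI ballI B)
    then show thesis by (rule that)
  qed
qed

text \<open>Projected along the stable space at \<open>x0\<close>, the parametrisation is
  \<open>T\<close> up to translation, so its derivative inherits injectivity from
  \<open>T\<close>.\<close>

lemma disc_inj:
  assumes \<sigma>: "tmap \<sigma>" and d: "H.disc (\<psi> \<sigma>) B Q c" and \<zeta>: "\<zeta> \<in> Q"
  shows "(\<psi> \<sigma> has_derivative B \<zeta>) (at \<zeta>)" "inj (blinfun_apply (B \<zeta>))"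
proof -
  show der: "(\<psi> \<sigma> has_derivative B \<zeta>) (at \<zeta>)" using d \<zeta> by (simp add: H.disc_def)
  have Qo: "open Q" using d by (simp add: H.disc_def)
  have "((\<lambda>\<zeta>. \<psi> \<sigma> \<zeta> - x0) has_derivative B \<zeta>) (at \<zeta>)"
    using has_derivative_diff[OF der has_derivative_const[of x0]] by simp
  from bounded_linear.has_derivative[OF pp_bounded_linear[OF x0] this]
  have "((\<lambda>\<zeta>. pp x0 (\<psi> \<sigma> \<zeta> - x0)) has_derivative (\<lambda>v. pp x0 (B \<zeta> v))) (at \<zeta>)" .
  then have "(T has_derivative (\<lambda>v. pp x0 (B \<zeta> v))) (at \<zeta>)"
    by (rule has_derivative_transform_within_open[OF _ Qo \<zeta>]) (use pp_\<psi>(1)[OF \<sigma>] Q_Z in blast)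
  from has_derivative_unique[OF this bounded_linear_imp_has_derivative[OF T(1)]]
  have eq: "pp x0 (B \<zeta> v) = T v" for v by metis
  show "inj (blinfun_apply (B \<zeta>))"
  proof (rule injI)
    fix u v assume "B \<zeta> u = B \<zeta> v"
    then have "T u = T v" using eq by metis
    then show "u = v" by (rule injD[OF T(2)])
  qed
qed

text \<open>A point where \<open>norm (T \<zeta>)\<close> reaches the radius leaves \<open>Z\<close>
  under any scaling by a factor above 1. In \<open>trv_chart\<close> this keeps parametrisations
  away from the boundary of the transversal.\<close>

lemma interior_Z: "interior Z \<subseteq> Q"
proof
  fix \<zeta> assume z: "\<zeta> \<in> interior Z"
  then obtain e where e: "0 < e" "ball \<zeta> e \<subseteq> Z" by (auto simp: mem_interior)
  show "\<zeta> \<in> Q"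
  proof (rule ccontr)
    assume "\<zeta> \<notin> Q"
    then have R: "2 * \<delta> / l0 ^ 3 \<le> norm (T \<zeta>)" by (simp add: Q_def)
    then have T0: "0 < norm (T \<zeta>)" using r_pos by linarith
    then have n0: "\<zeta> \<noteq> 0" using linear_0[OF bounded_linear.linear[OF T(1)]] by auto
    define t where "t = e / (2 * norm \<zeta>)"
    have t: "0 < t" using e n0 by (simp add: t_def)
    have "dist \<zeta> ((1 + t) *\<^sub>R \<zeta>) = t * norm \<zeta>" using t by (simp add: dist_norm scaleR_add_left)
    also have "\<dots> < e" using e n0 by (simp add: t_def)
    finally have "(1 + t) *\<^sub>R \<zeta> \<in> Z" using e by auto
    then have "(1 + t) * norm (T \<zeta>) \<le> 2 * \<delta> / l0 ^ 3"
      using t by (simp add: Z_def linear_cmul[OF bounded_linear.linear[OF T(1)]])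
    moreover have "0 < t * norm (T \<zeta>)" using t T0 by simp
    ultimately show False using R by (simp add: distrib_right)
  qed
qed

lemma trv_chart:
  assumes \<sigma>: "tmap \<sigma>" and d: "H.disc (\<psi> \<sigma>) B Q c"
  shows "volume_chart (trv \<sigma>) Q (\<psi> \<sigma>) \<rho>"
proof
  have Qo: "open Q" and Bc: "continuous_on Q B" using d by (simp_all add: H.disc_def)
  have inv: "\<rho> z \<in> Z" "\<psi> \<sigma> (\<rho> z) = z" if "z \<in> trv \<sigma>" for z
    using that pp_\<psi>(2)[OF \<sigma>] unfolding trv_eq by auto
  have "compact (trv \<sigma>)" unfolding trv_eq by (rule compact_continuous_image[OF \<psi>_continuous[OF \<sigma>] Z_compact])
  then show "trv \<sigma> \<in> sets borel" by (rule borel_compact)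
  show "local_param (trv \<sigma>) Q (\<psi> \<sigma>)"
    unfolding local_param_def
  proof (intro conjI exI ballI)
    show "open Q" by (rule Qo)
    have "\<psi> \<sigma> ` Q = trv \<sigma> \<inter> {z. norm (pp x0 (z - x0)) < 2 * \<delta> / l0 ^ 3}"
    proof (intro equalityI subsetI)
      fix z assume "z \<in> \<psi> \<sigma> ` Q"
      then obtain \<zeta> where z: "\<zeta> \<in> Q" "z = \<psi> \<sigma> \<zeta>" by blast
      then have "\<zeta> \<in> Z" using Q_Z by blast
      then show "z \<in> trv \<sigma> \<inter> {z. norm (pp x0 (z - x0)) < 2 * \<delta> / l0 ^ 3}"
        using z pp_\<psi>(1)[OF \<sigma>, of \<zeta>] unfolding trv_eq by (auto simp: Q_def)
    next
      fix z assume z: "z \<in> trv \<sigma> \<inter> {z. norm (pp x0 (z - x0)) < 2 * \<delta> / l0 ^ 3}"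
      then obtain \<zeta> where \<zeta>: "\<zeta> \<in> Z" "z = \<psi> \<sigma> \<zeta>" unfolding trv_eq by blast
      then have "\<zeta> \<in> Q" using z pp_\<psi>(1)[OF \<sigma> \<zeta>(1)] by (simp add: Q_def)
      then show "z \<in> \<psi> \<sigma> ` Q" using \<zeta> by blast
    qed
    moreover have "continuous_on UNIV (\<lambda>z. pp x0 (z - x0))"
      by (rule continuous_on_compose2[OF linear_continuous_on[OF pp_bounded_linear[OF x0], of UNIV]]) (auto intro!: continuous_intros)
    then have "open {z. norm (pp x0 (z - x0)) < 2 * \<delta> / l0 ^ 3}"
      by (intro open_Collect_less continuous_on_norm continuous_on_const)
    ultimately show "openin (top_of_set (trv \<sigma>)) (\<psi> \<sigma> ` Q)" unfolding openin_open by blast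
    show "homeomorphism Q (\<psi> \<sigma> ` Q) (\<psi> \<sigma>) \<rho>"
    proof -
      have r: "\<rho> (\<psi> \<sigma> \<zeta>) = \<zeta>" if "\<zeta> \<in> Q" for \<zeta> using pp_\<psi>(2)[OF \<sigma>] Q_Z that by blast
      have "\<rho> ` \<psi> \<sigma> ` Q = Q" by (simp add: image_image r cong: image_cong_simp)
      then show ?thesis
        using r continuous_on_subset[OF \<psi>_continuous[OF \<sigma>] Q_Z] \<rho>_continuous[of "\<psi> \<sigma> ` Q"] by (simp add: homeomorphism_def)
    qed
    show "continuous_on Q B" by (rule Bc)
  qed (use disc_inj[OF \<sigma> d] in auto)
  fix Q' and \<psi>' :: "real^'k \<Rightarrow> 'a" and z assume c: "local_param (trv \<sigma>) Q' \<psi>'" and z: "z \<in> Q'"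
  have Q'o: "open Q'" and im: "\<psi>' ` Q' \<subseteq> trv \<sigma>" using c by (auto simp: local_param_def dest: openin_imp_subset)
  obtain g where g: "homeomorphism Q' (\<psi>' ` Q') \<psi>' g" using c by (auto simp: local_param_def)
  have pc: "continuous_on Q' \<psi>'" and gi: "\<And>z. z \<in> Q' \<Longrightarrow> g (\<psi>' z) = z" using g by (auto simp: homeomorphism_def)
  have "continuous_on Q' (\<lambda>z. \<rho> (\<psi>' z))"
    by (rule continuous_on_compose2[OF \<rho>_continuous[of UNIV] pc]) simp
  moreover have "inj_on (\<lambda>z. \<rho> (\<psi>' z)) Q'"
  proof (rule inj_onI)
    fix u v assume uv: "u \<in> Q'" "v \<in> Q'" "\<rho> (\<psi>' u) = \<rho> (\<psi>' v)"
    have "\<psi>' u \<in> trv \<sigma>" "\<psi>' v \<in> trv \<sigma>" using im uv by auto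
    then have "\<psi>' u = \<psi>' v" using inv(2) uv(3) by metis
    then show "u = v" using gi uv by metis
  qed
  \<comment> \<open>Invariance of domain: in unstable coordinates the image of any parametrisation
    is open, hence contained in the interior of \<open>Z\<close>.\<close>
  ultimately have "open ((\<lambda>z. \<rho> (\<psi>' z)) ` Q')" using Q'o by (intro invariance_of_domain)
  moreover have "(\<lambda>z. \<rho> (\<psi>' z)) ` Q' \<subseteq> Z" using im inv(1) by blast
  ultimately have "(\<lambda>z. \<rho> (\<psi>' z)) ` Q' \<subseteq> Q" using interior_maximal interior_Z by blast
  then have 1: "\<rho> (\<psi>' z) \<in> Q" using z by blast
  have 2: "\<psi> \<sigma> (\<rho> (\<psi>' z)) = \<psi>' z" using inv(2) im z by blast
  obtain D where "(\<psi>' has_derivative D) (at z)" using c z by (auto simp: local_param_def)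
  then have "((\<lambda>z. \<psi>' z - x0) has_derivative D) (at z)"
    using has_derivative_diff[OF _ has_derivative_const[of x0]] by fastforce
  from bounded_linear.has_derivative[OF \<rho>_affine this]
  have "((\<lambda>z. \<rho> (\<psi>' z)) has_derivative (\<lambda>v. inv_into UNIV T (pp x0 (D v)))) (at z)" by (simp add: \<rho>_def)
  with 1 2 show "\<rho> (\<psi>' z) \<in> Q \<and> \<psi> \<sigma> (\<rho> (\<psi>' z)) = \<psi>' z \<and> (\<exists>u'. ((\<lambda>z. \<rho> (\<psi>' z)) has_derivative u') (at z))" by blast
qed

lemma dorb_diter: "blinfun_apply (H.dorb \<phi> B \<zeta> n) = diter f n (\<phi> \<zeta>) \<circ> blinfun_apply (B \<zeta>)"
proof (induction n)
  case 0 show ?case by (simp add: diter_0)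
next
  case (Suc n)
  show ?case by (rule ext) (simp add: Suc diter_Suc H.orb_def)
qed

lemma volume_in_chart:
  assumes \<sigma>: "tmap \<sigma>" and d: "H.disc (\<psi> \<sigma>) B Q c" and \<zeta>: "\<zeta> \<in> Q"
  shows "0 < unit_vol (H.dorb (\<psi> \<sigma>) B \<zeta> n)" "0 < unit_vol (B \<zeta>)"
    "volume_jacobian (\<psi> \<sigma>) \<zeta> = unit_ball_vol (real CARD('k)) / unit_vol (B \<zeta>)"
    "det_on (diter f n (\<psi> \<sigma> \<zeta>)) (tangent_space TYPE('k) (trv \<sigma>) (\<psi> \<sigma> \<zeta>)) = unit_vol (B \<zeta>) / unit_vol (H.dorb (\<psi> \<sigma>) B \<zeta> n)"
proof -
  interpret V: volume_chart "trv \<sigma>" Q "\<psi> \<sigma>" \<rho> by (rule trv_chart[OF \<sigma> d])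
  note B = disc_inj[OF \<sigma> d \<zeta>]
  note bl = blinfun.bounded_linear_right
  have dp: "blinfun_apply (V.dpar Q (\<psi> \<sigma>) \<zeta>) = B \<zeta>"
    by (rule has_derivative_unique[OF V.dpar(2)[OF V.chart \<zeta>] B(1)])
  have inj: "inj (diter f n (\<psi> \<sigma> \<zeta>) \<circ> blinfun_apply (B \<zeta>))" by (rule inj_compose[OF diter_inj B(2)])
  show "0 < unit_vol (H.dorb (\<psi> \<sigma>) B \<zeta> n)" using unit_vol_pos[OF bl] inj by (metis dorb_diter)
  show "0 < unit_vol (B \<zeta>)" by (rule unit_vol_pos[OF bl B(2)])
  show "volume_jacobian (\<psi> \<sigma>) \<zeta> = unit_ball_vol (real CARD('k)) / unit_vol (B \<zeta>)"
    using V.jacobian[OF V.chart \<zeta>] by (simp only: dp)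
  show "det_on (diter f n (\<psi> \<sigma> \<zeta>)) (tangent_space TYPE('k) (trv \<sigma>) (\<psi> \<sigma> \<zeta>)) = unit_vol (B \<zeta>) / unit_vol (H.dorb (\<psi> \<sigma>) B \<zeta> n)"
    unfolding V.tangent_space_eq[OF \<zeta>] dp dorb_diter
    by (rule det_on_range[OF bl B(2) has_derivative_bounded_linear[OF iter_derivative] inj])
qed

text \<open>The quotient of determinants at time \<open>n\<close> is the exponential of the
  difference of \<open>ln unit_vol\<close> times a fixed quotient of unit volumes at time 0. The
  latter is the quotient of the two chart Jacobians, which is the same correction that
  \<open>distr_holonomy\<close> introduces.\<close>

lemma holonomy_radon_nikodym:
  assumes \<sigma>: "tmap \<sigma>1" "tmap \<sigma>2"
  defines "C1 \<equiv> trv \<sigma>1 \<inter> (\<Union>x\<in>U. Lf x)" and "C2 \<equiv> trv \<sigma>2 \<inter> (\<Union>x\<in>U. Lf x)"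
    and "hol \<equiv> holonomy Lf U (trv \<sigma>2)"
  defines "\<nu>1 \<equiv> restrict_space (induced_volume TYPE('k) (trv \<sigma>1)) C1"
    and "\<nu>2 \<equiv> restrict_space (induced_volume TYPE('k) (trv \<sigma>2)) C2"
    and "\<Delta> \<equiv> \<lambda>y. lim (det_ratio TYPE('k) f (trv \<sigma>1) (trv \<sigma>2) hol y)"
  shows "\<And>y. y \<in> C1 \<Longrightarrow> convergent (det_ratio TYPE('k) f (trv \<sigma>1) (trv \<sigma>2) hol y)"
    and "\<Delta> \<in> borel_measurable \<nu>1"
    and "distr \<nu>2 (restrict_space borel C1) (inv_into C1 hol) = density \<nu>1 (\<lambda>y. ennreal (\<Delta> y))"
proof -
  obtain B1 c1 where d1: "H.disc (\<psi> \<sigma>1) B1 Q c1" using disc_ex[OF \<sigma>(1)] by blast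
  obtain B2 c2 where d2: "H.disc (\<psi> \<sigma>2) B2 Q c2" using disc_ex[OF \<sigma>(2)] by blast
  define K P where "K = crd \<sigma>1" and "P = hmap \<sigma>1 \<sigma>2"
  have K: "compact K" "K \<subseteq> Q" "continuous_on K P" "inj_on P K" "P ` K \<subseteq> Q"
    unfolding K_def P_def
    using crd_compact[OF \<sigma>(1)] crd_Q[OF \<sigma>(1)] hmap_continuous[OF \<sigma>] hmap_inj[OF \<sigma>] hmap_image[OF \<sigma>] crd_Q[OF \<sigma>(2)] by auto
  have Ci: "C1 = \<psi> \<sigma>1 ` K" "C2 = \<psi> \<sigma>2 ` P ` K"
    unfolding C1_def C2_def K_def P_def hmap_image[OF \<sigma>] by (rule crd_image[OF \<sigma>(1)], rule crd_image[OF \<sigma>(2)])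
  have hol: "hol (\<psi> \<sigma>1 \<zeta>) = \<psi> \<sigma>2 (P \<zeta>)" if "\<zeta> \<in> K" for \<zeta>
    unfolding hol_def P_def using that K_def by (intro holonomy_eq[OF \<sigma>]) simp
  have leaf: "\<exists>y. H.leaf_pair (\<psi> \<sigma>1) (\<psi> \<sigma>2) (3 * l0 * \<delta>) y \<zeta> (P \<zeta>)" if z: "\<zeta> \<in> K" for \<zeta>
  proof -
    obtain y where y: "y \<in> U" "meets \<sigma>1 y \<zeta>" "meets \<sigma>2 y (P \<zeta>)"
      using hmap[OF \<sigma>, of \<zeta>] z unfolding K_def P_def rel_def by blast
    have yU: "y \<in> Unb" using y U by blast
    show ?thesis
      unfolding H.leaf_pair_def H.orb_def
      by (intro exI[of _ y] conjI allI yU leaf_decay[OF \<sigma>(1) yU y(2)] leaf_decay[OF \<sigma>(2) yU y(3)])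
  qed
  define L where "L \<zeta> = lim (\<lambda>n. ln (unit_vol (H.dorb (\<psi> \<sigma>2) B2 (P \<zeta>) n)) - ln (unit_vol (H.dorb (\<psi> \<sigma>1) B1 \<zeta> n)))" for \<zeta>
  have conv: "(\<lambda>n. ln (unit_vol (H.dorb (\<psi> \<sigma>2) B2 (P \<zeta>) n)) - ln (unit_vol (H.dorb (\<psi> \<sigma>1) B1 \<zeta> n))) \<longlonglongrightarrow> L \<zeta>" if "\<zeta> \<in> K" for \<zeta>
    unfolding L_def by (rule H.R_convergent[OF d1 d2 K leaf C0 that])
  define D where "D \<zeta> = exp (if \<zeta> \<in> K then L \<zeta> else 0)" for \<zeta>
  have Dm: "D \<in> borel_measurable borel"
    unfolding D_def using H.lnD_measurable[OF d1 d2 K leaf C0] unfolding L_def[symmetric] by measurable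
  have PX: "P ` X \<in> sets borel" if "X \<in> sets borel" "X \<subseteq> K" for X
    by (rule H.image_borel[OF d1 d2 K leaf C0 that])
  have em: "emeasure lborel (P ` X) = (\<integral>\<^sup>+\<zeta>\<in>X. ennreal (D \<zeta>) \<partial>lborel)" if X: "X \<in> sets borel" "X \<subseteq> K" for X
  proof -
    have "emeasure lborel (P ` X) = (\<integral>\<^sup>+\<zeta>\<in>X. ennreal (exp (L \<zeta>)) \<partial>lborel)"
      unfolding L_def by (rule H.holonomy_density[OF d1 d2 K leaf C0 X])
    also have "\<dots> = (\<integral>\<^sup>+\<zeta>\<in>X. ennreal (D \<zeta>) \<partial>lborel)"
      using X(2) by (intro nn_integral_cong) (auto simp: D_def indicator_def)
    finally show ?thesis .
  qed
  have lim: "det_ratio TYPE('k) f (trv \<sigma>1) (trv \<sigma>2) hol (\<psi> \<sigma>1 \<zeta>) \<longlonglongrightarrow> D \<zeta> * volume_jacobian (\<psi> \<sigma>2) (P \<zeta>) / volume_jacobian (\<psi> \<sigma>1) \<zeta>"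
    if z: "\<zeta> \<in> K" for \<zeta>
  proof -
    have zQ: "\<zeta> \<in> Q" "P \<zeta> \<in> Q" using K z by auto
    note v1 = volume_in_chart[OF \<sigma>(1) d1 zQ(1)] and v2 = volume_in_chart[OF \<sigma>(2) d2 zQ(2)]
    have e1: "det_ratio TYPE('k) f (trv \<sigma>1) (trv \<sigma>2) hol (\<psi> \<sigma>1 \<zeta>) n =
      exp (ln (unit_vol (H.dorb (\<psi> \<sigma>2) B2 (P \<zeta>) n)) - ln (unit_vol (H.dorb (\<psi> \<sigma>1) B1 \<zeta> n))) * (unit_vol (B1 \<zeta>) / unit_vol (B2 (P \<zeta>)))" for n
      unfolding det_ratio_def hol[OF z] v1(4) v2(4) exp_diff using v1(1)[of n] v2(1)[of n] by simp
    have e2: "(\<lambda>n. exp (ln (unit_vol (H.dorb (\<psi> \<sigma>2) B2 (P \<zeta>) n)) - ln (unit_vol (H.dorb (\<psi> \<sigma>1) B1 \<zeta> n))) * (unit_vol (B1 \<zeta>) / unit_vol (B2 (P \<zeta>))))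
      \<longlonglongrightarrow> exp (L \<zeta>) * (unit_vol (B1 \<zeta>) / unit_vol (B2 (P \<zeta>)))"
      by (intro tendsto_mult tendsto_exp conv[OF z] tendsto_const)
    have w: "unit_ball_vol (real CARD('k)) \<noteq> 0" by (metis less_irrefl of_nat_0_le_iff unit_ball_vol_pos)
    have e3: "exp (L \<zeta>) * (unit_vol (B1 \<zeta>) / unit_vol (B2 (P \<zeta>))) = D \<zeta> * volume_jacobian (\<psi> \<sigma>2) (P \<zeta>) / volume_jacobian (\<psi> \<sigma>1) \<zeta>"
      using z v1(2) v2(2) w by (simp add: D_def v1(3) v2(3))
    show ?thesis using e2 unfolding e3 e1[symmetric] .
  qed
  show "convergent (det_ratio TYPE('k) f (trv \<sigma>1) (trv \<sigma>2) hol y)" if "y \<in> C1" for y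
    using that lim unfolding Ci by (auto simp: convergent_def)
  have \<Delta>: "\<Delta> (\<psi> \<sigma>1 \<zeta>) = D \<zeta> * volume_jacobian (\<psi> \<sigma>2) (P \<zeta>) / volume_jacobian (\<psi> \<sigma>1) \<zeta>" if "\<zeta> \<in> K" for \<zeta>
    unfolding \<Delta>_def by (rule limI[OF lim[OF that]])
  have Dpos: "0 < D \<zeta>" for \<zeta> by (simp add: D_def)
  note dh = distr_holonomy[OF trv_chart[OF \<sigma>(1) d1] trv_chart[OF \<sigma>(2) d2] borel_compact[OF K(1)] K(2,5,4,3) PX Dm Dpos em Ci hol \<Delta>]
  show "\<Delta> \<in> borel_measurable \<nu>1" unfolding \<nu>1_def by (rule dh(1))
  show "distr \<nu>2 (restrict_space borel C1) (inv_into C1 hol) = density \<nu>1 (\<lambda>y. ennreal (\<Delta> y))"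
    unfolding \<nu>1_def \<nu>2_def by (rule dh(2))
qed

end

theorem theoremB:
  fixes f :: "'a::banach \<Rightarrow> 'a" and \<mu> :: "'a measure" and A :: "'a set"
    and la :: "'a \<Rightarrow> real" and M :: "'a met_splitting"
    and ls :: real and m p :: nat and G :: "'a set"
  assumes "invariant_prob f \<mu>" and "hyp_H1 f" and "hyp_H2 f \<mu> A" and "hyp_H3 f \<mu>"
    and "lyapunov_splitting f \<mu> A la M"
    and "m = CARD('m::finite)" and "0 < p" and "ls < 1 / (2 * real p)"
    and "G = Gamma_set M la ls m p" and "0 < emeasure \<mu> G"
  shows "\<forall>\<^sub>F \<delta>2 in at_right 0. \<forall>\<delta>1 l \<delta>1' h.
    lyapunov_charts f M ls p G \<delta>1 \<delta>2 l \<and> 0 < \<delta>1' \<and> \<delta>1' \<le> \<delta>1 \<and> local_stable f M ls p G l \<delta>1' h \<longrightarrow>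
    (\<forall>l0>1. \<forall>n0. \<forall>x0 \<in> Gamma_le G l l0 \<inter> msp_K M n0.
      \<forall>\<^sub>F \<delta> in at_right 0. \<delta> \<le> \<delta>1' / 4 \<longrightarrow>
      (\<forall>\<^sub>F \<epsilon>0 in at_right 0. \<forall>\<Theta> U \<sigma>1 \<sigma>2.
        leaf_family M ls (Wss_loc f M ls p l \<delta>1' h) l0 x0 \<delta> (U_nbhd M G l l0 n0 x0 \<epsilon>0) \<Theta> \<and>
        compact U \<and> U \<subseteq> U_nbhd M G l l0 n0 x0 \<epsilon>0 \<and>
        transversal_map M ls l0 x0 \<delta> \<sigma>1 \<and> transversal_map M ls l0 x0 \<delta> \<sigma>2 \<longrightarrow>
        (let S = (\<Union>x\<in>U. leaf M ls l0 x0 \<delta> \<Theta> x);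
             \<Sigma>1 = transversal M ls l0 x0 \<delta> \<sigma>1; \<Sigma>2 = transversal M ls l0 x0 \<delta> \<sigma>2;
             C1 = \<Sigma>1 \<inter> S; C2 = \<Sigma>2 \<inter> S;
             hol = holonomy (leaf M ls l0 x0 \<delta> \<Theta>) U \<Sigma>2;
             \<nu>1 = restrict_space (induced_volume TYPE('m) \<Sigma>1) C1;
             \<nu>2 = restrict_space (induced_volume TYPE('m) \<Sigma>2) C2;
             \<Delta> = (\<lambda>y. lim (det_ratio TYPE('m) f \<Sigma>1 \<Sigma>2 hol y))
         in (\<forall>y\<in>C1. convergent (det_ratio TYPE('m) f \<Sigma>1 \<Sigma>2 hol y)) \<and>
            \<Delta> \<in> borel_measurable \<nu>1 \<and>
            distr \<nu>2 (restrict_space borel C1) (inv_into C1 hol) = density \<nu>1 (\<lambda>y. ennreal (\<Delta> y)))))"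
proof -
  obtain f' :: "'a \<Rightarrow> 'a \<Rightarrow>\<^sub>L 'a" and f'' :: "'a \<Rightarrow> 'a \<Rightarrow>\<^sub>L 'a \<Rightarrow>\<^sub>L 'a" where f': "\<And>x. (f has_derivative f' x) (at x)" and f'': "\<And>x. (f' has_derivative f'' x) (at x)"
    using assms(2) unfolding hyp_H1_def C2_map_def by blast
  have f'_cont: "continuous_on UNIV f'"
    by (rule continuous_at_imp_continuous_on, rule ballI, rule has_derivative_continuous[OF f''])
  have inj_f: "inj f" and "\<And>x. inj (frechet_derivative f (at x))" using assms(2) by (auto simp: hyp_H1_def)
  then have inj_f': "inj (blinfun_apply (f' x))" for x using frechet_derivative_at[OF f', of x] by simp
  have system: "lyapunov_system f f' \<mu> A la M ls m p G"
    by (rule lyapunov_system.intro) (use f' f'_cont inj_f inj_f' assms in auto)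
  define a0 g0 where "a0 = exp (lam_minus ls p)" and "g0 = exp (lam_plus ls p)"
  \<comment> \<open>The rate has to lie strictly above the contraction and strictly below both 1 and
    the expansion. The midpoint is fixed first, and \<open>\<delta>2\<close> is then small relative
    to it.\<close>
  define b where "b = (a0 + min 1 g0) / 2"
  \<comment> \<open>Here \<open>a0 < 1\<close> is the hypothesis on \<open>ls\<close>, in the form
    \<open>lam_minus ls p < 0\<close>.\<close>
  have ag: "0 < a0" "a0 < 1" "a0 < g0" using assms(7,8) by (simp_all add: a0_def g0_def lam_minus_def lam_plus_def)
  have b: "a0 < b" "b < 1" "b < g0" using ag by (auto simp: b_def)
  define k where "k = CARD('m) + 2"
  have "((\<lambda>d. exp d ^ k * a0) \<longlongrightarrow> exp 0 ^ k * a0) (at_right (0::real))"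
    "((\<lambda>d. exp d * (exp d * b)) \<longlongrightarrow> exp 0 * (exp 0 * b)) (at_right (0::real))"
    by (intro tendsto_intros)+
  then have "\<forall>\<^sub>F d in at_right (0::real). exp d ^ k * a0 < b" "\<forall>\<^sub>F d in at_right (0::real). exp d * (exp d * b) < 1"
    using b by (auto intro: order_tendstoD(2))
  with eventually_at_right_less[of "0::real"]
  have "\<forall>\<^sub>F d in at_right (0::real). 0 < d \<and> exp d ^ k * a0 < b \<and> exp d * (exp d * b) < 1"
    by (auto intro: eventually_conj)
  then show ?thesis
  proof (rule eventually_mono, intro allI impI ballI, elim conjE)
    fix \<delta>2 \<delta>1 l \<delta>1' h and l0 :: real and n0 x0
    assume d2: "0 < \<delta>2" "exp \<delta>2 ^ k * a0 < b" "exp \<delta>2 * (exp \<delta>2 * b) < 1"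
      and charts: "lyapunov_charts f M ls p G \<delta>1 \<delta>2 l" and stable: "local_stable f M ls p G l \<delta>1' h"
      and l0: "1 < l0" and x0: "x0 \<in> Gamma_le G l l0 \<inter> msp_K M n0"
    interpret lyapunov_chart_system f f' \<mu> A la M ls m p G \<delta>1 \<delta>2 l
      by (rule lyapunov_chart_system.intro[OF system]) (rule lyapunov_chart_system_axioms.intro[OF charts])
    have x0G: "x0 \<in> G" "x0 \<in> msp_K M n0" using x0 by (auto simp: Gamma_le_def)
    have \<delta>1: "0 < \<delta>1" using charts by (simp add: lyapunov_charts_def)
    have t: "((\<lambda>d. exp \<delta>2 ^ k * (a0 + d)) \<longlongrightarrow> exp \<delta>2 ^ k * (a0 + 0)) (at_right (0::real))"
      "((\<lambda>d. g0 - d) \<longlongrightarrow> g0 - 0) (at_right (0::real))" "((\<lambda>d. d) \<longlongrightarrow> 0) (at_right (0::real))"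
      by (intro tendsto_intros)+
    have "\<forall>\<^sub>F d in at_right (0::real). exp \<delta>2 ^ k * (a0 + d) < b"
      by (rule order_tendstoD(2)[OF t(1)]) (use d2 in simp)
    moreover have "\<forall>\<^sub>F d in at_right (0::real). b < g0 - d" by (rule order_tendstoD(1)[OF t(2)]) (use b in simp)
    moreover have "\<forall>\<^sub>F d in at_right (0::real). d < \<delta>1" by (rule order_tendstoD(2)[OF t(3) \<delta>1])
    moreover note eventually_at_right_less[of "0::real"]
    ultimately have "\<forall>\<^sub>F d in at_right (0::real). 0 < d \<and> exp \<delta>2 ^ k * (a0 + d) < b \<and> b < g0 - d \<and> d < \<delta>1"
      by eventually_elim auto
    \<comment> \<open>The charts that determine the rates get their own size
      \<open>\<delta>s\<close>: it fits below \<open>\<delta>1\<close> and keeps \<open>b\<close>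
      strictly between the perturbed rates.\<close>
    then obtain \<delta>s where ds: "0 < \<delta>s" "exp \<delta>2 ^ k * (a0 + \<delta>s) < b" "b < g0 - \<delta>s" "\<delta>s < \<delta>1"
      using eventually_happens[of _ "at_right (0::real)"] trivial_limit_at_right_real[of 0] by blast
    obtain T :: "real^'m \<Rightarrow> 'a" where T: "bounded_linear T" "inj T" "range T = Ep x0" "\<And>k. \<exists>i\<in>P_idx x0. T (axis k 1) \<in> piece M i x0"
      using Ep_param[OF assms(6) x0G(1)] by metis
    have "0 < 1 / (10 * l0)" using l0 by simp
    from Ep_near[OF x0G this T] obtain \<epsilon> where e: "0 < \<epsilon>"
      "\<And>y u. y \<in> G \<Longrightarrow> y \<in> msp_K M n0 \<Longrightarrow> norm (y - x0) < \<epsilon> \<Longrightarrow> u \<in> Ep x0 \<Longrightarrow> \<exists>v\<in>Ep y. norm (u - v) \<le> 1 / (10 * l0) * norm u" by metis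
    have "((\<lambda>d. (4 * l0 + 3) * (3 * l0 * d)) \<longlongrightarrow> (4 * l0 + 3) * (3 * l0 * 0)) (at_right (0::real))" by (intro tendsto_intros)
    then have "\<forall>\<^sub>F d in at_right (0::real). (4 * l0 + 3) * (3 * l0 * d) < \<delta>s / l0"
      using ds l0 by (intro order_tendstoD(2)) auto
    with eventually_at_right_less[of "0::real"]
    have "\<forall>\<^sub>F d in at_right (0::real). 0 < d \<and> (4 * l0 + 3) * (3 * l0 * d) < \<delta>s / l0" by (auto intro: eventually_conj)
    then show "\<forall>\<^sub>F \<delta> in at_right 0. \<delta> \<le> \<delta>1' / 4 \<longrightarrow>
      (\<forall>\<^sub>F \<epsilon>0 in at_right 0. \<forall>\<Theta> U \<sigma>1 \<sigma>2.
        leaf_family M ls (Wss_loc f M ls p l \<delta>1' h) l0 x0 \<delta> (U_nbhd M G l l0 n0 x0 \<epsilon>0) \<Theta> \<and>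
        compact U \<and> U \<subseteq> U_nbhd M G l l0 n0 x0 \<epsilon>0 \<and>
        transversal_map M ls l0 x0 \<delta> \<sigma>1 \<and> transversal_map M ls l0 x0 \<delta> \<sigma>2 \<longrightarrow>
        (let S = (\<Union>x\<in>U. leaf M ls l0 x0 \<delta> \<Theta> x);
             \<Sigma>1 = transversal M ls l0 x0 \<delta> \<sigma>1; \<Sigma>2 = transversal M ls l0 x0 \<delta> \<sigma>2;
             C1 = \<Sigma>1 \<inter> S; C2 = \<Sigma>2 \<inter> S;
             hol = holonomy (leaf M ls l0 x0 \<delta> \<Theta>) U \<Sigma>2;
             \<nu>1 = restrict_space (induced_volume TYPE('m) \<Sigma>1) C1;
             \<nu>2 = restrict_space (induced_volume TYPE('m) \<Sigma>2) C2;
             \<Delta> = (\<lambda>y. lim (det_ratio TYPE('m) f \<Sigma>1 \<Sigma>2 hol y))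
         in (\<forall>y\<in>C1. convergent (det_ratio TYPE('m) f \<Sigma>1 \<Sigma>2 hol y)) \<and>
            \<Delta> \<in> borel_measurable \<nu>1 \<and>
            distr \<nu>2 (restrict_space borel C1) (inv_into C1 hol) = density \<nu>1 (\<lambda>y. ennreal (\<Delta> y))))"
    proof (rule eventually_mono, intro impI)
      fix \<delta> :: real assume \<delta>: "0 < \<delta> \<and> (4 * l0 + 3) * (3 * l0 * \<delta>) < \<delta>s / l0"
      \<comment> \<open>Being below \<open>\<epsilon>\<close> gives nearby unstable spaces through
        \<open>Ep_near\<close>; being below \<open>\<delta>\<close> bounds the distance of the base
        points from \<open>x0\<close> in \<open>leaf_decay\<close>.\<close>
      have "\<forall>\<^sub>F d in at_right (0::real). d < min \<epsilon> \<delta>"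
        using e(1) \<delta> by (intro order_tendstoD(2)[OF tendsto_ident_at]) auto
      then show "\<forall>\<^sub>F \<epsilon>0 in at_right 0. \<forall>\<Theta> U \<sigma>1 \<sigma>2.
        leaf_family M ls (Wss_loc f M ls p l \<delta>1' h) l0 x0 \<delta> (U_nbhd M G l l0 n0 x0 \<epsilon>0) \<Theta> \<and>
        compact U \<and> U \<subseteq> U_nbhd M G l l0 n0 x0 \<epsilon>0 \<and>
        transversal_map M ls l0 x0 \<delta> \<sigma>1 \<and> transversal_map M ls l0 x0 \<delta> \<sigma>2 \<longrightarrow>
        (let S = (\<Union>x\<in>U. leaf M ls l0 x0 \<delta> \<Theta> x);
             \<Sigma>1 = transversal M ls l0 x0 \<delta> \<sigma>1; \<Sigma>2 = transversal M ls l0 x0 \<delta> \<sigma>2;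
             C1 = \<Sigma>1 \<inter> S; C2 = \<Sigma>2 \<inter> S;
             hol = holonomy (leaf M ls l0 x0 \<delta> \<Theta>) U \<Sigma>2;
             \<nu>1 = restrict_space (induced_volume TYPE('m) \<Sigma>1) C1;
             \<nu>2 = restrict_space (induced_volume TYPE('m) \<Sigma>2) C2;
             \<Delta> = (\<lambda>y. lim (det_ratio TYPE('m) f \<Sigma>1 \<Sigma>2 hol y))
         in (\<forall>y\<in>C1. convergent (det_ratio TYPE('m) f \<Sigma>1 \<Sigma>2 hol y)) \<and>
            \<Delta> \<in> borel_measurable \<nu>1 \<and>
            distr \<nu>2 (restrict_space borel C1) (inv_into C1 hol) = density \<nu>1 (\<lambda>y. ennreal (\<Delta> y)))"
      proof (rule eventually_mono, intro allI impI, elim conjE)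
        fix \<epsilon>0 \<Theta> U \<sigma>1 \<sigma>2
        assume e0: "\<epsilon>0 < min \<epsilon> \<delta>"
          and family: "leaf_family M ls (Wss_loc f M ls p l \<delta>1' h) l0 x0 \<delta> (U_nbhd M G l l0 n0 x0 \<epsilon>0) \<Theta>"
          and U: "compact U" "U \<subseteq> U_nbhd M G l l0 n0 x0 \<epsilon>0"
          and \<sigma>: "transversal_map M ls l0 x0 \<delta> \<sigma>1" "transversal_map M ls l0 x0 \<delta> \<sigma>2"
        have near: "\<exists>v\<in>Ep y. norm (u - v) \<le> 1 / (10 * l0) * norm u" if "y \<in> U_nbhd M G l l0 n0 x0 \<epsilon>0" "u \<in> Ep x0" for y u
          using that e0 by (intro e(2)) (auto simp: U_nbhd_def Gamma_le_def)
        interpret foliated_stack f f' \<mu> A la M ls m p G \<delta>1 \<delta>2 l T \<delta>1' h l0 n0 x0 \<delta> \<epsilon>0 \<Theta> U \<delta>s b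
        proof (rule foliated_stack.intro[OF lyapunov_chart_system_axioms], rule foliated_stack_axioms.intro)
          show "exp \<delta>2 ^ (CARD('m) + 2) * (exp (lam_minus ls p) + \<delta>s) < b" using ds(2) by (simp only: k_def a0_def)
          show "b < exp (lam_plus ls p) - \<delta>s" using ds(3) by (simp only: g0_def)
          show "\<exists>v\<in>Ep y. norm (u - v) \<le> 1 / (10 * l0) * norm u" if "y \<in> U_nbhd M G l l0 n0 x0 \<epsilon>0" "u \<in> Ep x0" for y u
            by (rule near[OF that])
        qed (use assms(6) stable x0G l0 family U T \<delta> e0 ds d2 in auto)
        show "let S = (\<Union>x\<in>U. leaf M ls l0 x0 \<delta> \<Theta> x);
             \<Sigma>1 = transversal M ls l0 x0 \<delta> \<sigma>1; \<Sigma>2 = transversal M ls l0 x0 \<delta> \<sigma>2;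
             C1 = \<Sigma>1 \<inter> S; C2 = \<Sigma>2 \<inter> S;
             hol = holonomy (leaf M ls l0 x0 \<delta> \<Theta>) U \<Sigma>2;
             \<nu>1 = restrict_space (induced_volume TYPE('m) \<Sigma>1) C1;
             \<nu>2 = restrict_space (induced_volume TYPE('m) \<Sigma>2) C2;
             \<Delta> = (\<lambda>y. lim (det_ratio TYPE('m) f \<Sigma>1 \<Sigma>2 hol y))
         in (\<forall>y\<in>C1. convergent (det_ratio TYPE('m) f \<Sigma>1 \<Sigma>2 hol y)) \<and>
            \<Delta> \<in> borel_measurable \<nu>1 \<and>
            distr \<nu>2 (restrict_space borel C1) (inv_into C1 hol) = density \<nu>1 (\<lambda>y. ennreal (\<Delta> y))"
          unfolding Let_def using holonomy_radon_nikodym[OF \<sigma>] by blast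
      qed
    qed
  qed
qed

end
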